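(* For any $\gamma\in(0,2)$, the limit \[ e_\gamma=\lim_{\epsilon\searrow0}\left(\Big(\log\frac1\delta\Big)^2\inf_{M_\gamma}E^\gamma_\epsilon-\frac{\pi\gamma^2}{2}\log\frac1\delta\right),\qquad\delta=\epsilon\log\frac1\epsilon, \] exists (as a real number).
   Context: $B_1^+(0)=B_1(0)\cap\mathbb{R}^2_+$, $\partial^+B_1(0)=\partial B_1(0)\cap\mathbb{R}^2_+$. For $\gamma\in(0,2)$, $M_\gamma=\{\mu\in W^{1,2}(-1,1):\mu(0)=1,\ \mu(\pm1)\le1-\gamma\}$. For $\mu\in M_\gamma$, $W^{1,2}_\mu(B_1^+(0))$ is the set of $w\in W^{1,2}(B_1^+(0))$ with $w(x_1,0)=\mu(x_1)$ on $(-1,1)$ and $w\le1-\gamma$ on $\partial^+B_1(0)$, and $E^\gamma_\epsilon(\mu)=\frac\epsilon2\int_{-1}^1\frac{(\mu')^2}{1-\mu^2}dx_1+\frac12\inf_{w\in W^{1,2}_\mu(B_1^+(0))}\int_{B_1^+(0)}|\nabla w|^2dx$.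
   Formalization: The energy is taken to be +∞ unless |μ| ≤ 1 on [−1,1] (and the integrand is 0 where μ² = 1 and μ' = 0); without this, profiles oscillating above 1 make the infimum −∞, so the limit as literally written would not be a real number. *)

theory Defs
  imports "HOL-Analysis.Analysis"
begin

definition smooth1 :: "(real \<Rightarrow> real) \<Rightarrow> bool" where
  "smooth1 f \<longleftrightarrow> (\<forall>k x. ((deriv ^^ k) f) differentiable (at x))"

definition test1 :: "real set \<Rightarrow> (real \<Rightarrow> real) \<Rightarrow> bool" where
  "test1 U \<phi> \<longleftrightarrow> smooth1 \<phi> \<and> (\<exists>K. compact K \<and> K \<subseteq> U \<and> (\<forall>x. x \<notin> K \<longrightarrow> \<phi> x = 0))"

type_synonym pt = "real \<times> real"

definition pd :: "bool \<Rightarrow> (pt \<Rightarrow> real) \<Rightarrow> (pt \<Rightarrow> real)" where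
  "pd b f = (\<lambda>(x, y). if b then deriv (\<lambda>t. f (t, y)) x else deriv (\<lambda>t. f (x, t)) y)"

definition grad2 :: "(pt \<Rightarrow> real) \<Rightarrow> pt \<Rightarrow> pt" where
  "grad2 f p = (pd True f p, pd False f p)"

definition smooth2 :: "(pt \<Rightarrow> real) \<Rightarrow> bool" where
  "smooth2 f \<longleftrightarrow> (\<forall>ks x. (foldr pd ks f) differentiable (at x))"

definition test2 :: "pt set \<Rightarrow> (pt \<Rightarrow> real) \<Rightarrow> bool" where
  "test2 U \<phi> \<longleftrightarrow> smooth2 \<phi> \<and> (\<exists>K. compact K \<and> K \<subseteq> U \<and> (\<forall>x. x \<notin> K \<longrightarrow> \<phi> x = 0))"

definition W12_1 :: "real set \<Rightarrow> (real \<Rightarrow> real) \<Rightarrow> (real \<Rightarrow> real) \<Rightarrow> bool" where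
  "W12_1 U u g \<longleftrightarrow>
     set_borel_measurable lborel U u \<and> set_borel_measurable lborel U g \<and>
     (\<integral>\<^sup>+x\<in>U. ennreal ((u x)\<^sup>2) \<partial>lborel) < \<infinity> \<and>
     (\<integral>\<^sup>+x\<in>U. ennreal ((g x)\<^sup>2) \<partial>lborel) < \<infinity> \<and>
     (\<forall>\<phi>. test1 U \<phi> \<longrightarrow>
        (LINT x:U|lborel. u x * deriv \<phi> x) = - (LINT x:U|lborel. g x * \<phi> x))"

definition in_W12_1 :: "real set \<Rightarrow> (real \<Rightarrow> real) \<Rightarrow> bool" where
  "in_W12_1 U u \<longleftrightarrow> (\<exists>g. W12_1 U u g)"

(* weak derivative (unique a.e.) *)
definition wderiv1 :: "real set \<Rightarrow> (real \<Rightarrow> real) \<Rightarrow> (real \<Rightarrow> real)" where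
  "wderiv1 U u = (SOME g. W12_1 U u g)"

definition W12_2 :: "pt set \<Rightarrow> (pt \<Rightarrow> real) \<Rightarrow> (pt \<Rightarrow> pt) \<Rightarrow> bool" where
  "W12_2 U w G \<longleftrightarrow>
     set_borel_measurable lborel U w \<and> set_borel_measurable lborel U G \<and>
     (\<integral>\<^sup>+x\<in>U. ennreal ((w x)\<^sup>2) \<partial>lborel) < \<infinity> \<and>
     (\<integral>\<^sup>+x\<in>U. ennreal ((norm (G x))\<^sup>2) \<partial>lborel) < \<infinity> \<and>
     (\<forall>\<phi>. test2 U \<phi> \<longrightarrow>
        (LINT x:U|lborel. w x * pd True \<phi> x) = - (LINT x:U|lborel. fst (G x) * \<phi> x) \<and>
        (LINT x:U|lborel. w x * pd False \<phi> x) = - (LINT x:U|lborel. snd (G x) * \<phi> x))"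

definition in_W12_2 :: "pt set \<Rightarrow> (pt \<Rightarrow> real) \<Rightarrow> bool" where
  "in_W12_2 U w \<longleftrightarrow> (\<exists>G. W12_2 U w G)"

(* weak gradient (unique a.e.) *)
definition wgrad :: "pt set \<Rightarrow> (pt \<Rightarrow> real) \<Rightarrow> (pt \<Rightarrow> pt)" where
  "wgrad U w = (SOME G. W12_2 U w G)"

definition Bplus :: "pt set" where
  "Bplus = {x. norm x < 1 \<and> snd x > 0}"

(* M_gamma; mu(0), mu(+-1) refer to the continuous representative *)
definition Mgam :: "real \<Rightarrow> (real \<Rightarrow> real) set" where
  "Mgam \<gamma> = {\<mu>. in_W12_1 {-1<..<1} \<mu> \<and> continuous_on {-1..1} \<mu> \<and>
                 \<mu> 0 = 1 \<and> \<mu> (-1) \<le> 1 - \<gamma> \<and> \<mu> 1 \<le> 1 - \<gamma>}"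

(* W^{1,2}_mu(B_1^+): boundary conditions in the sense of traces (Evans' definition:
   limits in L^2 of the boundary values of smooth approximants converging in W^{1,2}).
   The flat part is parametrised by x1 in (-1,1), the arc by the angle t in (0,pi)
   (arc-length). *)
definition Wmu :: "real \<Rightarrow> (real \<Rightarrow> real) \<Rightarrow> (pt \<Rightarrow> real) set" where
  "Wmu \<gamma> \<mu> = {w. in_W12_2 Bplus w \<and>
     (\<exists>\<phi>. (\<forall>n. smooth2 (\<phi> n)) \<and>
       (\<lambda>n. \<integral>\<^sup>+x\<in>Bplus. ennreal ((\<phi> n x - w x)\<^sup>2) \<partial>lborel) \<longlonglongrightarrow> 0 \<and>
       (\<lambda>n. \<integral>\<^sup>+x\<in>Bplus. ennreal ((norm (grad2 (\<phi> n) x - wgrad Bplus w x))\<^sup>2) \<partial>lborel) \<longlonglongrightarrow> 0 \<and>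
       (\<lambda>n. \<integral>\<^sup>+t\<in>{-1<..<1}. ennreal ((\<phi> n (t, 0) - \<mu> t)\<^sup>2) \<partial>lborel) \<longlonglongrightarrow> 0 \<and>
       (\<exists>g. (AE t in lborel. t \<in> {0<..<pi} \<longrightarrow> g t \<le> 1 - \<gamma>) \<and>
            (\<lambda>n. \<integral>\<^sup>+t\<in>{0<..<pi}. ennreal ((\<phi> n (cos t, sin t) - g t)\<^sup>2) \<partial>lborel) \<longlonglongrightarrow> 0))}"

definition dirichlet :: "(pt \<Rightarrow> real) \<Rightarrow> ennreal" where
  "dirichlet w = (\<integral>\<^sup>+x\<in>Bplus. ennreal ((norm (wgrad Bplus w x))\<^sup>2) \<partial>lborel)"

(* int (mu')^2/(1-mu^2); m=(mu, +-sqrt(1-mu^2)) so |mu| <= 1 is implicit: +infinity otherwise *)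
definition wall :: "(real \<Rightarrow> real) \<Rightarrow> ennreal" where
  "wall \<mu> = (if \<forall>x\<in>{-1..1}. \<bar>\<mu> x\<bar> \<le> 1
     then \<integral>\<^sup>+x\<in>{-1<..<1}. ennreal ((wderiv1 {-1<..<1} \<mu> x)\<^sup>2 / (1 - (\<mu> x)\<^sup>2)) \<partial>lborel
     else \<infinity>)"

definition Egam :: "real \<Rightarrow> real \<Rightarrow> (real \<Rightarrow> real) \<Rightarrow> ennreal" where
  "Egam \<gamma> \<epsilon> \<mu> = ennreal (\<epsilon> / 2) * wall \<mu> + ennreal (1/2) * (INF w\<in>Wmu \<gamma> \<mu>. dirichlet w)"

definition Einf :: "real \<Rightarrow> real \<Rightarrow> ennreal" where
  "Einf \<gamma> \<epsilon> = (INF \<mu>\<in>Mgam \<gamma>. Egam \<gamma> \<epsilon> \<mu>)"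

end

theory Submission
  imports Defs "HOL-Analysis.Analysis" "HOL-Real_Asymp.Real_Asymp"
begin

text \<open>
  Write \<open>L = ln (1 / \<delta>)\<close> and let \<open>G \<epsilon>\<close> be the renormalised minimal energy. An explicit logarithmic profile bounds
  \<open>G\<close> from above. In logarithmic polar coordinates \<open>(s, t)\<close>, completing the square around the gradient of
  \<open>(\<gamma> / L) s\<close> bounds \<open>G\<close> from below, because the wall energy controls \<open>1 - \<mu>\<close> near the origin; the same identity
  shows that for an almost minimiser \<open>L\<^sup>2\<close> times the integral of the square that was completed stays bounded.

  Convergence follows from almost monotonicity: for small \<open>\<epsilon>\<close>, and all sufficiently small \<open>\<epsilon>'\<close> depending on \<open>\<epsilon>\<close>,
  \<open>G \<epsilon>' \<le> G \<epsilon> + err \<epsilon>\<close> with \<open>err \<epsilon> \<rightarrow> 0\<close>. To compare the scales, pigeonholing over about \<open>L / 4\<close> annuli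
  of ratio \<open>exp 1\<close> gives one, at radius at least \<open>exp (- L / 2)\<close>, in which an almost minimiser for \<open>\<epsilon>\<close> is close to a
  logarithm. Its part inside this annulus is shrunk to the scale of \<open>\<epsilon>'\<close>, continued outside by an exact logarithm, and
  multiplied by a constant that restores the boundary value on the arc.
\<close>

text \<open>Scaling explains the normalisation. As \<open>\<delta> = exp (- L)\<close>, the factor
  \<open>L^2 * \<epsilon>\<close> of the wall energy behaves like \<open>L * exp (- L)\<close>. Put
  \<open>T = L' - L\<close> and \<open>a = L / L'\<close>. Dilation by \<open>exp (- T)\<close>
  multiplies the wall energy by \<open>exp T\<close> and preserves the Dirichlet energy; multiplying
  \<open>1 - w\<close> by \<open>a\<close> costs a factor \<open>a^2\<close> in the Dirichlet energy
  and, near \<open>\<mu> = 1\<close>, a factor \<open>a\<close> in the wall energy. Both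
  renormalised terms thus keep their values, and to leading order the added logarithm costs
  \<open>pi * \<gamma>^2 / 2 * (L' - L)\<close>, the change of the subtracted term. The comparison
  runs towards small \<epsilon>: as \<open>a\<close> tends to 0 the core is flattened towards 1, and
  with \<open>u = 1 - \<mu>\<close> the denominator \<open>u * (2 - u)\<close> is replaced by nearly
  \<open>2 * u\<close>, which is no smaller. The obstacle is the transition zone, where the
  denominator of the wall energy may degenerate; it dictates a squared cut-off and a positive lower
  bound for the average \<open>c\<close> of \<open>1 - \<mu>\<close> there. Since traces are defined
  through smooth approximants, the strip estimates are made for those, with bounds uniform in
  \<open>n\<close>, before passing to the limit.\<close>

abbreviation sqint :: "'a::euclidean_space set \<Rightarrow> ('a \<Rightarrow> real) \<Rightarrow> ennreal" where
  "sqint U f \<equiv> \<integral>\<^sup>+x\<in>U. ennreal ((f x)^2) \<partial>lborel"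

abbreviation grad_sq :: "(pt \<Rightarrow> real) \<Rightarrow> ennreal" where
  "grad_sq f \<equiv> sqint Bplus (\<lambda>x. norm (grad2 f x))"

subsection \<open>Smooth functions\<close>

definition smooth_on :: "real set \<Rightarrow> (real \<Rightarrow> real) \<Rightarrow> bool" where
  "smooth_on U f \<longleftrightarrow> (\<forall>k. \<forall>x\<in>U. ((deriv ^^ k) f) differentiable (at x))"

lemma smooth1_iff: "smooth1 f \<longleftrightarrow> smooth_on UNIV f"
  by (simp add: smooth1_def smooth_on_def)

lemma deriv_cong_open:
  assumes "open U" "x \<in> U" "\<And>y. y \<in> U \<Longrightarrow> f y = g y"
  shows "deriv f x = deriv g x"
  by (rule deriv_cong_ev) (use assms in \<open>auto simp: eventually_nhds\<close>)

lemma differentiable_cong_open: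
  assumes "open U" "x \<in> U" "\<And>y. y \<in> U \<Longrightarrow> f y = g y" "g differentiable (at x)"
  shows "(f :: real \<Rightarrow> real) differentiable (at x)"
proof -
  obtain D where "(g has_derivative D) (at x)" using assms(4) by (auto simp: differentiable_def)
  then have "(f has_derivative D) (at x)"
    by (rule has_derivative_transform_within_open[OF _ assms(1,2)]) (simp add: assms(3))
  then show ?thesis by (auto simp: differentiable_def)
qed

text \<open>A class closed under one differentiation contains all higher derivatives. The derivative
  has to agree with a member of the class only on the open set, which is enough because
  \<open>deriv\<close> is local.\<close>

lemma smooth_on_coinduct:
  assumes U: "open U" and f: "P f"
    and diff: "\<And>f x. P f \<Longrightarrow> x \<in> U \<Longrightarrow> f differentiable (at x)"
    and step: "\<And>f. P f \<Longrightarrow> \<exists>g. P g \<and> (\<forall>x\<in>U. deriv f x = g x)"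
  shows "smooth_on U f"
proof -
  have *: "\<exists>g. P g \<and> (\<forall>x\<in>U. (deriv ^^ k) f x = g x)" for k
  proof (induction k)
    case (Suc k)
    then obtain g where g: "P g" "\<forall>x\<in>U. (deriv ^^ k) f x = g x" by blast
    obtain h where h: "P h" "\<forall>x\<in>U. deriv g x = h x" using step[OF g(1)] by blast
    have "\<forall>x\<in>U. (deriv ^^ Suc k) f x = h x"
      using deriv_cong_open[OF U, of _ "(deriv ^^ k) f" g] g h by simp
    with h show ?case by blast
  qed (use f in auto)
  show ?thesis unfolding smooth_on_def
  proof (intro allI ballI)
    fix k x assume x: "x \<in> U"
    obtain g where g: "P g" "\<forall>x\<in>U. (deriv ^^ k) f x = g x" using * by blast
    show "(deriv ^^ k) f differentiable (at x)"
      by (rule differentiable_cong_open[OF U x, of _ g]) (use g x diff in auto)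
  qed
qed

lemma smooth_on_deriv: "smooth_on U f \<Longrightarrow> smooth_on U (deriv f)"
  unfolding smooth_on_def by (metis funpow_Suc_right o_apply)

lemma smooth_on_differentiable: "smooth_on U f \<Longrightarrow> x \<in> U \<Longrightarrow> f differentiable (at x)"
  unfolding smooth_on_def by (metis funpow_0)

lemma smooth_on_has_deriv:
  "smooth_on U f \<Longrightarrow> x \<in> U \<Longrightarrow> (f has_real_derivative deriv f x) (at x)"
  using smooth_on_differentiable DERIV_deriv_iff_real_differentiable by blast

lemma smooth_on_cong:
  assumes "open U" "smooth_on U f" "\<And>x. x \<in> U \<Longrightarrow> f x = g x"
  shows "smooth_on U g"
proof (rule smooth_on_coinduct[where P = "\<lambda>g. \<exists>f. smooth_on U f \<and> (\<forall>x\<in>U. f x = g x)", OF assms(1)])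
  show "\<exists>f. smooth_on U f \<and> (\<forall>x\<in>U. f x = g x)" using assms by blast
next
  fix g x assume "\<exists>f. smooth_on U f \<and> (\<forall>x\<in>U. f x = g x)" "x \<in> U"
  then obtain f where "smooth_on U f" "\<forall>x\<in>U. f x = g x" "x \<in> U" by blast
  then show "g differentiable (at x)"
    by (intro differentiable_cong_open[OF assms(1), of x g f] smooth_on_differentiable) auto
next
  fix g assume "\<exists>f. smooth_on U f \<and> (\<forall>x\<in>U. f x = g x)"
  then obtain f where f: "smooth_on U f" "\<forall>x\<in>U. f x = g x" by blast
  have "deriv g x = deriv f x" if "x \<in> U" for x
    by (rule deriv_cong_open[OF assms(1) that]) (use f in auto)
  then show "\<exists>h. (\<exists>f. smooth_on U f \<and> (\<forall>x\<in>U. f x = h x)) \<and> (\<forall>x\<in>U. deriv g x = h x)"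
    using smooth_on_deriv[OF f(1)] by (intro exI[of _ "deriv f"]) auto
qed

lemma smooth_onI_deriv:
  assumes "open U" "\<And>x. x \<in> U \<Longrightarrow> (f has_real_derivative g x) (at x)" "smooth_on U g"
  shows "smooth_on U f"
  unfolding smooth_on_def
proof (intro allI ballI)
  fix k x assume x: "x \<in> U"
  show "(deriv ^^ k) f differentiable (at x)"
  proof (cases k)
    case 0 then show ?thesis using assms(2)[OF x] by (auto simp: real_differentiable_def)
  next
    case (Suc j)
    have "smooth_on U (deriv f)"
      by (rule smooth_on_cong[OF assms(1,3)]) (use assms(2) DERIV_imp_deriv in fastforce)
    then show ?thesis using Suc x unfolding smooth_on_def by (metis funpow_Suc_right o_apply)
  qed
qed

lemma smooth_on_subset: "smooth_on U f \<Longrightarrow> V \<subseteq> U \<Longrightarrow> smooth_on V f"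
  unfolding smooth_on_def by blast

lemma smooth_on_Un: "smooth_on U f \<Longrightarrow> smooth_on V f \<Longrightarrow> smooth_on (U \<union> V) f"
  unfolding smooth_on_def by blast

text \<open>Product and chain rule lead out of the smooth functions only into sums, products and
  compositions of them. This closure is therefore an invariant for
  \<open>smooth_on_coinduct\<close>, which spares the Leibniz and Faa di Bruno formulas.\<close>

inductive smooth_alg :: "real set \<Rightarrow> (real \<Rightarrow> real) \<Rightarrow> bool" for U where
  base: "smooth_on U f \<Longrightarrow> smooth_alg U f"
| add: "smooth_alg U f \<Longrightarrow> smooth_alg U g \<Longrightarrow> smooth_alg U (\<lambda>x. f x + g x)"
| mult: "smooth_alg U f \<Longrightarrow> smooth_alg U g \<Longrightarrow> smooth_alg U (\<lambda>x. f x * g x)"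
| comp: "open V \<Longrightarrow> smooth_on V h \<Longrightarrow> smooth_alg U f \<Longrightarrow> f ` U \<subseteq> V \<Longrightarrow> smooth_alg U (\<lambda>x. h (f x))"

lemma smooth_alg_derivI:
  assumes "\<And>x. x \<in> U \<Longrightarrow> (f has_real_derivative g x) (at x)" "smooth_alg U g"
  shows "(\<forall>x\<in>U. f differentiable (at x)) \<and> (\<exists>g. smooth_alg U g \<and> (\<forall>x\<in>U. deriv f x = g x))"
  using assms by (metis DERIV_imp_deriv real_differentiable_def)

lemma smooth_alg_deriv:
  assumes "smooth_alg U f"
  shows "(\<forall>x\<in>U. f differentiable (at x)) \<and> (\<exists>g. smooth_alg U g \<and> (\<forall>x\<in>U. deriv f x = g x))"
  using assms
proof induction
  case (base f)
  then show ?case using smooth_on_differentiable smooth_on_deriv smooth_alg.base by blast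
next
  case (add f g)
  then obtain f' g' where *: "smooth_alg U f'" "\<forall>x\<in>U. deriv f x = f' x"
      "smooth_alg U g'" "\<forall>x\<in>U. deriv g x = g' x" by blast
  have D: "((\<lambda>x. f x + g x) has_real_derivative f' x + g' x) (at x)" if "x \<in> U" for x
    using add * that by (metis DERIV_add DERIV_deriv_iff_real_differentiable)
  show ?case
    by (rule smooth_alg_derivI[OF D]) (use * in \<open>auto intro: smooth_alg.intros\<close>)
next
  case (mult f g)
  then obtain f' g' where *: "smooth_alg U f'" "\<forall>x\<in>U. deriv f x = f' x"
      "smooth_alg U g'" "\<forall>x\<in>U. deriv g x = g' x" by blast
  have D: "((\<lambda>x. f x * g x) has_real_derivative f' x * g x + g' x * f x) (at x)" if "x \<in> U" for x
    using mult * that by (metis DERIV_mult DERIV_deriv_iff_real_differentiable)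
  show ?case
    by (rule smooth_alg_derivI[OF D]) (use * mult in \<open>auto intro!: smooth_alg.add smooth_alg.mult\<close>)
next
  case (comp V h f)
  then obtain f' where *: "smooth_alg U f'" "\<forall>x\<in>U. deriv f x = f' x" by blast
  have D: "((\<lambda>x. h (f x)) has_real_derivative deriv h (f x) * f' x) (at x)" if "x \<in> U" for x
  proof -
    have 1: "(h has_real_derivative deriv h (f x)) (at (f x))"
      using smooth_on_has_deriv[OF comp.hyps(2)] comp.hyps that by blast
    have 2: "(f has_real_derivative f' x) (at x)"
      using comp.IH * that by (metis DERIV_deriv_iff_real_differentiable)
    show ?thesis by (rule DERIV_chain2[OF 1 2])
  qed
  have "smooth_alg U (\<lambda>x. deriv h (f x))"
    using comp smooth_alg.comp smooth_on_deriv by blast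
  then show ?case
    by (intro smooth_alg_derivI[OF D]) (use * comp in \<open>auto intro!: smooth_alg.mult\<close>)
qed

lemma smooth_alg_imp: "open U \<Longrightarrow> smooth_alg U f \<Longrightarrow> smooth_on U f"
  by (rule smooth_on_coinduct[where P = "smooth_alg U"]) (use smooth_alg_deriv in blast)+

lemma smooth_on_const [simp]: "smooth_on U (\<lambda>x. c)"
proof -
  have "smooth_on UNIV (\<lambda>x. c)"
    by (rule smooth_on_coinduct[where P = "\<lambda>f. \<exists>c. f = (\<lambda>x. c)"]) auto
  then show ?thesis using smooth_on_subset by blast
qed

lemma smooth_on_id [simp]: "smooth_on U (\<lambda>x. x)"
proof -
  have "smooth_on UNIV (\<lambda>x. x)"
    by (rule smooth_onI_deriv[where g = "\<lambda>x. 1"]) auto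
  then show ?thesis using smooth_on_subset by blast
qed

lemma smooth_on_add: "open U \<Longrightarrow> smooth_on U f \<Longrightarrow> smooth_on U g \<Longrightarrow> smooth_on U (\<lambda>x. f x + g x)"
  and smooth_on_mult: "open U \<Longrightarrow> smooth_on U f \<Longrightarrow> smooth_on U g \<Longrightarrow> smooth_on U (\<lambda>x. f x * g x)"
  and smooth_on_comp: "open U \<Longrightarrow> open V \<Longrightarrow> smooth_on V h \<Longrightarrow> smooth_on U f \<Longrightarrow> f ` U \<subseteq> V
    \<Longrightarrow> smooth_on U (\<lambda>x. h (f x))"
  by (auto intro!: smooth_alg_imp intro: smooth_alg.intros)

lemma smooth_on_minus: "open U \<Longrightarrow> smooth_on U f \<Longrightarrow> smooth_on U (\<lambda>x. - f x)"
  using smooth_on_mult[of U "\<lambda>x. -1" f] by simp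

lemma smooth_on_diff: "open U \<Longrightarrow> smooth_on U f \<Longrightarrow> smooth_on U g \<Longrightarrow> smooth_on U (\<lambda>x. f x - g x)"
  using smooth_on_add[of U f "\<lambda>x. - g x"] smooth_on_minus by simp

text \<open>The monomials \<open>c * inverse x ^ n\<close> form a family closed under
  differentiation on the positive half-line, and \<open>inverse\<close> is the member with
  \<open>c = n = 1\<close>.\<close>

lemma smooth_on_inverse: "smooth_on {0<..} (inverse :: real \<Rightarrow> real)"
proof (rule smooth_on_coinduct[where P = "\<lambda>f. \<exists>c n. f = (\<lambda>x. c * inverse x ^ n)"])
  have D: "((\<lambda>x. c * inverse x ^ n) has_real_derivative (- c * real n) * inverse x ^ Suc n) (at x)"
    if "x > 0" for x c :: real and n
  proof -
    have "((\<lambda>x. c * inverse x ^ n) has_real_derivative c * (real n * (- (inverse x * inverse x) * inverse x ^ (n - 1)))) (at x)"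
      using that by (auto intro!: derivative_eq_intros simp: power2_eq_square)
    \<comment> \<open>For \<open>n = 0\<close> the truncated exponent \<open>n - 1\<close> is 0, but
      the factor \<open>real n\<close> vanishes.\<close>
    also have "c * (real n * (- (inverse x * inverse x) * inverse x ^ (n - 1))) = (- c * real n) * inverse x ^ Suc n"
      by (cases n) auto
    finally show ?thesis .
  qed
  show "f differentiable (at x)" if "\<exists>c n. f = (\<lambda>x. c * inverse x ^ n)" "x \<in> {0<..}" for f :: "real \<Rightarrow> real" and x
    using that D by (auto simp: real_differentiable_def)
  show "\<exists>g. (\<exists>c n. g = (\<lambda>x. c * inverse x ^ n)) \<and> (\<forall>x\<in>{0<..}. deriv f x = g x)"
    if f: "\<exists>c n. f = (\<lambda>x. c * inverse x ^ n)" for f :: "real \<Rightarrow> real"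
  proof -
    obtain c n where "f = (\<lambda>x. c * inverse x ^ n)" using f by blast
    then have "\<forall>x\<in>{0<..}. deriv f x = (- c * real n) * inverse x ^ Suc n"
      using D DERIV_imp_deriv by fastforce
    then show ?thesis by (intro exI[of _ "\<lambda>x. (- c * real n) * inverse x ^ Suc n"]) blast
  qed
  show "\<exists>c n. inverse = (\<lambda>x::real. c * inverse x ^ n)"
    by (intro exI[of _ 1] exI[of _ 1]) auto
qed auto

lemma smooth_on_ln: "smooth_on {0<..} (ln :: real \<Rightarrow> real)"
  by (rule smooth_onI_deriv[where g = inverse]) (auto intro: DERIV_ln smooth_on_inverse)

subsection \<open>A smooth step\<close>

definition flat_exp :: "real \<Rightarrow> real" where
  "flat_exp t = (if t > 0 then exp (- inverse t) else 0)"

lemma exp_inverse_poly_tendsto_0: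
  "((\<lambda>t::real. (inverse t ^ n) * exp (- inverse t)) \<longlongrightarrow> 0) (at_right 0)"
proof -
  have "((\<lambda>s::real. s ^ n / exp s) \<longlongrightarrow> 0) at_top" by (rule tendsto_power_div_exp_0)
  then have "((\<lambda>t::real. inverse t ^ n / exp (inverse t)) \<longlongrightarrow> 0) (at_right 0)"
    by (rule filterlim_compose) (rule filterlim_inverse_at_top_right)
  then show ?thesis by (simp add: exp_minus divide_inverse)
qed

text \<open>All derivatives of \<open>flat_exp\<close> have this form. For \<open>t > 0\<close>,
  differentiation sends \<open>p\<close> to \<open>X^2 * (p - p')\<close> in the variable
  \<open>X = inverse t\<close>, which is the polynomial appearing in
  \<open>flat_poly_deriv\<close>.\<close>

definition flat_poly :: "real poly \<Rightarrow> real \<Rightarrow> real" where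
  "flat_poly p t = (if t > 0 then poly p (inverse t) * exp (- inverse t) else 0)"

lemma flat_poly_tendsto_0: "((\<lambda>t. poly p (inverse t) * exp (- inverse t)) \<longlongrightarrow> (0::real)) (at_right 0)"
proof -
  have "((\<lambda>t. \<Sum>i\<le>degree p. coeff p i * (inverse t ^ i * exp (- inverse t))) \<longlongrightarrow> (\<Sum>i\<le>degree p. coeff p i * (0::real))) (at_right 0)"
    by (intro tendsto_sum tendsto_mult tendsto_const exp_inverse_poly_tendsto_0)
  then show ?thesis by (simp add: poly_altdef sum_distrib_right mult.assoc)
qed

lemma flat_poly_deriv:
  "(flat_poly p has_real_derivative flat_poly ([:0,0,1:] * (p - pderiv p)) t) (at t)"
proof -
  consider "t > 0" | "t < 0" | "t = 0" by linarith
  then show ?thesis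
  proof cases
    case 1
    have "((\<lambda>t. poly p (inverse t) * exp (- inverse t)) has_real_derivative flat_poly ([:0,0,1:] * (p - pderiv p)) t) (at t)"
      using 1 by (auto intro!: derivative_eq_intros simp: flat_poly_def algebra_simps power2_eq_square)
    then show ?thesis
      by (rule DERIV_cong_ev[THEN iffD1, rotated -1])
         (use 1 in \<open>auto simp: flat_poly_def eventually_nhds intro!: exI[of _ "{0<..}"]\<close>)
  next
    case 2
    have "((\<lambda>t. 0) has_real_derivative flat_poly ([:0,0,1:] * (p - pderiv p)) t) (at t)"
      using 2 by (auto simp: flat_poly_def)
    then show ?thesis
      by (rule DERIV_cong_ev[THEN iffD1, rotated -1])
         (use 2 in \<open>auto simp: flat_poly_def eventually_nhds intro!: exI[of _ "{..<0}"]\<close>)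
  next
    case 3
    \<comment> \<open>The difference quotient at 0 is again of this form: division by
      \<open>h\<close> multiplies the polynomial by its variable, giving
      \<open>pCons 0 p\<close>.\<close>
    have r: "((\<lambda>h. flat_poly p h / h) \<longlongrightarrow> 0) (at_right 0)"
      by (rule Lim_transform_eventually[OF flat_poly_tendsto_0[of "pCons 0 p"]])
         (auto simp: eventually_at_filter flat_poly_def divide_inverse)
    have l: "((\<lambda>h. flat_poly p h / h) \<longlongrightarrow> 0) (at_left 0)"
      by (rule Lim_transform_eventually[OF tendsto_const])
         (auto simp: eventually_at_filter flat_poly_def)
    have "((\<lambda>h. flat_poly p h / h) \<longlongrightarrow> 0) (at 0)"
      using l r by (simp add: filterlim_split_at)
    then show ?thesis using 3 by (simp add: DERIV_def flat_poly_def)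
  qed
qed

lemma smooth_on_flat_exp: "smooth_on UNIV flat_exp"
proof (rule smooth_on_coinduct[where P = "\<lambda>f. \<exists>p. f = flat_poly p"])
  show "\<exists>p. flat_exp = flat_poly p"
    by (rule exI[of _ 1]) (auto simp: flat_exp_def flat_poly_def)
qed (use flat_poly_deriv DERIV_imp_deriv in \<open>auto simp: real_differentiable_def\<close>, blast+)

definition smooth_step :: "real \<Rightarrow> real" where
  "smooth_step t = flat_exp t * inverse (flat_exp t + flat_exp (1 - t))"

lemma flat_exp_nonneg: "flat_exp t \<ge> 0" by (simp add: flat_exp_def)

lemma smooth_step_denom: "flat_exp t + flat_exp (1 - t) > 0"
  by (cases "t > 0") (auto simp: flat_exp_def intro: add_pos_nonneg)

lemma smooth_step_bounds: "0 \<le> smooth_step t" "smooth_step t \<le> 1"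
  using smooth_step_denom[of t] flat_exp_nonneg[of t] flat_exp_nonneg[of "1 - t"]
  by (auto simp: smooth_step_def field_simps)

lemma smooth_step_0: "t \<le> 0 \<Longrightarrow> smooth_step t = 0"
  by (simp add: smooth_step_def flat_exp_def)

lemma smooth_step_1: "t \<ge> 1 \<Longrightarrow> smooth_step t = 1"
  by (simp add: smooth_step_def flat_exp_def)

lemma smooth_on_smooth_step: "smooth_on UNIV smooth_step"
proof -
  have 1: "smooth_on UNIV (\<lambda>t. flat_exp (1 - t))"
    by (rule smooth_on_comp[OF _ _ smooth_on_flat_exp]) (auto intro: smooth_on_diff)
  have "smooth_on UNIV (\<lambda>t. flat_exp t * inverse (flat_exp t + flat_exp (1 - t)))"
    by (intro smooth_on_mult smooth_on_flat_exp smooth_on_comp[OF _ _ smooth_on_inverse] smooth_on_add 1)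
       (use smooth_step_denom in auto)
  then show ?thesis by (simp add: smooth_step_def[abs_def])
qed

lemma smooth_step_deriv_bound: "\<exists>B>0. \<forall>t. \<bar>deriv smooth_step t\<bar> \<le> B"
proof -
  have d: "(smooth_step has_real_derivative deriv smooth_step t) (at t)" for t
    using smooth_on_has_deriv[OF smooth_on_smooth_step] by auto
  have "continuous_on {0..1} (deriv smooth_step)"
    by (rule continuous_at_imp_continuous_on)
       (use smooth_on_has_deriv[OF smooth_on_deriv[OF smooth_on_smooth_step]] DERIV_isCont in blast)
  then have "bounded (deriv smooth_step ` {0..1})"
    using compact_continuous_image compact_imp_bounded by blast
  then obtain B where B: "B > 0" "\<And>t. t \<in> {0..1} \<Longrightarrow> \<bar>deriv smooth_step t\<bar> \<le> B"
    by (force simp: bounded_pos)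
  have "deriv smooth_step t = 0" if "t < 0" for t
    using deriv_cong_open[of "{..<0}" t smooth_step "\<lambda>_. 0"] that smooth_step_0 by auto
  moreover have "deriv smooth_step t = 0" if "t > 1" for t
    using deriv_cong_open[of "{1<..}" t smooth_step "\<lambda>_. 1"] that smooth_step_1 by auto
  ultimately have "\<bar>deriv smooth_step t\<bar> \<le> B" for t
    using B by (cases "t < 0"; cases "t > 1") auto
  then show ?thesis using B by blast
qed

subsection \<open>Smooth functions on the plane\<close>

lemma pd_True: "pd True f (x, y) = deriv (\<lambda>t. f (t, y)) x"
  and pd_False: "pd False f (x, y) = deriv (\<lambda>t. f (x, t)) y"
  by (simp_all add: pd_def)

lemma differentiable_partials:
  fixes f :: "pt \<Rightarrow> real"
  assumes "f differentiable (at (x, y))"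
  shows "((\<lambda>t. f (t, y)) has_real_derivative pd True f (x, y)) (at x)"
    and "((\<lambda>t. f (x, t)) has_real_derivative pd False f (x, y)) (at y)"
proof -
  obtain f' where f': "(f has_derivative f') (at (x, y))" using assms by (auto simp: differentiable_def)
  have "((\<lambda>t. (t, y)) has_derivative (\<lambda>h. (h, 0))) (at x)"
    by (auto intro!: derivative_eq_intros)
  then have "((\<lambda>t. f (t, y)) has_derivative (\<lambda>h. f' (h, 0))) (at x)"
    using f' by (rule has_derivative_compose)
  then have "(\<lambda>t. f (t, y)) differentiable (at x)" by (auto simp: differentiable_def)
  then show "((\<lambda>t. f (t, y)) has_real_derivative pd True f (x, y)) (at x)"
    unfolding pd_True by (simp add: DERIV_deriv_iff_real_differentiable)
  have "((\<lambda>t. (x, t)) has_derivative (\<lambda>h. (0, h))) (at y)"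
    by (auto intro!: derivative_eq_intros)
  then have "((\<lambda>t. f (x, t)) has_derivative (\<lambda>h. f' (0, h))) (at y)"
    using f' by (rule has_derivative_compose)
  then have "(\<lambda>t. f (x, t)) differentiable (at y)" by (auto simp: differentiable_def)
  then show "((\<lambda>t. f (x, t)) has_real_derivative pd False f (x, y)) (at y)"
    unfolding pd_False by (simp add: DERIV_deriv_iff_real_differentiable)
qed

text \<open>\<open>pd\<close> is made of one-variable derivatives along lines; here they are
  identified as the coordinates of the total derivative, and through \<open>pd_unique\<close> all
  rules for \<open>pd\<close> reduce to rules for \<open>has_derivative\<close>.\<close>

lemma has_derivative_grad2:
  fixes f :: "pt \<Rightarrow> real"
  assumes "f differentiable (at p)"
  shows "(f has_derivative (\<lambda>h. fst h * pd True f p + snd h * pd False f p)) (at p)"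
proof -
  obtain x y where p: "p = (x, y)" by force
  obtain f' where f': "(f has_derivative f') (at (x, y))" using assms p by (auto simp: differentiable_def)
  have "((\<lambda>t. (t, y)) has_derivative (\<lambda>h. (h, 0))) (at x)"
    by (auto intro!: derivative_eq_intros)
  then have "((\<lambda>t. f (t, y)) has_derivative (\<lambda>h. f' (h, 0))) (at x)"
    using f' by (rule has_derivative_compose)
  moreover have "((\<lambda>t. f (t, y)) has_derivative (\<lambda>h. pd True f p * h)) (at x)"
    using differentiable_partials(1)[of f x y] assms p by (simp add: has_field_derivative_def)
  ultimately have 1: "f' (h, 0) = pd True f p * h" for h
    using has_derivative_unique by metis
  have "((\<lambda>t. (x, t)) has_derivative (\<lambda>h. (0, h))) (at y)"
    by (auto intro!: derivative_eq_intros)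
  then have "((\<lambda>t. f (x, t)) has_derivative (\<lambda>h. f' (0, h))) (at y)"
    using f' by (rule has_derivative_compose)
  moreover have "((\<lambda>t. f (x, t)) has_derivative (\<lambda>h. pd False f p * h)) (at y)"
    using differentiable_partials(2)[of f x y] assms p by (simp add: has_field_derivative_def)
  ultimately have 2: "f' (0, h) = pd False f p * h" for h
    using has_derivative_unique by metis
  interpret bounded_linear f' using f' by (rule has_derivative_bounded_linear)
  have "f' h = fst h * pd True f p + snd h * pd False f p" for h
    using add[of "(fst h, 0)" "(0, snd h)"] by (simp add: 1 2 mult.commute)
  then have "f' = (\<lambda>h. fst h * pd True f p + snd h * pd False f p)" by blast
  then show ?thesis using f' p by simp
qed

lemma pd_unique:
  assumes "(f has_derivative (\<lambda>h. fst h * a + snd h * b)) (at (p::pt))"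
  shows "pd True f p = a" "pd False f p = b"
proof -
  have "f differentiable (at p)" using assms by (auto simp: differentiable_def)
  from has_derivative_unique[OF has_derivative_grad2[OF this] assms]
  have *: "fst h * pd True f p + snd h * pd False f p = fst h * a + snd h * b" for h by metis
  from *[of "(1,0)"] *[of "(0,1)"] show "pd True f p = a" "pd False f p = b" by auto
qed

lemma smooth2_differentiable: "smooth2 f \<Longrightarrow> f differentiable (at p)"
  unfolding smooth2_def by (metis foldr.simps(1) id_apply)

lemma smooth2_pd: "smooth2 f \<Longrightarrow> smooth2 (pd b f)"
proof -
  assume f: "smooth2 f"
  have "foldr pd ks (pd b f) = foldr pd (ks @ [b]) f" for ks by simp
  then show ?thesis using f unfolding smooth2_def by metis
qed

lemma smooth2_coinduct:
  assumes "P f" "\<And>f x. P f \<Longrightarrow> f differentiable (at x)" "\<And>f b. P f \<Longrightarrow> P (pd b f)"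
  shows "smooth2 f"
proof -
  have "P (foldr pd ks f)" for ks by (induction ks) (use assms in auto)
  then show ?thesis using assms(2) by (simp add: smooth2_def)
qed

text \<open>The plane analogue of \<open>smooth_alg\<close>. The dilation clause is there because
  the competitors are shrunk copies; outer composition with one-variable functions covers the radial
  profiles and the bumps.\<close>

inductive smooth2_alg :: "(pt \<Rightarrow> real) \<Rightarrow> bool" where
  base: "smooth2 f \<Longrightarrow> smooth2_alg f"
| add: "smooth2_alg f \<Longrightarrow> smooth2_alg g \<Longrightarrow> smooth2_alg (\<lambda>x. f x + g x)"
| mult: "smooth2_alg f \<Longrightarrow> smooth2_alg g \<Longrightarrow> smooth2_alg (\<lambda>x. f x * g x)"
| comp: "smooth_on UNIV h \<Longrightarrow> smooth2_alg f \<Longrightarrow> smooth2_alg (\<lambda>x. h (f x))"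
| scale: "smooth2_alg f \<Longrightarrow> smooth2_alg (\<lambda>x. f (c *\<^sub>R x))"

lemma has_derivative_grad2_add:
  assumes "f differentiable (at p)" "g differentiable (at p)"
  shows "((\<lambda>x. f x + g x) has_derivative (\<lambda>h. fst h * (pd True f p + pd True g p) + snd h * (pd False f p + pd False g p))) (at (p::pt))"
  by (rule has_derivative_eq_rhs[OF has_derivative_add[OF has_derivative_grad2[OF assms(1)] has_derivative_grad2[OF assms(2)]]])
     (auto simp: algebra_simps)

lemma has_derivative_grad2_mult:
  assumes "f differentiable (at p)" "g differentiable (at p)"
  shows "((\<lambda>x. f x * g x :: real) has_derivative (\<lambda>h. fst h * (f p * pd True g p + pd True f p * g p) + snd h * (f p * pd False g p + pd False f p * g p))) (at (p::pt))"
  by (rule has_derivative_eq_rhs[OF has_derivative_mult[OF has_derivative_grad2[OF assms(1)] has_derivative_grad2[OF assms(2)]]])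
     (auto simp: algebra_simps)

lemma has_derivative_grad2_comp:
  assumes "f differentiable (at p)" "(h has_real_derivative h') (at (f p))"
  shows "((\<lambda>x. h (f x) :: real) has_derivative (\<lambda>k. fst k * (h' * pd True f p) + snd k * (h' * pd False f p))) (at (p::pt))"
  by (rule has_derivative_eq_rhs[OF has_derivative_compose[OF has_derivative_grad2[OF assms(1)] assms(2)[unfolded has_field_derivative_def]]])
     (auto simp: algebra_simps)

lemma has_derivative_grad2_scale:
  assumes "f differentiable (at (c *\<^sub>R p))"
  shows "((\<lambda>x. f (c *\<^sub>R x) :: real) has_derivative (\<lambda>k. fst k * (c * pd True f (c *\<^sub>R p)) + snd k * (c * pd False f (c *\<^sub>R p)))) (at (p::pt))"
proof -
  have "((\<lambda>x::pt. c *\<^sub>R x) has_derivative (\<lambda>h. c *\<^sub>R h)) (at p)" by (auto intro!: derivative_eq_intros)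
  from has_derivative_eq_rhs[OF has_derivative_compose[OF this has_derivative_grad2[OF assms]]]
  show ?thesis by (auto simp: algebra_simps)
qed

lemmas pd_add = has_derivative_grad2_add[THEN pd_unique(1)] has_derivative_grad2_add[THEN pd_unique(2)]
lemmas pd_mult = has_derivative_grad2_mult[THEN pd_unique(1)] has_derivative_grad2_mult[THEN pd_unique(2)]
lemmas pd_comp = has_derivative_grad2_comp[THEN pd_unique(1)] has_derivative_grad2_comp[THEN pd_unique(2)]
lemmas pd_scale = has_derivative_grad2_scale[THEN pd_unique(1)] has_derivative_grad2_scale[THEN pd_unique(2)]

lemma smooth2_const [simp]: "smooth2 (\<lambda>x. c)"
proof (rule smooth2_coinduct[where P = "\<lambda>f. \<exists>c. f = (\<lambda>x. c)"])
  fix f :: "pt \<Rightarrow> real" and b assume "\<exists>c. f = (\<lambda>x. c)"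
  then show "\<exists>c. pd b f = (\<lambda>x. c)"
    by (cases b) (auto simp: pd_def fun_eq_iff)
qed auto

lemma smooth2_alg_pd: "smooth2_alg f \<Longrightarrow> (\<forall>x. f differentiable (at x)) \<and> (\<forall>b. smooth2_alg (pd b f))"
proof (induction rule: smooth2_alg.induct)
  case (base f)
  then show ?case using smooth2_differentiable smooth2_pd smooth2_alg.base by blast
next
  case (add f g)
  then have D: "f differentiable (at p)" "g differentiable (at p)" for p by blast+
  have "pd b (\<lambda>x. f x + g x) = (\<lambda>p. pd b f p + pd b g p)" for b
    by (cases b) (auto simp: fun_eq_iff pd_add D)
  moreover have "smooth2_alg (\<lambda>p. pd b f p + pd b g p)" for b using smooth2_alg.add add by blast
  moreover have "(\<lambda>x. f x + g x) differentiable (at p)" for p using D by (intro differentiable_add)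
  ultimately show ?case by simp
next
  case (mult f g)
  then have D: "f differentiable (at p)" "g differentiable (at p)" for p by blast+
  have "pd b (\<lambda>x. f x * g x) = (\<lambda>p. f p * pd b g p + pd b f p * g p)" for b
    by (cases b) (auto simp: fun_eq_iff pd_mult D)
  moreover have "smooth2_alg (\<lambda>p. f p * pd b g p + pd b f p * g p)" for b
    by (intro smooth2_alg.add smooth2_alg.mult) (use mult in blast)+
  moreover have "(\<lambda>x. f x * g x) differentiable (at p)" for p using D by (intro differentiable_mult)
  ultimately show ?case by simp
next
  case (comp h f)
  then have D: "f differentiable (at p)" for p by blast
  have H: "(h has_real_derivative deriv h t) (at t)" for t using comp smooth_on_has_deriv by auto
  have "pd b (\<lambda>x. h (f x)) = (\<lambda>p. deriv h (f p) * pd b f p)" for b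
    by (cases b) (auto simp: fun_eq_iff pd_comp[OF D H])
  moreover have "smooth2_alg (\<lambda>p. deriv h (f p))" using comp smooth_on_deriv smooth2_alg.comp by blast
  moreover have "(\<lambda>x. h (f x)) differentiable (at p)" for p
    using has_derivative_grad2_comp[OF D H, of p] unfolding differentiable_def by blast
  moreover have "smooth2_alg (pd b f)" for b using comp by blast
  ultimately show ?case by (auto intro: smooth2_alg.mult)
next
  case (scale f c)
  then have D: "f differentiable (at p)" for p by blast
  have "pd b (\<lambda>x. f (c *\<^sub>R x)) = (\<lambda>p. c * pd b f (c *\<^sub>R p))" for b
    by (cases b) (auto simp: fun_eq_iff pd_scale[OF D])
  moreover have "smooth2_alg (\<lambda>p. c)" by (simp add: smooth2_alg.base)
  moreover have "(\<lambda>x. f (c *\<^sub>R x)) differentiable (at p)" for p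
    using has_derivative_grad2_scale[OF D[of "c *\<^sub>R p"]] unfolding differentiable_def by blast
  moreover have "smooth2_alg (\<lambda>p. pd b f (c *\<^sub>R p))" for b
    using scale by (intro smooth2_alg.scale) blast
  ultimately show ?case by (auto intro: smooth2_alg.mult)
qed

lemma smooth2_alg_imp: "smooth2_alg f \<Longrightarrow> smooth2 f"
  by (rule smooth2_coinduct[where P = smooth2_alg]) (use smooth2_alg_pd in auto)

lemma smooth2_add: "smooth2 f \<Longrightarrow> smooth2 g \<Longrightarrow> smooth2 (\<lambda>x. f x + g x)"
  and smooth2_mult: "smooth2 f \<Longrightarrow> smooth2 g \<Longrightarrow> smooth2 (\<lambda>x. f x * g x)"
  and smooth2_comp: "smooth_on UNIV h \<Longrightarrow> smooth2 f \<Longrightarrow> smooth2 (\<lambda>x. h (f x))"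
  and smooth2_scale: "smooth2 f \<Longrightarrow> smooth2 (\<lambda>x. f (c *\<^sub>R x))"
  by (auto intro!: smooth2_alg_imp intro: smooth2_alg.intros)

lemma smooth2_diff: "smooth2 f \<Longrightarrow> smooth2 g \<Longrightarrow> smooth2 (\<lambda>x. f x - g x)"
  using smooth2_add[of f "\<lambda>x. (-1) * g x"] smooth2_mult[of "\<lambda>_. -1" g] by simp

lemma pd_fst: "pd b fst = (\<lambda>x. if b then 1 else 0)" and pd_snd: "pd b snd = (\<lambda>x. if b then 0 else 1)"
  by (cases b; auto simp: pd_def fun_eq_iff)+

lemma smooth2_fst: "smooth2 fst" and smooth2_snd: "smooth2 snd"
proof -
  have "smooth2_alg (\<lambda>x. c)" for c by (simp add: smooth2_alg.base)
  have *: "f differentiable (at x)" if "f = fst \<or> f = snd \<or> (\<exists>c. f = (\<lambda>x. c))" for f :: "pt \<Rightarrow> real" and x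
    using that by (auto intro!: bounded_linear_imp_differentiable[OF bounded_linear_fst] bounded_linear_imp_differentiable[OF bounded_linear_snd])
  have **: "pd b f = fst \<or> pd b f = snd \<or> (\<exists>c. pd b f = (\<lambda>x. c))" if "f = fst \<or> f = snd \<or> (\<exists>c. f = (\<lambda>x. c))" for f b
    using that by (cases b) (auto simp: pd_fst pd_snd, auto simp: pd_def fun_eq_iff)
  show "smooth2 fst" "smooth2 snd"
    by (rule smooth2_coinduct[where P = "\<lambda>f. f = fst \<or> f = snd \<or> (\<exists>c. f = (\<lambda>x. c))"]; use * ** in blast)+
qed

lemma smooth2_continuous: "smooth2 f \<Longrightarrow> continuous_on S f"
  by (meson continuous_at_imp_continuous_on differentiable_imp_continuous_within smooth2_differentiable)

lemma smooth2_sqnorm: "smooth2 (\<lambda>x. (fst x)^2 + (snd x)^2)"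
  unfolding power2_eq_square by (intro smooth2_add smooth2_mult smooth2_fst smooth2_snd)

subsection \<open>The fundamental lemma of the calculus of variations\<close>

text \<open>\<open>ennreal\<close> truncates negative values to 0, so the two densities are the
  positive and the negative part of \<open>h\<close>. A vanishing signed integral becomes an
  equality of measures, to which uniqueness theorems for measures apply.\<close>

lemma emeasure_pos_neg_part_eq_iff:
  fixes h :: "'a::euclidean_space \<Rightarrow> real"
  assumes int: "integrable lborel h" and A: "A \<in> sets borel"
  shows "emeasure (density lborel (\<lambda>x. ennreal (h x))) A = emeasure (density lborel (\<lambda>x. ennreal (- h x))) A
    \<longleftrightarrow> (LINT x:A|lborel. h x) = 0"
    "emeasure (density lborel (\<lambda>x. ennreal (h x))) A \<noteq> \<infinity>"
proof -
  have [measurable]: "h \<in> borel_measurable borel" using int by auto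
  let ?M = "density lborel (\<lambda>x. ennreal (h x))" and ?N = "density lborel (\<lambda>x. ennreal (- h x))"
  have pos: "integrable lborel (\<lambda>x. max 0 (h x))" "integrable lborel (\<lambda>x. max 0 (- h x))"
    using int by (auto intro!: integrable_max)
  have *: "ennreal y * indicator A x = ennreal (max 0 y * indicator A x)" for x y
    by (auto simp: indicator_def ennreal_neg max_def)
  have i: "integrable lborel (\<lambda>x. max 0 (h x) * indicator A x)" "integrable lborel (\<lambda>x. max 0 (- h x) * indicator A x)"
    using integrable_mult_indicator[OF _ pos(1), of A] integrable_mult_indicator[OF _ pos(2), of A] A
    by (auto simp: mult.commute)
  have M: "emeasure ?M A = ennreal (LINT x|lborel. max 0 (h x) * indicator A x)"
    using A i(1) by (simp add: emeasure_density * nn_integral_eq_integral)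
  have N: "emeasure ?N A = ennreal (LINT x|lborel. max 0 (- h x) * indicator A x)"
    using A i(2) by (simp add: emeasure_density * nn_integral_eq_integral)
  have "(LINT x:A|lborel. h x) = (LINT x|lborel. max 0 (h x) * indicator A x - max 0 (- h x) * indicator A x)"
    unfolding set_lebesgue_integral_def
    by (rule Bochner_Integration.integral_cong) (auto simp: indicator_def max_def)
  also have "\<dots> = (LINT x|lborel. max 0 (h x) * indicator A x) - (LINT x|lborel. max 0 (- h x) * indicator A x)"
    using i by (rule Bochner_Integration.integral_diff)
  finally show "emeasure ?M A = emeasure ?N A \<longleftrightarrow> (LINT x:A|lborel. h x) = 0" by (simp add: M N)
  show "emeasure ?M A \<noteq> \<infinity>" by (simp add: M)
qed

text \<open>Boxes form an intersection-stable generator, so the measures of the positive and the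
  negative part coincide. Uniqueness of densities makes both parts equal almost everywhere, and
  since at most one of them is nonzero at a point, both vanish.\<close>

lemma AE_zero_if_box_integrals_zero:
  fixes h :: "'a::euclidean_space \<Rightarrow> real"
  assumes int: "integrable lborel h" and box: "\<And>a b. (LINT x:box a b|lborel. h x) = 0"
  shows "AE x in lborel. h x = 0"
proof -
  have [measurable]: "h \<in> borel_measurable borel" using int by auto
  let ?M = "density lborel (\<lambda>x. ennreal (h x))" and ?N = "density lborel (\<lambda>x. ennreal (- h x))"
  have eq: "emeasure ?M (box a b) = emeasure ?N (box a b)" for a b
    using emeasure_pos_neg_part_eq_iff(1)[OF int, of "box a b"] box by simp
  have "?M = ?N"
  proof (rule measure_eqI_generator_eq[where E = "range (\<lambda>(a, b). box a b)" and \<Omega> = UNIV and A = "\<lambda>n. box (- real n *\<^sub>R One) (real n *\<^sub>R One)"])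
    show "Int_stable (range (\<lambda>(a, b). box a b :: 'a set))"
      by (auto simp: Int_stable_def box_Int_box)
    show "(\<Union>i. box (- real i *\<^sub>R One) (real i *\<^sub>R One)) = (UNIV :: 'a set)"
      by (simp add: UN_box_eq_UNIV)
    show "emeasure ?M (box (- real i *\<^sub>R One) (real i *\<^sub>R One)) \<noteq> \<infinity>" for i
      by (rule emeasure_pos_neg_part_eq_iff(2)[OF int]) simp
  qed (use eq in \<open>auto simp: borel_eq_box\<close>)
  then have "AE x in lborel. ennreal (h x) = ennreal (- h x)"
    by (intro sigma_finite_measure.density_unique[OF sigma_finite_lborel]) auto
  then show ?thesis
  proof (rule AE_mp, intro AE_I2 impI)
    fix x assume "ennreal (h x) = ennreal (- h x)"
    then show "h x = 0"
      using ennreal_neg[of "h x"] ennreal_neg[of "- h x"] ennreal_eq_0_iff[of "h x"] ennreal_eq_0_iff[of "- h x"]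
      by (cases "h x \<ge> 0") (simp_all del: ennreal_eq_0_iff)
  qed
qed

text \<open>By Lindelof, countably many boxes whose closures lie in \<open>U\<close> cover
  \<open>U\<close>, and the intersection of such a box with any other box is again of this kind; so
  the global criterion applies to \<open>h\<close> cut off to each of them.\<close>

lemma AE_zero_on_open:
  fixes h :: "'a::euclidean_space \<Rightarrow> real"
  assumes U: "open U"
    and int: "\<And>a b. cbox a b \<subseteq> U \<Longrightarrow> set_integrable lborel (cbox a b) h"
    and zero: "\<And>a b. cbox a b \<subseteq> U \<Longrightarrow> (LINT x:box a b|lborel. h x) = 0"
  shows "AE x in lborel. x \<in> U \<longrightarrow> h x = 0"
proof -
  define F where "F = {box a b |a b. cbox a b \<subseteq> U}"
  have "open S" if "S \<in> F" for S using that by (auto simp: F_def)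
  then obtain F' where F': "F' \<subseteq> F" "countable F'" "\<Union>F' = \<Union>F" using Lindelof by metis
  have UF: "\<Union>F' = U"
  proof -
    have "\<Union>F \<subseteq> U" using box_subset_cbox by (fastforce simp: F_def)
    moreover have "U \<subseteq> \<Union>F"
    proof
      fix x assume "x \<in> U"
      then obtain a b where "cbox a b \<subseteq> U" "x \<in> box a b" using open_contains_cbox[OF U] by metis
      then show "x \<in> \<Union>F" by (auto simp: F_def)
    qed
    ultimately show ?thesis using F' by auto
  qed
  have "AE x in lborel. x \<in> S \<longrightarrow> h x = 0" if "S \<in> F'" for S
  proof -
    have "S \<in> F" using that F' by blast
    then obtain a b where S: "S = box a b" "cbox a b \<subseteq> U" by (auto simp: F_def)
    have "AE x in lborel. indicator S x *\<^sub>R h x = 0"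
    proof (rule AE_zero_if_box_integrals_zero)
      have "set_integrable lborel S h"
        by (rule set_integrable_subset[OF int[OF S(2)]]) (auto simp: S box_subset_cbox)
      then show "integrable lborel (\<lambda>x. indicator S x *\<^sub>R h x)" by (simp add: set_integrable_def)
      fix c d :: 'a
      have *: "(LINT x:box c d|lborel. indicator S x *\<^sub>R h x) = (LINT x:(box a b \<inter> box c d)|lborel. h x)"
        unfolding set_lebesgue_integral_def by (rule Bochner_Integration.integral_cong) (auto simp: S indicator_def)
      show "(LINT x:box c d|lborel. indicator S x *\<^sub>R h x) = 0"
        unfolding * box_Int_box
      proof (rule zero)
        show "cbox (\<Sum>i\<in>Basis. max (a \<bullet> i) (c \<bullet> i) *\<^sub>R i) (\<Sum>i\<in>Basis. min (b \<bullet> i) (d \<bullet> i) *\<^sub>R i) \<subseteq> U"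
          using S(2) by (rule order_trans[rotated]) (auto simp: mem_box)
      qed
    qed
    then show ?thesis by (rule AE_mp) (auto simp: indicator_def)
  qed
  then have "AE x in lborel. \<forall>S\<in>F'. x \<in> S \<longrightarrow> h x = 0"
    by (subst AE_ball_countable[OF F'(2)]) blast
  then show ?thesis by (rule AE_mp) (use UF in auto)
qed

lemma set_integrable_of_sq:
  fixes g :: "'a::euclidean_space \<Rightarrow> real"
  assumes "set_borel_measurable lborel U g" "U \<in> sets lborel" "emeasure lborel U < \<infinity>"
    "sqint U g < \<infinity>"
  shows "set_integrable lborel U g"
  unfolding set_integrable_def
proof (rule integrableI_bounded)
  show m: "(\<lambda>x. indicat_real U x *\<^sub>R g x) \<in> borel_measurable lborel"
    using assms(1) by (simp add: set_borel_measurable_def)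
  have m2: "(\<lambda>x. ennreal ((g x)^2) * indicator U x) \<in> borel_measurable lborel"
  proof -
    have "(\<lambda>x. ennreal ((indicat_real U x *\<^sub>R g x)^2)) \<in> borel_measurable lborel" using m by measurable
    then show ?thesis by (rule measurable_cong[THEN iffD1, rotated]) (auto simp: indicator_def)
  qed
  have "(\<integral>\<^sup>+x. ennreal (norm (indicat_real U x *\<^sub>R g x)) \<partial>lborel) \<le> (\<integral>\<^sup>+x. indicator U x + ennreal ((g x)^2) * indicator U x \<partial>lborel)"
  proof (rule nn_integral_mono)
    fix x
    have "\<bar>g x\<bar> \<le> 1 + (g x)^2"
    proof (cases "\<bar>g x\<bar> \<le> 1")
      case False
      then have "\<bar>g x\<bar> * 1 \<le> \<bar>g x\<bar> * \<bar>g x\<bar>" by (intro mult_left_mono) auto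
      then show ?thesis by (simp add: power2_eq_square flip: abs_mult)
    qed (smt (verit) zero_le_power2)
    then have "ennreal \<bar>g x\<bar> \<le> 1 + ennreal ((g x)^2)"
      by (metis ennreal_1 ennreal_leI ennreal_plus zero_le_one zero_le_power2)
    then show "ennreal (norm (indicat_real U x *\<^sub>R g x)) \<le> indicator U x + ennreal ((g x)^2) * indicator U x"
      by (auto simp: indicator_def)
  qed
  also have "\<dots> = emeasure lborel U + sqint U g"
    using assms(2) m2 by (subst nn_integral_add) auto
  also have "\<dots> < \<infinity>" using assms(3,4) by (simp add: ennreal_add_eq_top less_top)
  finally show "(\<integral>\<^sup>+x. ennreal (norm (indicat_real U x *\<^sub>R g x)) \<partial>lborel) < \<infinity>" .
qed

text \<open>The transition layers, of width \<open>1 / n\<close>, lie inside the interval. Hence all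
  these functions are supported in the one compact set \<open>{a..b}\<close> while they converge to
  the indicator of its interior.\<close>

definition bump :: "nat \<Rightarrow> real \<Rightarrow> real \<Rightarrow> real \<Rightarrow> real" where
  "bump n a b x = smooth_step (real n * (x - a)) * smooth_step (real n * (b - x))"

lemma bump_bounds: "0 \<le> bump n a b x" "bump n a b x \<le> 1"
  by (auto simp: bump_def smooth_step_bounds intro!: mult_le_one)

lemma bump_eq_0: "x \<notin> {a<..<b} \<Longrightarrow> bump n a b x = 0"
  by (auto simp: bump_def smooth_step_0 mult_nonneg_nonpos not_less)

lemma bump_tendsto: "(\<lambda>n. bump n a b x) \<longlonglongrightarrow> indicator {a<..<b} x"
proof (cases "x \<in> {a<..<b}")
  case True
  have "\<forall>\<^sub>F n in sequentially. 1 \<le> real n * (x - a)" "\<forall>\<^sub>F n in sequentially. 1 \<le> real n * (b - x)"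
    using True by real_asymp+
  then have "\<forall>\<^sub>F n in sequentially. 1 = bump n a b x"
    by eventually_elim (simp add: bump_def smooth_step_1)
  then show ?thesis using True by (auto intro: Lim_transform_eventually[OF tendsto_const])
next
  case False then show ?thesis by (simp add: bump_eq_0 del: greaterThanLessThan_iff)
qed

lemma smooth_on_affine: "smooth_on UNIV (\<lambda>x. c * (x - a))"
  by (intro smooth_on_mult smooth_on_diff) auto

lemma smooth_on_bump: "smooth_on UNIV (bump n a b)"
proof -
  have 1: "smooth_on UNIV (\<lambda>x. smooth_step (real n * (x - a)))"
    by (rule smooth_on_comp[OF _ _ smooth_on_smooth_step smooth_on_affine]) auto
  have "smooth_on UNIV (\<lambda>x. - real n * (x - b))" by (rule smooth_on_affine)
  then have "smooth_on UNIV (\<lambda>x. real n * (b - x))" by (simp add: algebra_simps)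
  then have 2: "smooth_on UNIV (\<lambda>x. smooth_step (real n * (b - x)))"
    by (intro smooth_on_comp[OF _ _ smooth_on_smooth_step]) auto
  from smooth_on_mult[OF _ 1 2] show ?thesis by (simp add: bump_def[abs_def])
qed

lemma test1_bump: "{a..b} \<subseteq> U \<Longrightarrow> test1 U (bump n a b)"
  unfolding test1_def smooth1_iff
  by (intro conjI smooth_on_bump exI[of _ "{a..b}"]) (auto simp: bump_eq_0)

definition bump2 :: "nat \<Rightarrow> pt \<Rightarrow> pt \<Rightarrow> pt \<Rightarrow> real" where
  "bump2 n a b x = bump n (fst a) (fst b) (fst x) * bump n (snd a) (snd b) (snd x)"

lemma smooth2_bump2: "smooth2 (bump2 n a b)"
  unfolding bump2_def[abs_def]
  by (intro smooth2_mult smooth2_comp[OF smooth_on_bump] smooth2_fst smooth2_snd)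

lemma mem_box_pt: "x \<in> box (a::pt) b \<longleftrightarrow> fst x \<in> {fst a<..<fst b} \<and> snd x \<in> {snd a<..<snd b}"
  and mem_cbox_pt: "x \<in> cbox (a::pt) b \<longleftrightarrow> fst x \<in> {fst a..fst b} \<and> snd x \<in> {snd a..snd b}"
  by (auto simp: mem_box Basis_prod_def ball_Un inner_prod_def)

lemma bump2_bounds: "0 \<le> bump2 n a b x" "bump2 n a b x \<le> 1"
  by (auto simp: bump2_def bump_bounds intro!: mult_le_one)

lemma bump2_eq_0: "x \<notin> cbox a b \<Longrightarrow> bump2 n a b x = 0"
  by (auto simp: bump2_def mem_cbox_pt bump_eq_0)

lemma bump2_tendsto: "(\<lambda>n. bump2 n a b x) \<longlonglongrightarrow> indicator (box a b) x"
proof -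
  have "(\<lambda>n. bump2 n a b x) \<longlonglongrightarrow> indicator {fst a<..<fst b} (fst x) * indicator {snd a<..<snd b} (snd x)"
    unfolding bump2_def by (intro tendsto_mult bump_tendsto)
  also have "indicator {fst a<..<fst b} (fst x) * indicator {snd a<..<snd b} (snd x) = (indicator (box a b) x :: real)"
    by (auto simp: indicator_def mem_box_pt)
  finally show ?thesis .
qed

lemma test2_bump2: "cbox a b \<subseteq> U \<Longrightarrow> test2 U (bump2 n a b)"
  unfolding test2_def
  by (intro conjI smooth2_bump2 exI[of _ "cbox a b"]) (auto simp: bump2_eq_0 compact_cbox)

lemma box_integral_zero_of_bumps:
  fixes h :: "'a::euclidean_space \<Rightarrow> real" and \<phi> :: "nat \<Rightarrow> 'a \<Rightarrow> real"
  assumes int: "set_integrable lborel U h" and sub: "cbox a b \<subseteq> U"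
    and meas: "\<And>n. \<phi> n \<in> borel_measurable borel"
    and bnd: "\<And>n x. \<bar>\<phi> n x\<bar> \<le> 1" and supp: "\<And>n x. x \<notin> cbox a b \<Longrightarrow> \<phi> n x = 0"
    and lim: "\<And>x. (\<lambda>n. \<phi> n x) \<longlonglongrightarrow> indicator (box a b) x"
    and zero: "\<And>n. (LINT x:U|lborel. h x * \<phi> n x) = 0"
  shows "(LINT x:box a b|lborel. h x) = 0"
proof -
  let ?h = "\<lambda>x. indicator U x * h x"
  have i: "integrable lborel ?h" using int by (simp add: set_integrable_def)
  have "(\<lambda>n. LINT x|lborel. ?h x * \<phi> n x) \<longlonglongrightarrow> (LINT x|lborel. ?h x * indicator (box a b) x)"
  proof (rule integral_dominated_convergence[where w = "\<lambda>x. \<bar>?h x\<bar>"])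
    show "AE x in lborel. (\<lambda>n. ?h x * \<phi> n x) \<longlonglongrightarrow> ?h x * indicator (box a b) x"
      by (intro AE_I2 tendsto_mult tendsto_const lim)
    show "AE x in lborel. norm (?h x * \<phi> n x) \<le> \<bar>?h x\<bar>" for n
    proof (rule AE_I2)
      fix x show "norm (?h x * \<phi> n x) \<le> \<bar>?h x\<bar>"
        using mult_left_mono[OF bnd[of n x], of "\<bar>?h x\<bar>"] by (simp add: abs_mult)
    qed
  qed (use i meas in \<open>auto intro!: borel_measurable_times borel_measurable_integrable[OF i]\<close>)
  moreover have "(LINT x|lborel. ?h x * \<phi> n x) = 0" for n
    using zero[of n] by (simp add: set_lebesgue_integral_def mult.assoc)
  ultimately have "(LINT x|lborel. ?h x * indicator (box a b) x) = 0"
    using LIMSEQ_unique[OF _ tendsto_const[of 0]] by simp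
  moreover have "?h x * indicator (box a b) x = indicator (box a b) x *\<^sub>R h x" for x
    using sub box_subset_cbox[of a b] by (auto simp: indicator_def)
  ultimately show ?thesis by (simp add: set_lebesgue_integral_def)
qed

lemma set_integrable_mult_bounded:
  fixes h \<phi> :: "'a::euclidean_space \<Rightarrow> real"
  assumes "set_integrable lborel U h" "\<phi> \<in> borel_measurable borel" "\<And>x. \<bar>\<phi> x\<bar> \<le> B"
  shows "set_integrable lborel U (\<lambda>x. h x * \<phi> x)"
  unfolding set_integrable_def
proof (rule Bochner_Integration.integrable_bound)
  show "integrable lborel (\<lambda>x. B * (indicator U x *\<^sub>R h x))"
    using assms(1) by (simp add: set_integrable_def)
  have m: "(\<lambda>x. indicator U x *\<^sub>R h x) \<in> borel_measurable borel"
    using assms(1) by (auto simp: set_integrable_def)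
  have "(\<lambda>x. (indicator U x *\<^sub>R h x) * \<phi> x) \<in> borel_measurable borel"
    using m assms(2) by measurable
  then show "(\<lambda>x. indicator U x *\<^sub>R (h x * \<phi> x)) \<in> borel_measurable lborel" by (simp add: mult.assoc)
  show "AE x in lborel. norm (indicat_real U x *\<^sub>R (h x * \<phi> x)) \<le> norm (B * (indicat_real U x *\<^sub>R h x))"
  proof (rule AE_I2)
    fix x
    have "\<bar>\<phi> x\<bar> \<le> \<bar>B\<bar>" using assms(3)[of x] by linarith
    then have "\<bar>h x\<bar> * \<bar>\<phi> x\<bar> \<le> \<bar>h x\<bar> * \<bar>B\<bar>" by (intro mult_left_mono) auto
    then show "norm (indicat_real U x *\<^sub>R (h x * \<phi> x)) \<le> norm (B * (indicat_real U x *\<^sub>R h x))"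
      by (auto simp: indicator_def abs_mult mult.commute)
  qed
qed

text \<open>Stated for any dimension, since it is applied to \<open>bump\<close> on the interval and
  to \<open>bump2\<close> on the half-disc. Dominated convergence turns equality against bumps into
  equality of integrals over boxes.\<close>

lemma AE_eq_of_bumps:
  fixes g h :: "'a::euclidean_space \<Rightarrow> real" and \<phi> :: "nat \<Rightarrow> 'a \<Rightarrow> 'a \<Rightarrow> 'a \<Rightarrow> real"
  assumes U: "open U" and g: "set_integrable lborel U g" and h: "set_integrable lborel U h"
    and meas: "\<And>n a b. \<phi> n a b \<in> borel_measurable borel"
    and bnd: "\<And>n a b x. \<bar>\<phi> n a b x\<bar> \<le> 1" and supp: "\<And>n a b x. x \<notin> cbox a b \<Longrightarrow> \<phi> n a b x = 0"
    and lim: "\<And>a b x. (\<lambda>n. \<phi> n a b x) \<longlonglongrightarrow> indicator (box a b) x"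
    and eq: "\<And>n a b. cbox a b \<subseteq> U \<Longrightarrow> (LINT x:U|lborel. g x * \<phi> n a b x) = (LINT x:U|lborel. h x * \<phi> n a b x)"
  shows "AE x in lborel. x \<in> U \<longrightarrow> g x = h x"
proof -
  have d: "set_integrable lborel U (\<lambda>x. g x - h x)" using g h by (rule set_integral_diff)
  have "AE x in lborel. x \<in> U \<longrightarrow> g x - h x = 0"
  proof (rule AE_zero_on_open[OF U])
    fix a b assume ab: "cbox a b \<subseteq> U"
    show "set_integrable lborel (cbox a b) (\<lambda>x. g x - h x)"
      by (rule set_integrable_subset[OF d]) (use ab in auto)
    show "(LINT x:box a b|lborel. g x - h x) = 0"
    proof (rule box_integral_zero_of_bumps[OF d ab meas bnd supp lim])
      fix n
      have "(LINT x:U|lborel. (g x - h x) * \<phi> n a b x) = (LINT x:U|lborel. g x * \<phi> n a b x) - (LINT x:U|lborel. h x * \<phi> n a b x)"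
        unfolding left_diff_distrib
        by (rule set_integral_diff) (intro set_integrable_mult_bounded[OF g meas bnd] set_integrable_mult_bounded[OF h meas bnd])+
      then show "(LINT x:U|lborel. (g x - h x) * \<phi> n a b x) = 0" using eq[OF ab] by simp
    qed
  qed
  then show ?thesis by (rule AE_mp) auto
qed

lemma smooth_on_measurable: "smooth_on UNIV f \<Longrightarrow> f \<in> borel_measurable borel"
  by (intro borel_measurable_continuous_onI continuous_at_imp_continuous_on)
     (use smooth_on_has_deriv DERIV_isCont in blast)

lemma smooth2_measurable: "smooth2 f \<Longrightarrow> f \<in> borel_measurable borel"
  by (intro borel_measurable_continuous_onI smooth2_continuous)

section \<open>Uniqueness of weak derivatives on the interval and on the half-disc\<close>

abbreviation I1 :: "real set" where "I1 \<equiv> {-1<..<1}"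

lemma W12_1_integrable: "W12_1 I1 u g \<Longrightarrow> set_integrable lborel I1 u" "W12_1 I1 u g \<Longrightarrow> set_integrable lborel I1 g"
  by (rule set_integrable_of_sq; auto simp: W12_1_def)+

lemma W12_1_test: "W12_1 U u g \<Longrightarrow> test1 U \<phi> \<Longrightarrow>
    (LINT x:U|lborel. u x * deriv \<phi> x) = - (LINT x:U|lborel. g x * \<phi> x)"
  by (auto simp: W12_1_def)

lemma W12_2_test:
  assumes "W12_2 U u G" "test2 U \<phi>"
  shows "(LINT x:U|lborel. u x * pd True \<phi> x) = - (LINT x:U|lborel. fst (G x) * \<phi> x)"
    "(LINT x:U|lborel. u x * pd False \<phi> x) = - (LINT x:U|lborel. snd (G x) * \<phi> x)"
  using assms by (auto simp: W12_2_def)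

text \<open>\<open>wderiv1\<close> and \<open>wgrad\<close> are arbitrary choices among the weak
  derivatives. This lemma and its plane analogue allow \<open>wall\<close> and
  \<open>dirichlet\<close> to be evaluated with any explicit weak derivative.\<close>

lemma W12_1_unique:
  assumes "W12_1 I1 u g" "W12_1 I1 u h"
  shows "AE x in lborel. x \<in> I1 \<longrightarrow> g x = h x"
proof (rule AE_eq_of_bumps[where \<phi> = bump])
  show "(LINT x:I1|lborel. g x * bump n a b x) = (LINT x:I1|lborel. h x * bump n a b x)" if "cbox a b \<subseteq> I1" for n a b
  proof -
    have "test1 I1 (bump n a b)" using that by (intro test1_bump) auto
    from W12_1_test[OF assms(1) this] W12_1_test[OF assms(2) this] show ?thesis by simp
  qed
  show "\<bar>bump n a b x\<bar> \<le> 1" for n a b x using bump_bounds[of n a b x] by simp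
  show "bump n a b x = 0" if "x \<notin> cbox a b" for n a b x using that by (intro bump_eq_0) auto
  show "(\<lambda>n. bump n a b x) \<longlonglongrightarrow> indicator (box a b) x" for a b x using bump_tendsto[of a b x] by simp
qed (use assms W12_1_integrable smooth_on_measurable[OF smooth_on_bump] in auto)

lemma Bplus_alt: "Bplus = ball 0 1 \<inter> {x. 0 < snd x}"
  by (auto simp: Bplus_def)

lemma open_Bplus: "open Bplus"
  unfolding Bplus_alt by (intro open_Int open_ball open_Collect_less continuous_intros)

lemma Bplus_sets [measurable]: "Bplus \<in> sets borel" using open_Bplus by simp

lemma emeasure_Bplus: "emeasure lborel Bplus < \<infinity>"
proof -
  have "emeasure lborel Bplus \<le> emeasure lborel (ball (0::pt) 1)"
    by (rule emeasure_mono) (auto simp: Bplus_alt)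
  also have "\<dots> < \<infinity>" using emeasure_lborel_ball_finite by simp
  finally show ?thesis .
qed

lemma norm_fst_le': "\<bar>fst (p::pt)\<bar> \<le> norm p" and norm_snd_le': "\<bar>snd (p::pt)\<bar> \<le> norm p"
  using norm_fst_le[of "fst p" "snd p"] norm_snd_le[of "snd p" "fst p"] by auto

lemma W12_2_integrable:
  assumes "W12_2 Bplus u G"
  shows "set_integrable lborel Bplus u" "set_integrable lborel Bplus (\<lambda>x. fst (G x))" "set_integrable lborel Bplus (\<lambda>x. snd (G x))"
proof -
  have *: "sqint Bplus (\<lambda>x. norm (G x)) < \<infinity>" using assms by (auto simp: W12_2_def)
  have m: "(\<lambda>x. indicat_real Bplus x *\<^sub>R G x) \<in> borel_measurable lborel" using assms by (auto simp: W12_2_def set_borel_measurable_def)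
  show "set_integrable lborel Bplus u"
    by (rule set_integrable_of_sq) (use assms emeasure_Bplus in \<open>auto simp: W12_2_def\<close>)
  have m': "(\<lambda>x. fst (indicat_real Bplus x *\<^sub>R G x)) \<in> borel_measurable lborel"
           "(\<lambda>x. snd (indicat_real Bplus x *\<^sub>R G x)) \<in> borel_measurable lborel"
    by (intro measurable_compose[OF m] borel_measurable_continuous_onI continuous_intros)+
  have le: "sqint Bplus (\<lambda>x. f (G x)) < \<infinity>" if "\<And>p. \<bar>f p\<bar> \<le> norm p" for f :: "pt \<Rightarrow> real"
  proof (rule le_less_trans[OF _ *], rule nn_integral_mono)
    fix x
    have "(f (G x))^2 \<le> (norm (G x))^2" using that[of "G x"] by (simp add: abs_le_square_iff[symmetric])
    then show "ennreal ((f (G x))^2) * indicator Bplus x \<le> ennreal ((norm (G x))^2) * indicator Bplus x"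
      by (intro mult_right_mono ennreal_leI) auto
  qed
  show "set_integrable lborel Bplus (\<lambda>x. fst (G x))"
    by (rule set_integrable_of_sq)
       (use m'(1) emeasure_Bplus le[of fst, OF norm_fst_le'] in \<open>auto simp: set_borel_measurable_def\<close>)
  show "set_integrable lborel Bplus (\<lambda>x. snd (G x))"
    by (rule set_integrable_of_sq)
       (use m'(2) emeasure_Bplus le[of snd, OF norm_snd_le'] in \<open>auto simp: set_borel_measurable_def\<close>)
qed

lemma W12_2_unique:
  assumes "W12_2 Bplus u G" "W12_2 Bplus u H"
  shows "AE x in lborel. x \<in> Bplus \<longrightarrow> G x = H x"
proof -
  have eq: "(LINT x:Bplus|lborel. fst (G x) * bump2 n a b x) = (LINT x:Bplus|lborel. fst (H x) * bump2 n a b x)"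
           "(LINT x:Bplus|lborel. snd (G x) * bump2 n a b x) = (LINT x:Bplus|lborel. snd (H x) * bump2 n a b x)"
    if "cbox a b \<subseteq> Bplus" for n a b
  proof -
    have t: "test2 Bplus (bump2 n a b)" using that by (intro test2_bump2) auto
    from W12_2_test[OF assms(1) this] W12_2_test[OF assms(2) this]
    show "(LINT x:Bplus|lborel. fst (G x) * bump2 n a b x) = (LINT x:Bplus|lborel. fst (H x) * bump2 n a b x)"
         "(LINT x:Bplus|lborel. snd (G x) * bump2 n a b x) = (LINT x:Bplus|lborel. snd (H x) * bump2 n a b x)" by simp_all
  qed
  have b: "\<bar>bump2 n a b x\<bar> \<le> 1" for n a b x using bump2_bounds[of n a b x] by simp
  have "AE x in lborel. x \<in> Bplus \<longrightarrow> fst (G x) = fst (H x)"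
    using assms by (intro AE_eq_of_bumps[where \<phi> = bump2] open_Bplus W12_2_integrable bump2_eq_0 bump2_tendsto
        smooth2_measurable[OF smooth2_bump2] eq b)
  moreover have "AE x in lborel. x \<in> Bplus \<longrightarrow> snd (G x) = snd (H x)"
    using assms by (intro AE_eq_of_bumps[where \<phi> = bump2] open_Bplus W12_2_integrable bump2_eq_0 bump2_tendsto
        smooth2_measurable[OF smooth2_bump2] eq b)
  ultimately show ?thesis by eventually_elim (auto simp: prod_eq_iff)
qed

lemma W12_1_wderiv1: "in_W12_1 I1 u \<Longrightarrow> W12_1 I1 u (wderiv1 I1 u)"
  unfolding in_W12_1_def wderiv1_def by (fact someI_ex)

lemma W12_2_wgrad: "in_W12_2 Bplus u \<Longrightarrow> W12_2 Bplus u (wgrad Bplus u)"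
  unfolding in_W12_2_def wgrad_def by (fact someI_ex)

lemma wderiv1_AE: "W12_1 I1 u g \<Longrightarrow> AE x in lborel. x \<in> I1 \<longrightarrow> wderiv1 I1 u x = g x"
  by (rule W12_1_unique[OF W12_1_wderiv1]) (auto simp: in_W12_1_def)

lemma wgrad_AE: "W12_2 Bplus u G \<Longrightarrow> AE x in lborel. x \<in> Bplus \<longrightarrow> wgrad Bplus u x = G x"
  by (rule W12_2_unique[OF W12_2_wgrad]) (auto simp: in_W12_2_def)

lemma dirichlet_eq:
  assumes "W12_2 Bplus w G"
  shows "dirichlet w = sqint Bplus (\<lambda>x. norm (G x))"
  unfolding dirichlet_def using wgrad_AE[OF assms]
  by (intro nn_integral_cong_AE) (auto elim!: eventually_mono simp: indicator_def)

lemma wall_eq: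
  assumes "W12_1 I1 \<mu> g" "\<forall>x\<in>{-1..1}. \<bar>\<mu> x\<bar> \<le> 1"
  shows "wall \<mu> = (\<integral>\<^sup>+x\<in>I1. ennreal ((g x)^2 / (1 - (\<mu> x)\<^sup>2)) \<partial>lborel)"
proof -
  have "AE x in lborel. ennreal ((wderiv1 I1 \<mu> x)^2 / (1 - (\<mu> x)\<^sup>2)) * indicator I1 x
      = ennreal ((g x)^2 / (1 - (\<mu> x)\<^sup>2)) * indicator I1 x"
    using wderiv1_AE[OF assms(1)] by eventually_elim (simp add: indicator_def)
  then show ?thesis unfolding wall_def using assms(2) by (simp add: nn_integral_cong_AE)
qed

subsection \<open>Logarithmic polar coordinates\<close>

text \<open>The substitution rule on compact intervals passes to an increasing union by continuity
  from below of the two measures having the integrands as densities.\<close>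

lemma nn_integral_substitution_exhaust:
  fixes F :: "real \<Rightarrow> ennreal" and g g' :: "real \<Rightarrow> real" and a b :: "nat \<Rightarrow> real"
  assumes F: "F \<in> borel_measurable borel" and g: "g \<in> borel_measurable borel" "g' \<in> borel_measurable borel"
    and ab: "\<And>n. a n < b n" and inc: "incseq (\<lambda>n. {a n..b n})" and J: "(\<Union>n. {a n..b n}) = J"
    and der: "\<And>x. x \<in> J \<Longrightarrow> (g has_real_derivative g' x) (at x)"
    and cont: "continuous_on J g'" and nonneg: "\<And>x. x \<in> J \<Longrightarrow> g' x \<ge> 0"
    and K: "(\<Union>n. {g (a n)..g (b n)}) = K"
  shows "(\<integral>\<^sup>+x. F x * indicator K x \<partial>lborel) = (\<integral>\<^sup>+x. F (g x) * ennreal (g' x) * indicator J x \<partial>lborel)"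
proof -
  have sub: "{a n..b n} \<subseteq> J" for n using J by auto
  have mono: "g x \<le> g y" if "x \<le> y" "x \<in> {a n..b n}" "y \<in> {a n..b n}" for n x y
  proof (rule DERIV_nonneg_imp_nondecreasing[OF that(1)])
    fix t assume "x \<le> t" "t \<le> y"
    then have "t \<in> J" using that sub[of n] by auto
    then show "\<exists>d. (g has_real_derivative d) (at t) \<and> 0 \<le> d" using der nonneg by blast
  qed
  have inc2: "incseq (\<lambda>n. {g (a n)..g (b n)})"
  proof (intro incseq_SucI)
    fix n
    have "{a n..b n} \<subseteq> {a (Suc n)..b (Suc n)}" using inc by (auto simp: incseq_Suc_iff)
    then have "a (Suc n) \<le> a n" "b n \<le> b (Suc n)" using ab[of n] by auto
    then show "{g (a n)..g (b n)} \<subseteq> {g (a (Suc n))..g (b (Suc n))}"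
      using mono[of "a (Suc n)" "a n" "Suc n"] mono[of "b n" "b (Suc n)" "Suc n"] ab[of n] ab[of "Suc n"] by auto
  qed
  have Jm: "J \<in> sets borel" using J by auto
  let ?M = "density lborel F" and ?N = "density lborel (\<lambda>x. F (g x) * ennreal (g' x) * indicator J x)"
  have m: "(\<lambda>x. F (g x) * ennreal (g' x) * indicator J x) \<in> borel_measurable lborel"
    using F g Jm by measurable
  have "(\<integral>\<^sup>+x. F x * indicator K x \<partial>lborel) = emeasure ?M (\<Union>n. {g (a n)..g (b n)})"
    using F K by (subst emeasure_density) auto
  also have "\<dots> = (SUP n. emeasure ?M {g (a n)..g (b n)})"
    by (rule SUP_emeasure_incseq[symmetric]) (use inc2 in auto)
  also have "\<dots> = (SUP n. emeasure ?N {a n..b n})"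
  proof (rule SUP_cong[OF refl])
    fix n
    have "emeasure ?M {g (a n)..g (b n)} = (\<integral>\<^sup>+x. F x * indicator {g (a n)..g (b n)} x \<partial>lborel)"
      using F by (subst emeasure_density) auto
    also have "\<dots> = (\<integral>\<^sup>+x. F (g x) * ennreal (g' x) * indicator {a n..b n} x \<partial>lborel)"
      by (rule nn_integral_substitution_aux[OF F])
         (use der cont nonneg ab sub[of n] in \<open>auto intro: continuous_on_subset\<close>)
    also have "\<dots> = emeasure ?N {a n..b n}"
      using m sub[of n] by (subst emeasure_density) (auto intro!: nn_integral_cong simp: indicator_def)
    finally show "emeasure ?M {g (a n)..g (b n)} = emeasure ?N {a n..b n}" .
  qed
  also have "\<dots> = emeasure ?N (\<Union>n. {a n..b n})"
    by (rule SUP_emeasure_incseq) (use inc in auto)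
  also have "\<dots> = (\<integral>\<^sup>+x. F (g x) * ennreal (g' x) * indicator J x \<partial>lborel)"
    unfolding J using m Jm by (subst emeasure_density) (auto intro!: nn_integral_cong simp: indicator_def)
  finally show ?thesis .
qed

lemma nn_integral_subst_exp:
  fixes F :: "real \<Rightarrow> ennreal"
  assumes F: "F \<in> borel_measurable borel" and c: "c > 0"
  shows "(\<integral>\<^sup>+y. F y * indicator {0<..} y \<partial>lborel) = (\<integral>\<^sup>+s. F (c * exp s) * ennreal (c * exp s) \<partial>lborel)"
proof -
  have U: "(\<Union>n. {- real (Suc n)..real (Suc n)}) = (UNIV :: real set)"
  proof (intro set_eqI iffI UNIV_I)
    fix x :: real
    obtain n where "\<bar>x\<bar> \<le> real n" using real_arch_simple by blast
    then show "x \<in> (\<Union>n. {- real (Suc n)..real (Suc n)})" by (intro UN_I[of n]) auto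
  qed
  have K: "(\<Union>n. {c * exp (- real (Suc n))..c * exp (real (Suc n))}) = {0<..}"
  proof (intro set_eqI iffI)
    fix x assume "x \<in> (\<Union>n. {c * exp (- real (Suc n))..c * exp (real (Suc n))})"
    then obtain n where "c * exp (- real (Suc n)) \<le> x" by auto
    then show "x \<in> {0<..}" using c by (smt (verit) exp_gt_zero greaterThan_iff mult_pos_pos)
  next
    fix x :: real assume x: "x \<in> {0<..}"
    obtain n where n: "\<bar>ln (x / c)\<bar> \<le> real n" using real_arch_simple by blast
    have "x = c * exp (ln (x / c))" using x c by simp
    moreover have "exp (- real (Suc n)) \<le> exp (ln (x / c))" "exp (ln (x / c)) \<le> exp (real (Suc n))" using n by auto
    ultimately have "c * exp (- real (Suc n)) \<le> x" "x \<le> c * exp (real (Suc n))"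
      using c by (metis mult_le_cancel_left_pos)+
    then show "x \<in> (\<Union>n. {c * exp (- real (Suc n))..c * exp (real (Suc n))})" by auto
  qed
  have "(\<integral>\<^sup>+y. F y * indicator {0<..} y \<partial>lborel) = (\<integral>\<^sup>+s. F (c * exp s) * ennreal (c * exp s) * indicator UNIV s \<partial>lborel)"
    by (rule nn_integral_substitution_exhaust[where a = "\<lambda>n. - real (Suc n)" and b = "\<lambda>n. real (Suc n)"])
       (use F c U K in \<open>auto simp: incseq_def intro!: derivative_eq_intros continuous_intros\<close>)
  then show ?thesis by simp
qed

lemma nn_integral_subst_cot:
  fixes F :: "real \<Rightarrow> ennreal"
  assumes F: "F \<in> borel_measurable borel" and y: "y > 0"
  shows "(\<integral>\<^sup>+x. F x \<partial>lborel) = (\<integral>\<^sup>+t. F (y * cos t / sin t) * ennreal (y / (sin t)^2) * indicator {0<..<pi} t \<partial>lborel)"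
proof -
  \<comment> \<open>\<open>y * cot t\<close> decreases, so the substitution uses its negative and
    reflects the integrand. The offset 3 makes \<open>?a n < ?b n\<close> hold from
    \<open>n = 0\<close> on.\<close>
  let ?g = "\<lambda>t. - (y * cos t / sin t)" and ?a = "\<lambda>n. pi / real (n + 3)" and ?b = "\<lambda>n. pi - pi / real (n + 3)"
  have inc: "?a (Suc n) \<le> ?a n" for n by (simp add: divide_le_eq field_simps)
  have pos: "0 < ?a n" "?a n \<le> pi / 3" for n by (auto simp: field_simps)
  have U: "(\<Union>n. {?a n..?b n}) = {0<..<pi}"
  proof (intro set_eqI iffI)
    fix x assume "x \<in> (\<Union>n. {?a n..?b n})"
    then obtain n where "?a n \<le> x" "x \<le> ?b n" by auto
    moreover have "0 < ?a n" by (rule pos)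
    ultimately have "0 < x" "x < pi" by linarith+
    then show "x \<in> {0<..<pi}" by simp
  next
    fix x assume x: "x \<in> {0<..<pi}"
    define m where "m = min x (pi - x)"
    have m: "m > 0" using x by (auto simp: m_def)
    obtain n where n: "pi / m \<le> real n" using real_arch_simple by blast
    have "pi \<le> real n * m" using n m by (simp add: field_simps)
    also have "\<dots> \<le> real (n + 3) * m" using m by (intro mult_right_mono) auto
    finally have "pi / real (n + 3) \<le> m" by (simp add: divide_le_eq mult.commute)
    then show "x \<in> (\<Union>n. {?a n..?b n})" using m_def by (intro UN_I[of n]) auto
  qed
  have d: "(?g has_real_derivative y / (sin t)^2) (at t)" if "t \<in> {0<..<pi}" for t
  proof -
    have s: "sin t \<noteq> 0" using sin_gt_zero that by force
    have "(?g has_real_derivative - ((- (y * sin t) * sin t - y * cos t * cos t) / (sin t * sin t))) (at t)"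
      using s by (auto intro!: derivative_eq_intros)
    also have "- ((- (y * sin t) * sin t - y * cos t * cos t) / (sin t * sin t)) = - (- (y * sin t) * sin t - y * cos t * cos t) / (sin t)^2"
      by (simp only: minus_divide_left power2_eq_square)
    also have "- (- (y * sin t) * sin t - y * cos t * cos t) = y * ((sin t)^2 + (cos t)^2)"
      by algebra
    finally have "(?g has_real_derivative y * ((sin t)^2 + (cos t)^2) / (sin t)^2) (at t)" .
    then show ?thesis by simp
  qed
  have mono: "?g u \<le> ?g v" if "u \<le> v" "u \<in> {0<..<pi}" "v \<in> {0<..<pi}" for u v
  proof (rule DERIV_nonneg_imp_nondecreasing[OF that(1)])
    fix t assume "u \<le> t" "t \<le> v"
    then have "(?g has_real_derivative y / (sin t)^2) (at t)" using that by (intro d) auto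
    then show "\<exists>D. (?g has_real_derivative D) (at t) \<and> 0 \<le> D" using y by (intro exI[of _ "y / (sin t)^2"]) auto
  qed
  have K: "(\<Union>n. {?g (?a n)..?g (?b n)}) = UNIV"
  proof (intro set_eqI iffI UNIV_I)
    fix x :: real
    \<comment> \<open>The preimage of \<open>x\<close> under \<open>?g\<close>, because
      \<open>- cot (pi / 2 + v) = tan v\<close>.\<close>
    define t where "t = pi / 2 + arctan (x / y)"
    have t: "t \<in> {0<..<pi}" using arctan_bounded[of "x / y"] by (auto simp: t_def)
    have "sin t = cos (arctan (x / y))" "cos t = - sin (arctan (x / y))"
      by (simp_all add: t_def sin_add cos_add)
    then have "?g t = y * tan (arctan (x / y))" by (simp add: tan_def)
    then have gt: "?g t = x" using y by (simp add: tan_arctan)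
    obtain n where n: "t \<in> {?a n..?b n}" using t U by blast
    moreover have "?a n \<in> {0<..<pi}" "?b n \<in> {0<..<pi}"
    proof -
      have "0 < ?a n" "?a n \<le> pi / 3" by (rule pos)+
      then have "?a n < pi" using pi_gt_zero by linarith
      then show "?a n \<in> {0<..<pi}" "?b n \<in> {0<..<pi}" using \<open>0 < ?a n\<close> by simp_all
    qed
    ultimately have "?g (?a n) \<le> ?g t" "?g t \<le> ?g (?b n)" using t mono by (meson atLeastAtMost_iff)+
    then show "x \<in> (\<Union>n. {?g (?a n)..?g (?b n)})" using gt by auto
  qed
  have s0: "sin t \<noteq> 0" if "t \<in> {0<..<pi}" for t using sin_gt_zero that by force
  have Fm: "(\<lambda>x. F (- x)) \<in> borel_measurable borel" using F by measurable
  have "(\<integral>\<^sup>+x. F x \<partial>lborel) = (\<integral>\<^sup>+x. F (- x) \<partial>lborel)"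
    using nn_integral_real_affine[OF F, of "-1" 0] by simp
  also have "\<dots> = (\<integral>\<^sup>+x. F (- x) * indicator UNIV x \<partial>lborel)" by simp
  also have "\<dots> = (\<integral>\<^sup>+t. F (- ?g t) * ennreal (y / (sin t)^2) * indicator {0<..<pi} t \<partial>lborel)"
  proof (rule nn_integral_substitution_exhaust[OF Fm _ _ _ _ U d _ _ K])
    show "incseq (\<lambda>n. {?a n..?b n})" 
    proof (rule incseq_SucI)
      fix n show "{?a n..?b n} \<subseteq> {?a (Suc n)..?b (Suc n)}"
        using inc[of n] by (auto simp del: of_nat_Suc of_nat_add)
    qed
    show "continuous_on {0<..<pi} (\<lambda>t. y / (sin t)^2)" by (intro continuous_intros) (use s0 in auto)
    show "?a n < ?b n" for n using pos[of n] pi_gt_zero by linarith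
  qed (use y in \<open>auto\<close>)
  finally show ?thesis by simp
qed

text \<open>Two one-dimensional substitutions replace the planar change of variables:
  \<open>x = y * cot t\<close> at fixed height \<open>y\<close>, and after exchanging the integrals
  \<open>y = sin t * exp s\<close> at fixed angle \<open>t\<close>. Their derivatives multiply to
  \<open>exp (2 * s)\<close>.\<close>

lemma nn_integral_log_polar:
  fixes F :: "pt \<Rightarrow> ennreal"
  assumes F [measurable]: "F \<in> borel_measurable borel"
  shows "(\<integral>\<^sup>+x. F x * indicator {x. 0 < snd x} x \<partial>lborel) =
    (\<integral>\<^sup>+s. (\<integral>\<^sup>+t. F (exp s * cos t, exp s * sin t) * ennreal (exp (2 * s)) * indicator {0<..<pi} t \<partial>lborel) \<partial>lborel)"
proof -
  have F' [measurable]: "F \<in> borel_measurable (borel \<Otimes>\<^sub>M borel)" using F by (simp add: borel_prod)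
  have "(\<integral>\<^sup>+x. F x * indicator {x. 0 < snd x} x \<partial>lborel) = (\<integral>\<^sup>+x. F x * indicator {0<..} (snd x) \<partial>(lborel \<Otimes>\<^sub>M lborel))"
    by (auto simp: lborel_prod indicator_def intro!: nn_integral_cong)
  also have "\<dots> = (\<integral>\<^sup>+y. (\<integral>\<^sup>+x. F (x, y) * indicator {0<..} y \<partial>lborel) \<partial>lborel)"
    by (subst lborel_pair.nn_integral_snd[symmetric]) (auto simp: case_prod_beta)
  also have "\<dots> = (\<integral>\<^sup>+y. (\<integral>\<^sup>+t. F (y * cos t / sin t, y) * ennreal (y / (sin t)^2) * indicator {0<..<pi} t * indicator {0<..} y \<partial>lborel) \<partial>lborel)"
  proof (rule nn_integral_cong)
    fix y :: real
    show "(\<integral>\<^sup>+x. F (x, y) * indicator {0<..} y \<partial>lborel) = (\<integral>\<^sup>+t. F (y * cos t / sin t, y) * ennreal (y / (sin t)^2) * indicator {0<..<pi} t * indicator {0<..} y \<partial>lborel)"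
    proof (cases "y > 0")
      case True
      then show ?thesis using nn_integral_subst_cot[of "\<lambda>x. F (x, y)" y] by simp
    qed simp
  qed
  also have "\<dots> = (\<integral>\<^sup>+t. (\<integral>\<^sup>+y. F (y * cos t / sin t, y) * ennreal (y / (sin t)^2) * indicator {0<..<pi} t * indicator {0<..} y \<partial>lborel) \<partial>lborel)"
    by (rule lborel_pair.Fubini') measurable
  also have "\<dots> = (\<integral>\<^sup>+t. (\<integral>\<^sup>+s. F (exp s * cos t, exp s * sin t) * ennreal (exp (2 * s)) * indicator {0<..<pi} t \<partial>lborel) \<partial>lborel)"
  proof (rule nn_integral_cong)
    fix t :: real
    show "(\<integral>\<^sup>+y. F (y * cos t / sin t, y) * ennreal (y / (sin t)^2) * indicator {0<..<pi} t * indicator {0<..} y \<partial>lborel)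
       = (\<integral>\<^sup>+s. F (exp s * cos t, exp s * sin t) * ennreal (exp (2 * s)) * indicator {0<..<pi} t \<partial>lborel)"
    proof (cases "t \<in> {0<..<pi}")
      case True
      then have s: "sin t > 0" using sin_gt_zero by auto
      have "(\<integral>\<^sup>+y. F (y * cos t / sin t, y) * ennreal (y / (sin t)^2) * indicator {0<..} y \<partial>lborel)
         = (\<integral>\<^sup>+u. F (sin t * exp u * cos t / sin t, sin t * exp u) * ennreal (sin t * exp u / (sin t)^2) * ennreal (sin t * exp u) \<partial>lborel)"
        by (rule nn_integral_subst_exp[OF _ s]) measurable
      also have "\<dots> = (\<integral>\<^sup>+u. F (exp u * cos t, exp u * sin t) * ennreal (exp (2 * u)) \<partial>lborel)"
      proof (rule nn_integral_cong)
        fix u :: real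
        have "ennreal (sin t * exp u / (sin t)^2) * ennreal (sin t * exp u) = ennreal (exp (2 * u))"
          using s by (simp add: ennreal_mult[symmetric] power2_eq_square flip: exp_add)
        then show "F (sin t * exp u * cos t / sin t, sin t * exp u) * ennreal (sin t * exp u / (sin t)^2) * ennreal (sin t * exp u) = F (exp u * cos t, exp u * sin t) * ennreal (exp (2 * u))"
          using s by (simp add: mult.assoc) (simp add: mult.commute)
      qed
      finally show ?thesis using True by simp
    qed simp
  qed
  also have "\<dots> = (\<integral>\<^sup>+s. (\<integral>\<^sup>+t. F (exp s * cos t, exp s * sin t) * ennreal (exp (2 * s)) * indicator {0<..<pi} t \<partial>lborel) \<partial>lborel)"
    by (rule lborel_pair.Fubini') measurable
  finally show ?thesis .
qed

definition polar :: "pt \<Rightarrow> pt" where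
  "polar p = (exp (fst p) * cos (snd p), exp (fst p) * sin (snd p))"

definition lp :: "(pt \<Rightarrow> real) \<Rightarrow> pt \<Rightarrow> real" where "lp \<psi> p = \<psi> (polar p)"

definition lp_s :: "(pt \<Rightarrow> real) \<Rightarrow> pt \<Rightarrow> real" where
  "lp_s \<psi> p = exp (fst p) * (cos (snd p) * pd True \<psi> (polar p) + sin (snd p) * pd False \<psi> (polar p))"

definition lp_t :: "(pt \<Rightarrow> real) \<Rightarrow> pt \<Rightarrow> real" where
  "lp_t \<psi> p = exp (fst p) * (cos (snd p) * pd False \<psi> (polar p) - sin (snd p) * pd True \<psi> (polar p))"

definition lp_en :: "(pt \<Rightarrow> real) \<Rightarrow> pt \<Rightarrow> real" where
  "lp_en \<psi> p = (lp_s \<psi> p)^2 + (lp_t \<psi> p)^2"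

lemma continuous_on_polar [continuous_intros]: "continuous_on S polar"
  unfolding polar_def by (intro continuous_intros)

lemma continuous_on_lp:
  assumes "smooth2 \<psi>"
  shows "continuous_on S (lp \<psi>)" "continuous_on S (lp_s \<psi>)" "continuous_on S (lp_t \<psi>)" "continuous_on S (lp_en \<psi>)"
proof -
  have c: "continuous_on S (\<lambda>p. f (polar p))" if "smooth2 f" for f S
    by (rule continuous_on_compose2[OF smooth2_continuous[OF that, of UNIV] continuous_on_polar]) auto
  show "continuous_on S (lp \<psi>)" unfolding lp_def by (intro c assms)
  show s: "continuous_on S (lp_s \<psi>)" unfolding lp_s_def by (intro continuous_intros c smooth2_pd assms)
  show t: "continuous_on S (lp_t \<psi>)" unfolding lp_t_def by (intro continuous_intros c smooth2_pd assms)
  show "continuous_on S (lp_en \<psi>)" unfolding lp_en_def by (intro continuous_intros s t)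
qed

lemma lp_deriv:
  assumes "smooth2 \<psi>"
  shows "((\<lambda>s. lp \<psi> (s, t)) has_real_derivative lp_s \<psi> (s, t)) (at s)"
    and "((\<lambda>t. lp \<psi> (s, t)) has_real_derivative lp_t \<psi> (s, t)) (at t)"
proof -
  have g: "(\<psi> has_derivative (\<lambda>h. fst h * pd True \<psi> p + snd h * pd False \<psi> p)) (at p)" for p
    by (intro has_derivative_grad2 smooth2_differentiable assms)
  have "((\<lambda>s. polar (s, t)) has_derivative (\<lambda>h. (h * exp s * cos t, h * exp s * sin t))) (at s)"
    unfolding polar_def by (auto intro!: derivative_eq_intros)
  from has_derivative_compose[OF this g]
  show "((\<lambda>s. lp \<psi> (s, t)) has_real_derivative lp_s \<psi> (s, t)) (at s)"
    unfolding has_field_derivative_def lp_def lp_s_def by (rule has_derivative_eq_rhs) (auto simp: algebra_simps)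
  have "((\<lambda>t. polar (s, t)) has_derivative (\<lambda>h. (- (h * exp s * sin t), h * exp s * cos t))) (at t)"
    unfolding polar_def by (auto intro!: derivative_eq_intros)
  from has_derivative_compose[OF this g]
  show "((\<lambda>t. lp \<psi> (s, t)) has_real_derivative lp_t \<psi> (s, t)) (at t)"
    unfolding has_field_derivative_def lp_def lp_t_def by (rule has_derivative_eq_rhs) (auto simp: algebra_simps)
qed

lemma norm_grad2: "(norm (grad2 \<psi> p))^2 = (pd True \<psi> p)^2 + (pd False \<psi> p)^2"
  by (simp add: grad2_def norm_Pair)

text \<open>Logarithmic polar coordinates are conformal, and \<open>exp (2 * fst p)\<close> is their
  Jacobian. So the Dirichlet energy on the half-disc is the flat Dirichlet energy on a half-infinite
  strip of width \<open>pi\<close>.\<close>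

lemma lp_en_eq: "lp_en \<psi> p = exp (2 * fst p) * (norm (grad2 \<psi> (polar p)))^2"
proof -
  let ?c = "cos (snd p)" and ?s = "sin (snd p)" and ?A = "pd True \<psi> (polar p)" and ?B = "pd False \<psi> (polar p)"
  have "(?c * ?A + ?s * ?B)^2 + (?c * ?B - ?s * ?A)^2 = (?c^2 + ?s^2) * (?A^2 + ?B^2)"
    by algebra
  moreover have "exp (2 * fst p) = (exp (fst p))^2" by (simp add: power2_eq_square flip: exp_add)
  ultimately show ?thesis
    by (simp add: lp_en_def lp_s_def lp_t_def norm_grad2 power_mult_distrib flip: distrib_left)
qed

definition strip_en :: "(pt \<Rightarrow> real) \<Rightarrow> real set \<Rightarrow> ennreal" where
  "strip_en \<psi> S = (\<integral>\<^sup>+s. (\<integral>\<^sup>+t. ennreal (lp_en \<psi> (s, t)) * indicator {0<..<pi} t \<partial>lborel) * indicator S s \<partial>lborel)"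

lemma lp_en_measurable: "smooth2 \<psi> \<Longrightarrow> lp_en \<psi> \<in> borel_measurable borel"
  by (intro borel_measurable_continuous_onI continuous_on_lp)

lemma grad2_measurable: "smooth2 \<psi> \<Longrightarrow> grad2 \<psi> \<in> borel_measurable borel"
  unfolding grad2_def by (intro borel_measurable_continuous_onI continuous_intros smooth2_continuous smooth2_pd)

lemma strip_en_measurable [measurable]:
  assumes "smooth2 \<psi>"
  shows "(\<lambda>s. \<integral>\<^sup>+t. ennreal (lp_en \<psi> (s, t)) * indicator {0<..<pi} t \<partial>lborel) \<in> borel_measurable borel"
proof -
  have [measurable]: "lp_en \<psi> \<in> borel_measurable (borel \<Otimes>\<^sub>M borel)"
    using lp_en_measurable[OF assms] by (simp add: borel_prod)
  show ?thesis by measurable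
qed

lemma nn_integral_grad_Bplus:
  assumes \<psi>: "smooth2 \<psi>"
  shows "grad_sq \<psi> = strip_en \<psi> {..<0}"
proof -
  have [measurable]: "grad2 \<psi> \<in> borel_measurable borel" by (rule grad2_measurable[OF \<psi>])
  let ?F = "\<lambda>x. ennreal ((norm (grad2 \<psi> x))^2) * indicator (ball 0 1) x"
  have "grad_sq \<psi> = (\<integral>\<^sup>+x. ?F x * indicator {x. 0 < snd x} x \<partial>lborel)"
    by (rule nn_integral_cong) (auto simp: Bplus_alt indicator_def)
  also have "\<dots> = (\<integral>\<^sup>+s. (\<integral>\<^sup>+t. ?F (exp s * cos t, exp s * sin t) * ennreal (exp (2 * s)) * indicator {0<..<pi} t \<partial>lborel) \<partial>lborel)"
    by (rule nn_integral_log_polar) (measurable, simp)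
  also have "\<dots> = strip_en \<psi> {..<0}" unfolding strip_en_def
  proof (rule nn_integral_cong)
    fix s :: real
    have n: "norm (exp s * cos t, exp s * sin t) = exp s" for t
    proof -
      have "(exp s * cos t)^2 + (exp s * sin t)^2 = (exp s)^2"
        by (simp add: power_mult_distrib flip: distrib_left)
      then show ?thesis by (simp add: norm_Pair)
    qed
    have "?F (exp s * cos t, exp s * sin t) * ennreal (exp (2 * s)) * indicator {0<..<pi} t = ennreal (lp_en \<psi> (s, t)) * indicator {0<..<pi} t * indicator {..<0} s" for t
      using n[of t] by (auto simp: lp_en_eq polar_def indicator_def ennreal_mult[symmetric] mult.commute)
    then show "(\<integral>\<^sup>+t. ?F (exp s * cos t, exp s * sin t) * ennreal (exp (2 * s)) * indicator {0<..<pi} t \<partial>lborel) = (\<integral>\<^sup>+t. ennreal (lp_en \<psi> (s, t)) * indicator {0<..<pi} t \<partial>lborel) * indicator {..<0} s"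
      by (auto simp: indicator_def)
  qed
  finally show ?thesis .
qed

abbreviation rect :: "real \<Rightarrow> real \<Rightarrow> pt set" where "rect a b \<equiv> cbox (a, 0) (b, pi)"

text \<open>Transfers energies from iterated Lebesgue integrals to the gauge integral over a closed
  rectangle, the form in which the strip estimates are made. Open, half-open and closed ranges
  differ by null sets.\<close>

lemma nn_integral_strip_continuous:
  fixes e :: "pt \<Rightarrow> real"
  assumes c: "continuous_on UNIV e" and nn: "\<And>p. e p \<ge> 0"
  shows "(\<integral>\<^sup>+s. (\<integral>\<^sup>+t. ennreal (e (s, t)) * indicator {0<..<pi} t \<partial>lborel) * indicator {a..<b} s \<partial>lborel) = ennreal (integral (rect a b) e)"
proof -
  have m: "e \<in> borel_measurable borel" using c by (rule borel_measurable_continuous_onI)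
  then have [measurable]: "e \<in> borel_measurable (borel \<Otimes>\<^sub>M borel)" by (simp add: borel_prod)
  have si: "set_integrable lborel (rect a b) e"
    unfolding set_integrable_def
    by (rule borel_integrable_compact) (auto intro: continuous_on_subset[OF c] compact_cbox)
  have "(\<integral>\<^sup>+s. (\<integral>\<^sup>+t. ennreal (e (s, t)) * indicator {0<..<pi} t \<partial>lborel) * indicator {a..<b} s \<partial>lborel)
     = (\<integral>\<^sup>+s. (\<integral>\<^sup>+t. ennreal (e (s, t)) * indicator {0..pi} t * indicator {a..b} s \<partial>lborel) \<partial>lborel)"
  proof (rule nn_integral_cong_AE)
    have t: "(\<integral>\<^sup>+t. ennreal (e (s, t)) * indicator {0<..<pi} t \<partial>lborel) = (\<integral>\<^sup>+t. ennreal (e (s, t)) * indicator {0..pi} t \<partial>lborel)" for s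
    proof (rule nn_integral_cong_AE)
      show "AE t in lborel. ennreal (e (s, t)) * indicator {0<..<pi} t = ennreal (e (s, t)) * indicator {0..pi} t"
        using AE_lborel_singleton[of "0::real"] AE_lborel_singleton[of pi]
        by eventually_elim (auto simp: indicator_def)
    qed
    show "AE s in lborel. (\<integral>\<^sup>+t. ennreal (e (s, t)) * indicator {0<..<pi} t \<partial>lborel) * indicator {a..<b} s = (\<integral>\<^sup>+t. ennreal (e (s, t)) * indicator {0..pi} t * indicator {a..b} s \<partial>lborel)"
      using AE_lborel_singleton[of b]
    proof eventually_elim
      case (elim s) then show ?case by (cases "s \<in> {a..b}") (auto simp: t)
    qed
  qed
  also have "\<dots> = (\<integral>\<^sup>+p. ennreal (e p) * indicator {0..pi} (snd p) * indicator {a..b} (fst p) \<partial>(lborel \<Otimes>\<^sub>M lborel))"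
    by (subst lborel.nn_integral_fst[symmetric]) auto
  also have "\<dots> = (\<integral>\<^sup>+p. ennreal (indicator (rect a b) p *\<^sub>R e p) \<partial>lborel)"
    by (auto simp: lborel_prod indicator_def mem_cbox_pt intro!: nn_integral_cong)
  also have "\<dots> = ennreal (LINT p:rect a b|lborel. e p)"
    unfolding set_lebesgue_integral_def using si nn by (intro nn_integral_eq_integral) (auto simp: set_integrable_def)
  also have "(LINT p:rect a b|lborel. e p) = integral (rect a b) e"
    by (rule set_borel_integral_eq_integral(2)[OF si])
  finally show ?thesis .
qed

lemma strip_en_split:
  assumes "smooth2 \<psi>" "a \<le> b"
  shows "strip_en \<psi> {..<b} = strip_en \<psi> {..<a} + ennreal (integral (rect a b) (lp_en \<psi>))"
proof -
  let ?f = "\<lambda>s. \<integral>\<^sup>+t. ennreal (lp_en \<psi> (s, t)) * indicator {0<..<pi} t \<partial>lborel"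
  have [measurable]: "?f \<in> borel_measurable borel" using assms by measurable
  have "strip_en \<psi> {..<b} = (\<integral>\<^sup>+s. ?f s * indicator {..<a} s + ?f s * indicator {a..<b} s \<partial>lborel)"
    unfolding strip_en_def using assms(2) by (intro nn_integral_cong) (auto simp: indicator_def)
  also have "\<dots> = strip_en \<psi> {..<a} + (\<integral>\<^sup>+s. ?f s * indicator {a..<b} s \<partial>lborel)"
    unfolding strip_en_def by (subst nn_integral_add) auto
  also have "(\<integral>\<^sup>+s. ?f s * indicator {a..<b} s \<partial>lborel) = ennreal (integral (rect a b) (lp_en \<psi>))"
    by (rule nn_integral_strip_continuous[OF continuous_on_lp(4)[OF assms(1)]]) (simp add: lp_en_def)
  finally show ?thesis .
qed

lemma nn_integral_grad_Bplus_finite: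
  assumes "smooth2 \<psi>"
  shows "grad_sq \<psi> < \<infinity>"
proof -
  have "continuous_on (cball 0 1) (\<lambda>x. (norm (grad2 \<psi> x))^2)"
    unfolding grad2_def by (intro continuous_intros smooth2_continuous smooth2_pd assms)
  then have "bounded ((\<lambda>x. (norm (grad2 \<psi> x))^2) ` cball 0 1)"
    by (intro compact_imp_bounded compact_continuous_image) auto
  then obtain B where B: "\<And>x. x \<in> cball 0 1 \<Longrightarrow> (norm (grad2 \<psi> x))\<^sup>2 \<le> B" by (force simp: bounded_iff)
  have "grad_sq \<psi> \<le> (\<integral>\<^sup>+x. ennreal B * indicator Bplus x \<partial>lborel)"
    by (rule nn_integral_mono) (auto simp: indicator_def Bplus_alt intro!: ennreal_leI B)
  also have "\<dots> = ennreal B * emeasure lborel Bplus" by (subst nn_integral_cmult_indicator) auto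
  also have "\<dots> < \<infinity>" using emeasure_Bplus by (simp add: ennreal_mult_less_top)
  finally show ?thesis .
qed

subsection \<open>Weakly differentiable functions on the interval\<close>

lemma deriv_smooth_step_outside: "t < 0 \<or> t > 1 \<Longrightarrow> deriv smooth_step t = 0"
  using deriv_cong_open[of "{..<0}" t smooth_step "\<lambda>_. 0"] deriv_cong_open[of "{1<..}" t smooth_step "\<lambda>_. 1"]
    smooth_step_0 smooth_step_1 by auto

lemma smooth_step_has_deriv: "(smooth_step has_real_derivative deriv smooth_step t) (at t)"
  using smooth_on_has_deriv[OF smooth_on_smooth_step] by auto

lemma isCont_deriv_smooth_step: "isCont (deriv smooth_step) t"
  using smooth_on_has_deriv[OF smooth_on_deriv[OF smooth_on_smooth_step]] DERIV_isCont by blast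

lemma smooth_step_shift_deriv:
  "((\<lambda>x. smooth_step (real n * (x - a))) has_real_derivative real n * deriv smooth_step (real n * (x - a))) (at x)"
  by (rule DERIV_cong[OF DERIV_chain2[OF smooth_step_has_deriv, where g = "\<lambda>x. real n * (x - a)"]])
     (auto intro!: derivative_eq_intros)

lemma smooth_on_step_shift: "smooth_on UNIV (\<lambda>x. smooth_step (real n * (x - a)))"
  by (rule smooth_on_comp[OF _ _ smooth_on_smooth_step smooth_on_affine]) auto

lemma deriv_step_integral: "integrable lborel (deriv smooth_step)" "(LINT s|lborel. deriv smooth_step s) = 1"
proof -
  have "has_bochner_integral lborel (\<lambda>x. deriv smooth_step x * indicator {0..1} x) (smooth_step 1 - smooth_step 0)"
    by (rule has_bochner_integral_FTC_Icc_real) (auto simp: smooth_step_has_deriv isCont_deriv_smooth_step)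
  moreover have "deriv smooth_step x * indicator {0..1} x = deriv smooth_step x" for x
    by (cases "x < 0 \<or> x > 1") (auto simp: indicator_def deriv_smooth_step_outside)
  ultimately have "has_bochner_integral lborel (deriv smooth_step) 1"
    by (simp add: smooth_step_0 smooth_step_1)
  then show "integrable lborel (deriv smooth_step)" "(LINT s|lborel. deriv smooth_step s) = 1"
    by (auto simp: has_bochner_integral_iff)
qed

text \<open>The substitution \<open>x = a + s / n\<close> turns the concentrating kernel into the
  fixed kernel \<open>deriv smooth_step\<close>, which has integral 1; dominated convergence and
  continuity of \<mu> at \<open>a\<close> give the limit.\<close>

lemma approximate_identity:
  assumes a: "a \<in> I1" and c: "continuous_on {-1..1} \<mu>" and m: "(\<lambda>x. indicat_real I1 x * \<mu> x) \<in> borel_measurable borel"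
  shows "(\<lambda>n. LINT x:I1|lborel. \<mu> x * (real n * deriv smooth_step (real n * (x - a)))) \<longlonglongrightarrow> \<mu> a"
proof -
  let ?F = "\<lambda>x. indicat_real I1 x * \<mu> x"
  have "compact (\<mu> ` {-1..1})" using c by (intro compact_continuous_image) auto
  then obtain B where B: "\<And>x. x \<in> {-1..1} \<Longrightarrow> \<bar>\<mu> x\<bar> \<le> B" by (force dest!: compact_imp_bounded simp: bounded_iff)
  then have B0: "B \<ge> 0" by (metis abs_ge_zero atLeastAtMost_iff order_trans neg_le_0_iff_le zero_le_one)
  have BF: "\<bar>?F x\<bar> \<le> B" for x using B[of x] B0 by (auto simp: indicator_def)
  have sm: "deriv smooth_step \<in> borel_measurable borel" using deriv_step_integral by auto
  have "(\<lambda>n. LINT s|lborel. ?F (a + s / real n) * deriv smooth_step s) \<longlonglongrightarrow> (LINT s|lborel. \<mu> a * deriv smooth_step s)"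
  proof (rule integral_dominated_convergence[where w = "\<lambda>s. B * \<bar>deriv smooth_step s\<bar>"])
    show "AE s in lborel. (\<lambda>n. ?F (a + s / real n) * deriv smooth_step s) \<longlonglongrightarrow> \<mu> a * deriv smooth_step s"
    proof (intro AE_I2 tendsto_mult tendsto_const)
      fix s :: real
      have l: "(\<lambda>n. a + s / real n) \<longlonglongrightarrow> a" by real_asymp
      have "eventually (\<lambda>x. x \<in> I1) (nhds a)" using a by (intro eventually_nhds_in_open) auto
      then have ev: "\<forall>\<^sub>F n in sequentially. a + s / real n \<in> I1" by (rule eventually_compose_filterlim[OF _ l])
      have "isCont \<mu> a" using continuous_on_interior[OF c, of a] a by auto
      then have "(\<lambda>n. \<mu> (a + s / real n)) \<longlonglongrightarrow> \<mu> a" using l by (rule isCont_tendsto_compose)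
      then show "(\<lambda>n. ?F (a + s / real n)) \<longlonglongrightarrow> \<mu> a"
        by (rule Lim_transform_eventually) (use ev in eventually_elim, auto)
    qed
    show "integrable lborel (\<lambda>s. B * \<bar>deriv smooth_step s\<bar>)" using deriv_step_integral by auto
    show "AE s in lborel. norm (?F (a + s / real n) * deriv smooth_step s) \<le> B * \<bar>deriv smooth_step s\<bar>" for n
      using BF by (intro AE_I2) (auto simp: abs_mult intro!: mult_right_mono simp del: real_scaleR_def)
  qed (use m sm in \<open>measurable\<close>)
  then have L: "(\<lambda>n. LINT s|lborel. ?F (a + s / real n) * deriv smooth_step s) \<longlonglongrightarrow> \<mu> a"
    using deriv_step_integral by simp
  show ?thesis
  proof (rule Lim_transform_eventually[OF L], rule eventually_sequentiallyI[of 1])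
    fix n :: nat assume n: "n \<ge> 1"
    have "(LINT x:I1|lborel. \<mu> x * (real n * deriv smooth_step (real n * (x - a)))) = (LINT x|lborel. ?F x * (real n * deriv smooth_step (real n * (x - a))))"
      by (simp add: set_lebesgue_integral_def mult.assoc)
    also have "\<dots> = \<bar>1 / real n\<bar> *\<^sub>R (LINT s|lborel. ?F (a + 1 / real n * s) * (real n * deriv smooth_step (real n * (a + 1 / real n * s - a))))"
      using n by (intro lborel_integral_real_affine) auto
    also have "\<dots> = (LINT s|lborel. 1 / real n * (?F (a + 1 / real n * s) * (real n * deriv smooth_step (real n * (a + 1 / real n * s - a)))))"
      by (subst integral_mult_right_zero) simp
    also have "\<dots> = (LINT s|lborel. ?F (a + s / real n) * deriv smooth_step s)"
      using n by (intro Bochner_Integration.integral_cong) auto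
    finally show "(LINT s|lborel. ?F (a + s / real n) * deriv smooth_step s) = (LINT x:I1|lborel. \<mu> x * (real n * deriv smooth_step (real n * (x - a))))" ..
  qed
qed

lemma smooth_on_continuous: "smooth_on UNIV f \<Longrightarrow> continuous_on S f"
  by (intro continuous_at_imp_continuous_on) (use smooth_on_has_deriv DERIV_isCont in blast)

lemma test1_bounded:
  assumes "test1 U \<phi>" shows "\<exists>B. \<forall>x. \<bar>\<phi> x\<bar> \<le> B"
proof -
  obtain K where K: "compact K" "\<And>x. x \<notin> K \<Longrightarrow> \<phi> x = 0" using assms by (auto simp: test1_def)
  have "smooth_on UNIV \<phi>" using assms by (simp add: test1_def smooth1_iff)
  then have "compact (\<phi> ` K)" using K by (intro compact_continuous_image smooth_on_continuous)
  then obtain B where B: "\<And>x. x \<in> K \<Longrightarrow> \<bar>\<phi> x\<bar> \<le> B" by (force dest!: compact_imp_bounded simp: bounded_iff)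
  have "\<bar>\<phi> x\<bar> \<le> max B 0" for x using B[of x] K(2)[of x] by (cases "x \<in> K") auto
  then show ?thesis by blast
qed

lemma deriv_zero_outside_compact:
  assumes "compact K" "\<And>x. x \<notin> K \<Longrightarrow> \<phi> x = (0::real)" "x \<notin> K"
  shows "deriv \<phi> x = 0"
  using deriv_cong_open[of "- K" x \<phi> "\<lambda>_. 0"] assms compact_imp_closed[OF assms(1)] by auto

lemma test1_deriv: "test1 U \<phi> \<Longrightarrow> test1 U (deriv \<phi>)"
  unfolding test1_def smooth1_iff using smooth_on_deriv deriv_zero_outside_compact by metis

lemma test1_smooth: "test1 U \<phi> \<Longrightarrow> smooth_on UNIV \<phi>"
  by (simp add: test1_def smooth1_iff)

text \<open>The test function is a smoothed indicator of \<open>{a..b}\<close>: its derivative is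
  one approximate identity at \<open>a\<close> minus another at \<open>b\<close>. The descent takes
  place to the right of \<open>b\<close>, on \<open>{b..b + 1 / n}\<close>, which lies inside the
  interval for large \<open>n\<close>.\<close>

lemma W12_1_FTC:
  assumes W: "W12_1 I1 \<mu> g" and c: "continuous_on {-1..1} \<mu>" and ab: "-1 < a" "a < b" "b < 1"
  shows "(LINT x:{a..b}|lborel. g x) = \<mu> b - \<mu> a"
proof -
  let ?\<phi> = "\<lambda>n x. smooth_step (real n * (x - a)) - smooth_step (real n * (x - b))"
  let ?d = "\<lambda>n c x. real n * deriv smooth_step (real n * (x - c))"
  have dphi: "deriv (?\<phi> n) x = ?d n a x - ?d n b x" for n x
    by (intro DERIV_imp_deriv DERIV_diff smooth_step_shift_deriv)
  have m: "(\<lambda>x. indicat_real I1 x * \<mu> x) \<in> borel_measurable borel"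
    using W by (simp add: W12_1_def set_borel_measurable_def)
  have gi: "set_integrable lborel I1 g" and mi: "set_integrable lborel I1 \<mu>" using W12_1_integrable[OF W] by auto
  have gi': "integrable lborel (\<lambda>x. indicat_real I1 x * g x)" using gi by (simp add: set_integrable_def)
  have sm: "(\<lambda>x. smooth_step (real n * (x - c))) \<in> borel_measurable borel" for n c
    using smooth_on_measurable[OF smooth_on_step_shift] .
  have dsm: "?d n c \<in> borel_measurable borel" for n c
    using deriv_step_integral(1)[THEN borel_measurable_integrable] by measurable
  obtain B where B: "\<And>t. \<bar>deriv smooth_step t\<bar> \<le> B" using smooth_step_deriv_bound by blast
  have Bd: "\<bar>?d n c x\<bar> \<le> real n * B" for n c x using B[of "real n * (x - c)"] by (auto simp: abs_mult intro!: mult_left_mono)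
  have "(\<lambda>n. (LINT x:I1|lborel. \<mu> x * ?d n a x) - (LINT x:I1|lborel. \<mu> x * ?d n b x)) \<longlonglongrightarrow> \<mu> a - \<mu> b"
    by (intro tendsto_diff approximate_identity c m) (use ab in auto)
  moreover have "\<forall>\<^sub>F n in sequentially. (LINT x:I1|lborel. \<mu> x * ?d n a x) - (LINT x:I1|lborel. \<mu> x * ?d n b x) = - (LINT x|lborel. indicat_real I1 x * g x * ?\<phi> n x)"
  proof -
    have "\<forall>\<^sub>F n in sequentially. b + 1 / real n < 1" using ab by real_asymp
    moreover have "\<forall>\<^sub>F n in sequentially. n \<ge> (1::nat)" by (rule eventually_ge_at_top)
    ultimately show ?thesis
    proof eventually_elim
      case (elim n)
      have "test1 I1 (?\<phi> n)"
        unfolding test1_def smooth1_iff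
      proof (intro conjI exI[of _ "{a..b + 1 / real n}"])
        show "smooth_on UNIV (?\<phi> n)" by (intro smooth_on_diff smooth_on_step_shift) auto
        show "{a..b + 1 / real n} \<subseteq> I1" using ab elim by auto
        show "\<forall>x. x \<notin> {a..b + 1 / real n} \<longrightarrow> ?\<phi> n x = 0"
        proof (intro allI impI)
          fix x assume "x \<notin> {a..b + 1 / real n}"
          then consider "x < a" | "x > b + 1 / real n" by fastforce
          then show "?\<phi> n x = 0"
          proof cases
            case 1
            then have "real n * (x - a) \<le> 0" "real n * (x - b) \<le> 0" using ab by (auto intro: mult_nonneg_nonpos)
            then show ?thesis by (simp add: smooth_step_0)
          next
            case 2
            then have "1 \<le> real n * (x - b)" using elim by (simp add: field_simps)
            moreover have "real n * (x - b) \<le> real n * (x - a)" using ab by (intro mult_left_mono) auto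
            ultimately show ?thesis by (simp add: smooth_step_1)
          qed
        qed
      qed auto
      from W12_1_test[OF W this]
      have "(LINT x:I1|lborel. \<mu> x * ?d n a x - \<mu> x * ?d n b x) = - (LINT x:I1|lborel. g x * ?\<phi> n x)"
        unfolding dphi right_diff_distrib[of "\<mu> _"] .
      moreover have "(LINT x:I1|lborel. \<mu> x * ?d n a x - \<mu> x * ?d n b x) = (LINT x:I1|lborel. \<mu> x * ?d n a x) - (LINT x:I1|lborel. \<mu> x * ?d n b x)"
        by (intro set_integral_diff set_integrable_mult_bounded[OF mi dsm Bd])
      ultimately show ?case by (simp add: set_lebesgue_integral_def mult.assoc)
    qed
  qed
  ultimately have 1: "(\<lambda>n. - (LINT x|lborel. indicat_real I1 x * g x * ?\<phi> n x)) \<longlonglongrightarrow> \<mu> a - \<mu> b"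
    by (rule Lim_transform_eventually)
  have 2: "(\<lambda>n. LINT x|lborel. indicat_real I1 x * g x * ?\<phi> n x) \<longlonglongrightarrow> (LINT x|lborel. indicat_real I1 x * g x * indicator {a<..b} x)"
  proof (rule integral_dominated_convergence[where w = "\<lambda>x. \<bar>indicat_real I1 x * g x\<bar>"])
    show "AE x in lborel. (\<lambda>n. indicat_real I1 x * g x * ?\<phi> n x) \<longlonglongrightarrow> indicat_real I1 x * g x * indicator {a<..b} x"
    proof (intro AE_I2 tendsto_mult tendsto_const)
      fix x
      have st: "(\<lambda>n. smooth_step (real n * (x - c))) \<longlonglongrightarrow> (if x > c then 1 else 0)" for c
      proof (cases "x > c")
        case True
        then have "\<forall>\<^sub>F n in sequentially. 1 \<le> real n * (x - c)" by real_asymp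
        then have "\<forall>\<^sub>F n in sequentially. 1 = smooth_step (real n * (x - c))" by eventually_elim (simp add: smooth_step_1)
        then show ?thesis using True by (auto intro: Lim_transform_eventually[OF tendsto_const])
      next
        case False
        then have "smooth_step (real n * (x - c)) = 0" for n by (intro smooth_step_0 mult_nonneg_nonpos) auto
        then show ?thesis using False by simp
      qed
      have "(\<lambda>n. ?\<phi> n x) \<longlonglongrightarrow> (if x > a then 1 else 0) - (if x > b then 1 else 0)" by (intro tendsto_diff st)
      also have "(if x > a then 1 else 0) - (if x > b then 1 else 0) = (indicator {a<..b} x :: real)" using ab by auto
      finally show "(\<lambda>n. ?\<phi> n x) \<longlonglongrightarrow> indicator {a<..b} x" .
    qed
    show "AE x in lborel. norm (indicat_real I1 x * g x * ?\<phi> n x) \<le> \<bar>indicat_real I1 x * g x\<bar>" for n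
    proof (rule AE_I2)
      fix x
      have "\<bar>?\<phi> n x\<bar> \<le> 1" using smooth_step_bounds[of "real n * (x - a)"] smooth_step_bounds[of "real n * (x - b)"] by linarith
      then show "norm (indicat_real I1 x * g x * ?\<phi> n x) \<le> \<bar>indicat_real I1 x * g x\<bar>"
        using mult_left_mono[of "\<bar>?\<phi> n x\<bar>" 1 "\<bar>indicat_real I1 x * g x\<bar>"] by (simp add: abs_mult)
    qed
    show "(\<lambda>x. indicat_real I1 x * g x * ?\<phi> n x) \<in> borel_measurable lborel" for n
      using sm borel_measurable_integrable[OF gi'] by measurable
  qed (use gi' in auto)
  have "- (LINT x|lborel. indicat_real I1 x * g x * indicator {a<..b} x) = \<mu> a - \<mu> b"
    by (rule LIMSEQ_unique[OF tendsto_minus[OF 2] 1])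
  moreover have "(LINT x|lborel. indicat_real I1 x * g x * indicator {a<..b} x) = (LINT x:{a..b}|lborel. g x)"
  proof -
    have "AE x in lborel. indicat_real I1 x * g x * indicator {a<..b} x = indicator {a..b} x *\<^sub>R g x"
      using AE_lborel_singleton[of a] by eventually_elim (use ab in \<open>auto simp: indicator_def\<close>)
    moreover have "set_integrable lborel {a..b} g" by (rule set_integrable_subset[OF gi]) (use ab in auto)
    ultimately show ?thesis unfolding set_lebesgue_integral_def set_integrable_def
      using borel_measurable_integrable[OF gi'] by (intro integral_cong_AE) auto
  qed
  ultimately show ?thesis by simp
qed

text \<open>That the endpoints lie outside \<open>V\<close> but in its closure is the point: for the
  complement of a level set inside an interval spanned by two of its points, this forces both
  endpoints of every gap into the level set.\<close>

lemma open_component_interval: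
  fixes V C :: "real set"
  assumes O: "open V" "bounded V" and C: "C \<in> components V"
  shows "\<exists>c d. c < d \<and> C = {c<..<d} \<and> c \<notin> V \<and> d \<notin> V \<and> c \<in> closure V \<and> d \<in> closure V"
proof -
  have ne: "C \<noteq> {}" and sub: "C \<subseteq> V" and con: "connected C" and op: "open C"
    using in_components_nonempty[OF C] in_components_subset[OF C] in_components_connected[OF C] open_components[OF O(1) C] by auto
  have bd: "bdd_above C" "bdd_below C" using bounded_subset[OF O(2) sub] by (auto simp: bounded_imp_bdd_above bounded_imp_bdd_below)
  let ?c = "Inf C" and ?d = "Sup C"
  have nc: "?c \<notin> C" "?d \<notin> C"
  proof -
    show "?c \<notin> C"
    proof
      assume "?c \<in> C"
      then obtain e where "e > 0" "ball ?c e \<subseteq> C" using op open_contains_ball by blast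
      then have "?c - e / 2 \<in> C" by (auto simp: subset_eq dist_real_def)
      then have "?c \<le> ?c - e / 2" using bd by (intro cInf_lower)
      then show False using \<open>e > 0\<close> by simp
    qed
    show "?d \<notin> C"
    proof
      assume "?d \<in> C"
      then obtain e where "e > 0" "ball ?d e \<subseteq> C" using op open_contains_ball by blast
      then have "?d + e / 2 \<in> C" by (auto simp: subset_eq dist_real_def)
      then have "?d + e / 2 \<le> ?d" using bd by (intro cSup_upper)
      then show False using \<open>e > 0\<close> by simp
    qed
  qed
  have eq: "C = {?c<..<?d}"
  proof (intro set_eqI iffI)
    fix x assume x: "x \<in> C"
    then have "?c \<le> x" "x \<le> ?d" using bd by (auto intro: cInf_lower cSup_upper)
    moreover have "x \<noteq> ?c" "x \<noteq> ?d" using x nc by auto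
    ultimately show "x \<in> {?c<..<?d}" by auto
  next
    fix x assume "x \<in> {?c<..<?d}"
    then obtain y z where "y \<in> C" "y < x" "z \<in> C" "x < z"
      using cInf_lessD[OF ne, of x] less_cSupD[OF ne, of x] by auto
    then show "x \<in> C" using con[unfolded connected_iff_interval] by (meson less_imp_le)
  qed
  have lt: "?c < ?d" using ne eq by (metis greaterThanLessThan_empty_iff not_le)
  have "?c \<notin> V"
  proof
    assume c: "?c \<in> V"
    have "{?c..<?d} \<subseteq> C"
    proof (rule components_maximal[OF C])
      show "{?c..<?d} \<subseteq> V" using c sub eq by force
      show "C \<inter> {?c..<?d} \<noteq> {}" using ne subset_trans[OF eq[THEN equalityD1], of "{?c..<?d}"] by force
    qed auto
    then show False using nc lt by auto
  qed
  moreover have "?d \<notin> V"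
  proof
    assume d: "?d \<in> V"
    have "{?c<..?d} \<subseteq> C"
    proof (rule components_maximal[OF C])
      show "{?c<..?d} \<subseteq> V" using d sub eq by force
      show "C \<inter> {?c<..?d} \<noteq> {}" using ne subset_trans[OF eq[THEN equalityD1], of "{?c<..?d}"] by force
    qed auto
    then show False using nc lt by auto
  qed
  moreover have "?c \<in> closure V" "?d \<in> closure V"
    using closure_contains_Inf[OF ne bd(2)] closure_contains_Sup[OF ne bd(1)] closure_mono[OF sub] by auto
  ultimately show ?thesis using lt eq by blast
qed

text \<open>The components are countably many disjoint open sets. Their contributions are summed for
  the measures of the positive and of the negative part separately, so no signed series
  occurs.\<close>

lemma integral_zero_if_components_zero:
  fixes g :: "real \<Rightarrow> real"
  assumes g: "integrable lborel g" and O: "open V"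
    and z: "\<And>C. C \<in> components V \<Longrightarrow> (LINT x:C|lborel. g x) = 0"
  shows "(LINT x:V|lborel. g x) = 0"
proof -
  have oC: "open C" if "C \<in> components V" for C using open_components[OF O that] .
  have cnt: "countable (components V)" 
  proof (rule countable_disjoint_open_subsets)
    show "pairwise disjnt (components V)"
      using pairwise_disjoint_components[of V] unfolding disjnt_def pairwise_def .
  qed (rule oC)
  have dis: "disjoint_family_on (\<lambda>C. C) (components V)"
    using components_nonoverlap by (auto simp: disjoint_family_on_def) 
  have s: "emeasure M V = (\<integral>\<^sup>+C. emeasure M C \<partial>count_space (components V))" if "sets M = sets borel" for M :: "real measure"
  proof -
    have "emeasure M (\<Union>C\<in>components V. C) = (\<integral>\<^sup>+C. emeasure M C \<partial>count_space (components V))"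
      by (rule emeasure_UN_countable[OF _ cnt dis]) (use oC that in auto)
    then show ?thesis by simp
  qed
  have "emeasure (density lborel (\<lambda>x. ennreal (g x))) V = emeasure (density lborel (\<lambda>x. ennreal (- g x))) V"
    unfolding s[of "density lborel (\<lambda>x. ennreal (g x))", simplified] s[of "density lborel (\<lambda>x. ennreal (- g x))", simplified]
    by (intro nn_integral_cong) (use emeasure_pos_neg_part_eq_iff(1)[OF g] oC z in auto)
  then show ?thesis using emeasure_pos_neg_part_eq_iff(1)[OF g] O by simp
qed

text \<open>The complement of a level set consists of intervals over which the derivative integrates to zero.\<close>

lemma weak_deriv_zero_on_level_set:
  fixes \<mu> g :: "real \<Rightarrow> real"
  assumes gi: "set_integrable lborel I1 g" and c: "continuous_on I1 \<mu>"
    and ftc: "\<And>a b. -1 < a \<Longrightarrow> a < b \<Longrightarrow> b < 1 \<Longrightarrow> (LINT x:{a..b}|lborel. g x) = \<mu> b - \<mu> a"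
  shows "AE x in lborel. x \<in> I1 \<longrightarrow> \<mu> x = k \<longrightarrow> g x = 0"
proof -
  let ?G = "\<lambda>x. indicat_real I1 x * g x"
  have G: "integrable lborel ?G" using gi by (simp add: set_integrable_def)
  have Gset: "set_integrable lborel A ?G" if "A \<in> sets borel" for A
    unfolding set_integrable_def using integrable_mult_indicator[OF _ G] that by simp
  define Z0 where "Z0 = {x\<in>I1. \<mu> x = k}"
  have Z0: "Z0 \<in> sets borel"
  proof -
    have "closedin (top_of_set I1) Z0" unfolding Z0_def using continuous_closedin_preimage_constant[OF c] by auto
    then obtain T where "closed T" "Z0 = I1 \<inter> T" by (auto simp: closedin_closed)
    then show ?thesis by auto
  qed
  have zero: "(LINT x:{p..q}|lborel. ?G x) = 0" if "-1 < p" "p \<le> q" "q < 1" "\<mu> p = \<mu> q" for p q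
  proof (cases "p = q")
    case True
    have "AE x in lborel. x \<noteq> q" by (rule AE_lborel_singleton)
    then have "AE x in lborel. indicator {p..q} x *\<^sub>R ?G x = 0" by (rule AE_mp) (auto simp: True)
    then show ?thesis unfolding set_lebesgue_integral_def by (rule integral_eq_zero_AE)
  next
    case False
    have "(LINT x:{p..q}|lborel. ?G x) = (LINT x:{p..q}|lborel. g x)"
      unfolding set_lebesgue_integral_def using that by (intro Bochner_Integration.integral_cong) (auto simp: indicator_def)
    then show ?thesis using ftc[of p q] that False by simp
  qed
  have "AE x in lborel. x \<in> I1 \<longrightarrow> indicator Z0 x * g x = 0"
  proof (rule AE_zero_on_open)
    fix a b :: real assume ab: "cbox a b \<subseteq> I1"
    have e: "indicator Z0 x * g x = indicator Z0 x *\<^sub>R ?G x" for x by (auto simp: indicator_def Z0_def)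
    show "set_integrable lborel (cbox a b) (\<lambda>x. indicat_real Z0 x * g x)"
      unfolding e set_integrable_def by (rule integrable_mult_indicator[OF _ Gset[OF Z0, unfolded set_integrable_def]]) simp
    show "(LINT x:box a b|lborel. indicat_real Z0 x * g x) = 0"
    proof (cases "a < b")
      case False
      then show ?thesis by (simp add: set_lebesgue_integral_def)
    next
      case True
      then have ab': "-1 < a" "b < 1" using subsetD[OF ab, of a] subsetD[OF ab, of b] by auto
      define Z where "Z = {x\<in>{a..b}. \<mu> x = k}"
      have cab: "continuous_on {a..b} \<mu>" by (rule continuous_on_subset[OF c]) (use ab' in auto)
      have Zc: "closed Z" unfolding Z_def by (rule continuous_closed_preimage_constant[OF cab]) auto
      have eqZ: "(LINT x:box a b|lborel. indicat_real Z0 x * g x) = (LINT x:Z|lborel. ?G x)"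
      proof -
        have "AE x in lborel. indicator (box a b) x *\<^sub>R (indicat_real Z0 x * g x) = indicator Z x *\<^sub>R ?G x"
          using AE_lborel_singleton[of a] AE_lborel_singleton[of b]
          by eventually_elim (use ab' in \<open>auto simp: indicator_def Z_def Z0_def\<close>)
        then show ?thesis unfolding set_lebesgue_integral_def e
          using borel_measurable_integrable[OF Gset[of Z, unfolded set_integrable_def]] Zc
            borel_measurable_integrable[OF integrable_mult_indicator[OF _ Gset[OF Z0, unfolded set_integrable_def], of "box a b"]]
          by (intro integral_cong_AE) (auto simp: e)
      qed
      show ?thesis
      proof (cases "Z = {}")
        case True then show ?thesis using eqZ by (simp add: set_lebesgue_integral_def)
      next
        case False
        have bd: "bdd_below Z" "bdd_above Z" by (auto simp: Z_def intro!: bdd_belowI[of _ a] bdd_aboveI[of _ b])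
        \<comment> \<open>Between the first and the last point of the level set the total integral
          vanishes, because \<open>\<mu> p = \<mu> q\<close>, and so does the integral over the
          gaps; this leaves zero for the level set itself.\<close>
        define p where "p = Inf Z"
        define q where "q = Sup Z"
        have pq: "p \<in> Z" "q \<in> Z" "p \<le> q"
          unfolding p_def q_def using closed_contains_Inf[OF False bd(1) Zc] closed_contains_Sup[OF False bd(2) Zc]
            cInf_le_cSup[OF False bd(2,1)] by auto
        have Zpq: "Z \<subseteq> {p..q}" unfolding p_def q_def using bd by (auto intro: cInf_lower cSup_upper)
        define U where "U = {p..q} - Z"
        have U_alt: "U = {p<..<q} - Z" using pq by (auto simp: U_def less_le)
        have oU: "open U" unfolding U_alt using Zc by (intro open_Diff) auto
        have bU: "bounded U" unfolding U_def by (rule bounded_subset[of "{p..q}"]) auto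
        have clU: "closure U \<subseteq> {p..q}" by (rule closure_minimal) (auto simp: U_def)
        have U0: "(LINT x:U|lborel. ?G x) = 0"
        proof (rule integral_zero_if_components_zero[OF G oU])
          fix C assume "C \<in> components U"
          then obtain c d where cd: "c < d" "C = {c<..<d}" "c \<notin> U" "d \<notin> U" "c \<in> closure U" "d \<in> closure U"
            using open_component_interval[OF oU bU] by blast
          then have "c \<in> {p..q}" "d \<in> {p..q}" using clU by auto
          then have Zcd: "c \<in> Z" "d \<in> Z" using cd by (auto simp: U_def)
          have "AE x in lborel. indicator C x *\<^sub>R ?G x = indicator {c..d} x *\<^sub>R ?G x"
            using AE_lborel_singleton[of c] AE_lborel_singleton[of d] by eventually_elim (auto simp: cd indicator_def)
          then have "(LINT x:C|lborel. ?G x) = (LINT x:{c..d}|lborel. ?G x)"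
            unfolding set_lebesgue_integral_def using Gset[of C] Gset[of "{c..d}"] cd
            by (intro integral_cong_AE) (auto simp: set_integrable_def)
          also have "\<dots> = 0" by (rule zero) (use Zcd cd ab' in \<open>auto simp: Z_def\<close>)
          finally show "(LINT x:C|lborel. ?G x) = 0" .
        qed
        have zu: "{p..q} = Z \<union> U" using Zpq by (auto simp: U_def)
        have "(LINT x:{p..q}|lborel. ?G x) = (LINT x:Z|lborel. ?G x) + (LINT x:U|lborel. ?G x)"
          unfolding zu by (intro set_integral_Un Gset) (use Zc oU in \<open>auto simp: U_def\<close>)
        moreover have "(LINT x:{p..q}|lborel. ?G x) = 0" by (rule zero) (use pq ab' in \<open>auto simp: Z_def\<close>)
        ultimately show ?thesis using U0 eqZ by simp
      qed
    qed
  qed auto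
  then show ?thesis by (rule AE_mp) (auto simp: Z0_def)
qed

text \<open>Growth is linear because the weight \<open>1 - \<mu>^2\<close> is at most twice
  \<open>1 - \<mu>\<close>. With \<open>M\<close> the maximum of \<open>1 - \<mu>\<close> on
  \<open>{0..x}\<close>, Young's inequality against a weight of size at most \<open>2 * M\<close>
  yields \<open>M <= x * wall \<mu> + M / 2\<close>, and half of \<open>M\<close> is
  absorbed.\<close>

lemma wall_growth:
  fixes \<mu> :: "real \<Rightarrow> real"
  assumes W: "W12_1 I1 \<mu> g" and c: "continuous_on {-1..1} \<mu>" and \<mu>0: "\<mu> 0 = 1"
    and bnd: "\<forall>x\<in>{-1..1}. \<bar>\<mu> x\<bar> \<le> 1" and fin: "wall \<mu> < \<infinity>"
    and x: "0 < x" "x < 1"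
  shows "1 - \<mu> x \<le> 2 * x * enn2real (wall \<mu>)"
proof -
  define u where "u y = 1 - \<mu> y" for y
  have u02: "0 \<le> u y" "u y \<le> 2" if "y \<in> {-1..1}" for y using bnd that by (auto simp: u_def abs_le_iff)
  have cu: "continuous_on {0..x} u" unfolding u_def using x by (intro continuous_intros continuous_on_subset[OF c]) auto
  obtain m where m: "m \<in> {0..x}" "\<And>y. y \<in> {0..x} \<Longrightarrow> u y \<le> u m"
    using continuous_attains_sup[of "{0..x}" u] cu x by force
  define M where "M = u m"
  have ux: "u x \<le> M" using m(2)[of x] x by (simp add: M_def)
  show ?thesis
  proof (cases "M \<le> 0")
    case True
    have "0 \<le> 2 * x * enn2real (wall \<mu>)" using x by simp
    then show ?thesis using True ux by (simp add: u_def)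
  next
    case False
    then have Mpos: "M > 0" by simp
    define A where "A = {y\<in>{0..x}. u y = M}"
    have "closed A" unfolding A_def by (rule continuous_closed_preimage_constant[OF cu]) auto
    moreover have "A \<noteq> {}" using m by (auto simp: A_def M_def)
    moreover have bA: "bdd_below A" by (auto simp: A_def intro!: bdd_belowI[of _ 0])
    ultimately have iA: "Inf A \<in> A" by (intro closed_contains_Inf)
    define x1 where "x1 = Inf A"
    have x1: "0 \<le> x1" "x1 \<le> x" "u x1 = M" using iA by (auto simp: x1_def A_def)
    have lt: "u y < M" if "0 \<le> y" "y < x1" for y
    proof -
      have "y \<notin> A" using cInf_lower[OF _ bA, of y] that by (auto simp: x1_def)
      then have "u y \<noteq> M" using that x1 by (auto simp: A_def)
      moreover have "u y \<le> M" using m(2)[of y] that x1 by (auto simp: M_def)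
      ultimately show ?thesis by simp
    qed
    \<comment> \<open>Before the first maximum point \<open>u < M <= 2\<close>, and after the last
      zero \<open>u > 0\<close>. Between them the denominator \<open>u * (2 - u)\<close> is
      positive, so no quotient by zero, which would count as 0, hides the derivative.\<close>
    define Z where "Z = {y\<in>{0..x1}. u y = 0}"
    have "continuous_on {0..x1} u" using cu x1 by (rule_tac continuous_on_subset) auto
    then have "closed Z" unfolding Z_def by (rule continuous_closed_preimage_constant) auto
    moreover have "Z \<noteq> {}" using x1 \<mu>0 by (auto simp: Z_def u_def intro!: exI[of _ 0])
    moreover have bZ: "bdd_above Z" by (auto simp: Z_def intro!: bdd_aboveI[of _ x1])
    ultimately have sZ: "Sup Z \<in> Z" by (intro closed_contains_Sup)
    define z where "z = Sup Z"
    have z: "0 \<le> z" "z \<le> x1" "u z = 0" using sZ by (auto simp: z_def Z_def)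
    have zx1: "z < x1" using z x1 Mpos by (cases "z = x1") auto
    have pos: "u y > 0" if "z < y" "y < x1" for y
    proof -
      have "y \<notin> Z" using cSup_upper[OF _ bZ, of y] that by (auto simp: z_def)
      then have "u y \<noteq> 0" using that z by (auto simp: Z_def)
      then show ?thesis using u02(1)[of y] that z x1 x by auto
    qed
    have gi: "set_integrable lborel I1 g" using W12_1_integrable[OF W] by simp
    have gz: "set_integrable lborel {z..x1} g" by (rule set_integrable_subset[OF gi]) (use z x1 x in auto)
    have "M = - (LINT y:{z..x1}|lborel. g y)"
      using W12_1_FTC[OF W c, of z x1] z x1 x zx1 by (simp add: u_def)
    also have "\<dots> \<le> (LINT y|lborel. \<bar>indicator {z..x1} y *\<^sub>R g y\<bar>)"
      unfolding set_lebesgue_integral_def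
      using integral_abs_bound[of lborel "\<lambda>y. indicator {z..x1} y *\<^sub>R g y"] by linarith
    finally have "ennreal M \<le> ennreal (LINT y|lborel. \<bar>indicator {z..x1} y *\<^sub>R g y\<bar>)" by (rule ennreal_leI)
    also have "\<dots> = (\<integral>\<^sup>+y. ennreal \<bar>indicator {z..x1} y *\<^sub>R g y\<bar> \<partial>lborel)"
      using gz by (intro nn_integral_eq_integral[symmetric]) (auto simp: set_integrable_def)
    also have "\<dots> \<le> (\<integral>\<^sup>+y. ennreal x * (ennreal ((g y)^2 / (1 - (\<mu> y)\<^sup>2)) * indicator I1 y) + ennreal (M / (2 * x)) * indicator {z..x1} y \<partial>lborel)"
    proof (rule nn_integral_mono_AE)
      show "AE y in lborel. ennreal \<bar>indicator {z..x1} y *\<^sub>R g y\<bar> \<le> ennreal x * (ennreal ((g y)^2 / (1 - (\<mu> y)\<^sup>2)) * indicator I1 y) + ennreal (M / (2 * x)) * indicator {z..x1} y"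
        using AE_lborel_singleton[of z] AE_lborel_singleton[of x1]
      proof eventually_elim
        case (elim y)
        show ?case
        proof (cases "z < y \<and> y < x1")
          case True
          then have up: "0 < u y" "u y < M" using pos lt[of y] z by auto
          have M2: "M \<le> 2" using u02(2)[of x1] x1 x by auto
          define q where "q = 1 - (\<mu> y)\<^sup>2"
          have q: "q = u y * (2 - u y)" by (simp add: q_def u_def power2_eq_square algebra_simps)
          then have qpos: "q > 0" using up M2 by simp
          have "q \<le> M * 2" unfolding q using up M2 by (intro mult_mono) auto
          then have q2: "q / (4 * x) \<le> M / (2 * x)" using x by (simp add: field_simps)
          \<comment> \<open>Young's inequality, weighted so that its second term integrates to at
            most \<open>M / 2\<close> over an interval of length at most \<open>x\<close>.\<close>
          have "0 \<le> (2 * x * \<bar>g y\<bar> - q)^2" by simp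
          then have "4 * x * q * \<bar>g y\<bar> \<le> 4 * x^2 * (g y)^2 + q^2" by (simp add: power2_diff power_mult_distrib algebra_simps)
          then have "\<bar>g y\<bar> \<le> (4 * x^2 * (g y)^2 + q^2) / (4 * x * q)" using x qpos by (simp add: field_simps)
          also have "\<dots> = x * ((g y)^2 / q) + q / (4 * x)" using x qpos by (simp add: field_simps power2_eq_square)
          finally have "\<bar>g y\<bar> \<le> x * ((g y)^2 / q) + M / (2 * x)" using q2 by linarith
          then have "ennreal \<bar>g y\<bar> \<le> ennreal (x * ((g y)^2 / q) + M / (2 * x))" by (rule ennreal_leI)
          also have "\<dots> = ennreal (x * ((g y)^2 / q)) + ennreal (M / (2 * x))"
            using x qpos Mpos by (intro ennreal_plus) auto
          also have "ennreal (x * ((g y)^2 / q)) = ennreal x * ennreal ((g y)^2 / q)"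
            using x qpos by (intro ennreal_mult) auto
          finally show ?thesis using True z x1 x by (simp add: indicator_def q_def)
        qed (use elim in \<open>auto simp: indicator_def\<close>)
      qed
    qed
    also have "\<dots> \<le> ennreal x * wall \<mu> + ennreal (M / 2)"
    proof -
      have mg: "(\<lambda>y. indicat_real I1 y * g y) \<in> borel_measurable borel" and mm: "(\<lambda>y. indicat_real I1 y * \<mu> y) \<in> borel_measurable borel"
        using W by (auto simp: W12_1_def set_borel_measurable_def)
      have "(\<lambda>y. ennreal ((indicat_real I1 y * g y)^2 / (1 - (indicat_real I1 y * \<mu> y)\<^sup>2)) * indicator I1 y) \<in> borel_measurable borel"
        using mg mm by measurable
      moreover have "(\<lambda>y. ennreal ((indicat_real I1 y * g y)^2 / (1 - (indicat_real I1 y * \<mu> y)\<^sup>2)) * indicator I1 y)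
          = (\<lambda>y. ennreal ((g y)^2 / (1 - (\<mu> y)\<^sup>2)) * indicator I1 y)"
        by (auto simp: indicator_def)
      ultimately have m: "(\<lambda>y. ennreal ((g y)^2 / (1 - (\<mu> y)\<^sup>2)) * indicator I1 y) \<in> borel_measurable lborel" by simp
      have "M / (2 * x) * (x1 - z) \<le> M / (2 * x) * x" using Mpos x x1 z by (intro mult_left_mono) auto
      also have "\<dots> = M / 2" using x by simp
      finally have "ennreal (M / (2 * x)) * ennreal (x1 - z) \<le> ennreal (M / 2)"
        using Mpos x zx1 by (simp add: ennreal_mult[symmetric] ennreal_leI)
      then have "(\<integral>\<^sup>+y. ennreal (M / (2 * x)) * indicator {z..x1} y \<partial>lborel) \<le> ennreal (M / 2)"
        using zx1 by (simp add: nn_integral_cmult_indicator)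
      moreover have "(\<integral>\<^sup>+y. ennreal x * (ennreal ((g y)^2 / (1 - (\<mu> y)\<^sup>2)) * indicator I1 y) \<partial>lborel) = ennreal x * wall \<mu>"
        unfolding wall_eq[OF W bnd] by (rule nn_integral_cmult[OF m])
      ultimately show ?thesis using m by (subst nn_integral_add) (auto intro!: add_left_mono)
    qed
    finally have "ennreal M \<le> ennreal x * ennreal (enn2real (wall \<mu>)) + ennreal (M / 2)"
      using fin by (simp add: less_top)
    then have "M \<le> x * enn2real (wall \<mu>) + M / 2"
      using x Mpos by (simp add: ennreal_mult[symmetric] ennreal_plus[symmetric] del: ennreal_plus)
    then show ?thesis using ux by (simp add: u_def)
  qed
qed

text \<open>The values of \<open>\<mu>\<close> outside the interval are multiplied by zero.\<close>

lemma smooth_deriv_integral_zero: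
  assumes "smooth_on UNIV f" "compact K" "K \<subseteq> I1" "\<And>x. x \<notin> K \<Longrightarrow> f x = 0"
  shows "(LINT x:I1|lborel. deriv f x) = 0"
proof -
  have "has_bochner_integral lborel (\<lambda>x. deriv f x * indicator {-1..1} x) (f 1 - f (-1))"
    by (intro has_bochner_integral_FTC_Icc_real smooth_on_has_deriv[OF assms(1)]
        DERIV_isCont[OF smooth_on_has_deriv[OF smooth_on_deriv[OF assms(1)]]]) auto
  moreover have "f 1 = 0" "f (-1) = 0" using assms(3,4) by fastforce+
  moreover have "deriv f x * indicator {-1..1} x = indicator I1 x *\<^sub>R deriv f x" for x
  proof (cases "x \<in> I1")
    case False
    then have "deriv f x = 0" using assms(3) by (intro deriv_zero_outside_compact[OF assms(2,4)]) auto
    then show ?thesis by simp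
  qed (auto simp: indicator_def)
  ultimately show ?thesis by (simp add: has_bochner_integral_iff set_lebesgue_integral_def)
qed

lemma continuous_bounded_on_compact:
  fixes f :: "'a::topological_space \<Rightarrow> real"
  assumes "compact K" "continuous_on K f"
  obtains B where "B \<ge> 0" "\<And>x. x \<in> K \<Longrightarrow> \<bar>f x\<bar> \<le> B"
proof -
  have "bounded (f ` K)" using assms compact_continuous_image compact_imp_bounded by blast
  then obtain B where "\<And>x. x \<in> K \<Longrightarrow> \<bar>f x\<bar> \<le> B" by (force simp: bounded_iff)
  then have "\<And>x. x \<in> K \<Longrightarrow> \<bar>f x\<bar> \<le> max B 0" by fastforce
  then show ?thesis using that[of "max B 0"] by auto
qed

lemma sq_add3_le: "(a + b + c)^2 \<le> 3 * (a^2 + b^2 + c^2)" for a b c :: real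
proof -
  have "3 * (a^2 + b^2 + c^2) - (a + b + c)\<^sup>2 = (a - b)^2 + (b - c)^2 + (a - c)^2" by algebra
  then show ?thesis using zero_le_power2[of "a - b"] zero_le_power2[of "b - c"] zero_le_power2[of "a - c"] by linarith
qed

text \<open>The shape shared by all competitors on the flat boundary: a smooth function plus a
  cut-off, shrunk copy of \<mu>. Requiring \<theta> to vanish already beyond \<open>s * q\<close>
  with \<open>q < 1\<close> gives every pulled-back test function compact support inside the
  original open interval.\<close>

lemma W12_1_rescale:
  assumes W: "W12_1 I1 \<mu> g" and p: "smooth_on UNIV p" and \<theta>: "smooth_on UNIV \<theta>"
    and s: "0 < s" and q: "q < 1" and sup: "\<And>x. \<bar>x\<bar> > s * q \<Longrightarrow> \<theta> x = 0"
  shows "W12_1 I1 (\<lambda>x. p x + \<theta> x * \<mu> (x / s)) (\<lambda>x. deriv p x + deriv \<theta> x * \<mu> (x / s) + \<theta> x * g (x / s) / s)"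
proof -
  let ?F = "\<lambda>y. indicat_real I1 y * \<mu> y" and ?G = "\<lambda>y. indicat_real I1 y * g y"
  have Fi: "integrable lborel ?F" and Gi: "integrable lborel ?G"
    using W12_1_integrable[OF W] by (auto simp: set_integrable_def)
  note [measurable] = borel_measurable_integrable[OF Fi, simplified] borel_measurable_integrable[OF Gi, simplified]
    smooth_on_measurable[OF p] smooth_on_measurable[OF \<theta>] smooth_on_measurable[OF smooth_on_deriv[OF p]] smooth_on_measurable[OF smooth_on_deriv[OF \<theta>]]
  have out: "\<theta> x = 0 \<and> deriv \<theta> x = 0" if "x / s \<notin> I1" for x
  proof -
    have "\<bar>x\<bar> \<ge> s" using that s by (auto simp: abs_if field_simps)
    then have x: "\<bar>x\<bar> > s * q" using q s by (smt (verit) mult_less_cancel_left2)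
    have "deriv \<theta> x = deriv (\<lambda>_. 0) x"
    proof (rule deriv_cong_open[of "- {- (s * q)..s * q}"])
      show "\<theta> y = 0" if "y \<in> - {- (s * q)..s * q}" for y using sup[of y] that by (auto simp: abs_if split: if_splits)
    qed (use x in auto)
    then show ?thesis using sup[OF x] by simp
  qed
  \<comment> \<open>Outside the interval \<mu> and \<open>g\<close> are arbitrary and not even known
    to be measurable. Since \<theta> and its derivative vanish there, both can be replaced by their
    extensions by zero.\<close>
  have \<theta>F: "\<theta> x * \<mu> (x / s) = \<theta> x * ?F (x / s)" "\<theta> x * g (x / s) = \<theta> x * ?G (x / s)" "deriv \<theta> x * \<mu> (x / s) = deriv \<theta> x * ?F (x / s)" for x
    using out[of x] by (auto simp: indicator_def)
  have id: "(\<lambda>x. p x + \<theta> x * \<mu> (x / s)) = (\<lambda>x. p x + \<theta> x * ?F (x / s))"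
    "(\<lambda>x. deriv p x + deriv \<theta> x * \<mu> (x / s) + \<theta> x * g (x / s) / s) = (\<lambda>x. deriv p x + deriv \<theta> x * ?F (x / s) + \<theta> x * ?G (x / s) / s)"
    unfolding \<theta>F by (rule refl)+
  obtain Bp where Bp: "Bp \<ge> 0" "\<And>x. x \<in> {-1..1} \<Longrightarrow> \<bar>p x\<bar> \<le> Bp" by (rule continuous_bounded_on_compact[OF _ smooth_on_continuous[OF p], of "{-1..1}"]) auto
  obtain Bp' where Bp': "Bp' \<ge> 0" "\<And>x. x \<in> {-1..1} \<Longrightarrow> \<bar>deriv p x\<bar> \<le> Bp'" by (rule continuous_bounded_on_compact[OF _ smooth_on_continuous[OF smooth_on_deriv[OF p]], of "{-1..1}"]) auto
  obtain Bt where Bt: "Bt \<ge> 0" "\<And>x. x \<in> {-1..1} \<Longrightarrow> \<bar>\<theta> x\<bar> \<le> Bt" by (rule continuous_bounded_on_compact[OF _ smooth_on_continuous[OF \<theta>], of "{-1..1}"]) auto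
  obtain Bt' where Bt': "Bt' \<ge> 0" "\<And>x. x \<in> {-1..1} \<Longrightarrow> \<bar>deriv \<theta> x\<bar> \<le> Bt'" by (rule continuous_bounded_on_compact[OF _ smooth_on_continuous[OF smooth_on_deriv[OF \<theta>]], of "{-1..1}"]) auto
  have sqF: "(\<integral>\<^sup>+x. ennreal ((?F (x / s))^2) \<partial>lborel) < \<infinity>" and sqG: "(\<integral>\<^sup>+x. ennreal ((?G (x / s))^2) \<partial>lborel) < \<infinity>"
  proof -
    have *: "(\<integral>\<^sup>+x. ennreal ((indicat_real I1 (x / s) * h (x / s))^2) \<partial>lborel) < \<infinity>"
      if h: "sqint I1 h < \<infinity>" and [measurable]: "(\<lambda>y. indicat_real I1 y * h y) \<in> borel_measurable borel" for h
    proof -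
      let ?H = "\<lambda>x. ennreal ((indicat_real I1 (x / s) * h (x / s))^2)"
      have "(\<integral>\<^sup>+x. ?H x \<partial>lborel) = ennreal \<bar>s\<bar> * (\<integral>\<^sup>+x. ?H (0 + s * x) \<partial>lborel)"
        using s by (intro nn_integral_real_affine) auto
      also have "(\<integral>\<^sup>+x. ?H (0 + s * x) \<partial>lborel) = sqint I1 h"
        using s by (intro nn_integral_cong) (auto simp: indicator_def)
      finally show ?thesis using h by (simp add: ennreal_mult_less_top)
    qed
    show "(\<integral>\<^sup>+x. ennreal ((?F (x / s))^2) \<partial>lborel) < \<infinity>" "(\<integral>\<^sup>+x. ennreal ((?G (x / s))^2) \<partial>lborel) < \<infinity>"
      by (rule *; use W in \<open>simp add: W12_1_def\<close>; measurable)+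
  qed
  have fin: "sqint I1 h < \<infinity>"
    if h: "\<And>x. x \<in> I1 \<Longrightarrow> (h x)\<^sup>2 \<le> A + B * (?F (x / s))^2 + C * (?G (x / s))^2" and ABC: "A \<ge> 0" "B \<ge> 0" "C \<ge> 0" for h A B C
  proof -
    have "sqint I1 h \<le> (\<integral>\<^sup>+x. ennreal A * indicator I1 x + ennreal B * ennreal ((?F (x / s))^2) + ennreal C * ennreal ((?G (x / s))^2) \<partial>lborel)"
    proof (rule nn_integral_mono)
      fix x
      show "ennreal ((h x)^2) * indicator I1 x \<le> ennreal A * indicator I1 x + ennreal B * ennreal ((?F (x / s))^2) + ennreal C * ennreal ((?G (x / s))^2)"
      proof (cases "x \<in> I1")
        case True
        have "ennreal ((h x)^2) \<le> ennreal (A + B * (?F (x / s))^2 + C * (?G (x / s))^2)" using h[OF True] by (rule ennreal_leI)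
        also have "\<dots> = ennreal A + ennreal B * ennreal ((?F (x / s))^2) + ennreal C * ennreal ((?G (x / s))^2)"
          using ABC by (simp add: ennreal_mult ennreal_plus)
        finally show ?thesis using True by simp
      qed simp
    qed
    also have "\<dots> = ennreal A * emeasure lborel I1 + ennreal B * (\<integral>\<^sup>+x. ennreal ((?F (x / s))^2) \<partial>lborel) + ennreal C * (\<integral>\<^sup>+x. ennreal ((?G (x / s))^2) \<partial>lborel)"
      by (simp add: nn_integral_add nn_integral_cmult nn_integral_cmult_indicator)
    also have "\<dots> < \<infinity>" using sqF sqG by (simp add: ennreal_mult_less_top)
    finally show ?thesis .
  qed
  have mono_sq: "\<bar>x\<bar> \<le> B \<Longrightarrow> (x * y)\<^sup>2 \<le> B^2 * y^2" for x B y :: real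
    by (simp add: power_mult_distrib abs_le_square_iff[symmetric] mult_right_mono)
  show ?thesis unfolding id W12_1_def
  proof (intro conjI allI impI)
    show "set_borel_measurable lborel I1 (\<lambda>x. p x + \<theta> x * ?F (x / s))"
      "set_borel_measurable lborel I1 (\<lambda>x. deriv p x + deriv \<theta> x * ?F (x / s) + \<theta> x * ?G (x / s) / s)"
      unfolding set_borel_measurable_def by measurable
    show "sqint I1 (\<lambda>x. p x + \<theta> x * ?F (x / s)) < \<infinity>"
    proof (rule fin[of _ "3 * Bp^2" "3 * Bt^2" 0])
      fix x assume x: "x \<in> I1"
      have "(p x + \<theta> x * ?F (x / s) + 0)^2 \<le> 3 * ((p x)^2 + (\<theta> x * ?F (x / s))^2 + 0^2)" by (rule sq_add3_le)
      moreover have "(p x * 1)^2 \<le> Bp^2 * 1^2" "(\<theta> x * ?F (x / s))^2 \<le> Bt^2 * (?F (x / s))^2" using x by (intro mono_sq Bp Bt; simp)+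
      ultimately show "(p x + \<theta> x * ?F (x / s))^2 \<le> 3 * Bp^2 + 3 * Bt^2 * (?F (x / s))^2 + 0 * (?G (x / s))^2" by simp
    qed auto
    show "sqint I1 (\<lambda>x. deriv p x + deriv \<theta> x * ?F (x / s) + \<theta> x * ?G (x / s) / s) < \<infinity>"
    proof (rule fin[of _ "3 * Bp'^2" "3 * Bt'^2" "3 * (Bt / s)^2"])
      fix x assume x: "x \<in> I1"
      have "(deriv p x + deriv \<theta> x * ?F (x / s) + \<theta> x / s * ?G (x / s))^2 \<le> 3 * ((deriv p x)^2 + (deriv \<theta> x * ?F (x / s))^2 + (\<theta> x / s * ?G (x / s))^2)" by (rule sq_add3_le)
      moreover have "(deriv p x * 1)^2 \<le> Bp'^2 * 1^2" "(deriv \<theta> x * ?F (x / s))^2 \<le> Bt'^2 * (?F (x / s))^2" using x by (intro mono_sq Bp' Bt'; simp)+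
      moreover have "(\<theta> x / s * ?G (x / s))^2 \<le> (Bt / s)^2 * (?G (x / s))^2" using x s Bt(2)[of x] by (intro mono_sq) (simp add: divide_right_mono)
      ultimately show "(deriv p x + deriv \<theta> x * ?F (x / s) + \<theta> x * ?G (x / s) / s)^2 \<le> 3 * Bp'^2 + 3 * Bt'^2 * (?F (x / s))^2 + 3 * (Bt / s)^2 * (?G (x / s))^2" by simp
    qed auto
    fix \<phi> assume t: "test1 I1 \<phi>"
    then obtain K where K: "compact K" "K \<subseteq> I1" "\<And>x. x \<notin> K \<Longrightarrow> \<phi> x = 0" by (auto simp: test1_def)
    have s\<phi>: "smooth_on UNIV \<phi>" using t by (rule test1_smooth)
    obtain B where B: "\<And>x. \<bar>\<phi> x\<bar> \<le> B" using test1_bounded[OF t] by blast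
    obtain B' where B': "\<And>x. \<bar>deriv \<phi> x\<bar> \<le> B'" using test1_bounded[OF test1_deriv[OF t]] by blast
    note [measurable] = smooth_on_measurable[OF s\<phi>] smooth_on_measurable[OF smooth_on_deriv[OF s\<phi>]]
    have d\<phi>: "(\<phi> has_real_derivative deriv \<phi> x) (at x)" for x using smooth_on_has_deriv[OF s\<phi>] by auto
    have d\<theta>: "(\<theta> has_real_derivative deriv \<theta> x) (at x)" for x using smooth_on_has_deriv[OF \<theta>] by auto
    have dp: "(p has_real_derivative deriv p x) (at x)" for x using smooth_on_has_deriv[OF p] by auto
    have z: "\<phi> x = 0" "deriv \<phi> x = 0" if "x \<notin> I1" for x
    proof -
      have "x \<notin> K" using that K(2) by auto
      then show "\<phi> x = 0" "deriv \<phi> x = 0" using K(3) deriv_zero_outside_compact[OF K(1), of \<phi>] by auto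
    qed
    have zI: "indicat_real {-1..1} x * (y * deriv \<phi> x) = y * deriv \<phi> x" "indicat_real {-1..1} x * (y * \<phi> x) = y * \<phi> x"
      "indicat_real I1 x * (y * deriv \<phi> x) = y * deriv \<phi> x" "indicat_real I1 x * (y * \<phi> x) = y * \<phi> x" for x y
      by (cases "x \<in> I1"; auto simp: z indicator_def)+
    text \<open>Both sides split into a smooth part and a part that is moved to the original interval by the substitution \<open>x = s y\<close>.\<close>
    define \<Phi> where "\<Phi> y = \<theta> (s * y) * \<phi> (s * y)" for y
    have dPhi: "(\<Phi> has_real_derivative s * (deriv \<theta> (s * y) * \<phi> (s * y) + \<theta> (s * y) * deriv \<phi> (s * y))) (at y)" for y
    proof -
      have 1: "((\<lambda>y. \<theta> (s * y)) has_real_derivative deriv \<theta> (s * y) * s) (at y)"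
        by (rule DERIV_chain2[OF d\<theta>]) (auto intro!: derivative_eq_intros)
      have 2: "((\<lambda>y. \<phi> (s * y)) has_real_derivative deriv \<phi> (s * y) * s) (at y)"
        by (rule DERIV_chain2[OF d\<phi>]) (auto intro!: derivative_eq_intros)
      show ?thesis unfolding \<Phi>_def by (rule DERIV_cong[OF DERIV_mult[OF 1 2]]) (simp add: algebra_simps)
    qed
    have tPhi: "test1 I1 \<Phi>"
      unfolding test1_def smooth1_iff
    proof (intro conjI exI[of _ "{-q..q}"])
      have sc: "smooth_on UNIV (\<lambda>y. s * y)" by (intro smooth_on_mult) auto
      show "smooth_on UNIV \<Phi>" unfolding \<Phi>_def by (intro smooth_on_mult smooth_on_comp[OF _ _ \<theta> sc] smooth_on_comp[OF _ _ s\<phi> sc]) auto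
      show "{-q..q} \<subseteq> I1" using q by auto
      show "\<forall>y. y \<notin> {-q..q} \<longrightarrow> \<Phi> y = 0"
      proof (intro allI impI)
        fix y assume "y \<notin> {-q..q}"
        then have "\<bar>s * y\<bar> > s * q" using s by (auto simp: abs_mult)
        then show "\<Phi> y = 0" using sup by (simp add: \<Phi>_def)
      qed
    qed auto
    have key: "(LINT y|lborel. ?F y * deriv \<Phi> y) = - (LINT y|lborel. ?G y * \<Phi> y)"
      using W12_1_test[OF W tPhi] by (simp add: set_lebesgue_integral_def mult.assoc)
    have aff: "(LINT x|lborel. h x) = s * (LINT y|lborel. h (s * y))" for h :: "real \<Rightarrow> real"
      using lborel_integral_real_affine[of s h 0] s by simp
    obtain BP where BP: "\<And>x. \<bar>\<Phi> x\<bar> \<le> BP" using test1_bounded[OF tPhi] by blast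
    have bdF: "integrable lborel (\<lambda>y. ?F y * h (s * y))" if h: "h \<in> borel_measurable borel" "\<And>x. \<bar>h x\<bar> \<le> C" for h C
      using set_integrable_mult_bounded[of UNIV ?F "\<lambda>y. h (s * y)" C] Fi h by (auto simp: set_integrable_def)
    have bt: "\<bar>deriv \<theta> x * \<phi> x\<bar> \<le> Bt' * B" "\<bar>\<theta> x * deriv \<phi> x\<bar> \<le> Bt * B'" for x
    proof -
      have "0 \<le> B" "0 \<le> B'" using abs_ge_zero order_trans B[of 2] B'[of 2] by blast+
      then show "\<bar>deriv \<theta> x * \<phi> x\<bar> \<le> Bt' * B" "\<bar>\<theta> x * deriv \<phi> x\<bar> \<le> Bt * B'"
        by (cases "x \<in> I1"; simp add: z abs_mult Bt Bt' B B' mult_mono)+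
    qed
    have i1: "integrable lborel (\<lambda>y. ?F y * (deriv \<theta> (s * y) * \<phi> (s * y)))"
      by (rule bdF[of "\<lambda>x. deriv \<theta> x * \<phi> x", OF _ bt(1)]) measurable
    have i2: "integrable lborel (\<lambda>y. ?F y * (\<theta> (s * y) * deriv \<phi> (s * y)))"
      by (rule bdF[of "\<lambda>x. \<theta> x * deriv \<phi> x", OF _ bt(2)]) measurable
    have i3: "integrable lborel (\<lambda>y. ?G y * \<Phi> y)"
      using set_integrable_mult_bounded[of UNIV ?G \<Phi> BP] Gi BP smooth_on_measurable[OF test1_smooth[OF tPhi]] by (auto simp: set_integrable_def)
    have ip: "integrable lborel (\<lambda>x. p x * deriv \<phi> x)" "integrable lborel (\<lambda>x. deriv p x * \<phi> x)"
    proof -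
      have "integrable lborel (\<lambda>x. indicator {-1..1} x *\<^sub>R (p x * deriv \<phi> x))"
        by (rule borel_integrable_compact) (intro continuous_intros smooth_on_continuous p smooth_on_deriv s\<phi> | simp)+
      then show "integrable lborel (\<lambda>x. p x * deriv \<phi> x)"
        by (rule Bochner_Integration.integrable_cong[THEN iffD1, rotated -1]) (auto simp: zI)
      have "integrable lborel (\<lambda>x. indicator {-1..1} x *\<^sub>R (deriv p x * \<phi> x))"
        by (rule borel_integrable_compact) (intro continuous_intros smooth_on_continuous p smooth_on_deriv s\<phi> | simp)+
      then show "integrable lborel (\<lambda>x. deriv p x * \<phi> x)"
        by (rule Bochner_Integration.integrable_cong[THEN iffD1, rotated -1]) (auto simp: zI)
    qed
    have pp: "(LINT x|lborel. p x * deriv \<phi> x) = - (LINT x|lborel. deriv p x * \<phi> x)"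
    proof -
      have "(LINT x:I1|lborel. deriv (\<lambda>x. p x * \<phi> x) x) = 0"
        by (rule smooth_deriv_integral_zero[OF smooth_on_mult[OF _ p s\<phi>] K(1,2)]) (use K in auto)
      moreover have "deriv (\<lambda>x. p x * \<phi> x) x = p x * deriv \<phi> x + deriv p x * \<phi> x" for x
        by (rule DERIV_imp_deriv) (rule DERIV_cong[OF DERIV_mult[OF dp d\<phi>]], simp)
      ultimately have "(LINT x:I1|lborel. p x * deriv \<phi> x + deriv p x * \<phi> x) = 0" by simp
      moreover have "(LINT x:I1|lborel. p x * deriv \<phi> x + deriv p x * \<phi> x) = (LINT x|lborel. p x * deriv \<phi> x + deriv p x * \<phi> x)"
        unfolding set_lebesgue_integral_def by (rule Bochner_Integration.integral_cong) (auto simp: zI distrib_left)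
      ultimately show ?thesis using ip by simp
    qed
    have j1: "integrable lborel (\<lambda>x. \<theta> x * ?F (x / s) * deriv \<phi> x)"
      using lborel_integrable_real_affine_iff[of s "\<lambda>x. \<theta> x * ?F (x / s) * deriv \<phi> x" 0] i2 s by (simp add: ac_simps)
    have j2: "integrable lborel (\<lambda>x. deriv \<theta> x * ?F (x / s) * \<phi> x)"
      using lborel_integrable_real_affine_iff[of s "\<lambda>x. deriv \<theta> x * ?F (x / s) * \<phi> x" 0] i1 s by (simp add: ac_simps)
    have j3: "integrable lborel (\<lambda>x. \<theta> x * ?G (x / s) / s * \<phi> x)"
      using lborel_integrable_real_affine_iff[of s "\<lambda>x. \<theta> x * ?G (x / s) / s * \<phi> x" 0] i3 s by (simp add: ac_simps \<Phi>_def)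
    have "(LINT x:I1|lborel. (p x + \<theta> x * ?F (x / s)) * deriv \<phi> x) = (LINT x|lborel. p x * deriv \<phi> x + \<theta> x * ?F (x / s) * deriv \<phi> x)"
      unfolding set_lebesgue_integral_def
      apply (rule Bochner_Integration.integral_cong[OF refl])
      subgoal for x by (cases "x \<in> I1") (auto simp: z algebra_simps)
      done
    also have "\<dots> = - (LINT x|lborel. deriv p x * \<phi> x) + (LINT x|lborel. \<theta> x * ?F (x / s) * deriv \<phi> x)"
      using ip j1 pp by simp
    also have "(LINT x|lborel. \<theta> x * ?F (x / s) * deriv \<phi> x) = s * (LINT y|lborel. ?F y * (\<theta> (s * y) * deriv \<phi> (s * y)))"
      using aff[of "\<lambda>x. \<theta> x * ?F (x / s) * deriv \<phi> x"] s by (simp add: ac_simps)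
    \<comment> \<open>The derivative of \<open>\<Phi>\<close> produces, besides the wanted term, one
      with \<open>deriv \<theta>\<close>. It is split off and becomes the middle term of the new
      weak derivative.\<close>
    also have "\<dots> = (LINT y|lborel. ?F y * deriv \<Phi> y) - s * (LINT y|lborel. ?F y * (deriv \<theta> (s * y) * \<phi> (s * y)))"
    proof -
      have "(LINT y|lborel. ?F y * deriv \<Phi> y) = (LINT y|lborel. s * (?F y * (deriv \<theta> (s * y) * \<phi> (s * y))) + s * (?F y * (\<theta> (s * y) * deriv \<phi> (s * y))))"
        unfolding DERIV_imp_deriv[OF dPhi] by (rule Bochner_Integration.integral_cong) (auto simp: algebra_simps)
      also have "\<dots> = s * (LINT y|lborel. ?F y * (deriv \<theta> (s * y) * \<phi> (s * y))) + s * (LINT y|lborel. ?F y * (\<theta> (s * y) * deriv \<phi> (s * y)))"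
        using i1 i2 by simp
      finally show ?thesis by simp
    qed
    also have "s * (LINT y|lborel. ?F y * (deriv \<theta> (s * y) * \<phi> (s * y))) = (LINT x|lborel. deriv \<theta> x * ?F (x / s) * \<phi> x)"
      using aff[of "\<lambda>x. deriv \<theta> x * ?F (x / s) * \<phi> x"] s by (simp add: ac_simps)
    also have "(LINT y|lborel. ?F y * deriv \<Phi> y) = - (LINT x|lborel. \<theta> x * ?G (x / s) / s * \<phi> x)"
    proof -
      have "(LINT x|lborel. \<theta> x * ?G (x / s) / s * \<phi> x) = s * (LINT y|lborel. 1 / s * (?G y * \<Phi> y))"
        using aff[of "\<lambda>x. \<theta> x * ?G (x / s) / s * \<phi> x"] s by (simp add: ac_simps \<Phi>_def)
      also have "\<dots> = (LINT y|lborel. ?G y * \<Phi> y)" using s by simp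
      finally show ?thesis using key by simp
    qed
    also have "- (LINT x|lborel. deriv p x * \<phi> x) + (- (LINT x|lborel. \<theta> x * ?G (x / s) / s * \<phi> x) - (LINT x|lborel. deriv \<theta> x * ?F (x / s) * \<phi> x))
       = - (LINT x|lborel. deriv p x * \<phi> x + deriv \<theta> x * ?F (x / s) * \<phi> x + \<theta> x * ?G (x / s) / s * \<phi> x)"
      using ip j2 j3 by simp
    also have "\<dots> = - (LINT x:I1|lborel. (deriv p x + deriv \<theta> x * ?F (x / s) + \<theta> x * ?G (x / s) / s) * \<phi> x)"
      unfolding set_lebesgue_integral_def
      apply (rule arg_cong[where f = uminus])
      apply (rule Bochner_Integration.integral_cong[OF refl])
      subgoal for x by (cases "x \<in> I1") (auto simp: z algebra_simps)
      done
    finally show "(LINT x:I1|lborel. (p x + \<theta> x * ?F (x / s)) * deriv \<phi> x) = - (LINT x:I1|lborel. (deriv p x + deriv \<theta> x * ?F (x / s) + \<theta> x * ?G (x / s) / s) * \<phi> x)" .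
  qed
qed

subsection \<open>Energy estimates on a strip\<close>

text \<open>The partial derivatives are parameters and only continuity is asked of them. So the
  class contains the pullbacks \<open>lp\<close> of smooth functions and is stable under subtracting
  functions affine in \<open>s\<close>.\<close>

definition strip_fun :: "(pt \<Rightarrow> real) \<Rightarrow> (pt \<Rightarrow> real) \<Rightarrow> (pt \<Rightarrow> real) \<Rightarrow> bool" where
  "strip_fun F Fs Ft \<longleftrightarrow> continuous_on UNIV F \<and> continuous_on UNIV Fs \<and> continuous_on UNIV Ft \<and>
    (\<forall>s t. ((\<lambda>s. F (s, t)) has_real_derivative Fs (s, t)) (at s)) \<and>
    (\<forall>s t. ((\<lambda>t. F (s, t)) has_real_derivative Ft (s, t)) (at t))"

lemma strip_fun_cont:
  assumes "strip_fun F Fs Ft"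
  shows "continuous_on S F" "continuous_on S Fs" "continuous_on S Ft"
  using assms continuous_on_subset by (auto simp: strip_fun_def)

lemma cont_rect:
  assumes "continuous_on UNIV (f :: pt \<Rightarrow> real)"
  shows "f integrable_on rect a b"
  by (rule integrable_continuous) (rule continuous_on_subset[OF assms], simp)

lemma cont_slice:
  assumes "continuous_on UNIV (f :: pt \<Rightarrow> real)"
  shows "continuous_on S (\<lambda>t. f (s, t))" "continuous_on S (\<lambda>s. f (s, t))"
  by (rule continuous_on_compose2[OF assms]; auto intro!: continuous_intros)+

lemma rect_fubini:
  assumes "continuous_on UNIV (f :: pt \<Rightarrow> real)"
  shows "integral (rect a b) f = integral {a..b} (\<lambda>s. integral {0..pi} (\<lambda>t. f (s, t)))"
    and "integral (rect a b) f = integral {0..pi} (\<lambda>t. integral {a..b} (\<lambda>s. f (s, t)))"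
proof -
  have c: "continuous_on (rect a b) f" by (rule continuous_on_subset[OF assms]) simp
  show 1: "integral (rect a b) f = integral {a..b} (\<lambda>s. integral {0..pi} (\<lambda>t. f (s, t)))"
    using integral_prod_continuous[OF c] by simp
  have "integral (cbox a b) (\<lambda>x. integral (cbox 0 pi) (\<lambda>y. (\<lambda>s t. f (s, t)) x y)) = integral (cbox 0 pi) (\<lambda>y. integral (cbox a b) (\<lambda>x. (\<lambda>s t. f (s, t)) x y))"
    by (rule integral_swap_continuous) (use c in simp)
  then show "integral (rect a b) f = integral {0..pi} (\<lambda>t. integral {a..b} (\<lambda>s. f (s, t)))"
    using 1 by simp
qed

lemma rect_split:
  assumes f: "continuous_on UNIV (f :: pt \<Rightarrow> real)" and "a \<le> c" "c \<le> b"
  shows "integral (rect a b) f = integral (rect a c) f + integral (rect c b) f"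
proof -
  have i: "(\<lambda>s. integral {0..pi} (\<lambda>t. f (s, t))) integrable_on {a..b}"
  proof -
    have "continuous_on (cbox a b) (\<lambda>s. integral (cbox 0 pi) (\<lambda>t. f (s, t)))"
      by (rule integral_continuous_on_param) (simp add: continuous_on_subset[OF f])
    then show ?thesis using integrable_continuous_real by simp
  qed
  show ?thesis unfolding rect_fubini(1)[OF f]
    using Henstock_Kurzweil_Integration.integral_combine[OF assms(2,3) i] by simp
qed

lemma rect_const: "a \<le> b \<Longrightarrow> integral (rect a b) (\<lambda>p. k) = k * pi * (b - a)"
  by (simp add: content_Pair)

lemma rect_nonneg: "continuous_on UNIV f \<Longrightarrow> (\<And>p. p \<in> rect a b \<Longrightarrow> f p \<ge> 0) \<Longrightarrow> integral (rect a b) f \<ge> (0::real)"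
  by (rule Henstock_Kurzweil_Integration.integral_nonneg[OF cont_rect])

lemma rect_mono: "continuous_on UNIV f \<Longrightarrow> continuous_on UNIV g \<Longrightarrow> (\<And>p. p \<in> rect a b \<Longrightarrow> f p \<le> g p) \<Longrightarrow>
    integral (rect a b) f \<le> (integral (rect a b) g :: real)"
  by (rule integral_le[OF cont_rect cont_rect])

lemma sq_add_le: "(x + y)^2 \<le> 2 * x^2 + 2 * y^2" for x y :: real
  using sum_squares_bound[of x y] by (simp add: power2_sum)

lemma sq_integral_le:
  fixes f :: "'a::euclidean_space \<Rightarrow> real"
  assumes c: "continuous_on (cbox a b) f"
  shows "(integral (cbox a b) f)^2 \<le> measure lborel (cbox a b) * integral (cbox a b) (\<lambda>x. (f x)^2)"
proof -
  let ?A = "measure lborel (cbox a b)" and ?I = "integral (cbox a b) f" and ?Q = "integral (cbox a b) (\<lambda>x. (f x)^2)"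
  have fi: "f integrable_on cbox a b" and f2i: "(\<lambda>x. (f x)^2) integrable_on cbox a b"
    by (intro integrable_continuous continuous_intros c)+
  show ?thesis
  proof (cases "?A = 0")
    case True
    have "?I = 0" using True integral_null[of a b f] by simp
    then show ?thesis using True by simp
  next
    case False
    then have A: "?A > 0" by (simp add: less_le)
    have "0 \<le> integral (cbox a b) (\<lambda>x. (f x - ?I / ?A)^2)"
      by (intro Henstock_Kurzweil_Integration.integral_nonneg integrable_continuous continuous_intros c) auto
    also have "(\<lambda>x. (f x - ?I / ?A)^2) = (\<lambda>x. (f x)^2 - 2 * (?I / ?A) * f x + (?I / ?A)^2)"
      by (auto simp: power2_diff fun_eq_iff)
    also have "integral (cbox a b) \<dots> = ?Q - 2 * (?I / ?A) * ?I + (?I / ?A)^2 * ?A"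
      using fi f2i by (subst integral_add integral_diff; (intro integrable_diff integrable_on_mult_right integrable_const f2i fi)?)+ (simp add: mult.commute)
    also have "\<dots> = ?Q - ?I\<^sup>2 / ?A" using A by (simp add: field_simps power2_eq_square)
    finally show ?thesis using A by (simp add: field_simps)
  qed
qed

lemma rect_sq_le:
  assumes "continuous_on UNIV f" "a \<le> b"
  shows "(integral (rect a b) f)^2 \<le> (b - a) * pi * integral (rect a b) (\<lambda>p. (f p)^2)"
  using sq_integral_le[of "(a, 0)" "(b, pi)" f] continuous_on_subset[OF assms(1)] assms(2) by (simp add: content_Pair)

lemma interval_sq_le:
  fixes f :: "real \<Rightarrow> real"
  assumes "continuous_on {a..b} f" "a \<le> b"
  shows "(integral {a..b} f)^2 \<le> (b - a) * integral {a..b} (\<lambda>x. (f x)^2)"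
  using sq_integral_le[of a b f] assms by simp

context
  fixes F Fs Ft :: "pt \<Rightarrow> real"
  assumes F: "strip_fun F Fs Ft"
begin

lemma contF: "continuous_on S F" "continuous_on S Fs" "continuous_on S Ft"
  using strip_fun_cont[OF F] by auto

lemma derF: "((\<lambda>s. F (s, t)) has_real_derivative Fs (s, t)) (at s)"
  "((\<lambda>t. F (s, t)) has_real_derivative Ft (s, t)) (at t)"
  using F by (auto simp: strip_fun_def)

text \<open>Turns integrals over vertical sides into area integrals. The weight \<open>k\<close> is
  later the constant 1, the ramp \<open>s - a\<close>, which removes the side \<open>s = a\<close>,
  or a cut-off, which removes the side \<open>s = b + 1\<close>.\<close>

lemma strip_FTC_s:
  assumes ab: "a \<le> b" and k: "\<And>s. (k has_real_derivative k' s) (at s)" and k': "continuous_on UNIV k'"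
  shows "integral (rect a b) (\<lambda>p. k (fst p) * Fs p + k' (fst p) * F p) =
    k b * integral {0..pi} (\<lambda>t. F (b, t)) - k a * integral {0..pi} (\<lambda>t. F (a, t))"
proof -
  have ck: "continuous_on UNIV k" using k by (meson DERIV_isCont continuous_at_imp_continuous_on)
  have c: "continuous_on UNIV (\<lambda>p. k (fst p) * Fs p + k' (fst p) * F p)"
    by (intro continuous_intros contF continuous_on_compose2[OF ck] continuous_on_compose2[OF k']) auto
  have "integral {a..b} (\<lambda>s. k s * Fs (s, t) + k' s * F (s, t)) = k b * F (b, t) - k a * F (a, t)" for t
  proof (rule integral_unique, rule fundamental_theorem_of_calculus[OF ab])
    fix s
    have "((\<lambda>s. k s * F (s, t)) has_real_derivative k s * Fs (s, t) + k' s * F (s, t)) (at s)"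
      by (rule DERIV_cong[OF DERIV_mult[OF k derF(1)]]) simp
    then show "((\<lambda>s. k s * F (s, t)) has_vector_derivative k s * Fs (s, t) + k' s * F (s, t)) (at s within {a..b})"
      by (simp add: has_real_derivative_iff_has_vector_derivative has_vector_derivative_at_within)
  qed
  then have "integral (rect a b) (\<lambda>p. k (fst p) * Fs p + k' (fst p) * F p) = integral {0..pi} (\<lambda>t. k b * F (b, t) - k a * F (a, t))"
    by (simp add: rect_fubini(2)[OF c])
  also have "\<dots> = k b * integral {0..pi} (\<lambda>t. F (b, t)) - k a * integral {0..pi} (\<lambda>t. F (a, t))"
    by (subst integral_diff) (auto intro!: integrable_continuous_real continuous_intros cont_slice contF)
  finally show ?thesis .
qed

text \<open>The weight \<open>pi - snd p\<close> vanishes on the side \<open>t = pi\<close>, so only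
  the side \<open>t = 0\<close> contributes. Only the positive half of the flat boundary enters the
  estimates in this way.\<close>

lemma strip_FTC_t:
  assumes ab: "a \<le> b"
  shows "integral (rect a b) (\<lambda>p. (pi - snd p) * Ft p) = integral (rect a b) F - pi * integral {a..b} (\<lambda>s. F (s, 0))"
proof -
  have c: "continuous_on UNIV (\<lambda>p. (pi - snd p) * Ft p)" by (intro continuous_intros contF)
  have "integral {0..pi} (\<lambda>t. (pi - t) * Ft (s, t)) = integral {0..pi} (\<lambda>t. F (s, t)) - pi * F (s, 0)" for s
  proof -
    have "((\<lambda>t. (pi - t) * Ft (s, t) - (F (s, t) - F (s, 0))) has_integral (pi - pi) * (F (s, pi) - F (s, 0)) - (pi - 0) * (F (s, 0) - F (s, 0))) {0..pi}"
    proof (rule fundamental_theorem_of_calculus)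
      fix t
      have "((\<lambda>t. (pi - t) * (F (s, t) - F (s, 0))) has_real_derivative (pi - t) * Ft (s, t) - (F (s, t) - F (s, 0))) (at t)"
        by (auto intro!: derivative_eq_intros derF(2))
      then show "((\<lambda>t. (pi - t) * (F (s, t) - F (s, 0))) has_vector_derivative (pi - t) * Ft (s, t) - (F (s, t) - F (s, 0))) (at t within {0..pi})"
        by (simp add: has_real_derivative_iff_has_vector_derivative has_vector_derivative_at_within)
    qed simp
    then have "0 = integral {0..pi} (\<lambda>t. (pi - t) * Ft (s, t) - (F (s, t) - F (s, 0)))" by (simp add: integral_unique)
    also have "\<dots> = integral {0..pi} (\<lambda>t. (pi - t) * Ft (s, t)) - (integral {0..pi} (\<lambda>t. F (s, t)) - integral {0..pi} (\<lambda>t. F (s, 0)))"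
      by (subst integral_diff integral_diff; (intro integrable_continuous_real continuous_intros cont_slice contF)?)+ simp
    finally show ?thesis by simp
  qed
  then have "integral (rect a b) (\<lambda>p. (pi - snd p) * Ft p) = integral {a..b} (\<lambda>s. integral {0..pi} (\<lambda>t. F (s, t)) - pi * F (s, 0))"
    by (simp add: rect_fubini(1)[OF c])
  also have "\<dots> = integral {a..b} (\<lambda>s. integral {0..pi} (\<lambda>t. F (s, t))) - integral {a..b} (\<lambda>s. pi * F (s, 0))"
  proof (rule integral_diff)
    have "continuous_on (cbox a b) (\<lambda>s. integral (cbox 0 pi) (\<lambda>t. F (s, t)))"
      by (rule integral_continuous_on_param) (use contF in simp)
    then show "(\<lambda>s. integral {0..pi} (\<lambda>t. F (s, t))) integrable_on {a..b}" using integrable_continuous_real by simp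
    show "(\<lambda>s. pi * F (s, 0)) integrable_on {a..b}" by (intro integrable_continuous_real continuous_intros cont_slice contF)
  qed
  finally show ?thesis by (simp add: rect_fubini(1)[OF contF(1)])
qed

text \<open>Completing the square around the gradient of \<open>lm ln |x|\<close>, extended below \<open>a + 1\<close> by a flow that starts on the flat boundary.\<close>

lemma strip_excess:
  fixes a lm :: real
  assumes a: "a + 1 \<le> 0"
  defines "A \<equiv> integral {0..pi} (\<lambda>t. F (0, t))" and "m \<equiv> integral {a..a+1} (\<lambda>s. F (s, 0))"
  shows "integral (rect (a+1) 0) (\<lambda>p. (Fs p - lm)^2 + (Ft p)^2) + 2 * lm * (A - pi * m) - lm\<^sup>2 * pi * (- a + pi^2)
    \<le> integral (rect a 0) (\<lambda>p. (Fs p)^2 + (Ft p)^2)"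
proof -
  \<comment> \<open>The field \<open>(s - a, pi - t)\<close> has zero divergence, its
    \<open>s\<close>-component is 1 at \<open>s = a + 1\<close> and 0 at \<open>s = a\<close>, and
    it enters only through \<open>t = 0\<close>, with strength \<open>pi\<close>. It therefore
    continues the constant field \<open>(1, 0)\<close> down to the flat boundary, and the total flux
    of the gradient is \<open>A - pi * m\<close>.\<close>
  let ?e = "\<lambda>p. (Fs p)^2 + (Ft p)^2" and ?X = "\<lambda>p. (fst p - a) * Fs p + (pi - snd p) * Ft p"
  have ce: "continuous_on UNIV ?e" by (intro continuous_intros contF)
  have A1: "A = integral {0..pi} (\<lambda>t. F (a+1, t)) + integral (rect (a+1) 0) Fs"
    using strip_FTC_s[of "a+1" 0 "\<lambda>_. 1" "\<lambda>_. 0"] a by (simp add: A_def)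
  have A2: "integral {0..pi} (\<lambda>t. F (a+1, t)) = integral (rect a (a+1)) (\<lambda>p. (fst p - a) * Fs p + F p)"
  proof -
    have k: "((\<lambda>s. s - a) has_real_derivative 1) (at s)" for s by (auto intro!: derivative_eq_intros)
    show ?thesis using strip_FTC_s[of a "a+1" "\<lambda>s. s - a" "\<lambda>_. 1", OF _ k] by simp
  qed
  have X: "integral (rect a (a+1)) ?X = integral (rect a (a+1)) (\<lambda>p. (fst p - a) * Fs p + F p) - pi * m"
  proof -
    have "integral (rect a (a+1)) ?X = integral (rect a (a+1)) (\<lambda>p. (fst p - a) * Fs p) + integral (rect a (a+1)) (\<lambda>p. (pi - snd p) * Ft p)"
      by (intro integral_add cont_rect continuous_intros contF)
    moreover have "integral (rect a (a+1)) (\<lambda>p. (fst p - a) * Fs p + F p) = integral (rect a (a+1)) (\<lambda>p. (fst p - a) * Fs p) + integral (rect a (a+1)) F"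
      by (intro integral_add cont_rect continuous_intros contF)
    ultimately show ?thesis using strip_FTC_t[of a "a+1"] by (simp add: m_def)
  qed
  have AX: "A - pi * m = integral (rect (a+1) 0) Fs + integral (rect a (a+1)) ?X" using A1 A2 X by simp
  have E1: "integral (rect (a+1) 0) (\<lambda>p. (Fs p - lm)^2 + (Ft p)^2) = integral (rect (a+1) 0) ?e - 2 * lm * integral (rect (a+1) 0) Fs + lm^2 * pi * (- a - 1)"
  proof -
    have "(\<lambda>p. (Fs p - lm)^2 + (Ft p)^2) = (\<lambda>p. (?e p - 2 * lm * Fs p) + lm^2)" by (auto simp: power2_diff)
    then have "integral (rect (a+1) 0) (\<lambda>p. (Fs p - lm)^2 + (Ft p)^2) = integral (rect (a+1) 0) (\<lambda>p. ?e p - 2 * lm * Fs p) + integral (rect (a+1) 0) (\<lambda>p. lm^2)"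
      by (simp only:) (intro integral_add cont_rect continuous_intros contF)
    also have "integral (rect (a+1) 0) (\<lambda>p. ?e p - 2 * lm * Fs p) = integral (rect (a+1) 0) ?e - integral (rect (a+1) 0) (\<lambda>p. 2 * lm * Fs p)"
      by (intro integral_diff cont_rect continuous_intros contF)
    finally show ?thesis using rect_const[of "a+1" 0 "lm^2"] a by simp
  qed
  \<comment> \<open>The square is completed around \<open>lm\<close> times the field. Its squared
    length is at most \<open>1 + pi^2\<close>, which is the source of \<open>pi^2\<close> in the
    statement.\<close>
  have E0: "0 \<le> integral (rect a (a+1)) ?e - 2 * lm * integral (rect a (a+1)) ?X + lm^2 * (pi * (1 + pi^2))"
  proof -
    let ?Y = "\<lambda>p::pt. (fst p - a)^2 + (pi - snd p)^2"
    have "0 \<le> integral (rect a (a+1)) (\<lambda>p. (Fs p - lm * (fst p - a))^2 + (Ft p - lm * (pi - snd p))^2)"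
      by (intro rect_nonneg continuous_intros contF) auto
    also have "(\<lambda>p. (Fs p - lm * (fst p - a))^2 + (Ft p - lm * (pi - snd p))^2) = (\<lambda>p. (?e p - 2 * lm * ?X p) + lm^2 * ?Y p)"
      by (rule ext) algebra
    also have "integral (rect a (a+1)) \<dots> = integral (rect a (a+1)) (\<lambda>p. ?e p - 2 * lm * ?X p) + integral (rect a (a+1)) (\<lambda>p. lm^2 * ?Y p)"
      by (intro integral_add cont_rect continuous_intros contF)
    also have "integral (rect a (a+1)) (\<lambda>p. ?e p - 2 * lm * ?X p) = integral (rect a (a+1)) ?e - integral (rect a (a+1)) (\<lambda>p. 2 * lm * ?X p)"
      by (intro integral_diff cont_rect continuous_intros contF)
    also have "integral (rect a (a+1)) (\<lambda>p. 2 * lm * ?X p) = 2 * lm * integral (rect a (a+1)) ?X" by simp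
    also have "integral (rect a (a+1)) (\<lambda>p. lm^2 * ?Y p) \<le> integral (rect a (a+1)) (\<lambda>p. lm^2 * (1 + pi^2))"
    proof (intro rect_mono continuous_intros mult_left_mono add_mono)
      fix p assume "p \<in> rect a (a+1)"
      then show "(fst p - a)^2 \<le> 1" "(pi - snd p)^2 \<le> pi^2" by (auto simp: mem_cbox_pt abs_square_le_1 intro!: power_mono)
    qed auto
    also have "\<dots> = lm^2 * (pi * (1 + pi^2))" by (subst rect_const) (auto simp: algebra_simps)
    finally show ?thesis by simp
  qed
  have "integral (rect a 0) ?e = integral (rect a (a+1)) ?e + integral (rect (a+1) 0) ?e"
    by (rule rect_split[OF ce]) (use a in auto)
  then show ?thesis using E0 E1 unfolding AX by (simp add: algebra_simps)
qed

text \<open>A point \<open>(s, t)\<close> is joined to \<open>(x, 0)\<close> by a segment in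
  direction \<open>s\<close> followed by one in direction \<open>t\<close>, and the squared
  differences are averaged over \<open>x\<close>. The boundary enters only through an average, which
  survives the \<open>L^2\<close> convergence of traces.\<close>

lemma strip_poincare:
  fixes b :: real
  defines "c0 \<equiv> integral {b..b+1} (\<lambda>s. F (s, 0))"
  shows "integral (rect b (b+1)) (\<lambda>p. (F p)^2) \<le> 4 * pi^2 * integral (rect b (b+1)) (\<lambda>p. (Fs p)^2 + (Ft p)^2) + 2 * pi * c0^2"
proof -
  define P where "P t = integral {b..b+1} (\<lambda>s. (Fs (s, t))^2)" for t
  define Q where "Q s = integral {0..pi} (\<lambda>t. (Ft (s, t))^2)" for s
  have cP: "continuous_on UNIV P"
  proof -
    have "continuous_on UNIV (\<lambda>t. integral (cbox b (b+1)) (\<lambda>s. (Fs (s, t))^2))"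
      by (rule integral_continuous_on_param) (auto intro!: continuous_intros continuous_on_compose2[OF contF(2)] simp: case_prod_beta)
    then show ?thesis by (simp add: P_def[abs_def])
  qed
  have cQ: "continuous_on UNIV Q"
  proof -
    have "continuous_on UNIV (\<lambda>s. integral (cbox 0 pi) (\<lambda>t. (Ft (s, t))^2))"
      by (rule integral_continuous_on_param) (auto intro!: continuous_intros continuous_on_compose2[OF contF(3)] simp: case_prod_beta)
    then show ?thesis by (simp add: Q_def[abs_def])
  qed
  have si: "(\<lambda>s. (Fs (s, t))^2) integrable_on {x..y}" "(\<lambda>t. (Ft (s, t))^2) integrable_on {x..y}" for s t x y
    by (intro integrable_continuous_real continuous_intros cont_slice contF)+
  have d1': "(F (y, t) - F (x, t))^2 \<le> P t" if xy: "x \<le> y" "b \<le> x" "y \<le> b + 1" for x y t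
  proof -
    have "((\<lambda>s. Fs (s, t)) has_integral F (y, t) - F (x, t)) {x..y}"
      using xy(1) derF(1) by (intro fundamental_theorem_of_calculus) (auto simp: has_real_derivative_iff_has_vector_derivative[symmetric] has_field_derivative_at_within)
    then have "(F (y, t) - F (x, t))^2 = (integral {x..y} (\<lambda>s. Fs (s, t)))^2" by (simp add: integral_unique)
    also have "\<dots> \<le> (y - x) * integral {x..y} (\<lambda>s. (Fs (s, t))^2)"
      by (rule interval_sq_le[OF cont_slice(2)[OF contF(2)] xy(1)])
    also have "\<dots> \<le> 1 * P t" unfolding P_def
      using xy by (intro mult_mono integral_subset_le si Henstock_Kurzweil_Integration.integral_nonneg) auto
    finally show ?thesis by simp
  qed
  have d1: "(F (y, t) - F (x, t))^2 \<le> P t" if "x \<in> {b..b+1}" "y \<in> {b..b+1}" for x y t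
    using d1'[of x y t] d1'[of y x t] that by (cases "x \<le> y") (auto simp: power2_commute)
  have d2: "(F (x, t) - F (x, 0))^2 \<le> pi * Q x" if t: "t \<in> {0..pi}" for x t
  proof -
    have "((\<lambda>u. Ft (x, u)) has_integral F (x, t) - F (x, 0)) {0..t}"
      using t derF(2) by (intro fundamental_theorem_of_calculus) (auto simp: has_real_derivative_iff_has_vector_derivative[symmetric] has_field_derivative_at_within)
    then have "(F (x, t) - F (x, 0))^2 = (integral {0..t} (\<lambda>u. Ft (x, u)))^2" by (simp add: integral_unique)
    also have "\<dots> \<le> (t - 0) * integral {0..t} (\<lambda>u. (Ft (x, u))^2)"
      using t by (intro interval_sq_le[OF cont_slice(1)[OF contF(3)]]) auto
    also have "\<dots> \<le> pi * Q x" unfolding Q_def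
      using t by (intro mult_mono integral_subset_le si Henstock_Kurzweil_Integration.integral_nonneg) auto
    finally show ?thesis .
  qed
  define q where "q = integral {b..b+1} Q"
  have pt: "(F (s, t))^2 \<le> 4 * P t + 4 * pi * q + 2 * c0^2" if st: "s \<in> {b..b+1}" "t \<in> {0..pi}" for s t
  proof -
    let ?h = "\<lambda>x. F (s, t) - F (x, 0)"
    have ch: "continuous_on S ?h" for S by (intro continuous_intros cont_slice contF)
    have "integral {b..b+1} ?h = integral {b..b+1} (\<lambda>x. F (s, t)) - c0"
      unfolding c0_def by (intro integral_diff integrable_continuous_real continuous_intros cont_slice contF)
    then have "(F (s, t) - c0)^2 = (integral {b..b+1} ?h)^2" by simp
    also have "\<dots> \<le> (b + 1 - b) * integral {b..b+1} (\<lambda>x. (?h x)^2)" by (rule interval_sq_le[OF ch]) simp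
    also have "integral {b..b+1} (\<lambda>x. (?h x)^2) \<le> integral {b..b+1} (\<lambda>x. 2 * P t + 2 * pi * Q x)"
    proof (rule integral_le)
      show "(\<lambda>x. (?h x)^2) integrable_on {b..b+1}" by (intro integrable_continuous_real continuous_intros ch cont_slice contF)
      show "(\<lambda>x. 2 * P t + 2 * pi * Q x) integrable_on {b..b+1}"
        by (intro integrable_continuous_real continuous_intros continuous_on_subset[OF cQ]) auto
      fix x assume x: "x \<in> {b..b+1}"
      have "?h x = (F (s, t) - F (x, t)) + (F (x, t) - F (x, 0))" by simp
      then have "(?h x)^2 \<le> 2 * (F (s, t) - F (x, t))^2 + 2 * (F (x, t) - F (x, 0))^2"
        using sq_add_le[of "F (s, t) - F (x, t)" "F (x, t) - F (x, 0)"] by simp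
      then show "(?h x)^2 \<le> 2 * P t + 2 * pi * Q x" using d1[OF x st(1), of t] d2[OF st(2), of x] by linarith
    qed
    also have "integral {b..b+1} (\<lambda>x. 2 * P t + 2 * pi * Q x) = 2 * P t + 2 * pi * q"
      unfolding q_def by (subst integral_add) (auto intro!: integrable_continuous_real continuous_intros continuous_on_subset[OF cQ])
    finally have "(F (s, t) - c0)^2 \<le> 2 * P t + 2 * pi * q" by simp
    moreover have "(F (s, t))^2 \<le> 2 * (F (s, t) - c0)^2 + 2 * c0^2"
      using sum_squares_bound[of "F (s, t) - c0" c0] power2_sum[of "F (s, t) - c0" c0] by simp
    ultimately show ?thesis by linarith
  qed
  have qr: "q = integral (rect b (b+1)) (\<lambda>p. (Ft p)^2)"
    unfolding q_def Q_def by (rule rect_fubini(1)[symmetric]) (intro continuous_intros contF)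
  have pr: "integral {0..pi} P = integral (rect b (b+1)) (\<lambda>p. (Fs p)^2)"
    unfolding P_def by (rule rect_fubini(2)[symmetric]) (intro continuous_intros contF)
  have cR: "continuous_on UNIV (\<lambda>p::pt. 4 * P (snd p) + 4 * pi * q + 2 * c0^2)"
    by (intro continuous_intros continuous_on_compose2[OF cP]) auto
  have "integral (rect b (b+1)) (\<lambda>p. (F p)^2) \<le> integral (rect b (b+1)) (\<lambda>p. 4 * P (snd p) + 4 * pi * q + 2 * c0^2)"
  proof (rule rect_mono[OF _ cR])
    show "continuous_on UNIV (\<lambda>p. (F p)^2)" by (intro continuous_intros contF)
    show "(F p)^2 \<le> 4 * P (snd p) + 4 * pi * q + 2 * c0^2" if "p \<in> rect b (b+1)" for p
      using pt[of "fst p" "snd p"] that by (simp add: mem_cbox_pt)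
  qed
  also have "\<dots> = integral {0..pi} (\<lambda>t. 4 * P t + (4 * pi * q + 2 * c0^2))"
    unfolding rect_fubini(2)[OF cR] by (simp add: add.assoc)
  also have "\<dots> = 4 * integral {0..pi} P + (4 * pi * q + 2 * c0^2) * pi"
    by (subst integral_add) (auto intro!: integrable_continuous_real continuous_intros continuous_on_subset[OF cP])
  also have "\<dots> \<le> 4 * pi^2 * (integral {0..pi} P + q) + 2 * pi * c0^2"
  proof -
    have "1 \<le> pi^2" using pi_ge_two by (intro one_le_power) linarith
    moreover have "0 \<le> integral {0..pi} P" unfolding pr by (intro rect_nonneg continuous_intros contF) auto
    ultimately have "4 * 1 * integral {0..pi} P \<le> 4 * pi^2 * integral {0..pi} P" by (intro mult_right_mono) auto
    then show ?thesis by (simp add: algebra_simps power2_eq_square)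
  qed
  also have "integral {0..pi} P + q = integral (rect b (b+1)) (\<lambda>p. (Fs p)^2 + (Ft p)^2)"
    unfolding pr qr by (intro integral_add[symmetric] cont_rect continuous_intros contF)
  finally show ?thesis .
qed

end

lemma strip_fun_shift:
  assumes "strip_fun F Fs Ft"
  shows "strip_fun (\<lambda>p. F p - c - lm * (fst p - b)) (\<lambda>p. Fs p - lm) Ft"
  using assms by (auto simp: strip_fun_def intro!: continuous_intros derivative_eq_intros)

text \<open>Both bounds concern the replacement of \<open>F\<close> on \<open>s > b\<close> by a function that is affine in \<open>s\<close> for
  \<open>s \<ge> b + 1\<close>; the first bounds the old energy from below, the second the new one from above.\<close>

lemma strip_glue:
  fixes b T c B lm \<kappa> :: real
  assumes F: "strip_fun F Fs Ft" and b: "b + 1 \<le> 0" "b + 1 \<le> T"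
    and ct: "\<And>s. (ct has_real_derivative ct' s) (at s)" "continuous_on UNIV ct'"
    and ct1: "\<And>s. s \<le> b \<Longrightarrow> ct s = 1" and ct0: "\<And>s. b + 1 \<le> s \<Longrightarrow> ct s = 0"
    and ctb: "\<And>s. 0 \<le> ct s" "\<And>s. ct s \<le> 1" "\<And>s. \<bar>ct' s\<bar> \<le> B"
    and lm: "lm \<ge> 0" and \<kappa>: "\<kappa> \<ge> 0"
  defines "A \<equiv> integral {0..pi} (\<lambda>t. F (0, t))"
    and "\<eta> \<equiv> integral (rect b (b+1)) (\<lambda>p. (Fs p - lm)^2 + (Ft p)^2)"
    and "d \<equiv> integral {b..b+1} (\<lambda>s. F (s, 0) - lm * (s - b)) - c"
  defines "Q \<equiv> (4 + 16 * pi^2 * B^2) * \<eta> + 8 * pi * B^2 * d^2 + 4 * pi * (1 + B^2) * (lm - \<kappa>)^2"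
  defines "h \<equiv> (\<lambda>p. F p - c - \<kappa> * (fst p - b))"
  shows "0 \<le> Q"
    and "integral (rect b 0) (\<lambda>p. (Fs p)^2 + (Ft p)^2) \<ge> - lm\<^sup>2 * pi * b + 2 * lm * (A - pi * c + pi * lm * b) - 2 * lm * sqrt (pi * Q)"
    and "integral (rect b T) (\<lambda>p. (\<kappa> + (ct (fst p) * (Fs p - \<kappa>) + ct' (fst p) * h p))^2 + (ct (fst p) * Ft p)^2)
      \<le> \<kappa>^2 * pi * (T - b) + 2 * \<kappa> * sqrt (pi * Q) + Q"
    and "A - pi * c + pi * lm * b \<le> sqrt (pi * (- b) * integral (rect b 0) (\<lambda>p. (Fs p - lm)^2 + (Ft p)^2)) + sqrt (pi * Q)"
proof -
  \<comment> \<open>\<open>f\<close> is the deviation from the logarithm of slope \<open>lm\<close>,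
    to which \<open>F\<close> is close; \<open>h\<close> is the deviation from the logarithm of
    slope \<kappa> that is to be inserted. They differ by \<open>(lm - \<kappa>) * (s - b)\<close>,
    whence the last term of \<open>Q\<close>.\<close>
  define f where "f = (\<lambda>p. F p - c - lm * (fst p - b))"
  let ?fs = "\<lambda>p. Fs p - lm"
  have f: "strip_fun f ?fs Ft" unfolding f_def by (rule strip_fun_shift[OF F])
  have h: "strip_fun h (\<lambda>p. Fs p - \<kappa>) Ft" unfolding h_def by (rule strip_fun_shift[OF F])
  have ck: "continuous_on UNIV ct" using ct(1) by (meson DERIV_isCont continuous_at_imp_continuous_on)
  have cct: "continuous_on S (\<lambda>p::pt. ct (fst p))" "continuous_on S (\<lambda>p::pt. ct' (fst p))" for S
    by (intro continuous_on_compose2[OF ck] continuous_on_compose2[OF ct(2)] continuous_intros; simp)+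
  note ci = continuous_intros contF[OF F] contF[OF f] contF[OF h] cct
  have \<eta>0: "\<eta> \<ge> 0" unfolding \<eta>_def by (intro rect_nonneg ci) auto
  show Q0: "0 \<le> Q" unfolding Q_def using \<eta>0 by auto
  define \<Phi> where "\<Phi> = integral (rect b (b+1)) (\<lambda>p. (f p)^2)"
  have \<Phi>: "\<Phi> \<le> 4 * pi^2 * \<eta> + 2 * pi * d^2"
  proof -
    have "integral {b..b+1} (\<lambda>s. f (s, 0)) = integral {b..b+1} (\<lambda>s. (F (s, 0) - lm * (s - b)) - c)" by (simp add: f_def algebra_simps)
    also have "\<dots> = d" unfolding d_def
      by (subst integral_diff) (auto intro!: integrable_continuous_real continuous_intros cont_slice contF[OF F])
    finally show ?thesis using strip_poincare[OF f, of b] unfolding \<Phi>_def \<eta>_def by simp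
  qed
  have B2: "B^2 * \<Phi> \<le> B^2 * (4 * pi^2 * \<eta> + 2 * pi * d^2)" by (rule mult_left_mono[OF \<Phi>]) simp
  have ctsq: "(ct s * x)^2 \<le> x^2" for s x
    using ctb(1,2)[of s] by (simp add: power_mult_distrib mult_left_le_one_le power_le_one)
  have ct'sq: "(ct' s * x)^2 \<le> B^2 * x^2" for s x
    using ctb(3)[of s] by (simp add: power_mult_distrib abs_le_square_iff[symmetric] mult_right_mono)
  \<comment> \<open>By \<open>strip_FTC_s\<close> with the cut-off as weight, \<open>R\<close> is
    minus the integral of \<open>f\<close> over the side \<open>s = b\<close>. Written as an area
    integral it is controlled by the excess and by the Poincare inequality on the annulus.\<close>
  define R where "R = integral (rect b (b+1)) (\<lambda>p. ct (fst p) * ?fs p + ct' (fst p) * f p)"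
  have R: "R^2 \<le> pi * Q"
  proof -
    have "R^2 \<le> (b + 1 - b) * pi * integral (rect b (b+1)) (\<lambda>p. (ct (fst p) * ?fs p + ct' (fst p) * f p)^2)"
      unfolding R_def by (intro rect_sq_le ci) simp
    also have "integral (rect b (b+1)) (\<lambda>p. (ct (fst p) * ?fs p + ct' (fst p) * f p)^2)
      \<le> integral (rect b (b+1)) (\<lambda>p. 2 * ((Fs p - lm)^2 + (Ft p)^2) + 2 * B^2 * (f p)^2)"
    proof (intro rect_mono ci)
      fix p
      show "(ct (fst p) * ?fs p + ct' (fst p) * f p)^2 \<le> 2 * ((Fs p - lm)^2 + (Ft p)^2) + 2 * B^2 * (f p)^2"
        using sq_add_le[of "ct (fst p) * ?fs p" "ct' (fst p) * f p"] ctsq[of "fst p" "?fs p"] ct'sq[of "fst p" "f p"] zero_le_power2[of "Ft p"]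
        by (simp only: mult.assoc distrib_left)
    qed
    also have "\<dots> = 2 * \<eta> + 2 * B^2 * \<Phi>"
    proof -
      have "integral (rect b (b+1)) (\<lambda>p. 2 * ((Fs p - lm)^2 + (Ft p)^2) + 2 * B^2 * (f p)^2)
        = integral (rect b (b+1)) (\<lambda>p. 2 * ((Fs p - lm)^2 + (Ft p)^2)) + integral (rect b (b+1)) (\<lambda>p. 2 * B^2 * (f p)^2)"
        by (intro integral_add cont_rect ci)
      then show ?thesis unfolding \<eta>_def \<Phi>_def by (simp only: integral_mult_right)
    qed
    also have "\<dots> \<le> Q"
    proof -
      have "Q = 2 * \<eta> + 2 * (B^2 * (4 * pi^2 * \<eta> + 2 * pi * d^2))
          + (2 * \<eta> + 8 * pi^2 * B^2 * \<eta> + 4 * pi * B^2 * d^2 + 4 * pi * (1 + B^2) * (lm - \<kappa>)^2)"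
        unfolding Q_def by algebra
      moreover have "0 \<le> 2 * \<eta> + 8 * pi^2 * B^2 * \<eta> + 4 * pi * B^2 * d^2 + 4 * pi * (1 + B^2) * (lm - \<kappa>)^2"
        using \<eta>0 by (intro add_nonneg_nonneg mult_nonneg_nonneg) auto
      ultimately show ?thesis using B2 by linarith
    qed
    finally show ?thesis by (simp add: mult_left_mono)
  qed
  have aR: "\<bar>R\<bar> \<le> sqrt (pi * Q)" using R real_le_rsqrt by (metis abs_le_square_iff abs_of_nonneg real_sqrt_abs real_sqrt_le_iff)
  define S where "S = integral (rect b 0) ?fs"
  have S: "S = A - pi * c + pi * lm * b + R"
  proof -
    have 1: "S = integral {0..pi} (\<lambda>t. f (0, t)) - integral {0..pi} (\<lambda>t. f (b, t))"
      using strip_FTC_s[OF f, of b 0 "\<lambda>_. 1" "\<lambda>_. 0"] b by (simp add: S_def)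
    have 2: "R = - integral {0..pi} (\<lambda>t. f (b, t))"
      using strip_FTC_s[OF f _ ct, of b "b+1"] ct1[of b] ct0[of "b+1"] by (simp add: R_def)
    have "integral {0..pi} (\<lambda>t. f (0, t)) = integral {0..pi} (\<lambda>t. F (0, t) - (c - lm * b))" by (simp add: f_def algebra_simps)
    also have "\<dots> = A - pi * (c - lm * b)" unfolding A_def
      by (subst integral_diff) (auto intro!: integrable_continuous_real continuous_intros cont_slice contF[OF F])
    finally show ?thesis using 1 2 by (simp add: algebra_simps)
  qed
  show "integral (rect b 0) (\<lambda>p. (Fs p)^2 + (Ft p)^2) \<ge> - lm\<^sup>2 * pi * b + 2 * lm * (A - pi * c + pi * lm * b) - 2 * lm * sqrt (pi * Q)"
  proof -
    \<comment> \<open>Linearising the square at \<open>lm\<close> bounds the energy below by the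
      flux of \<open>Fs\<close>, which is known from the boundary values on both sides.\<close>
    have "integral (rect b 0) (\<lambda>p. lm^2 + 2 * lm * ?fs p) \<le> integral (rect b 0) (\<lambda>p. (Fs p)^2 + (Ft p)^2)"
    proof (intro rect_mono ci)
      fix p
      have "(Fs p)^2 = lm^2 + 2 * lm * ?fs p + (?fs p)^2" by (simp add: power2_eq_square algebra_simps)
      then show "lm^2 + 2 * lm * ?fs p \<le> (Fs p)^2 + (Ft p)^2" by simp
    qed
    also have "integral (rect b 0) (\<lambda>p. lm^2 + 2 * lm * ?fs p) = integral (rect b 0) (\<lambda>p. lm^2) + integral (rect b 0) (\<lambda>p. 2 * lm * ?fs p)"
      by (intro integral_add cont_rect ci)
    finally have "- lm\<^sup>2 * pi * b + 2 * lm * S \<le> integral (rect b 0) (\<lambda>p. (Fs p)^2 + (Ft p)^2)"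
      using rect_const[of b 0 "lm^2"] b by (simp add: S_def)
    moreover have "2 * lm * (- R) \<le> 2 * lm * sqrt (pi * Q)" using aR lm by (intro mult_left_mono) auto
    ultimately show ?thesis unfolding S by (simp add: algebra_simps)
  qed
  show "A - pi * c + pi * lm * b \<le> sqrt (pi * (- b) * integral (rect b 0) (\<lambda>p. (Fs p - lm)^2 + (Ft p)^2)) + sqrt (pi * Q)"
  proof -
    have "S^2 \<le> (0 - b) * pi * integral (rect b 0) (\<lambda>p. (?fs p)^2)"
      unfolding S_def using b by (intro rect_sq_le ci) auto
    also have "\<dots> \<le> (0 - b) * pi * integral (rect b 0) (\<lambda>p. (Fs p - lm)^2 + (Ft p)^2)"
      using b by (intro mult_left_mono rect_mono ci) (auto intro: mult_nonpos_nonneg)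
    finally have "S \<le> sqrt (pi * (- b) * integral (rect b 0) (\<lambda>p. (Fs p - lm)^2 + (Ft p)^2))"
      by (intro real_le_rsqrt) (simp add: mult.commute)
    then show ?thesis using S aR by linarith
  qed
  define J where "J = integral (rect b (b+1)) (\<lambda>p. (ct (fst p) * (Fs p - \<kappa>) + ct' (fst p) * h p)^2 + (ct (fst p) * Ft p)^2)"
  have J: "J \<le> Q"
  proof -
    have "J \<le> integral (rect b (b+1)) (\<lambda>p. 4 * ((Fs p - lm)^2 + (Ft p)^2) + 4 * B^2 * (f p)^2 + 4 * (1 + B^2) * (lm - \<kappa>)^2)"
      unfolding J_def
    proof (intro rect_mono ci)
      fix p assume p: "p \<in> rect b (b+1)"
      let ?w = "lm - \<kappa>"
      have hs: "(Fs p - \<kappa>)^2 \<le> 2 * (Fs p - lm)^2 + 2 * ?w^2" using sq_add_le[of "Fs p - lm" ?w] by simp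
      have "h p = f p + ?w * (fst p - b)" by (simp add: h_def f_def algebra_simps)
      then have "(h p)^2 \<le> 2 * (f p)^2 + 2 * (?w * (fst p - b))^2" using sq_add_le by simp
      moreover have "(?w * (fst p - b))^2 \<le> ?w^2 * 1"
        using p unfolding power_mult_distrib by (intro mult_left_mono) (auto simp: mem_cbox_pt abs_square_le_1)
      ultimately have hh: "(h p)^2 \<le> 2 * (f p)^2 + 2 * ?w^2" by simp
      have "(ct (fst p) * (Fs p - \<kappa>) + ct' (fst p) * h p)^2 \<le> 2 * (ct (fst p) * (Fs p - \<kappa>))^2 + 2 * (ct' (fst p) * h p)^2"
        by (rule sq_add_le)
      also have "\<dots> \<le> 2 * (Fs p - \<kappa>)^2 + 2 * (B^2 * (h p)^2)" using ctsq[of "fst p" "Fs p - \<kappa>"] ct'sq[of "fst p" "h p"] by linarith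
      also have "\<dots> \<le> 2 * (2 * (Fs p - lm)^2 + 2 * ?w^2) + 2 * (B^2 * (2 * (f p)^2 + 2 * ?w^2))"
        using hs hh by (intro add_mono mult_left_mono) auto
      finally have "(ct (fst p) * (Fs p - \<kappa>) + ct' (fst p) * h p)^2 \<le> 4 * (Fs p - lm)^2 + 4 * B^2 * (f p)^2 + 4 * (1 + B^2) * ?w^2"
        by (simp add: algebra_simps)
      moreover have "(ct (fst p) * Ft p)^2 \<le> 4 * (Ft p)^2" using ctsq[of "fst p" "Ft p"] zero_le_power2[of "Ft p"] by linarith
      ultimately show "(ct (fst p) * (Fs p - \<kappa>) + ct' (fst p) * h p)^2 + (ct (fst p) * Ft p)^2 \<le> 4 * ((Fs p - lm)^2 + (Ft p)^2) + 4 * B^2 * (f p)^2 + 4 * (1 + B^2) * ?w^2"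
        by simp
    qed
    also have "\<dots> = 4 * \<eta> + 4 * B^2 * \<Phi> + 4 * (1 + B^2) * (lm - \<kappa>)^2 * pi"
    proof -
      have "integral (rect b (b+1)) (\<lambda>p. 4 * ((Fs p - lm)^2 + (Ft p)^2) + 4 * B^2 * (f p)^2 + 4 * (1 + B^2) * (lm - \<kappa>)^2)
        = integral (rect b (b+1)) (\<lambda>p. 4 * ((Fs p - lm)^2 + (Ft p)^2) + 4 * B^2 * (f p)^2) + integral (rect b (b+1)) (\<lambda>p. 4 * (1 + B^2) * (lm - \<kappa>)^2)"
        by (intro integral_add cont_rect ci)
      also have "integral (rect b (b+1)) (\<lambda>p. 4 * ((Fs p - lm)^2 + (Ft p)^2) + 4 * B^2 * (f p)^2)
        = integral (rect b (b+1)) (\<lambda>p. 4 * ((Fs p - lm)^2 + (Ft p)^2)) + integral (rect b (b+1)) (\<lambda>p. 4 * B^2 * (f p)^2)"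
        by (intro integral_add cont_rect ci)
      finally have "integral (rect b (b+1)) (\<lambda>p. 4 * ((Fs p - lm)^2 + (Ft p)^2) + 4 * B^2 * (f p)^2 + 4 * (1 + B^2) * (lm - \<kappa>)^2)
        = integral (rect b (b+1)) (\<lambda>p. 4 * ((Fs p - lm)^2 + (Ft p)^2)) + integral (rect b (b+1)) (\<lambda>p. 4 * B^2 * (f p)^2)
          + integral (rect b (b+1)) (\<lambda>p. 4 * (1 + B^2) * (lm - \<kappa>)^2)" .
      moreover have "integral (rect b (b+1)) (\<lambda>p. 4 * (1 + B^2) * (lm - \<kappa>)^2) = 4 * (1 + B^2) * (lm - \<kappa>)^2 * pi"
        by (subst rect_const) auto
      ultimately show ?thesis unfolding \<eta>_def \<Phi>_def by (simp only: integral_mult_right)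
    qed
    also have "\<dots> \<le> Q" unfolding Q_def using B2 by (simp add: algebra_simps)
    finally show ?thesis .
  qed
  define K where "K = integral (rect b (b+1)) (\<lambda>p. ct (fst p) * (Fs p - \<kappa>) + ct' (fst p) * h p)"
  have "K^2 \<le> (b + 1 - b) * pi * integral (rect b (b+1)) (\<lambda>p. (ct (fst p) * (Fs p - \<kappa>) + ct' (fst p) * h p)^2)"
    unfolding K_def by (intro rect_sq_le ci) simp
  also have "\<dots> \<le> (b + 1 - b) * pi * J"
    unfolding J_def by (intro mult_left_mono rect_mono ci) auto
  also have "\<dots> \<le> pi * Q" using J by simp
  finally have K: "K \<le> sqrt (pi * Q)" by (rule real_le_rsqrt)
  let ?E = "\<lambda>p. (\<kappa> + (ct (fst p) * (Fs p - \<kappa>) + ct' (fst p) * h p))^2 + (ct (fst p) * Ft p)^2"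
  have cE: "continuous_on UNIV ?E" by (intro ci)
  have ct'0: "ct' s = 0" if "b + 1 < s" for s
  proof -
    have "((\<lambda>_. 0) has_real_derivative ct' s) (at s)"
    proof (rule has_field_derivative_transform_within_open[OF ct(1)])
      show "open {b+1<..}" by simp
    qed (use ct0 that in auto)
    then show ?thesis using DERIV_unique DERIV_const by blast
  qed
  \<comment> \<open>The closed rectangle to the right of the annulus contains the edge
    \<open>s = b + 1\<close>, where the vanishing of the derivative comes from its
    continuity.\<close>
  have ct'1: "ct' (b + 1) = 0"
  proof -
    have "((ct') \<longlongrightarrow> ct' (b+1)) (at_right (b+1))" 
      using ct(2) by (simp add: continuous_on_eq_continuous_at isCont_def filterlim_at_split)
    moreover have "((ct') \<longlongrightarrow> 0) (at_right (b+1))"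
      by (rule Lim_transform_eventually[OF tendsto_const]) (auto simp: eventually_at_filter ct'0)
    ultimately show ?thesis using tendsto_unique trivial_limit_at_right_real by blast
  qed
  have "integral (rect b T) ?E = integral (rect b (b+1)) ?E + integral (rect (b+1) T) ?E"
    by (rule rect_split[OF cE]) (use b in auto)
  also have "integral (rect (b+1) T) ?E = integral (rect (b+1) T) (\<lambda>p. \<kappa>^2)"
  proof (rule integral_cong)
    fix p assume "p \<in> rect (b+1) T"
    then have "b + 1 \<le> fst p" by (simp add: mem_cbox_pt)
    then have "ct (fst p) = 0" "ct' (fst p) = 0" using ct0[of "fst p"] ct'0[of "fst p"] ct'1
      by (auto, cases "b + 1 = fst p", auto)
    then show "?E p = \<kappa>^2" by simp
  qed
  also have "\<dots> = \<kappa>^2 * pi * (T - (b + 1))" by (rule rect_const[OF b(2)])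
  also have "integral (rect b (b+1)) ?E = \<kappa>^2 * pi + 2 * \<kappa> * K + J"
  proof -
    let ?g = "\<lambda>p. ct (fst p) * (Fs p - \<kappa>) + ct' (fst p) * h p"
    have "?E = (\<lambda>p. (\<kappa>^2 + 2 * \<kappa> * ?g p) + ((?g p)^2 + (ct (fst p) * Ft p)^2))" by (rule ext) algebra
    then have "integral (rect b (b+1)) ?E = integral (rect b (b+1)) (\<lambda>p. \<kappa>^2 + 2 * \<kappa> * ?g p) + J"
      unfolding J_def by (simp only:) (intro integral_add cont_rect ci)
    also have "integral (rect b (b+1)) (\<lambda>p. \<kappa>^2 + 2 * \<kappa> * ?g p) = integral (rect b (b+1)) (\<lambda>p. \<kappa>^2) + integral (rect b (b+1)) (\<lambda>p. 2 * \<kappa> * ?g p)"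
      by (intro integral_add cont_rect ci)
    also have "integral (rect b (b+1)) (\<lambda>p. \<kappa>^2) = \<kappa>^2 * pi" by (subst rect_const) auto
    also have "integral (rect b (b+1)) (\<lambda>p. 2 * \<kappa> * ?g p) = 2 * \<kappa> * K" unfolding K_def by simp
    finally show ?thesis .
  qed
  finally have "integral (rect b T) ?E = \<kappa>^2 * pi * (T - b) + 2 * \<kappa> * K + J" by (simp add: algebra_simps)
  moreover have "2 * \<kappa> * K \<le> 2 * \<kappa> * sqrt (pi * Q)" using K \<kappa> by (intro mult_left_mono) auto
  ultimately show "integral (rect b T) ?E \<le> \<kappa>^2 * pi * (T - b) + 2 * \<kappa> * sqrt (pi * Q) + Q" using J by linarith
qed

subsection \<open>Square-integrable limits\<close>

lemma set_measurable_diff: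
  fixes f g :: "'a::euclidean_space \<Rightarrow> 'b::euclidean_space"
  assumes "f \<in> borel_measurable borel" "set_borel_measurable lborel U g" "U \<in> sets borel"
  shows "set_borel_measurable lborel U (\<lambda>x. f x - g x)"
proof -
  have 1: "(\<lambda>x. indicator U x *\<^sub>R g x) \<in> borel_measurable borel" using assms(2) by (simp add: set_borel_measurable_def)
  have "(\<lambda>x. indicator U x *\<^sub>R f x - indicator U x *\<^sub>R g x) \<in> borel_measurable borel"
    using 1 assms by measurable
  then show ?thesis by (simp add: set_borel_measurable_def scaleR_diff_right)
qed

lemma set_measurable_norm_sq:
  fixes V :: "'a::euclidean_space \<Rightarrow> 'b::euclidean_space"
  assumes "set_borel_measurable lborel U V" "U \<in> sets borel"
  shows "(\<lambda>x. ennreal ((norm (V x))^2) * indicator U x) \<in> borel_measurable borel"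
proof -
  have 1: "(\<lambda>x. indicator U x *\<^sub>R V x) \<in> borel_measurable borel" using assms(1) by (simp add: set_borel_measurable_def)
  have "(\<lambda>x. ennreal ((norm (indicator U x *\<^sub>R V x))^2)) \<in> borel_measurable borel" using 1 by measurable
  moreover have "(\<lambda>x. ennreal ((norm (indicator U x *\<^sub>R V x))^2)) = (\<lambda>x. ennreal ((norm (V x))^2) * indicator U x)"
    by (auto simp: indicator_def)
  ultimately show ?thesis by (simp only:)
qed

lemma set_measurable_sq:
  fixes V :: "'a::euclidean_space \<Rightarrow> real"
  assumes "set_borel_measurable lborel U V" "U \<in> sets borel"
  shows "(\<lambda>x. ennreal ((V x)^2) * indicator U x) \<in> borel_measurable borel"
  using set_measurable_norm_sq[OF assms] by simp

lemma tendsto_0_lt: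
  assumes "X \<longlonglongrightarrow> (0::ennreal)" "e > 0" shows "\<forall>\<^sub>F n in sequentially. X n < e"
  using order_tendstoD(2)[OF assms] .

text \<open>On a set of finite measure, \<open>|h| <= t + h^2 / t\<close> for every
  \<open>t > 0\<close> takes the place of the Cauchy-Schwarz inequality; \<open>t\<close> is tied to
  the desired accuracy.\<close>

lemma L2_null_imp_L1_null:
  fixes h :: "nat \<Rightarrow> 'a::euclidean_space \<Rightarrow> real"
  assumes U: "U \<in> sets borel" "emeasure lborel U < \<infinity>"
    and m: "\<And>n. set_borel_measurable lborel U (h n)"
    and lim: "(\<lambda>n. sqint U (h n)) \<longlonglongrightarrow> 0"
  shows "(\<lambda>n. LINT x:U|lborel. \<bar>h n x\<bar>) \<longlonglongrightarrow> 0" "\<forall>\<^sub>F n in sequentially. set_integrable lborel U (h n)"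
proof -
  let ?X = "\<lambda>n. sqint U (h n)"
  have fin: "\<forall>\<^sub>F n in sequentially. ?X n < \<infinity>" using tendsto_0_lt[OF lim, of \<infinity>] by simp
  then show int: "\<forall>\<^sub>F n in sequentially. set_integrable lborel U (h n)"
    by eventually_elim (rule set_integrable_of_sq, use U m in auto)
  define M where "M = measure lborel U"
  show "(\<lambda>n. LINT x:U|lborel. \<bar>h n x\<bar>) \<longlonglongrightarrow> 0"
  proof (rule LIMSEQ_I)
    fix e :: real assume e: "e > 0"
    \<comment> \<open>Makes \<open>t * M < e / 2\<close>, also when \<open>M = 0\<close>. A square
      integral below \<open>t * e / 2\<close> then keeps the other half below
      \<open>e / 2\<close>.\<close>
    define t where "t = e / (4 * (M + 1))"
    have M0: "M \<ge> 0" by (simp add: M_def)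
    then have t: "t > 0" using e by (simp add: t_def)
    have tM: "t * M < e / 2"
    proof -
      have "t * M < t * (2 * (M + 1))" using t M0 by (intro mult_strict_left_mono) auto
      also have "\<dots> = e / 2" using M0 by (simp add: t_def field_simps)
      finally show ?thesis .
    qed
    have "\<forall>\<^sub>F n in sequentially. ?X n < ennreal (t * e / 2)" by (rule tendsto_0_lt[OF lim]) (use t e in simp)
    then have "\<forall>\<^sub>F n in sequentially. norm ((LINT x:U|lborel. \<bar>h n x\<bar>) - 0) < e" using int
    proof eventually_elim
      case (elim n)
      have sq: "set_integrable lborel U (\<lambda>x. (h n x)^2)" unfolding set_integrable_def
      proof (rule integrableI_bounded)
        have "(\<lambda>x. (indicator U x *\<^sub>R h n x)^2) \<in> borel_measurable lborel" using m[of n] unfolding set_borel_measurable_def by measurable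
        moreover have "(\<lambda>x. (indicator U x *\<^sub>R h n x)^2) = (\<lambda>x. indicator U x *\<^sub>R (h n x)\<^sup>2)" by (auto simp: indicator_def)
        ultimately show "(\<lambda>x. indicat_real U x *\<^sub>R (h n x)\<^sup>2) \<in> borel_measurable lborel" by simp
        have "(\<integral>\<^sup>+x. ennreal (norm (indicat_real U x *\<^sub>R (h n x)\<^sup>2)) \<partial>lborel) = ?X n"
          by (rule nn_integral_cong) (auto simp: indicator_def)
        also have "\<dots> < \<infinity>" using elim(1) less_top order_less_trans by (metis ennreal_less_top infinity_ennreal_def)
        finally show "(\<integral>\<^sup>+x. ennreal (norm (indicat_real U x *\<^sub>R (h n x)\<^sup>2)) \<partial>lborel) < \<infinity>" .
      qed
      have "ennreal (LINT x:U|lborel. (h n x)^2) = ?X n"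
        unfolding set_lebesgue_integral_def using sq
        by (subst nn_integral_eq_integral[symmetric]) (auto simp: set_integrable_def indicator_def intro!: nn_integral_cong)
      then have "ennreal (LINT x:U|lborel. (h n x)^2) < ennreal (t * e / 2)" using elim(1) by simp
      then have c: "(LINT x:U|lborel. (h n x)^2) < t * e / 2"
        using t e by (simp add: ennreal_less_iff set_lebesgue_integral_def)
      have ci: "set_integrable lborel U (\<lambda>x. t)" unfolding set_integrable_def using U by (simp add: less_top)
      have ai: "set_integrable lborel U (\<lambda>x. \<bar>h n x\<bar>)" using elim(2) by (rule set_integrable_abs)
      have "(LINT x:U|lborel. \<bar>h n x\<bar>) \<le> (LINT x:U|lborel. t + (h n x)^2 / t)"
      proof (rule set_integral_mono[OF ai])
        show "set_integrable lborel U (\<lambda>x. t + (h n x)^2 / t)" by (intro set_integral_add ci set_integrable_divide sq)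
        fix x
        have "0 \<le> (\<bar>h n x\<bar> - t)^2" by simp
        then have "\<bar>h n x\<bar> * t \<le> t * t + (h n x)^2"
        proof -
          have "(\<bar>h n x\<bar> - t)^2 = (h n x)^2 + t * t - 2 * (\<bar>h n x\<bar> * t)" by (simp add: power2_diff power2_eq_square[of t])
          moreover have "0 \<le> \<bar>h n x\<bar> * t" using t by simp
          ultimately show ?thesis using \<open>0 \<le> (\<bar>h n x\<bar> - t)^2\<close> by linarith
        qed
        then show "\<bar>h n x\<bar> \<le> t + (h n x)^2 / t" using t by (simp add: field_simps)
      qed
      also have "\<dots> = t * M + (LINT x:U|lborel. (h n x)^2) / t"
        using set_integral_add(2)[OF ci set_integrable_divide[OF sq, of t]] U by (simp add: M_def set_lebesgue_integral_def)
      also have "(LINT x:U|lborel. (h n x)^2) / t < e / 2" using c t by (simp add: field_simps)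
      finally have "(LINT x:U|lborel. \<bar>h n x\<bar>) < e" using tM by simp
      moreover have "0 \<le> (LINT x:U|lborel. \<bar>h n x\<bar>)" by (auto simp: set_lebesgue_integral_def)
      ultimately show ?case by simp
    qed
    then show "\<exists>N. \<forall>n\<ge>N. norm ((LINT x:U|lborel. \<bar>h n x\<bar>) - 0) < e" by (simp add: eventually_sequentially)
  qed
qed

text \<open>The integrals are extended nonnegative numbers, so the triangle inequality for norms is
  replaced by Young's inequality with a free parameter \<open>t\<close>, used in both directions;
  the finite energy of the limit absorbs the error as \<open>t\<close> gets small.\<close>

lemma L2_norm_tendsto:
  fixes V :: "nat \<Rightarrow> 'a::euclidean_space \<Rightarrow> 'b::euclidean_space"
  assumes U: "U \<in> sets borel" and m: "\<And>n. V n \<in> borel_measurable borel" and mW: "set_borel_measurable lborel U W"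
    and fin: "sqint U (\<lambda>x. norm (W x)) < \<infinity>"
    and lim: "(\<lambda>n. sqint U (\<lambda>x. norm (V n x - W x))) \<longlonglongrightarrow> 0"
  shows "(\<lambda>n. sqint U (\<lambda>x. norm (V n x))) \<longlonglongrightarrow> (sqint U (\<lambda>x. norm (W x)))"
proof -
  let ?A = "sqint U (\<lambda>x. norm (W x))" and ?An = "\<lambda>n. sqint U (\<lambda>x. norm (V n x))"
    and ?e = "\<lambda>n. sqint U (\<lambda>x. norm (V n x - W x))"
  have mV: "set_borel_measurable lborel U (V n)" for n
    unfolding set_borel_measurable_def using m[of n] U by measurable
  have mD: "set_borel_measurable lborel U (\<lambda>x. V n x - W x)" for n by (rule set_measurable_diff[OF m mW U])
  note ms [measurable] = set_measurable_norm_sq[OF mV U] set_measurable_norm_sq[OF mW U] set_measurable_norm_sq[OF mD U]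
  \<comment> \<open>One inequality for both directions. The cross term is always estimated with
    \<open>norm (W x)\<close>, whose square has the fixed finite integral \<open>?A\<close>.\<close>
  have gen: "sqint U (\<lambda>x. norm (P x)) \<le> sqint U (\<lambda>x. norm (R x)) + ennreal (1 + 1 / t) * ?e n + ennreal t * ?A"
    if t: "t > 0" and PR: "\<And>x. norm (P x) \<le> norm (R x) + norm (V n x - W x)" and c: "R = W \<or> (R = V n \<and> P = W)"
      and mR: "(\<lambda>x. ennreal ((norm (R x))^2) * indicator U x) \<in> borel_measurable borel" for P R n t
  proof -
    have "sqint U (\<lambda>x. norm (P x)) \<le> (\<integral>\<^sup>+x. ennreal ((norm (R x))^2) * indicator U x + ennreal (1 + 1 / t) * (ennreal ((norm (V n x - W x))^2) * indicator U x) + ennreal t * (ennreal ((norm (W x))^2) * indicator U x) \<partial>lborel)"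
    proof (rule nn_integral_mono)
      fix x
      let ?d = "norm (V n x - W x)" and ?w = "norm (W x)"
      have young: "2 * ?w * ?d \<le> t * ?w^2 + ?d^2 / t"
      proof -
        have "0 \<le> (t * ?w - ?d)^2" by simp
        then have "t * (2 * ?w * ?d) \<le> t * (t * ?w^2 + ?d^2 / t)" using t by (simp add: power2_diff power2_eq_square algebra_simps)
        then show ?thesis using t by (simp add: mult_le_cancel_left_pos)
      qed
      have "(norm (P x))^2 \<le> (norm (R x))^2 + ?d^2 + 2 * ?w * ?d"
        using c
      proof
        assume R: "R = W"
        have "(norm (P x))^2 \<le> (?w + ?d)^2" using PR[of x] R by (intro power_mono) auto
        then show ?thesis using R by (simp add: power2_sum)
      next
        assume R: "R = V n \<and> P = W"
        have "(?w - ?d) \<le> norm (V n x)" using PR[of x] R by simp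
        show ?thesis
        proof (cases "?w \<le> ?d")
          case True
          then have 1: "?w * ?w \<le> ?w * ?d" by (intro mult_left_mono) auto
          have 2: "0 \<le> ?w * ?d" by simp
          have "2 * ?w * ?d = ?w * ?d + ?w * ?d" by simp
          then have "?w^2 \<le> 2 * ?w * ?d" using 1 2 unfolding power2_eq_square by linarith
          then show ?thesis using R by (smt (verit) zero_le_power2)
        next
          case False
          then have "(?w - ?d)^2 \<le> (norm (V n x))^2" using PR[of x] R by (intro power_mono) auto
          then show ?thesis using R by (simp add: power2_diff) (smt (verit) zero_le_power2)
        qed
      qed
      then have "(norm (P x))^2 \<le> (norm (R x))^2 + (1 + 1 / t) * ?d^2 + t * ?w^2" using young by (simp add: algebra_simps)
      then have "ennreal ((norm (P x))^2) \<le> ennreal ((norm (R x))^2 + (1 + 1 / t) * ?d^2 + t * ?w^2)" by (rule ennreal_leI)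
      also have "\<dots> = ennreal ((norm (R x))^2) + ennreal (1 + 1 / t) * ennreal (?d^2) + ennreal t * ennreal (?w^2)"
        using t by (subst ennreal_plus ennreal_mult | simp)+
      finally show "ennreal ((norm (P x))^2) * indicator U x \<le> ennreal ((norm (R x))^2) * indicator U x + ennreal (1 + 1 / t) * (ennreal (?d^2) * indicator U x) + ennreal t * (ennreal (?w^2) * indicator U x)"
        by (simp add: indicator_def)
    qed
    also have "\<dots> = sqint U (\<lambda>x. norm (R x)) + ennreal (1 + 1 / t) * ?e n + ennreal t * ?A"
      using mR by (simp add: nn_integral_add nn_integral_cmult)
    finally show ?thesis .
  qed
  have up: "?An n \<le> ?A + ennreal (1 + 1 / t) * ?e n + ennreal t * ?A" if "t > 0" for n t
    by (rule gen[OF that]) (use norm_triangle_sub in auto)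
  have lo: "?A \<le> ?An n + ennreal (1 + 1 / t) * ?e n + ennreal t * ?A" if "t > 0" for n t
    by (rule gen[OF that]) (use norm_triangle_sub norm_minus_commute in \<open>auto simp: norm_minus_commute\<close>)
  define a where "a = enn2real ?A"
  have a: "?A = ennreal a" "a \<ge> 0" using fin by (auto simp: a_def less_top)
  have fe: "\<forall>\<^sub>F n in sequentially. ?e n < \<infinity>" using tendsto_0_lt[OF lim, of \<infinity>] by simp
  have "(\<lambda>n. enn2real (?An n)) \<longlonglongrightarrow> a"
  proof (rule LIMSEQ_I)
    fix r :: real assume r: "r > 0"
    define t where "t = r / (4 * (a + 1))"
    have t: "t > 0" using r a by (simp add: t_def)
    have ta: "t * a < r / 2"
    proof -
      have "t * a < t * (2 * (a + 1))" using t a by (intro mult_strict_left_mono) auto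
      also have "\<dots> = r / 2" using a by (simp add: t_def field_simps)
      finally show ?thesis .
    qed
    define q where "q = 1 + 1 / t"
    have q: "q > 0" unfolding q_def using t by (simp add: add_pos_pos)
    define d where "d = r / (2 * q)"
    have "d > 0" "q * d = r / 2" using q r by (auto simp: d_def)
    then have d: "d > 0" "(1 + 1 / t) * d = r / 2" by (simp_all add: q_def)
    have "\<forall>\<^sub>F n in sequentially. ?e n < ennreal d" by (rule tendsto_0_lt[OF lim]) (use d in simp)
    then have "\<forall>\<^sub>F n in sequentially. norm (enn2real (?An n) - a) < r"
    proof eventually_elim
      case (elim n)
      obtain e where e0: "e \<ge> 0" "?e n = ennreal e" using elim by (cases "?e n") auto
      then have ee: "?e n = ennreal e" "e \<ge> 0" "e < d" using elim by (auto simp: ennreal_less_iff)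
      have u: "?An n \<le> ennreal (a + (1 + 1 / t) * e + t * a)"
        using up[OF t, of n] ee a t by (simp add: ennreal_mult ennreal_plus)
      then have f: "?An n < \<infinity>" by (simp add: le_less_trans)
      define b where "b = enn2real (?An n)"
      have b: "?An n = ennreal b" "b \<ge> 0" using f by (auto simp: b_def less_top)
      have nn: "0 \<le> (1 + 1 / t) * e" "0 \<le> t * a" using t ee a by auto
      have "b \<le> a + (1 + 1 / t) * e + t * a"
        using u nn a unfolding b(1) by (subst (asm) ennreal_le_iff) auto
      moreover have "ennreal a \<le> ennreal (b + (1 + 1 / t) * e + t * a)"
        using lo[OF t, of n] ee a b t by (simp add: ennreal_mult ennreal_plus)
      then have "a \<le> b + (1 + 1 / t) * e + t * a"
        using nn b(2) by (subst (asm) ennreal_le_iff) auto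
      moreover have "(1 + 1 / t) * e \<le> r / 2" unfolding d(2)[symmetric] using ee t by (intro mult_left_mono) auto
      moreover obtain z where z: "z = (1 + 1 / t) * e" by blast
      ultimately have "\<bar>b - a\<bar> < r" using ta unfolding z[symmetric] by linarith
      then show ?case by (simp add: b_def[symmetric])
    qed
    then show "\<exists>N. \<forall>n\<ge>N. norm (enn2real (?An n) - a) < r" by (simp add: eventually_sequentially)
  qed
  then have "(\<lambda>n. ennreal (enn2real (?An n))) \<longlonglongrightarrow> ennreal a" by (intro tendsto_ennrealI)
  moreover have "\<forall>\<^sub>F n in sequentially. ennreal (enn2real (?An n)) = ?An n"
    using fe
  proof eventually_elim
    case (elim n)
    have "?An n < \<infinity>" using up[of 1 n] elim a by (auto simp: ennreal_mult_less_top ennreal_add_less_top less_top intro: le_less_trans)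
    then show ?case by (simp add: less_top)
  qed
  ultimately show ?thesis unfolding a(1) by (rule Lim_transform_eventually)
qed

subsection \<open>Limits of smooth functions are weakly differentiable\<close>

lemma pd_zero_outside:
  assumes "open V" "\<And>x. x \<in> V \<Longrightarrow> f x = 0" "x \<in> V" "smooth2 f"
  shows "pd b f x = 0"
proof -
  have "((\<lambda>_. 0) has_derivative (\<lambda>h. fst h * pd True f x + snd h * pd False f x)) (at x)"
    by (rule has_derivative_transform_within_open[OF has_derivative_grad2[OF smooth2_differentiable[OF assms(4)]] assms(1,3)])
       (simp add: assms(2))
  from has_derivative_unique[OF this has_derivative_const]
  have "fst h * pd True f x + snd h * pd False f x = 0" for h by meson
  from this[of "(1,0)"] this[of "(0,1)"] show ?thesis by (cases b) auto
qed

lemma smooth2_compact_bounded: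
  assumes "smooth2 f" "compact K" "\<And>x. x \<notin> K \<Longrightarrow> f x = 0"
  obtains B where "B \<ge> 0" "\<And>x. \<bar>f x\<bar> \<le> B"
proof -
  obtain B where B: "B \<ge> 0" "\<And>x. x \<in> K \<Longrightarrow> \<bar>f x\<bar> \<le> B"
    by (rule continuous_bounded_on_compact[OF assms(2) smooth2_continuous[OF assms(1)]]) auto
  have "\<bar>f x\<bar> \<le> B" for x using B assms(3)[of x] by (cases "x \<in> K") auto
  then show ?thesis using B(1) that by blast
qed

text \<open>Fubini and the fundamental theorem of calculus along lines. The interval extends to
  \<open>R + 1\<close> so that its endpoints lie strictly outside the ball of radius
  \<open>R\<close> that contains the support.\<close>

lemma integral_pd_zero:
  assumes g: "smooth2 g" and K: "compact K" "\<And>x. x \<notin> K \<Longrightarrow> g x = 0"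
  shows "(LINT x|lborel. pd b g x) = 0" "integrable lborel (pd b g)" "integrable lborel g"
proof -
  have pz: "pd b g x = 0" if "x \<notin> K" for b x
    by (rule pd_zero_outside[of "- K"]) (use K g that compact_imp_closed[OF K(1)] in auto)
  have int: "integrable lborel f" if "smooth2 f" "\<And>x. x \<notin> K \<Longrightarrow> f x = 0" for f
  proof -
    have "integrable lborel (\<lambda>x. indicator K x *\<^sub>R f x)"
      by (rule borel_integrable_compact[OF K(1) smooth2_continuous[OF that(1)]])
    moreover have "(\<lambda>x. indicator K x *\<^sub>R f x) = f" by (rule ext, simp add: indicator_def) (use that(2) in blast)
    ultimately show ?thesis by simp
  qed
  show i: "integrable lborel (pd b g)" for b using int[OF smooth2_pd[OF g] pz] .
  show "integrable lborel g" using int[OF g K(2)] .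
  obtain R where R: "R > 0" "\<And>x. x \<in> K \<Longrightarrow> norm x \<le> R" using compact_imp_bounded[OF K(1)] bounded_pos by blast
  have out: "g (x, y) = 0" if "\<bar>x\<bar> > R \<or> \<bar>y\<bar> > R" for x y
    using R(2)[of "(x, y)"] K(2) norm_fst_le'[of "(x,y)"] norm_snd_le'[of "(x,y)"] that by force
  have pout: "pd b g (x, y) = 0" if "\<bar>x\<bar> > R \<or> \<bar>y\<bar> > R" for x y b
    using R(2)[of "(x, y)"] pz norm_fst_le'[of "(x,y)"] norm_snd_le'[of "(x,y)"] that by force
  have c1: "isCont (\<lambda>t. pd b g (t, y)) x" and c2: "isCont (\<lambda>t. pd b g (y, t)) x" for b x y
    using continuous_on_compose2[OF smooth2_continuous[OF smooth2_pd[OF g], of UNIV b], of UNIV "\<lambda>t. (t, y)"]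
      continuous_on_compose2[OF smooth2_continuous[OF smooth2_pd[OF g], of UNIV b], of UNIV "\<lambda>t. (y, t)"]
    by (auto simp: continuous_on_eq_continuous_at intro!: continuous_intros)
  have T: "(LINT t|lborel. pd True g (t, y)) = 0" for y
  proof -
    have "has_bochner_integral lborel (\<lambda>t. pd True g (t, y) * indicator {-(R+1)..R+1} t) (g (R+1, y) - g (-(R+1), y))"
      using R by (intro has_bochner_integral_FTC_Icc_real differentiable_partials smooth2_differentiable g c1) auto
    moreover have "(\<lambda>t. pd True g (t, y) * indicator {-(R+1)..R+1} t) = (\<lambda>t. pd True g (t, y))"
    proof
      fix t show "pd True g (t, y) * indicator {-(R+1)..R+1} t = pd True g (t, y)"
        using pout[of t y True] by (cases "\<bar>t\<bar> > R") (auto simp: indicator_def)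
    qed
    ultimately show ?thesis using out[of "R+1" y] out[of "-(R+1)" y] R by (simp add: has_bochner_integral_iff)
  qed
  have F: "(LINT t|lborel. pd False g (x, t)) = 0" for x
  proof -
    have "has_bochner_integral lborel (\<lambda>t. pd False g (x, t) * indicator {-(R+1)..R+1} t) (g (x, R+1) - g (x, -(R+1)))"
      using R by (intro has_bochner_integral_FTC_Icc_real differentiable_partials smooth2_differentiable g c2) auto
    moreover have "(\<lambda>t. pd False g (x, t) * indicator {-(R+1)..R+1} t) = (\<lambda>t. pd False g (x, t))"
    proof
      fix t show "pd False g (x, t) * indicator {-(R+1)..R+1} t = pd False g (x, t)"
        using pout[of x t False] by (cases "\<bar>t\<bar> > R") (auto simp: indicator_def)
    qed
    ultimately show ?thesis using out[of x "R+1"] out[of x "-(R+1)"] R by (simp add: has_bochner_integral_iff)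
  qed
  have i': "integrable (lborel \<Otimes>\<^sub>M lborel) (case_prod (\<lambda>x y. pd b g (x, y)))" for b
    using i[of b] by (simp add: lborel_prod)
  show "(LINT x|lborel. pd b g x) = 0"
  proof (cases b)
    case True
    have "(LINT x|lborel. pd True g x) = (LINT x|(lborel \<Otimes>\<^sub>M lborel). case_prod (\<lambda>x y. pd True g (x, y)) x)" by (simp add: lborel_prod)
    also have "\<dots> = (LINT y|lborel. LINT x|lborel. pd True g (x, y))" by (rule lborel_pair.integral_snd[OF i', symmetric])
    finally show ?thesis using T True by simp
  next
    case False
    have "(LINT x|lborel. pd False g x) = (LINT x|(lborel \<Otimes>\<^sub>M lborel). case_prod (\<lambda>x y. pd False g (x, y)) x)" by (simp add: lborel_prod)
    also have "\<dots> = (LINT x|lborel. LINT y|lborel. pd False g (x, y))" by (rule lborel_pair.integral_fst[OF i', symmetric])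
    finally show ?thesis using F False by simp
  qed
qed

lemma smooth2_integration_by_parts:
  assumes f: "smooth2 f" and t: "test2 U \<phi>"
  shows "(LINT x:U|lborel. f x * pd b \<phi> x) = - (LINT x:U|lborel. pd b f x * \<phi> x)"
proof -
  obtain K where K: "compact K" "K \<subseteq> U" "\<And>x. x \<notin> K \<Longrightarrow> \<phi> x = 0" and s: "smooth2 \<phi>" using t by (auto simp: test2_def)
  have pz: "pd b \<phi> x = 0" if "x \<notin> K" for b x
    by (rule pd_zero_outside[of "- K"]) (use K s that compact_imp_closed[OF K(1)] in auto)
  have *: "pd b (\<lambda>x. f x * \<phi> x) x = f x * pd b \<phi> x + pd b f x * \<phi> x" for x
    using pd_mult[OF smooth2_differentiable[OF f] smooth2_differentiable[OF s]] by (cases b) auto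
  have sp: "smooth2 (\<lambda>x. f x * \<phi> x)" by (intro smooth2_mult f s)
  have i1: "integrable lborel (\<lambda>x. f x * pd b \<phi> x)"
    by (rule integral_pd_zero(3)[OF _ K(1)]) (auto intro: smooth2_mult f smooth2_pd s simp: pz)
  have i2: "integrable lborel (\<lambda>x. pd b f x * \<phi> x)"
    by (rule integral_pd_zero(3)[OF _ K(1)]) (auto intro: smooth2_mult f smooth2_pd s simp: K)
  have "(LINT x|lborel. pd b (\<lambda>x. f x * \<phi> x) x) = 0" by (rule integral_pd_zero(1)[OF sp K(1)]) (simp add: K)
  then have "(LINT x|lborel. f x * pd b \<phi> x) = - (LINT x|lborel. pd b f x * \<phi> x)" unfolding * using i1 i2 by simp
  moreover have "(LINT x:U|lborel. f x * pd b \<phi> x) = (LINT x|lborel. f x * pd b \<phi> x)" "(LINT x:U|lborel. pd b f x * \<phi> x) = (LINT x|lborel. pd b f x * \<phi> x)"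
    unfolding set_lebesgue_integral_def
  proof (rule_tac [!] Bochner_Integration.integral_cong[OF refl])
    fix x
    show "indicat_real U x *\<^sub>R (f x * pd b \<phi> x) = f x * pd b \<phi> x"
      using K(2) pz[of x b] by (cases "x \<in> K") auto
    show "indicat_real U x *\<^sub>R (pd b f x * \<phi> x) = pd b f x * \<phi> x"
      using K(2) K(3)[of x] by (cases "x \<in> K") auto
  qed
  ultimately show ?thesis by simp
qed

lemma set_integral_mult_tendsto:
  fixes f :: "nat \<Rightarrow> 'a::euclidean_space \<Rightarrow> real"
  assumes U: "U \<in> sets borel" "emeasure lborel U < \<infinity>"
    and m: "\<And>n. f n \<in> borel_measurable borel" and mw: "set_borel_measurable lborel U w" and wi: "set_integrable lborel U w"
    and lim: "(\<lambda>n. sqint U (\<lambda>x. f n x - w x)) \<longlonglongrightarrow> 0"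
    and \<phi>: "\<phi> \<in> borel_measurable borel" "\<And>x. \<bar>\<phi> x\<bar> \<le> B"
  shows "(\<lambda>n. LINT x:U|lborel. f n x * \<phi> x) \<longlonglongrightarrow> (LINT x:U|lborel. w x * \<phi> x)"
proof -
  have md: "set_borel_measurable lborel U (\<lambda>x. f n x - w x)" for n by (rule set_measurable_diff[OF m mw U(1)])
  note L = L2_null_imp_L1_null[OF U md lim]
  have "(\<lambda>n. B * (LINT x:U|lborel. \<bar>f n x - w x\<bar>)) \<longlonglongrightarrow> B * 0" by (intro tendsto_mult tendsto_const L)
  then have "(\<lambda>n. B * (LINT x:U|lborel. \<bar>f n x - w x\<bar>)) \<longlonglongrightarrow> 0" by simp
  then have "(\<lambda>n. (LINT x:U|lborel. f n x * \<phi> x) - (LINT x:U|lborel. w x * \<phi> x)) \<longlonglongrightarrow> 0"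
  proof (rule Lim_null_comparison[rotated])
    show "\<forall>\<^sub>F n in sequentially. norm ((LINT x:U|lborel. f n x * \<phi> x) - (LINT x:U|lborel. w x * \<phi> x)) \<le> B * (LINT x:U|lborel. \<bar>f n x - w x\<bar>)"
      using L(2)
    proof eventually_elim
      case (elim n)
      have fi: "set_integrable lborel U (f n)" using set_integral_add(1)[OF elim wi] by simp
      have di: "set_integrable lborel U (\<lambda>x. (f n x - w x) * \<phi> x)" by (rule set_integrable_mult_bounded[OF elim \<phi>])
      have "(LINT x:U|lborel. f n x * \<phi> x) - (LINT x:U|lborel. w x * \<phi> x) = (LINT x:U|lborel. f n x * \<phi> x - w x * \<phi> x)"
        by (rule set_integral_diff(2)[symmetric]) (intro set_integrable_mult_bounded[OF fi \<phi>] set_integrable_mult_bounded[OF wi \<phi>])+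
      also have "\<dots> = (LINT x:U|lborel. (f n x - w x) * \<phi> x)" by (simp add: left_diff_distrib)
      finally have "norm ((LINT x:U|lborel. f n x * \<phi> x) - (LINT x:U|lborel. w x * \<phi> x)) \<le> (LINT x:U|lborel. norm ((f n x - w x) * \<phi> x))"
        using set_integral_norm_bound[OF di] by simp
      also have "\<dots> \<le> (LINT x:U|lborel. B * \<bar>f n x - w x\<bar>)"
      proof (rule set_integral_mono)
        show "set_integrable lborel U (\<lambda>x. norm ((f n x - w x) * \<phi> x))" by (rule set_integrable_norm[OF di])
        show "set_integrable lborel U (\<lambda>x. B * \<bar>f n x - w x\<bar>)" using set_integrable_abs[OF elim] by simp
        show "norm ((f n x - w x) * \<phi> x) \<le> B * \<bar>f n x - w x\<bar>" for x
          using mult_right_mono[OF \<phi>(2)[of x], of "\<bar>f n x - w x\<bar>"] by (simp add: abs_mult mult.commute)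
      qed
      also have "\<dots> = B * (LINT x:U|lborel. \<bar>f n x - w x\<bar>)" by simp
      finally show ?case .
    qed
  qed
  then show ?thesis by (simp add: LIM_zero_iff)
qed

text \<open>Integration by parts for the smooth approximants passes to the \<open>L^2\<close> limit.
  Competitors in the plane obtain their weak gradients from this alone, without product and chain
  rules for weak derivatives.\<close>

lemma W12_2_of_smooth_limit:
  assumes s: "\<And>n. smooth2 (f n)"
    and mw: "set_borel_measurable lborel Bplus w" "set_borel_measurable lborel Bplus G"
    and fin: "sqint Bplus w < \<infinity>" "sqint Bplus (\<lambda>x. norm (G x)) < \<infinity>"
    and lim: "(\<lambda>n. sqint Bplus (\<lambda>x. f n x - w x)) \<longlonglongrightarrow> 0"
      "(\<lambda>n. sqint Bplus (\<lambda>x. norm (grad2 (f n) x - G x))) \<longlonglongrightarrow> 0"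
  shows "W12_2 Bplus w G"
proof -
  have comp: "set_borel_measurable lborel Bplus (\<lambda>x. p (G x)) \<and> set_integrable lborel Bplus (\<lambda>x. p (G x)) \<and>
     (\<lambda>n. sqint Bplus (\<lambda>x. p (grad2 (f n) x) - p (G x))) \<longlonglongrightarrow> 0"
    if p: "bounded_linear p" "\<And>v. \<bar>p v\<bar> \<le> norm v" for p :: "pt \<Rightarrow> real"
  proof (intro conjI)
    interpret bounded_linear p by (rule p)
    have "(\<lambda>x. p (indicat_real Bplus x *\<^sub>R G x)) \<in> borel_measurable lborel"
      using mw(2) unfolding set_borel_measurable_def
      by (rule measurable_compose) (intro borel_measurable_continuous_onI continuous_on continuous_on_id)
    then show m: "set_borel_measurable lborel Bplus (\<lambda>x. p (G x))" unfolding set_borel_measurable_def by (simp add: scaleR)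
    have le: "sqint Bplus (\<lambda>x. p (V x)) \<le> sqint Bplus (\<lambda>x. norm (V x))" for V
    proof (rule nn_integral_mono)
      fix x
      have "(p (V x))^2 \<le> (norm (V x))^2" using p(2)[of "V x"] by (simp add: abs_le_square_iff[symmetric])
      then show "ennreal ((p (V x))^2) * indicator Bplus x \<le> ennreal ((norm (V x))^2) * indicator Bplus x"
        by (intro mult_right_mono ennreal_leI) auto
    qed
    show "set_integrable lborel Bplus (\<lambda>x. p (G x))"
      by (rule set_integrable_of_sq[OF m]) (use emeasure_Bplus le_less_trans[OF le fin(2)] in auto)
    show "(\<lambda>n. sqint Bplus (\<lambda>x. p (grad2 (f n) x) - p (G x))) \<longlonglongrightarrow> 0"
    proof (rule tendsto_sandwich[OF _ _ tendsto_const lim(2)])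
      show "\<forall>\<^sub>F n in sequentially. (sqint Bplus (\<lambda>x. p (grad2 (f n) x) - p (G x))) \<le> sqint Bplus (\<lambda>x. norm (grad2 (f n) x - G x))"
        using le[of "\<lambda>x. grad2 (f n) x - G x" for n] by (simp add: diff)
    qed simp
  qed
  have wi: "set_integrable lborel Bplus w" by (rule set_integrable_of_sq[OF mw(1)]) (use emeasure_Bplus fin in auto)
  have ibp: "(LINT x:Bplus|lborel. w x * pd b \<phi> x) = - (LINT x:Bplus|lborel. p (G x) * \<phi> x)"
    if t: "test2 Bplus \<phi>" and p: "bounded_linear p" "\<And>v. \<bar>p v\<bar> \<le> norm v" and pb: "\<And>g x. p (grad2 g x) = pd b g x"
    for b \<phi> and p :: "pt \<Rightarrow> real"
  proof -
    obtain K where K: "compact K" "\<And>x. x \<notin> K \<Longrightarrow> \<phi> x = 0" and s\<phi>: "smooth2 \<phi>" using t by (auto simp: test2_def)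
    have pz: "pd b \<phi> x = 0" if "x \<notin> K" for b x
      by (rule pd_zero_outside[of "- K"]) (use K s\<phi> that compact_imp_closed[OF K(1)] in auto)
    obtain B where B: "\<And>x. \<bar>\<phi> x\<bar> \<le> B" using smooth2_compact_bounded[OF s\<phi> K] by blast
    obtain B' where B': "\<And>x. \<bar>pd b \<phi> x\<bar> \<le> B'" using smooth2_compact_bounded[OF smooth2_pd[OF s\<phi>] K(1) pz] by blast
    note c = comp[OF p]
    have 1: "(\<lambda>n. LINT x:Bplus|lborel. f n x * pd b \<phi> x) \<longlonglongrightarrow> (LINT x:Bplus|lborel. w x * pd b \<phi> x)"
      by (rule set_integral_mult_tendsto[OF _ emeasure_Bplus smooth2_measurable[OF s] mw(1) wi lim(1) smooth2_measurable[OF smooth2_pd[OF s\<phi>]] B']) simp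
    have 2: "(\<lambda>n. LINT x:Bplus|lborel. p (grad2 (f n) x) * \<phi> x) \<longlonglongrightarrow> (LINT x:Bplus|lborel. p (G x) * \<phi> x)"
      by (rule set_integral_mult_tendsto[OF _ emeasure_Bplus _ _ _ _ smooth2_measurable[OF s\<phi>] B])
         (use c pb smooth2_measurable[OF smooth2_pd[OF s]] in auto)
    have "(\<lambda>n. LINT x:Bplus|lborel. f n x * pd b \<phi> x) = (\<lambda>n. - (LINT x:Bplus|lborel. p (grad2 (f n) x) * \<phi> x))"
      using smooth2_integration_by_parts[OF s t] by (simp add: pb)
    then show ?thesis using LIMSEQ_unique[OF 1] tendsto_minus[OF 2] by simp
  qed
  show ?thesis unfolding W12_2_def
    using mw fin ibp[OF _ bounded_linear_fst norm_fst_le', of _ True] ibp[OF _ bounded_linear_snd norm_snd_le', of _ False]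
    by (auto simp: grad2_def)
qed

subsection \<open>Rescaled and localised competitors\<close>

lemma nn_integral_scale2:
  fixes h :: "pt \<Rightarrow> ennreal"
  assumes [measurable]: "h \<in> borel_measurable borel" and s: "s > 0"
  shows "(\<integral>\<^sup>+x. h ((1 / s) *\<^sub>R x) \<partial>lborel) = ennreal (s^2) * (\<integral>\<^sup>+x. h x \<partial>lborel)"
proof -
  have "(\<integral>\<^sup>+x. h ((1 / s) *\<^sub>R x) \<partial>lborel) = (\<integral>\<^sup>+x. h ((1 / s) *\<^sub>R x) \<partial>density (distr lborel borel (\<lambda>x. 0 + s *\<^sub>R x)) (\<lambda>_. \<bar>s\<bar> ^ DIM(pt)))"
    using s by (subst lborel_affine[of s 0]) auto
  also have "\<dots> = (\<integral>\<^sup>+x. ennreal (\<bar>s\<bar> ^ DIM(pt)) * h ((1 / s) *\<^sub>R (0 + s *\<^sub>R x)) \<partial>lborel)"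
    by (simp add: nn_integral_density nn_integral_distr)
  also have "\<dots> = (\<integral>\<^sup>+x. ennreal (s^2) * h x \<partial>lborel)"
    using s by (intro nn_integral_cong) (simp add: power2_eq_square)
  also have "\<dots> = ennreal (s^2) * (\<integral>\<^sup>+x. h x \<partial>lborel)" by (rule nn_integral_cmult) simp
  finally show ?thesis .
qed

lemma smooth2_line: "smooth2 f \<Longrightarrow> smooth_on UNIV (\<lambda>t. f (t, 0))"
proof (rule smooth_on_coinduct[where P = "\<lambda>g. \<exists>f. smooth2 f \<and> g = (\<lambda>t. f (t, 0))"])
  fix g x assume "\<exists>f. smooth2 f \<and> g = (\<lambda>t. f (t, 0))"
  then show "g differentiable (at x)"
    using differentiable_partials(1)[OF smooth2_differentiable] by (auto simp: real_differentiable_def)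
next
  fix g assume "\<exists>f. smooth2 f \<and> g = (\<lambda>t. f (t, 0))"
  then obtain f where "smooth2 f" "g = (\<lambda>t. f (t, 0))" by blast
  then show "\<exists>h. (\<exists>f. smooth2 f \<and> h = (\<lambda>t. f (t, 0))) \<and> (\<forall>x\<in>UNIV. deriv g x = h x)"
    by (intro exI[of _ "\<lambda>t. pd True f (t, 0)"] conjI exI[of _ "pd True f"]) (auto simp: pd_True intro: smooth2_pd)
qed auto

definition approx :: "(pt \<Rightarrow> real) \<Rightarrow> (real \<Rightarrow> real) \<Rightarrow> (nat \<Rightarrow> pt \<Rightarrow> real) \<Rightarrow> bool" where
  "approx w \<mu> \<phi> \<longleftrightarrow> (\<forall>n. smooth2 (\<phi> n)) \<and>
    (\<lambda>n. sqint Bplus (\<lambda>x. \<phi> n x - w x)) \<longlonglongrightarrow> 0 \<and>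
    (\<lambda>n. sqint Bplus (\<lambda>x. norm (grad2 (\<phi> n) x - wgrad Bplus w x))) \<longlonglongrightarrow> 0 \<and>
    (\<lambda>n. sqint I1 (\<lambda>t. \<phi> n (t, 0) - \<mu> t)) \<longlonglongrightarrow> 0"

text \<open>Replaces the trace \<open>g\<close> on the arc by a one-sided statement: since
  \<open>g\<close> is at most \<open>1 - \<gamma>\<close>, the part of \<open>\<phi> n\<close> above
  that value is dominated by its distance to \<open>g\<close> and tends to zero in
  \<open>L^2\<close>.\<close>

definition arc_below :: "real \<Rightarrow> (nat \<Rightarrow> pt \<Rightarrow> real) \<Rightarrow> bool" where
  "arc_below \<gamma> \<phi> \<longleftrightarrow> (\<lambda>n. \<integral>\<^sup>+t\<in>{0<..<pi}. ennreal ((max 0 (\<phi> n (cos t, sin t) - (1 - \<gamma>)))^2) \<partial>lborel) \<longlonglongrightarrow> 0"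

lemma WmuD:
  assumes "w \<in> Wmu \<gamma> \<mu>"
  shows "in_W12_2 Bplus w" "\<exists>\<phi>. approx w \<mu> \<phi> \<and> arc_below \<gamma> \<phi>"
proof -
  show "in_W12_2 Bplus w" using assms by (simp add: Wmu_def)
  obtain \<phi> g where a: "approx w \<mu> \<phi>" and g: "AE t in lborel. t \<in> {0<..<pi} \<longrightarrow> g t \<le> 1 - \<gamma>"
    "(\<lambda>n. \<integral>\<^sup>+t\<in>{0<..<pi}. ennreal ((\<phi> n (cos t, sin t) - g t)^2) \<partial>lborel) \<longlonglongrightarrow> 0"
    using assms unfolding Wmu_def approx_def by blast
  have "arc_below \<gamma> \<phi>" unfolding arc_below_def
  proof (rule tendsto_sandwich[OF _ _ tendsto_const g(2)])
    have "(\<integral>\<^sup>+t\<in>{0<..<pi}. ennreal ((max 0 (\<phi> n (cos t, sin t) - (1 - \<gamma>)))^2) \<partial>lborel) \<le> (\<integral>\<^sup>+t\<in>{0<..<pi}. ennreal ((\<phi> n (cos t, sin t) - g t)^2) \<partial>lborel)" for n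
    proof (rule nn_integral_mono_AE)
      show "AE t in lborel. ennreal ((max 0 (\<phi> n (cos t, sin t) - (1 - \<gamma>)))^2) * indicator {0<..<pi} t \<le> ennreal ((\<phi> n (cos t, sin t) - g t)^2) * indicator {0<..<pi} t"
        using g(1)
      proof eventually_elim
        case (elim t)
        show ?case
        proof (cases "t \<in> {0<..<pi}")
          case True
          then have "\<bar>max 0 (\<phi> n (cos t, sin t) - (1 - \<gamma>))\<bar> \<le> \<bar>\<phi> n (cos t, sin t) - g t\<bar>" using elim by auto
          then have "(max 0 (\<phi> n (cos t, sin t) - (1 - \<gamma>)))^2 \<le> (\<phi> n (cos t, sin t) - g t)^2" by (simp only: abs_le_square_iff)
          then show ?thesis by (intro mult_right_mono ennreal_leI) auto
        qed simp
      qed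
    qed
    then show "\<forall>\<^sub>F n in sequentially. (\<integral>\<^sup>+t\<in>{0<..<pi}. ennreal ((max 0 (\<phi> n (cos t, sin t) - (1 - \<gamma>)))^2) \<partial>lborel) \<le> (\<integral>\<^sup>+t\<in>{0<..<pi}. ennreal ((\<phi> n (cos t, sin t) - g t)^2) \<partial>lborel)"
      by simp
  qed simp
  then show "\<exists>\<phi>. approx w \<mu> \<phi> \<and> arc_below \<gamma> \<phi>" using a by blast
qed

lemma approx_subseq:
  assumes "approx w \<mu> \<phi>" "arc_below \<gamma> \<phi>" "strict_mono (r :: nat \<Rightarrow> nat)"
  shows "approx w \<mu> (\<phi> \<circ> r)" "arc_below \<gamma> (\<phi> \<circ> r)"
  using assms unfolding approx_def arc_below_def
  by (auto simp: o_def dest: LIMSEQ_subseq_LIMSEQ)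

lemma approx_dirichlet:
  assumes w: "in_W12_2 Bplus w" and a: "approx w \<mu> \<phi>"
  shows "(\<lambda>n. grad_sq (\<phi> n)) \<longlonglongrightarrow> dirichlet w" "dirichlet w < \<infinity>"
proof -
  note W = W12_2_wgrad[OF w]
  show "(\<lambda>n. grad_sq (\<phi> n)) \<longlonglongrightarrow> dirichlet w"
    unfolding dirichlet_def
    by (rule L2_norm_tendsto) (use W a in \<open>auto simp: W12_2_def approx_def intro: grad2_measurable\<close>)
  show "dirichlet w < \<infinity>" unfolding dirichlet_def using W by (simp add: W12_2_def)
qed

lemma norm_pt_sq: "(norm (v::pt))^2 = (fst v)^2 + (snd v)^2"
  by (cases v) (simp add: norm_Pair)

lemma norm_add_sq_le: "(norm (a + b))^2 \<le> 2 * (norm a)^2 + 2 * (norm (b::'a::real_normed_vector))^2"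
proof -
  have "(norm (a + b))^2 \<le> (norm a + norm b)^2" by (intro power_mono norm_triangle_ineq) auto
  also have "\<dots> \<le> 2 * (norm a)^2 + 2 * (norm b)^2" by (rule sq_add_le)
  finally show ?thesis .
qed

text \<open>One formula transforms the function, its flat trace and the approximants simultaneously.
  \<open>P\<close> carries the values on the arc; \<open>\<Theta>\<close> vanishes beyond the radius
  \<open>s * q < s\<close>, so the dilated function enters only inside its domain. The second
  conclusion allows the energy to be computed on smooth functions.\<close>

lemma competitor_rescale:
  fixes w P \<Theta> :: "pt \<Rightarrow> real" and \<mu> :: "real \<Rightarrow> real" and s q \<gamma> :: real and \<phi> :: "nat \<Rightarrow> pt \<Rightarrow> real"
  assumes w: "in_W12_2 Bplus w" and a: "approx w \<mu> \<phi>" and m\<mu>: "set_borel_measurable lborel I1 \<mu>"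
    and P: "smooth2 P" and \<Theta>: "smooth2 \<Theta>" and s: "0 < s" "s \<le> 1" and q: "q < 1"
    and sup: "\<And>x. norm x > s * q \<Longrightarrow> \<Theta> x = 0"
    and arc: "\<And>t. t \<in> {0<..<pi} \<Longrightarrow> P (cos t, sin t) \<le> 1 - \<gamma>"
  defines "w' \<equiv> \<lambda>x. P x + \<Theta> x * w ((1 / s) *\<^sub>R x)"
    and "\<mu>' \<equiv> \<lambda>t. P (t, 0) + \<Theta> (t, 0) * \<mu> (t / s)"
    and "\<phi>' \<equiv> \<lambda>n x. P x + \<Theta> x * \<phi> n ((1 / s) *\<^sub>R x)"
  shows "w' \<in> Wmu \<gamma> \<mu>'"
    and "(\<lambda>n. grad_sq (\<phi>' n)) \<longlonglongrightarrow> dirichlet w'"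
proof -
  note W = W12_2_wgrad[OF w]
  define k where "k = 1 / s"
  have k: "k > 0" using s by (simp add: k_def)
  have s\<phi>: "smooth2 (\<phi> n)" for n using a by (simp add: approx_def)
  define F where "F = (\<lambda>y. indicat_real Bplus y * w y)"
  define H where "H = (\<lambda>y. indicat_real Bplus y *\<^sub>R wgrad Bplus w y)"
  have [measurable]: "F \<in> borel_measurable borel" "H \<in> borel_measurable borel"
    using W by (simp_all add: W12_2_def set_borel_measurable_def F_def H_def)
  note [measurable] = smooth2_measurable[OF s\<phi>] smooth2_measurable[OF P] smooth2_measurable[OF \<Theta>]
    grad2_measurable[OF s\<phi>] grad2_measurable[OF P] grad2_measurable[OF \<Theta>]
  define d1 where "d1 n y = indicat_real Bplus y * (\<phi> n y - F y)" for n y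
  define d2 where "d2 n y = indicat_real Bplus y *\<^sub>R (grad2 (\<phi> n) y - H y)" for n y
  have [measurable]: "d1 n \<in> borel_measurable borel" "d2 n \<in> borel_measurable borel" for n
    unfolding d1_def d2_def by measurable
  let ?X1 = "\<lambda>n. \<integral>\<^sup>+y. ennreal ((d1 n y)^2) \<partial>lborel" and ?X2 = "\<lambda>n. \<integral>\<^sup>+y. ennreal ((norm (d2 n y))^2) \<partial>lborel"
  have X1: "?X1 \<longlonglongrightarrow> 0"
  proof -
    have "?X1 n = sqint Bplus (\<lambda>x. \<phi> n x - w x)" for n
      by (rule nn_integral_cong) (auto simp: d1_def F_def indicator_def)
    then show ?thesis using a by (simp add: approx_def)
  qed
  have X2: "?X2 \<longlonglongrightarrow> 0"
  proof -
    have "?X2 n = sqint Bplus (\<lambda>x. norm (grad2 (\<phi> n) x - wgrad Bplus w x))" for n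
      by (rule nn_integral_cong) (auto simp: d2_def H_def indicator_def)
    then show ?thesis using a by (simp add: approx_def)
  qed
  have \<Theta>0: "\<Theta> x = 0" "grad2 \<Theta> x = 0" if "s * q < norm x" for x
  proof -
    show "\<Theta> x = 0" using sup that by simp
    have o: "open {x::pt. s * q < norm x}" by (intro open_Collect_less continuous_intros)
    have "pd b \<Theta> x = 0" for b by (rule pd_zero_outside[OF o _ _ \<Theta>]) (use sup that in auto)
    then show "grad2 \<Theta> x = 0" by (simp add: grad2_def zero_prod_def)
  qed
  have out: "\<Theta> x = 0" "grad2 \<Theta> x = 0" if "x \<in> Bplus" "k *\<^sub>R x \<notin> Bplus" for x
  proof -
    have "\<not> norm (k *\<^sub>R x) < 1" using that k by (auto simp: Bplus_def)
    then have "s \<le> norm x" using s by (simp add: k_def field_simps)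
    then have "s * q < norm x" using q s by (smt (verit) mult_less_cancel_left2)
    then show "\<Theta> x = 0" "grad2 \<Theta> x = 0" using \<Theta>0 by auto
  qed
  have sup': "\<Theta> x = 0" "pd b \<Theta> x = 0" if "x \<notin> cball 0 (s * q)" for x b
  proof -
    have n: "s * q < norm x" using that by simp
    show "\<Theta> x = 0" by (rule \<Theta>0(1)[OF n])
    have "fst (grad2 \<Theta> x) = 0" "snd (grad2 \<Theta> x) = 0" using \<Theta>0(2)[OF n] by auto
    then show "pd b \<Theta> x = 0" by (cases b) (auto simp: grad2_def)
  qed
  obtain B where B: "B \<ge> 0" "\<And>x. \<bar>\<Theta> x\<bar> \<le> B" 
    by (rule smooth2_compact_bounded[OF \<Theta> compact_cball[of 0 "s * q"] sup'(1)], assumption, rule that)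
  obtain B1 where B1: "B1 \<ge> 0" "\<And>x. \<bar>pd True \<Theta> x\<bar> \<le> B1" 
    by (rule smooth2_compact_bounded[OF smooth2_pd[OF \<Theta>] compact_cball[of 0 "s * q"] sup'(2)], assumption, rule that)
  obtain B2 where B2: "B2 \<ge> 0" "\<And>x. \<bar>pd False \<Theta> x\<bar> \<le> B2" 
    by (rule smooth2_compact_bounded[OF smooth2_pd[OF \<Theta>] compact_cball[of 0 "s * q"] sup'(2)], assumption, rule that)
  define C where "C = B1^2 + B2^2"
  have C: "(norm (grad2 \<Theta> x))^2 \<le> C" for x
    unfolding norm_grad2 C_def using B1 B2 by (intro add_mono) (auto simp: abs_le_square_iff[symmetric])
  have Bsq: "(\<Theta> x)^2 \<le> B^2" for x using B by (simp add: abs_le_square_iff[symmetric])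
  \<comment> \<open>The gradient predicted by product and chain rule, with \<open>w\<close> and its
    weak gradient extended by zero. That it is the weak gradient of \<open>w'\<close> follows from
    the convergence \<open>lim2\<close>.\<close>
  define G' where "G' x = grad2 P x + F (k *\<^sub>R x) *\<^sub>R grad2 \<Theta> x + (k * \<Theta> x) *\<^sub>R H (k *\<^sub>R x)" for x
  have grad': "grad2 (\<phi>' n) x = grad2 P x + \<phi> n (k *\<^sub>R x) *\<^sub>R grad2 \<Theta> x + (k * \<Theta> x) *\<^sub>R grad2 (\<phi> n) (k *\<^sub>R x)" for n x
  proof -
    have sc: "smooth2 (\<lambda>x. \<phi> n (k *\<^sub>R x))" by (rule smooth2_scale[OF s\<phi>])
    have sm: "smooth2 (\<lambda>x. \<Theta> x * \<phi> n (k *\<^sub>R x))" by (rule smooth2_mult[OF \<Theta> sc])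
    show ?thesis unfolding \<phi>'_def k_def[symmetric] grad2_def
      using pd_add[OF smooth2_differentiable[OF P] smooth2_differentiable[OF sm]]
        pd_mult[OF smooth2_differentiable[OF \<Theta>] smooth2_differentiable[OF sc]]
        pd_scale[OF smooth2_differentiable[OF s\<phi>]]
      by (simp add: algebra_simps)
  qed
  have s\<phi>': "smooth2 (\<phi>' n)" for n unfolding \<phi>'_def by (intro smooth2_add smooth2_mult smooth2_scale P \<Theta> s\<phi>)
  have w'F: "w' x = P x + \<Theta> x * F (k *\<^sub>R x)" if "x \<in> Bplus" for x
    using out[OF that] by (auto simp: w'_def F_def k_def[symmetric] indicator_def)
  have sc1: "(\<integral>\<^sup>+x. ennreal c1 * ennreal ((f (k *\<^sub>R x))^2) + ennreal c2 * ennreal ((norm (v (k *\<^sub>R x)))^2) \<partial>lborel)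
      = ennreal c1 * (ennreal (s^2) * (\<integral>\<^sup>+y. ennreal ((f y)^2) \<partial>lborel)) + ennreal c2 * (ennreal (s^2) * (\<integral>\<^sup>+y. ennreal ((norm (v y))^2) \<partial>lborel))"
    if [measurable]: "f \<in> borel_measurable borel" "v \<in> borel_measurable borel" for c1 c2 and f :: "pt \<Rightarrow> real" and v :: "pt \<Rightarrow> pt"
    using nn_integral_scale2[of "\<lambda>x. ennreal ((f x)^2)" s] nn_integral_scale2[of "\<lambda>x. ennreal ((norm (v x))^2)" s] s
    by (simp add: nn_integral_add nn_integral_cmult k_def)
  have cvg: "(\<lambda>n. ennreal c1 * (ennreal (s^2) * ?X1 n) + ennreal c2 * (ennreal (s^2) * ?X2 n)) \<longlonglongrightarrow> 0" for c1 c2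
  proof -
    have "(\<lambda>n. ennreal c1 * (ennreal (s^2) * ?X1 n) + ennreal c2 * (ennreal (s^2) * ?X2 n)) \<longlonglongrightarrow> ennreal c1 * (ennreal (s^2) * 0) + ennreal c2 * (ennreal (s^2) * 0)"
      by (intro tendsto_add ennreal_tendsto_cmult X1 X2) auto
    then show ?thesis by simp
  qed
  have lim1: "(\<lambda>n. sqint Bplus (\<lambda>x. \<phi>' n x - w' x)) \<longlonglongrightarrow> 0"
  proof (rule tendsto_sandwich[OF _ _ tendsto_const cvg[of "B^2" 0]])
    have "sqint Bplus (\<lambda>x. \<phi>' n x - w' x) \<le> (\<integral>\<^sup>+x. ennreal (B^2) * ennreal ((d1 n (k *\<^sub>R x))^2) + ennreal 0 * ennreal ((norm (d2 n (k *\<^sub>R x)))^2) \<partial>lborel)" for n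
    proof (rule nn_integral_mono)
      fix x
      show "ennreal ((\<phi>' n x - w' x)^2) * indicator Bplus x \<le> ennreal (B^2) * ennreal ((d1 n (k *\<^sub>R x))^2) + ennreal 0 * ennreal ((norm (d2 n (k *\<^sub>R x)))^2)"
      proof (cases "x \<in> Bplus")
        case True
        have "\<phi>' n x - w' x = \<Theta> x * d1 n (k *\<^sub>R x)"
          unfolding w'F[OF True] \<phi>'_def d1_def k_def[symmetric] using out[OF True] by (auto simp: indicator_def algebra_simps)
        then have "(\<phi>' n x - w' x)^2 \<le> B^2 * (d1 n (k *\<^sub>R x))^2" using Bsq[of x] by (simp add: power_mult_distrib mult_right_mono)
        then have "ennreal ((\<phi>' n x - w' x)^2) \<le> ennreal (B^2) * ennreal ((d1 n (k *\<^sub>R x))^2)"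
          by (simp add: ennreal_mult[symmetric] ennreal_leI)
        then show ?thesis using True by simp
      qed simp
    qed
    then show "\<forall>\<^sub>F n in sequentially. (sqint Bplus (\<lambda>x. \<phi>' n x - w' x)) \<le> ennreal (B^2) * (ennreal (s^2) * ?X1 n) + ennreal 0 * (ennreal (s^2) * ?X2 n)"
      by (subst (asm) sc1) auto
  qed simp
  have lim2: "(\<lambda>n. sqint Bplus (\<lambda>x. norm (grad2 (\<phi>' n) x - G' x))) \<longlonglongrightarrow> 0"
  proof (rule tendsto_sandwich[OF _ _ tendsto_const cvg[of "2 * C" "2 * (k^2 * B^2)"]])
    have "sqint Bplus (\<lambda>x. norm (grad2 (\<phi>' n) x - G' x)) \<le> (\<integral>\<^sup>+x. ennreal (2 * C) * ennreal ((d1 n (k *\<^sub>R x))^2) + ennreal (2 * (k^2 * B^2)) * ennreal ((norm (d2 n (k *\<^sub>R x)))^2) \<partial>lborel)" for n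
    proof (rule nn_integral_mono)
      fix x
      show "ennreal ((norm (grad2 (\<phi>' n) x - G' x))^2) * indicator Bplus x \<le> ennreal (2 * C) * ennreal ((d1 n (k *\<^sub>R x))^2) + ennreal (2 * (k^2 * B^2)) * ennreal ((norm (d2 n (k *\<^sub>R x)))^2)"
      proof (cases "x \<in> Bplus")
        case True
        have "grad2 (\<phi>' n) x - G' x = d1 n (k *\<^sub>R x) *\<^sub>R grad2 \<Theta> x + (k * \<Theta> x) *\<^sub>R d2 n (k *\<^sub>R x)"
          unfolding grad' G'_def d1_def d2_def using out[OF True] by (auto simp: indicator_def algebra_simps)
        then have "(norm (grad2 (\<phi>' n) x - G' x))^2 \<le> 2 * (norm (d1 n (k *\<^sub>R x) *\<^sub>R grad2 \<Theta> x))^2 + 2 * (norm ((k * \<Theta> x) *\<^sub>R d2 n (k *\<^sub>R x)))^2"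
          by (simp only: norm_add_sq_le)
        also have "\<dots> = 2 * ((norm (grad2 \<Theta> x))^2 * (d1 n (k *\<^sub>R x))^2) + 2 * ((k^2 * (\<Theta> x)^2) * (norm (d2 n (k *\<^sub>R x)))^2)"
          by (simp add: power_mult_distrib)
        also have "\<dots> \<le> 2 * (C * (d1 n (k *\<^sub>R x))^2) + 2 * ((k^2 * B^2) * (norm (d2 n (k *\<^sub>R x)))^2)"
          using C[of x] Bsq[of x] by (intro add_mono mult_left_mono mult_right_mono) auto
        finally have "(norm (grad2 (\<phi>' n) x - G' x))^2 \<le> (2 * C) * (d1 n (k *\<^sub>R x))^2 + (2 * (k^2 * B^2)) * (norm (d2 n (k *\<^sub>R x)))^2"
          by simp
        then have "ennreal ((norm (grad2 (\<phi>' n) x - G' x))^2) \<le> ennreal ((2 * C) * (d1 n (k *\<^sub>R x))^2 + (2 * (k^2 * B^2)) * (norm (d2 n (k *\<^sub>R x)))^2)"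
          by (rule ennreal_leI)
        also have "\<dots> = ennreal (2 * C) * ennreal ((d1 n (k *\<^sub>R x))^2) + ennreal (2 * (k^2 * B^2)) * ennreal ((norm (d2 n (k *\<^sub>R x)))^2)"
          by (subst ennreal_plus) (auto simp: ennreal_mult C_def)
        finally show ?thesis using True by simp
      qed simp
    qed
    then show "\<forall>\<^sub>F n in sequentially. (sqint Bplus (\<lambda>x. norm (grad2 (\<phi>' n) x - G' x))) \<le> ennreal (2 * C) * (ennreal (s^2) * ?X1 n) + ennreal (2 * (k^2 * B^2)) * (ennreal (s^2) * ?X2 n)"
      by (subst (asm) sc1) auto
  qed simp
  have cb: "compact (cball (0::pt) 1)" by simp
  obtain D0 where D0: "D0 \<ge> 0" "\<And>x. x \<in> cball 0 1 \<Longrightarrow> \<bar>P x\<bar> \<le> D0" 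
    by (rule continuous_bounded_on_compact[OF cb smooth2_continuous[OF P]]) (rule that)
  obtain D1 where D1: "D1 \<ge> 0" "\<And>x. x \<in> cball 0 1 \<Longrightarrow> \<bar>pd True P x\<bar> \<le> D1" 
    by (rule continuous_bounded_on_compact[OF cb smooth2_continuous[OF smooth2_pd[OF P]]]) (rule that)
  obtain D2 where D2: "D2 \<ge> 0" "\<And>x. x \<in> cball 0 1 \<Longrightarrow> \<bar>pd False P x\<bar> \<le> D2" 
    by (rule continuous_bounded_on_compact[OF cb smooth2_continuous[OF smooth2_pd[OF P]]]) (rule that)
  have Bsub: "x \<in> cball 0 1" if "x \<in> Bplus" for x using that by (auto simp: Bplus_def)
  have F2: "(\<integral>\<^sup>+y. ennreal ((F y)^2) \<partial>lborel) < \<infinity>"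
  proof -
    have "(\<integral>\<^sup>+y. ennreal ((F y)^2) \<partial>lborel) = sqint Bplus w"
      by (rule nn_integral_cong) (auto simp: F_def indicator_def)
    then show ?thesis using W by (simp add: W12_2_def)
  qed
  have H2: "(\<integral>\<^sup>+y. ennreal ((norm (H y))^2) \<partial>lborel) < \<infinity>"
  proof -
    have "(\<integral>\<^sup>+y. ennreal ((norm (H y))^2) \<partial>lborel) = sqint Bplus (\<lambda>x. norm (wgrad Bplus w x))"
      by (rule nn_integral_cong) (auto simp: H_def indicator_def)
    then show ?thesis using W by (simp add: W12_2_def)
  qed
  have fin: "(\<integral>\<^sup>+x\<in>Bplus. ennreal (h x) \<partial>lborel) < \<infinity>"
    if h: "\<And>x. x \<in> Bplus \<Longrightarrow> h x \<le> A + (c1 * (F (k *\<^sub>R x))^2 + c2 * (norm (H (k *\<^sub>R x)))^2)" and ac: "A \<ge> 0" "c1 \<ge> 0" "c2 \<ge> 0" for h A c1 c2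
  proof -
    have "(\<integral>\<^sup>+x\<in>Bplus. ennreal (h x) \<partial>lborel) \<le> (\<integral>\<^sup>+x. ennreal A * indicator Bplus x + (ennreal c1 * ennreal ((F (k *\<^sub>R x))^2) + ennreal c2 * ennreal ((norm (H (k *\<^sub>R x)))^2)) \<partial>lborel)"
    proof (rule nn_integral_mono)
      fix x
      show "ennreal (h x) * indicator Bplus x \<le> ennreal A * indicator Bplus x + (ennreal c1 * ennreal ((F (k *\<^sub>R x))^2) + ennreal c2 * ennreal ((norm (H (k *\<^sub>R x)))^2))"
      proof (cases "x \<in> Bplus")
        case True
        have "ennreal (h x) \<le> ennreal (A + (c1 * (F (k *\<^sub>R x))^2 + c2 * (norm (H (k *\<^sub>R x)))^2))" by (rule ennreal_leI[OF h[OF True]])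
        also have "\<dots> = ennreal A + (ennreal c1 * ennreal ((F (k *\<^sub>R x))^2) + ennreal c2 * ennreal ((norm (H (k *\<^sub>R x)))^2))"
          using ac by (simp add: ennreal_plus ennreal_mult)
        finally show ?thesis using True by simp
      qed simp
    qed
    also have "\<dots> = ennreal A * emeasure lborel Bplus + (ennreal c1 * (ennreal (s^2) * (\<integral>\<^sup>+y. ennreal ((F y)^2) \<partial>lborel)) + ennreal c2 * (ennreal (s^2) * (\<integral>\<^sup>+y. ennreal ((norm (H y))^2) \<partial>lborel)))"
      by (subst nn_integral_add) (auto simp: nn_integral_cmult_indicator sc1)
    also have "\<dots> < \<infinity>" using F2 H2 emeasure_Bplus by (simp add: ennreal_mult_less_top)
    finally show ?thesis .
  qed
  have fw: "sqint Bplus w' < \<infinity>"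
  proof (rule fin[of _ "2 * D0^2" "2 * B^2" 0])
    fix x assume x: "x \<in> Bplus"
    have "(w' x)^2 \<le> 2 * (P x)^2 + 2 * (\<Theta> x * F (k *\<^sub>R x))^2" unfolding w'F[OF x] by (rule sq_add_le)
    moreover have "(P x)^2 \<le> D0^2" using D0 Bsub[OF x] by (simp add: abs_le_square_iff[symmetric])
    moreover have "(\<Theta> x * F (k *\<^sub>R x))^2 \<le> B^2 * (F (k *\<^sub>R x))^2" using Bsq[of x] by (simp add: power_mult_distrib mult_right_mono)
    ultimately show "(w' x)^2 \<le> 2 * D0^2 + (2 * B^2 * (F (k *\<^sub>R x))^2 + 0 * (norm (H (k *\<^sub>R x)))^2)" by simp
  qed auto
  have fG: "sqint Bplus (\<lambda>x. norm (G' x)) < \<infinity>"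
  proof (rule fin[of _ "2 * (D1^2 + D2^2)" "4 * C" "4 * (k^2 * B^2)"])
    fix x assume x: "x \<in> Bplus"
    have "(norm (G' x))^2 \<le> 2 * (norm (grad2 P x))^2 + 2 * (norm (F (k *\<^sub>R x) *\<^sub>R grad2 \<Theta> x + (k * \<Theta> x) *\<^sub>R H (k *\<^sub>R x)))^2"
      unfolding G'_def add.assoc by (rule norm_add_sq_le)
    also have "\<dots> \<le> 2 * (norm (grad2 P x))^2 + 2 * (2 * (norm (F (k *\<^sub>R x) *\<^sub>R grad2 \<Theta> x))^2 + 2 * (norm ((k * \<Theta> x) *\<^sub>R H (k *\<^sub>R x)))^2)"
      by (intro add_left_mono mult_left_mono norm_add_sq_le) auto
    also have "\<dots> = 2 * (norm (grad2 P x))^2 + (4 * ((norm (grad2 \<Theta> x))^2 * (F (k *\<^sub>R x))^2) + 4 * ((k^2 * (\<Theta> x)^2) * (norm (H (k *\<^sub>R x)))^2))"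
      by (simp add: power_mult_distrib)
    also have "\<dots> \<le> 2 * (D1^2 + D2^2) + (4 * (C * (F (k *\<^sub>R x))^2) + 4 * ((k^2 * B^2) * (norm (H (k *\<^sub>R x)))^2))"
      using C[of x] Bsq[of x] D1 D2 Bsub[OF x] unfolding norm_grad2
      by (intro add_mono mult_left_mono mult_right_mono) (auto simp: abs_le_square_iff[symmetric])
    finally show "(norm (G' x))^2 \<le> 2 * (D1^2 + D2^2) + (4 * C * (F (k *\<^sub>R x))^2 + 4 * (k^2 * B^2) * (norm (H (k *\<^sub>R x)))^2)" by simp
  qed (auto simp: C_def)
  have mw': "set_borel_measurable lborel Bplus w'"
  proof -
    have "(\<lambda>x. indicat_real Bplus x * (P x + \<Theta> x * F (k *\<^sub>R x))) \<in> borel_measurable lborel" by measurable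
    moreover have "(\<lambda>x. indicat_real Bplus x * (P x + \<Theta> x * F (k *\<^sub>R x))) = (\<lambda>x. indicat_real Bplus x *\<^sub>R w' x)"
    proof
      fix x show "indicat_real Bplus x * (P x + \<Theta> x * F (k *\<^sub>R x)) = indicat_real Bplus x *\<^sub>R w' x"
        using w'F[of x] by (cases "x \<in> Bplus") auto
    qed
    ultimately show ?thesis by (simp only: set_borel_measurable_def)
  qed
  have mG': "set_borel_measurable lborel Bplus G'"
    unfolding set_borel_measurable_def G'_def by measurable
  have W': "W12_2 Bplus w' G'" by (rule W12_2_of_smooth_limit[OF s\<phi>' mw' mG' fw fG lim1 lim2])
  have AEG: "AE x in lborel. x \<in> Bplus \<longrightarrow> wgrad Bplus w' x = G' x" by (rule wgrad_AE[OF W'])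
  have lim2': "(\<lambda>n. sqint Bplus (\<lambda>x. norm (grad2 (\<phi>' n) x - wgrad Bplus w' x))) \<longlonglongrightarrow> 0"
  proof -
    have "sqint Bplus (\<lambda>x. norm (grad2 (\<phi>' n) x - wgrad Bplus w' x)) = sqint Bplus (\<lambda>x. norm (grad2 (\<phi>' n) x - G' x))" for n
    proof (rule nn_integral_cong_AE)
      show "AE x in lborel. ennreal ((norm (grad2 (\<phi>' n) x - wgrad Bplus w' x))^2) * indicator Bplus x = ennreal ((norm (grad2 (\<phi>' n) x - G' x))^2) * indicator Bplus x"
        using AEG by eventually_elim (simp add: indicator_def)
    qed
    then show ?thesis using lim2 by simp
  qed
  have lim3: "(\<lambda>n. sqint I1 (\<lambda>t. \<phi>' n (t, 0) - \<mu>' t)) \<longlonglongrightarrow> 0"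
  proof -
    let ?e = "\<lambda>n t. ennreal ((\<phi> n (t, 0) - \<mu> t)^2) * indicator I1 t"
    have me: "?e n \<in> borel_measurable borel" for n
    proof (rule set_measurable_sq)
      show "set_borel_measurable lborel I1 (\<lambda>t. \<phi> n (t, 0) - \<mu> t)"
        by (rule set_measurable_diff[OF _ m\<mu>]) (auto intro: smooth_on_measurable[OF smooth2_line[OF s\<phi>]])
    qed simp
    have "(\<lambda>n. ennreal (B^2) * (ennreal s * (\<integral>\<^sup>+t. ?e n t \<partial>lborel))) \<longlonglongrightarrow> ennreal (B^2) * (ennreal s * 0)"
      by (intro ennreal_tendsto_cmult) (use a in \<open>auto simp: approx_def\<close>)
    then have c: "(\<lambda>n. ennreal (B^2) * (ennreal s * (\<integral>\<^sup>+t. ?e n t \<partial>lborel))) \<longlonglongrightarrow> 0" by simp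
    show ?thesis
    proof (rule tendsto_sandwich[OF _ _ tendsto_const c])
      have "sqint I1 (\<lambda>t. \<phi>' n (t, 0) - \<mu>' t) \<le> ennreal (B^2) * (ennreal s * (\<integral>\<^sup>+t. ?e n t \<partial>lborel))" for n
      proof -
        have "sqint I1 (\<lambda>t. \<phi>' n (t, 0) - \<mu>' t) \<le> (\<integral>\<^sup>+t. ennreal (B^2) * ?e n (t / s) \<partial>lborel)"
        proof (rule nn_integral_mono)
          fix t
          have eq: "\<phi>' n (t, 0) - \<mu>' t = \<Theta> (t, 0) * (\<phi> n (t / s, 0) - \<mu> (t / s))"
            by (simp add: \<phi>'_def \<mu>'_def algebra_simps)
          show "ennreal ((\<phi>' n (t, 0) - \<mu>' t)^2) * indicator I1 t \<le> ennreal (B^2) * ?e n (t / s)"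
          proof (cases "t / s \<in> I1")
            case True
            have "(\<phi>' n (t, 0) - \<mu>' t)^2 \<le> B^2 * (\<phi> n (t / s, 0) - \<mu> (t / s))^2"
              unfolding eq power_mult_distrib using Bsq by (intro mult_right_mono) auto
            then have "ennreal ((\<phi>' n (t, 0) - \<mu>' t)^2) \<le> ennreal (B^2) * ennreal ((\<phi> n (t / s, 0) - \<mu> (t / s))^2)"
              by (simp add: ennreal_mult[symmetric] ennreal_leI)
            then show ?thesis using True by (simp add: indicator_def)
          next
            case False
            then have "s \<le> \<bar>t\<bar>" using s by (auto simp: abs_if field_simps split: if_splits)
            then have "s * q < norm (t, 0::real)" using q s by (simp add: norm_Pair) (smt (verit) mult_less_cancel_left2)
            then have "\<Theta> (t, 0) = 0" by (rule sup)
            then show ?thesis unfolding eq by simp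
          qed
        qed
        also have "\<dots> = ennreal (B^2) * (\<integral>\<^sup>+t. ?e n (t / s) \<partial>lborel)"
          by (rule nn_integral_cmult) (use me[of n] in measurable)
        also have "(\<integral>\<^sup>+t. ?e n (t / s) \<partial>lborel) = ennreal \<bar>s\<bar> * (\<integral>\<^sup>+t. ?e n ((0 + s * t) / s) \<partial>lborel)"
          by (rule nn_integral_real_affine) (use me[of n] s in \<open>measurable, auto\<close>)
        also have "(\<integral>\<^sup>+t. ?e n ((0 + s * t) / s) \<partial>lborel) = (\<integral>\<^sup>+t. ?e n t \<partial>lborel)" using s by simp
        finally show ?thesis using s by simp
      qed
      then show "\<forall>\<^sub>F n in sequentially. (sqint I1 (\<lambda>t. \<phi>' n (t, 0) - \<mu>' t)) \<le> ennreal (B^2) * (ennreal s * (\<integral>\<^sup>+t. ?e n t \<partial>lborel))" by simp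
    qed simp
  qed
  have arc0: "\<phi>' n (cos t, sin t) = P (cos t, sin t)" for n t
  proof -
    have "norm (cos t, sin t) = 1" by (simp add: norm_Pair)
    moreover have "s * q < 1" using q s by (smt (verit) mult_less_cancel_left2 mult_left_le_one_le)
    ultimately have "\<Theta> (cos t, sin t) = 0" by (intro sup) simp
    then show ?thesis by (simp add: \<phi>'_def)
  qed
  show "w' \<in> Wmu \<gamma> \<mu>'"
    unfolding Wmu_def mem_Collect_eq
  proof (intro conjI exI[of _ \<phi>'] exI[of _ "\<lambda>t. P (cos t, sin t)"] allI)
    show "in_W12_2 Bplus w'" using W' by (auto simp: in_W12_2_def)
    show "AE t in lborel. t \<in> {0<..<pi} \<longrightarrow> P (cos t, sin t) \<le> 1 - \<gamma>" using arc by auto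
    show "(\<lambda>n. \<integral>\<^sup>+t\<in>{0<..<pi}. ennreal ((\<phi>' n (cos t, sin t) - P (cos t, sin t))^2) \<partial>lborel) \<longlonglongrightarrow> 0" by (simp add: arc0)
  qed (use s\<phi>' lim1 lim2' lim3 in auto)
  show "(\<lambda>n. grad_sq (\<phi>' n)) \<longlonglongrightarrow> dirichlet w'"
    unfolding dirichlet_eq[OF W']
    by (rule L2_norm_tendsto[OF _ grad2_measurable[OF s\<phi>'] mG' fG lim2]) simp
qed

subsection \<open>The glued competitor\<close>

text \<open>The argument is a squared radius, which keeps the radial cut-off smooth at the origin;
  the descent from 1 to \<open>exp 2\<close> is one unit of logarithmic radius. Squaring the step
  makes \<open>1 - cutoff\<close> a square, so the squared derivative is bounded by a multiple of
  \<open>1 - cutoff\<close>.\<close>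

definition cutoff :: "real \<Rightarrow> real" where
  "cutoff \<tau> = 1 - (smooth_step ((\<tau> - 1) / (exp 2 - 1)))\<^sup>2"

lemma exp2_gt1: "exp (2::real) - 1 > 0" by simp

lemma cutoff_has_deriv:
  "(cutoff has_real_derivative - (2 * smooth_step ((\<tau> - 1) / (exp 2 - 1)) * deriv smooth_step ((\<tau> - 1) / (exp 2 - 1)) / (exp 2 - 1))) (at \<tau>)"
proof -
  have 1: "((\<lambda>\<tau>. smooth_step ((\<tau> - 1) / (exp 2 - 1))) has_real_derivative deriv smooth_step ((\<tau> - 1) / (exp 2 - 1)) * (1 / (exp 2 - 1))) (at \<tau>)"
    by (rule DERIV_chain2[OF smooth_step_has_deriv]) (auto intro!: derivative_eq_intros)
  show ?thesis unfolding cutoff_def[abs_def]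
    by (rule derivative_eq_intros 1 refl | simp)+
qed

lemmas cutoff_deriv = DERIV_imp_deriv[OF cutoff_has_deriv]

lemma smooth_on_cutoff: "smooth_on UNIV cutoff"
proof -
  have "smooth_on UNIV (\<lambda>\<tau>. 1 / (exp 2 - 1) * (\<tau> - 1))" by (rule smooth_on_affine)
  then have "smooth_on UNIV (\<lambda>\<tau>. (\<tau> - 1) / (exp 2 - 1))" by simp
  then have "smooth_on UNIV (\<lambda>\<tau>. smooth_step ((\<tau> - 1) / (exp 2 - 1)))"
    by (intro smooth_on_comp[OF _ _ smooth_on_smooth_step]) auto
  then show ?thesis unfolding cutoff_def[abs_def] power2_eq_square
    by (intro smooth_on_diff smooth_on_mult) auto
qed

lemma cutoff_1: "\<tau> \<le> 1 \<Longrightarrow> cutoff \<tau> = 1"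
  using exp2_gt1 by (simp add: cutoff_def smooth_step_0 divide_nonpos_pos)

lemma cutoff_0: "exp 2 \<le> \<tau> \<Longrightarrow> cutoff \<tau> = 0"
  using exp2_gt1 by (simp add: cutoff_def smooth_step_1)

lemma cutoff_bounds: "0 \<le> cutoff \<tau>" "cutoff \<tau> \<le> 1"
  using smooth_step_bounds by (auto simp: cutoff_def power_le_one)

lemma cutoff_deriv_0: "\<tau> \<le> 1 \<or> \<tau> > exp 2 \<Longrightarrow> deriv cutoff \<tau> = 0"
  unfolding cutoff_deriv using exp2_gt1 deriv_smooth_step_outside[of "(\<tau> - 1) / (exp 2 - 1)"]
  by (auto simp: smooth_step_0 divide_nonpos_pos)

text \<open>The first bound uses that \<open>1 - cutoff\<close> is a square; it compensates a
  vanishing denominator in the wall energy. The second bounds the derivative in logarithmic radius: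
  with \<open>\<tau> = exp (2 * (s - b))\<close>, differentiation in \<open>s\<close> brings the
  factor \<open>2 * \<tau>\<close>.\<close>

lemma cutoff_deriv_bounds:
  obtains C where "C > 0" "\<And>\<tau>. (deriv cutoff \<tau>)^2 \<le> C * (1 - cutoff \<tau>)" "\<And>\<tau>. 0 \<le> \<tau> \<Longrightarrow> \<bar>deriv cutoff \<tau> * (2 * \<tau>)\<bar> \<le> C"
proof -
  obtain B where B: "B > 0" "\<And>t. \<bar>deriv smooth_step t\<bar> \<le> B" using smooth_step_deriv_bound by blast
  define e where "e = exp (2::real) - 1"
  have e: "e > 0" by (simp add: e_def)
  define C where "C = (2 * B / e)^2 + 2 * B / e * (2 * exp 2)"
  have 1: "(deriv cutoff \<tau>)^2 \<le> (2 * B / e)^2 * (1 - cutoff \<tau>)" for \<tau>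
  proof -
    let ?s = "smooth_step ((\<tau> - 1) / e)" and ?d = "deriv smooth_step ((\<tau> - 1) / e)"
    have "(deriv cutoff \<tau>)^2 = (2 * ?d / e)^2 * ?s^2"
      unfolding cutoff_deriv e_def[symmetric] by (simp add: power_mult_distrib power_divide)
    also have "\<dots> \<le> (2 * B / e)^2 * ?s^2"
      using B e by (intro mult_right_mono) (auto simp: power_divide power_mult_distrib divide_right_mono abs_le_square_iff[symmetric])
    finally show ?thesis by (simp add: cutoff_def e_def)
  qed
  have 2: "\<bar>deriv cutoff \<tau> * (2 * \<tau>)\<bar> \<le> 2 * B / e * (2 * exp 2)" if "0 \<le> \<tau>" for \<tau>
  proof (cases "\<tau> > exp 2")
    case True
    then show ?thesis using B e by (simp add: cutoff_deriv_0)
  next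
    case False
    let ?s = "smooth_step ((\<tau> - 1) / e)" and ?d = "deriv smooth_step ((\<tau> - 1) / e)"
    have "\<bar>deriv cutoff \<tau>\<bar> = 2 * (?s * \<bar>?d\<bar>) / e"
      unfolding cutoff_deriv e_def[symmetric] using smooth_step_bounds(1)[of "(\<tau> - 1) / e"] e by (simp add: abs_mult)
    also have "\<dots> \<le> 2 * (1 * B) / e"
      using smooth_step_bounds[of "(\<tau> - 1) / e"] B e by (intro divide_right_mono mult_left_mono mult_mono) auto
    finally have "\<bar>deriv cutoff \<tau>\<bar> * (2 * \<tau>) \<le> 2 * B / e * (2 * exp 2)"
      using False that B e by (intro mult_mono) auto
    then show ?thesis using that by (simp add: abs_mult)
  qed
  have p: "0 < (2 * B / e)^2" "0 < 2 * B / e * (2 * exp 2)" using B e by auto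
  show ?thesis
  proof (rule that)
    show "C > 0" unfolding C_def by (rule add_pos_pos[OF p])
    show "(deriv cutoff \<tau>)^2 \<le> C * (1 - cutoff \<tau>)" for \<tau>
    proof -
      have "(2 * B / e)^2 * (1 - cutoff \<tau>) \<le> C * (1 - cutoff \<tau>)"
        using p cutoff_bounds by (intro mult_right_mono) (auto simp: C_def)
      then show ?thesis using 1[of \<tau>] by linarith
    qed
    show "\<bar>deriv cutoff \<tau> * (2 * \<tau>)\<bar> \<le> C" if "0 \<le> \<tau>" for \<tau>
      unfolding C_def by (rule order_trans[OF 2[OF that]]) simp
  qed
qed

text \<open>As \<open>\<tau>\<close> is a squared radius, the second factor is \<open>c\<close> plus
  \<kappa> times the logarithm of the radius. The first factor vanishes for
  \<open>\<tau> <= 1\<close> and so removes the singularity of the logarithm.\<close>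

definition outer :: "real \<Rightarrow> real \<Rightarrow> real \<Rightarrow> real" where
  "outer c \<kappa> \<tau> = (1 - cutoff \<tau>) * (c + \<kappa> / 2 * ln \<tau>)"

lemma outer_0: "\<tau> \<le> 1 \<Longrightarrow> outer c \<kappa> \<tau> = 0" by (simp add: outer_def cutoff_1)

lemma smooth_on_outer: "smooth_on UNIV (outer c \<kappa>)"
proof -
  have "smooth_on {0<..} (outer c \<kappa>)"
    unfolding outer_def[abs_def]
    by (intro smooth_on_mult smooth_on_diff smooth_on_add smooth_on_const smooth_on_ln smooth_on_subset[OF smooth_on_cutoff]) auto
  moreover have "smooth_on {..<1} (outer c \<kappa>)"
    by (rule smooth_on_cong[OF _ smooth_on_const[of _ 0]]) (auto simp: outer_0)
  ultimately have "smooth_on ({0<..} \<union> {..<1}) (outer c \<kappa>)" by (rule smooth_on_Un)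
  moreover have "{0<..} \<union> {..<1} = (UNIV :: real set)" by auto
  ultimately show ?thesis by simp
qed

lemma outer_deriv:
  assumes "\<tau> > 0"
  shows "deriv (outer c \<kappa>) \<tau> = - deriv cutoff \<tau> * (c + \<kappa> / 2 * ln \<tau>) + (1 - cutoff \<tau>) * (\<kappa> / (2 * \<tau>))"
proof (rule DERIV_imp_deriv)
  have k: "(cutoff has_real_derivative deriv cutoff \<tau>) (at \<tau>)" using smooth_on_has_deriv[OF smooth_on_cutoff] by simp
  show "(outer c \<kappa> has_real_derivative - deriv cutoff \<tau> * (c + \<kappa> / 2 * ln \<tau>) + (1 - cutoff \<tau>) * (\<kappa> / (2 * \<tau>))) (at \<tau>)"
    unfolding outer_def[abs_def] using assms
    by (auto intro!: derivative_eq_intros k simp: field_simps)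
qed

definition sqn :: "pt \<Rightarrow> real" where "sqn x = (fst x)^2 + (snd x)^2"

lemma sqn_norm: "sqn x = (norm x)^2" by (simp add: sqn_def norm_pt_sq)

definition mult_part :: "real \<Rightarrow> real \<Rightarrow> pt \<Rightarrow> real" where
  "mult_part a R x = a * cutoff (sqn x / R^2)"

text \<open>Chosen together with \<open>mult_part\<close> so that, for the glued function
  \<open>w'\<close> and the cut-off \<open>k\<close>, \<open>1 - w'\<close> is \<open>a\<close>
  times the convex combination with weights \<open>k\<close> and \<open>1 - k\<close> of the shrunk
  \<open>1 - w\<close> and the logarithm.\<close>

definition add_part :: "real \<Rightarrow> real \<Rightarrow> real \<Rightarrow> real \<Rightarrow> pt \<Rightarrow> real" where
  "add_part a R c \<kappa> x = 1 - a * (cutoff (sqn x / R^2) + outer c \<kappa> (sqn x / R^2))"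

lemma smooth2_radial:
  assumes "smooth_on UNIV f"
  shows "smooth2 (\<lambda>x. f (sqn x / R^2))"
proof -
  have "smooth_on UNIV (\<lambda>t. (1 / R^2) * (t - 0))" by (rule smooth_on_affine)
  then have "smooth_on UNIV (\<lambda>t. f (t / R^2))"
    by (intro smooth_on_comp[OF _ _ assms]) auto
  from smooth2_comp[OF this smooth2_sqnorm] show ?thesis by (simp add: sqn_def)
qed

lemma smooth2_mult_part: "smooth2 (mult_part a R)"
  unfolding mult_part_def[abs_def] by (intro smooth2_mult smooth2_const smooth2_radial smooth_on_cutoff)

lemma smooth2_add_part: "smooth2 (add_part a R c \<kappa>)"
  unfolding add_part_def[abs_def]
  by (intro smooth2_diff smooth2_mult smooth2_add smooth2_const smooth2_radial smooth_on_cutoff smooth_on_outer)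

lemma sqn_polar: "sqn (polar p) = exp (2 * fst p)"
proof -
  have "sqn (polar p) = (exp (fst p))^2 * ((cos (snd p))^2 + (sin (snd p))^2)"
    unfolding sqn_def polar_def fst_conv snd_conv power_mult_distrib distrib_left by (rule refl)
  also have "\<dots> = exp (2 * fst p)" by (simp add: power2_eq_square flip: exp_add)
  finally show ?thesis .
qed

text \<open>The energy density in logarithmic coordinates of \<open>c + \<kappa> * (s - b) + k * (lp
  \<psi> - c - \<kappa> * (s - b))\<close>, where \<open>k\<close> is the cut-off. It has the form
  of the integrand bounded in \<open>strip_glue\<close>.\<close>

definition glue_en :: "real \<Rightarrow> real \<Rightarrow> real \<Rightarrow> (pt \<Rightarrow> real) \<Rightarrow> pt \<Rightarrow> real" where
  "glue_en b c \<kappa> \<psi> p = (\<kappa> + (cutoff (exp (2 * (fst p - b))) * (lp_s \<psi> p - \<kappa>)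
      + deriv cutoff (exp (2 * (fst p - b))) * (2 * exp (2 * (fst p - b))) * (lp \<psi> p - c - \<kappa> * (fst p - b))))^2
    + (cutoff (exp (2 * (fst p - b))) * lp_t \<psi> p)^2"

lemma cutoff_exp_has_deriv:
  "((\<lambda>s. cutoff (exp (2 * (s - b)))) has_real_derivative deriv cutoff (exp (2 * (s - b))) * (2 * exp (2 * (s - b)))) (at s)"
proof -
  have 1: "(cutoff has_real_derivative deriv cutoff t) (at t)" for t using smooth_on_has_deriv[OF smooth_on_cutoff] by simp
  have 2: "((\<lambda>s. exp (2 * (s - b))) has_real_derivative 2 * exp (2 * (s - b))) (at s)"
    by (auto intro!: derivative_eq_intros)
  show ?thesis by (rule DERIV_chain2[OF 1 2])
qed

lemma continuous_on_deriv_cutoff_exp: "continuous_on S (\<lambda>s. deriv cutoff (exp (2 * (s - b))) * (2 * exp (2 * (s - b))))"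
  by (intro continuous_intros continuous_on_compose2[OF smooth_on_continuous[OF smooth_on_deriv[OF smooth_on_cutoff], of UNIV]]) auto

lemma continuous_on_cutoff_exp: "continuous_on S (\<lambda>s. cutoff (exp (2 * (s - b))))"
  by (intro continuous_intros continuous_on_compose2[OF smooth_on_continuous[OF smooth_on_cutoff, of UNIV]]) auto

lemma continuous_glue_en:
  assumes "smooth2 \<psi>"
  shows "continuous_on UNIV (glue_en b c \<kappa> \<psi>)"
proof -
  have 1: "continuous_on UNIV (\<lambda>p::pt. cutoff (exp (2 * (fst p - b))))"
    by (rule continuous_on_compose2[OF continuous_on_cutoff_exp, of UNIV]) (auto intro!: continuous_intros)
  have 2: "continuous_on UNIV (\<lambda>p::pt. deriv cutoff (exp (2 * (fst p - b))) * (2 * exp (2 * (fst p - b))))"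
    by (rule continuous_on_compose2[OF continuous_on_deriv_cutoff_exp, of UNIV]) (auto intro!: continuous_intros)
  show ?thesis unfolding glue_en_def by (intro continuous_intros 1 2 continuous_on_lp assms)
qed

lemma strip_fun_lp: "smooth2 \<psi> \<Longrightarrow> strip_fun (lp \<psi>) (lp_s \<psi>) (lp_t \<psi>)"
  unfolding strip_fun_def using continuous_on_lp lp_deriv by blast

text \<open>Shrinking by \<open>exp (- T)\<close> is a translation by \<open>T\<close> in
  \<open>s\<close>, so the energy over \<open>s < 0\<close> becomes an energy over
  \<open>s < T\<close>. To the left of \<open>b\<close> the cut-off is 1 and the original energy
  reappears unchanged.\<close>

lemma glue_strip_en:
  fixes \<phi> :: "pt \<Rightarrow> real" and a b c \<kappa> T :: real
  assumes \<phi>: "smooth2 \<phi>" and bT: "b \<le> T"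
  defines "\<phi>' \<equiv> \<lambda>x. add_part a (exp (b - T)) c \<kappa> x + mult_part a (exp (b - T)) x * \<phi> ((1 / exp (- T)) *\<^sub>R x)"
    and "\<psi> \<equiv> \<lambda>x. 1 - \<phi> x"
  shows "strip_en \<phi>' {..<0} = ennreal (a^2) * (strip_en \<psi> {..<b} + ennreal (integral (rect b T) (glue_en b c \<kappa> \<psi>)))"
proof -
  have s\<psi>: "smooth2 \<psi>" unfolding \<psi>_def by (intro smooth2_diff smooth2_const \<phi>)
  have s\<phi>': "smooth2 \<phi>'" unfolding \<phi>'_def by (intro smooth2_add smooth2_mult smooth2_add_part smooth2_mult_part smooth2_scale \<phi>)
  let ?k = "\<lambda>s. cutoff (exp (2 * (s - b)))" and ?k' = "\<lambda>s. deriv cutoff (exp (2 * (s - b))) * (2 * exp (2 * (s - b)))"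
  have lp: "lp \<phi>' (s, t) = 1 - a * (c + \<kappa> * (s + T - b) + ?k (s + T) * (lp \<psi> (s + T, t) - c - \<kappa> * (s + T - b)))" for s t
  proof -
    have 1: "(1 / exp (- T)) *\<^sub>R polar (s, t) = polar (s + T, t)"
      by (simp add: polar_def exp_add exp_minus divide_inverse algebra_simps)
    have 2: "sqn (polar (s, t)) / (exp (b - T))^2 = exp (2 * (s + T - b))"
      by (simp add: sqn_polar power2_eq_square divide_inverse flip: exp_add exp_minus)
    have "lp \<phi>' (s, t) = 1 - a * (?k (s + T) + (1 - ?k (s + T)) * (c + \<kappa> / 2 * (2 * (s + T - b)))) + a * ?k (s + T) * \<phi> (polar (s + T, t))"
      unfolding lp_def \<phi>'_def add_part_def mult_part_def outer_def 1 2 by simp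
    then show ?thesis unfolding lp_def \<psi>_def by (simp add: algebra_simps)
  qed
  have ps: "lp_s \<phi>' (s, t) = - a * (\<kappa> + (?k (s + T) * (lp_s \<psi> (s + T, t) - \<kappa>) + ?k' (s + T) * (lp \<psi> (s + T, t) - c - \<kappa> * (s + T - b))))" for s t
  proof (rule DERIV_unique[OF lp_deriv(1)[OF s\<phi>']])
    have k: "((\<lambda>s. ?k (s + T)) has_real_derivative ?k' (s + T)) (at s)"
      using cutoff_exp_has_deriv[of b "s + T"] DERIV_shift[of "\<lambda>s. cutoff (exp (2 * (s - b)))" _ s T] by blast
    have l: "((\<lambda>s. lp \<psi> (s + T, t)) has_real_derivative lp_s \<psi> (s + T, t)) (at s)"
      using lp_deriv(1)[OF s\<psi>, of t "s + T"] DERIV_shift[of "\<lambda>s. lp \<psi> (s, t)" _ s T] by blast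
    show "((\<lambda>s. lp \<phi>' (s, t)) has_real_derivative - a * (\<kappa> + (?k (s + T) * (lp_s \<psi> (s + T, t) - \<kappa>) + ?k' (s + T) * (lp \<psi> (s + T, t) - c - \<kappa> * (s + T - b))))) (at s)"
      unfolding lp by (rule derivative_eq_intros k l refl | simp)+
  qed
  have pt: "lp_t \<phi>' (s, t) = - a * (?k (s + T) * lp_t \<psi> (s + T, t))" for s t
  proof (rule DERIV_unique[OF lp_deriv(2)[OF s\<phi>']])
    show "((\<lambda>t. lp \<phi>' (s, t)) has_real_derivative - a * (?k (s + T) * lp_t \<psi> (s + T, t))) (at t)"
      unfolding lp by (rule derivative_eq_intros lp_deriv(2)[OF s\<psi>] refl | simp)+
  qed
  have en: "lp_en \<phi>' (s, t) = a^2 * glue_en b c \<kappa> \<psi> (T + s, t)" for s t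
  proof -
    have sq: "(- a * X)^2 + (- a * Y)^2 = a^2 * (X^2 + Y^2)" for X Y by algebra
    show ?thesis unfolding lp_en_def ps pt glue_en_def fst_conv add.commute[of T s] by (rule sq)
  qed
  have cE: "continuous_on UNIV (glue_en b c \<kappa> \<psi>)" by (rule continuous_glue_en[OF s\<psi>])
  have nE: "glue_en b c \<kappa> \<psi> p \<ge> 0" for p by (simp add: glue_en_def)
  have [measurable]: "glue_en b c \<kappa> \<psi> \<in> borel_measurable (borel \<Otimes>\<^sub>M borel)"
    using borel_measurable_continuous_onI[OF cE] by (simp add: borel_prod)
  define j where "j s = (\<integral>\<^sup>+t. ennreal (glue_en b c \<kappa> \<psi> (s, t)) * indicator {0<..<pi} t \<partial>lborel)" for s
  have [measurable]: "j \<in> borel_measurable borel" unfolding j_def by measurable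
  have "strip_en \<phi>' {..<0} = (\<integral>\<^sup>+s. ennreal (a^2) * (j (T + 1 * s) * indicator {..<T} (T + 1 * s)) \<partial>lborel)"
    unfolding strip_en_def
  proof (rule nn_integral_cong)
    fix s
    have "(\<integral>\<^sup>+t. ennreal (lp_en \<phi>' (s, t)) * indicator {0<..<pi} t \<partial>lborel) = (\<integral>\<^sup>+t. ennreal (a^2) * (ennreal (glue_en b c \<kappa> \<psi> (T + s, t)) * indicator {0<..<pi} t) \<partial>lborel)"
      by (rule nn_integral_cong) (simp add: en ennreal_mult nE mult.assoc)
    also have "\<dots> = ennreal (a^2) * j (T + s)" unfolding j_def by (rule nn_integral_cmult) measurable
    finally show "(\<integral>\<^sup>+t. ennreal (lp_en \<phi>' (s, t)) * indicator {0<..<pi} t \<partial>lborel) * indicator {..<0} s = ennreal (a^2) * (j (T + 1 * s) * indicator {..<T} (T + 1 * s))"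
      by (simp add: indicator_def)
  qed
  also have "\<dots> = ennreal (a^2) * (\<integral>\<^sup>+s. j (T + 1 * s) * indicator {..<T} (T + 1 * s) \<partial>lborel)"
    by (rule nn_integral_cmult) measurable
  also have "(\<integral>\<^sup>+s. j (T + 1 * s) * indicator {..<T} (T + 1 * s) \<partial>lborel) = (\<integral>\<^sup>+s. j s * indicator {..<T} s \<partial>lborel)"
    using nn_integral_real_affine[of "\<lambda>s. j s * indicator {..<T} s" 1 T] by simp
  also have "\<dots> = (\<integral>\<^sup>+s. j s * indicator {..<b} s + j s * indicator {b..<T} s \<partial>lborel)"
    using bT by (intro nn_integral_cong) (auto simp: indicator_def)
  also have "\<dots> = (\<integral>\<^sup>+s. j s * indicator {..<b} s \<partial>lborel) + (\<integral>\<^sup>+s. j s * indicator {b..<T} s \<partial>lborel)"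
    by (rule nn_integral_add) measurable
  also have "(\<integral>\<^sup>+s. j s * indicator {b..<T} s \<partial>lborel) = ennreal (integral (rect b T) (glue_en b c \<kappa> \<psi>))"
    unfolding j_def by (rule nn_integral_strip_continuous[OF cE nE])
  also have "(\<integral>\<^sup>+s. j s * indicator {..<b} s \<partial>lborel) = strip_en \<psi> {..<b}"
    unfolding strip_en_def
  proof (rule nn_integral_cong)
    fix s
    have "glue_en b c \<kappa> \<psi> (s, t) = lp_en \<psi> (s, t)" if "s < b" for t
      using that by (simp add: glue_en_def lp_en_def cutoff_1 cutoff_deriv_0)
    then show "j s * indicator {..<b} s = (\<integral>\<^sup>+t. ennreal (lp_en \<psi> (s, t)) * indicator {0<..<pi} t \<partial>lborel) * indicator {..<b} s"
      by (simp add: j_def indicator_def)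
  qed
  finally show ?thesis .
qed

subsection \<open>Boundary averages\<close>

text \<open>The traces converge in \<open>L^2\<close> with respect to \<open>x = exp s\<close>,
  while the average is taken in \<open>s\<close>. On \<open>{b..b+1}\<close> one has
  \<open>ds <= exp (- b) dx\<close>, so convergence in \<open>L^1\<close> of the traces
  suffices.\<close>

lemma flat_average_tendsto:
  assumes a: "approx w \<mu> \<phi>" and c: "continuous_on {-1..1} \<mu>" and m: "set_borel_measurable lborel I1 \<mu>" and b: "b + 1 < 0"
  shows "(\<lambda>n. integral {b..b+1} (\<lambda>s. \<phi> n (exp s, 0))) \<longlonglongrightarrow> integral {b..b+1} (\<lambda>s. \<mu> (exp s))"
proof -
  have s\<phi>: "smooth2 (\<phi> n)" for n using a by (simp add: approx_def)
  have cl: "continuous_on S (\<lambda>t. \<phi> n (t, 0))" for S n by (rule smooth_on_continuous[THEN continuous_on_subset, OF smooth2_line[OF s\<phi>], of _ UNIV]) simp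
  have md: "set_borel_measurable lborel I1 (\<lambda>t. \<phi> n (t, 0) - \<mu> t)" for n
    by (rule set_measurable_diff[OF _ m]) (auto intro: smooth_on_measurable[OF smooth2_line[OF s\<phi>]])
  have fin: "emeasure lborel I1 < \<infinity>" by simp
  note L = L2_null_imp_L1_null[OF _ fin md]
  have lim: "(\<lambda>n. LINT t:I1|lborel. \<bar>\<phi> n (t, 0) - \<mu> t\<bar>) \<longlonglongrightarrow> 0"
    by (rule L(1)) (use a in \<open>auto simp: approx_def\<close>)
  have int: "\<forall>\<^sub>F n in sequentially. set_integrable lborel I1 (\<lambda>t. \<phi> n (t, 0) - \<mu> t)"
    by (rule L(2)) (use a in \<open>auto simp: approx_def\<close>)
  have sub: "{exp b..exp (b + 1)} \<subseteq> I1"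
  proof -
    have 1: "exp (b + 1) < 1" using b by simp
    show ?thesis
    proof
      fix x assume "x \<in> {exp b..exp (b + 1)}"
      then have "exp b \<le> x" "x \<le> exp (b + 1)" by auto
      then have "0 < x" "x < 1" using 1 exp_gt_zero[of b] by linarith+
      then show "x \<in> I1" by simp
    qed
  qed
  have cm: "continuous_on {exp b..exp (b+1)} \<mu>" by (rule continuous_on_subset[OF c]) (use sub in force)
  have ce: "continuous_on {b..b+1} (\<lambda>s. \<mu> (exp s))"
    by (rule continuous_on_compose2[OF cm]) (auto intro!: continuous_intros)
  have cp: "continuous_on {b..b+1} (\<lambda>s. \<phi> n (exp s, 0))" for n
    by (rule continuous_on_compose2[OF cl[of UNIV]]) (auto intro!: continuous_intros)
  have "(\<lambda>n. exp (- b) * (LINT t:I1|lborel. \<bar>\<phi> n (t, 0) - \<mu> t\<bar>)) \<longlonglongrightarrow> exp (- b) * 0"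
    by (intro tendsto_mult tendsto_const lim)
  then have z: "(\<lambda>n. exp (- b) * (LINT t:I1|lborel. \<bar>\<phi> n (t, 0) - \<mu> t\<bar>)) \<longlonglongrightarrow> 0" by simp
  have "(\<lambda>n. integral {b..b+1} (\<lambda>s. \<phi> n (exp s, 0)) - integral {b..b+1} (\<lambda>s. \<mu> (exp s))) \<longlonglongrightarrow> 0"
  proof (rule Lim_null_comparison[OF _ z])
    show "\<forall>\<^sub>F n in sequentially. norm (integral {b..b+1} (\<lambda>s. \<phi> n (exp s, 0)) - integral {b..b+1} (\<lambda>s. \<mu> (exp s))) \<le> exp (- b) * (LINT t:I1|lborel. \<bar>\<phi> n (t, 0) - \<mu> t\<bar>)"
      using int
    proof eventually_elim
      case (elim n)
      let ?d = "\<lambda>t. \<bar>\<phi> n (t, 0) - \<mu> t\<bar>"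
      have cd: "continuous_on {exp b..exp (b+1)} ?d" by (intro continuous_intros cl cm)
      have ced: "continuous_on {b..b+1} (\<lambda>s. ?d (exp s))" by (intro continuous_intros ce cp)
      have "integral {b..b+1} (\<lambda>s. \<phi> n (exp s, 0)) - integral {b..b+1} (\<lambda>s. \<mu> (exp s)) = integral {b..b+1} (\<lambda>s. \<phi> n (exp s, 0) - \<mu> (exp s))"
        by (rule integral_diff[symmetric]) (intro integrable_continuous_real ce cp)+
      then have "norm (integral {b..b+1} (\<lambda>s. \<phi> n (exp s, 0)) - integral {b..b+1} (\<lambda>s. \<mu> (exp s))) \<le> integral {b..b+1} (\<lambda>s. ?d (exp s))"
        by (simp only:) (rule integral_norm_bound_integral, auto intro!: integrable_continuous_real continuous_intros ce cp)
      also have "\<dots> \<le> integral {b..b+1} (\<lambda>s. exp (- b) * (exp s * ?d (exp s)))"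
      proof (rule integral_le)
        show "?d (exp s) \<le> exp (- b) * (exp s * ?d (exp s))" if "s \<in> {b..b+1}" for s
        proof -
          have "1 * ?d (exp s) \<le> exp (s - b) * ?d (exp s)" using that by (intro mult_right_mono) auto
          then show ?thesis by (simp add: mult.assoc[symmetric] flip: exp_add)
        qed
      qed (intro integrable_continuous_real continuous_intros ced)+
      also have "\<dots> = exp (- b) * integral {b..b+1} (\<lambda>s. exp s * ?d (exp s))" by simp
      also have "integral {b..b+1} (\<lambda>s. exp s * ?d (exp s)) = integral {exp b..exp (b+1)} ?d"
      proof (rule integral_unique)
        have "((\<lambda>s. exp s *\<^sub>R ?d (exp s)) has_integral integral {exp b..exp (b+1)} ?d) {b..b+1}"
          by (rule has_integral_substitution[OF _ _ _ cd]) (auto intro!: derivative_eq_intros DERIV_subset[OF DERIV_exp])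
        then show "((\<lambda>s. exp s * ?d (exp s)) has_integral integral {exp b..exp (b+1)} ?d) {b..b+1}" by simp
      qed
      also have "integral {exp b..exp (b+1)} ?d = (LINT t:{exp b..exp (b+1)}|lborel. ?d t)"
        by (rule set_borel_integral_eq_integral(2)[symmetric])
           (rule set_integrable_subset[OF set_integrable_abs[OF elim]], use sub in auto)
      also have "\<dots> \<le> (LINT t:I1|lborel. ?d t)"
      proof -
        have 1: "set_integrable lborel I1 ?d" by (rule set_integrable_abs[OF elim])
        have 2: "set_integrable lborel {exp b..exp (b+1)} ?d" by (rule set_integrable_subset[OF 1]) (use sub in auto)
        have "indicator {exp b..exp (b+1)} t *\<^sub>R ?d t \<le> indicator I1 t *\<^sub>R ?d t" for t
          using subsetD[OF sub, of t] by (cases "t \<in> {exp b..exp (b+1)}") auto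
        then show ?thesis using 1 2 unfolding set_lebesgue_integral_def set_integrable_def by (intro integral_mono)
      qed
      finally show ?case by simp
    qed
  qed
  then show ?thesis by (simp add: LIM_zero_iff)
qed

text \<open>Approximants may exceed \<open>1 - \<gamma>\<close> on the arc. The \<open>L^1\<close>
  norm of that excess serves as the null sequence by which the integral over the arc can miss
  \<open>pi * \<gamma>\<close>.\<close>

lemma arc_deficit_tendsto:
  assumes s: "\<And>n. smooth2 (\<phi> n)" and a: "arc_below \<gamma> \<phi>"
  shows "\<exists>\<delta>. \<delta> \<longlonglongrightarrow> 0 \<and> (\<forall>\<^sub>F n in sequentially. pi * \<gamma> - \<delta> n \<le> integral {0..pi} (\<lambda>t. lp (\<lambda>x. 1 - \<phi> n x) (0, t)))"
proof -
  let ?h = "\<lambda>n t. max 0 (\<phi> n (cos t, sin t) - (1 - \<gamma>))"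
  have c: "continuous_on S (\<lambda>t. \<phi> n (cos t, sin t))" for n S
    by (rule continuous_on_compose2[OF smooth2_continuous[OF s, of UNIV]]) (auto intro!: continuous_intros)
  have ch: "continuous_on S (?h n)" for n S by (intro continuous_intros c)
  have m: "set_borel_measurable lborel {0<..<pi} (?h n)" for n
    unfolding set_borel_measurable_def using borel_measurable_continuous_onI[OF ch[of UNIV n]] by measurable
  have f: "emeasure lborel {0<..<pi} < \<infinity>" by simp
  note L = L2_null_imp_L1_null[OF _ f m a[unfolded arc_below_def]]
  let ?\<delta> = "\<lambda>n. LINT t:{0<..<pi}|lborel. \<bar>?h n t\<bar>"
  have "pi * \<gamma> - ?\<delta> n \<le> integral {0..pi} (\<lambda>t. lp (\<lambda>x. 1 - \<phi> n x) (0, t))" for n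
  proof -
    have si: "set_integrable lborel {0..pi} (?h n)"
      unfolding set_integrable_def by (rule borel_integrable_compact[OF _ ch]) simp
    have "?\<delta> n = (LINT t:{0..pi}|lborel. ?h n t)"
    proof -
      have "AE t in lborel. indicator {0<..<pi} t *\<^sub>R \<bar>?h n t\<bar> = indicator {0..pi} t *\<^sub>R ?h n t"
        using AE_lborel_singleton[of "0::real"] AE_lborel_singleton[of pi] by eventually_elim (auto simp: indicator_def)
      then show ?thesis unfolding set_lebesgue_integral_def
        using borel_measurable_continuous_onI[OF ch[of UNIV n]] by (intro integral_cong_AE) auto
    qed
    also have "\<dots> = integral {0..pi} (?h n)" by (rule set_borel_integral_eq_integral(2)[OF si])
    finally have e: "?\<delta> n = integral {0..pi} (?h n)" .
    have "pi * \<gamma> - ?\<delta> n = integral {0..pi} (\<lambda>t. \<gamma> - ?h n t)"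
      unfolding e by (subst integral_diff) (auto intro!: integrable_continuous_real ch)
    also have "\<dots> \<le> integral {0..pi} (\<lambda>t. 1 - \<phi> n (cos t, sin t))"
      by (rule integral_le) (auto intro!: integrable_continuous_real continuous_intros ch c)
    finally show ?thesis by (simp add: lp_def polar_def)
  qed
  then show ?thesis using L(1) by (intro exI[of _ ?\<delta>]) auto
qed

lemma grad_one_minus:
  assumes "smooth2 \<phi>"
  shows "strip_en (\<lambda>x. 1 - \<phi> x) {..<0} = grad_sq \<phi>"
proof -
  have s: "smooth2 (\<lambda>x. 1 - \<phi> x)" by (intro smooth2_diff smooth2_const assms)
  have "grad2 (\<lambda>x. 1 - \<phi> x) x = - grad2 \<phi> x" for x
  proof -
    have "((\<lambda>x. 1 - \<phi> x) has_derivative (\<lambda>h. fst h * (- pd True \<phi> x) + snd h * (- pd False \<phi> x))) (at x)"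
      by (rule has_derivative_eq_rhs[OF has_derivative_diff[OF has_derivative_const has_derivative_grad2[OF smooth2_differentiable[OF assms]]]])
         (auto simp: algebra_simps)
    from pd_unique[OF this] show ?thesis by (simp add: grad2_def)
  qed
  then show ?thesis unfolding nn_integral_grad_Bplus[OF s, symmetric] by simp
qed

lemma mult_part_support:
  assumes "exp (- T) * exp (b + 1) \<le> norm x"
  shows "mult_part a (exp (b - T)) x = 0"
proof -
  have "exp (- T) * exp (b + 1) = exp 1 * exp (b - T)" by (simp flip: exp_add)
  then have "exp 1 * exp (b - T) \<le> norm x" using assms by simp
  then have "(exp 1 * exp (b - T))^2 \<le> (norm x)^2" by (intro power_mono) auto
  moreover have "(exp (1::real))^2 = exp 2" by (simp add: power2_eq_square flip: exp_add)
  ultimately have "exp 2 \<le> sqn x / (exp (b - T))^2" by (simp add: sqn_norm power_mult_distrib field_simps)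
  then show ?thesis by (simp add: mult_part_def cutoff_0)
qed

lemma add_part_unit:
  assumes "sqn x = 1" "b + 1 \<le> T"
  shows "add_part a (exp (b - T)) c \<kappa> x = 1 - a * (c + \<kappa> * (T - b))"
proof -
  have "1 / (exp (b - T))^2 = exp (2 * (T - b))"
    by (simp add: power2_eq_square divide_inverse flip: exp_add exp_minus)
  then have t: "sqn x / (exp (b - T))^2 = exp (2 * (T - b))" using assms(1) by simp
  have "cutoff (exp (2 * (T - b))) = 0" using assms(2) by (intro cutoff_0) simp
  then show ?thesis unfolding add_part_def outer_def t by (simp add: algebra_simps)
qed

text \<open>The constant \<open>c\<close> is read off from \<mu>, whereas the strip estimates see
  the trace of an approximant. Their difference is the quantity \<open>d\<close> of
  \<open>strip_glue\<close>, which therefore disappears in the limit.\<close>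

lemma flat_deviation_tendsto:
  assumes ap: "approx w \<mu> \<phi>" and c\<mu>: "continuous_on {-1..1} \<mu>" and m\<mu>: "set_borel_measurable lborel I1 \<mu>"
    and b: "b + 1 < 0" and cdef: "c = integral {b..b+1} (\<lambda>s. (1 - \<mu> (exp s)) - lm * (s - b))"
  shows "(\<lambda>n. integral {b..b+1} (\<lambda>s. lp (\<lambda>x. 1 - \<phi> n x) (s, 0) - lm * (s - b)) - c) \<longlonglongrightarrow> 0"
proof -
  let ?d = "\<lambda>n. integral {b..b+1} (\<lambda>s. lp (\<lambda>x. 1 - \<phi> n x) (s, 0) - lm * (s - b)) - c"
  have s\<phi>: "smooth2 (\<phi> n)" for n using ap by (simp add: approx_def)
  have sub: "{exp b..exp (b + 1)} \<subseteq> {-1..1}"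
  proof
    fix x assume "x \<in> {exp b..exp (b + 1)}"
    then have "exp b \<le> x" "x \<le> exp (b + 1)" by auto
    moreover have "exp (b + 1) < 1" using b by simp
    ultimately have "0 < x" "x < 1" using exp_gt_zero[of b] by linarith+
    then show "x \<in> {-1..1}" by simp
  qed
  have ce: "continuous_on {b..b+1} (\<lambda>s. \<mu> (exp s))"
  proof (rule continuous_on_compose2[OF c\<mu>])
    show "continuous_on {b..b+1} exp" by (intro continuous_intros)
    have "exp ` {b..b+1} \<subseteq> {exp b..exp (b + 1)}" by auto
    then show "exp ` {b..b+1} \<subseteq> {-1..1}" using sub by blast
  qed
  have cp: "continuous_on {b..b+1} (\<lambda>s. \<phi> n (exp s, 0))" for n
    by (rule continuous_on_compose2[OF smooth_on_continuous[OF smooth2_line[OF s\<phi>], of UNIV]]) (auto intro!: continuous_intros)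
  have deq: "?d n = integral {b..b+1} (\<lambda>s. \<mu> (exp s)) - integral {b..b+1} (\<lambda>s. \<phi> n (exp s, 0))" for n
  proof -
    have "?d n = integral {b..b+1} (\<lambda>s. (1 - \<phi> n (exp s, 0)) - lm * (s - b)) - integral {b..b+1} (\<lambda>s. (1 - \<mu> (exp s)) - lm * (s - b))"
      by (subst cdef) (simp add: lp_def polar_def)
    also have "\<dots> = integral {b..b+1} (\<lambda>s. ((1 - \<phi> n (exp s, 0)) - lm * (s - b)) - ((1 - \<mu> (exp s)) - lm * (s - b)))"
      by (rule integral_diff[symmetric]) (intro integrable_continuous_real continuous_intros ce cp)+
    also have "\<dots> = integral {b..b+1} (\<lambda>s. \<mu> (exp s) - \<phi> n (exp s, 0))" by (simp add: algebra_simps)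
    also have "\<dots> = integral {b..b+1} (\<lambda>s. \<mu> (exp s)) - integral {b..b+1} (\<lambda>s. \<phi> n (exp s, 0))"
      by (rule integral_diff) (intro integrable_continuous_real ce cp)+
    finally show ?thesis .
  qed
  have "(\<lambda>n. integral {b..b+1} (\<lambda>s. \<mu> (exp s)) - integral {b..b+1} (\<lambda>s. \<phi> n (exp s, 0))) \<longlonglongrightarrow> integral {b..b+1} (\<lambda>s. \<mu> (exp s)) - integral {b..b+1} (\<lambda>s. \<mu> (exp s))"
    by (intro tendsto_diff tendsto_const flat_average_tendsto[OF ap c\<mu> m\<mu> b])
  then show ?thesis by (simp add: deq)
qed

text \<open>Outside radius \<open>exp b\<close> the old energy is discarded and the new one
  inserted. \<open>strip_glue\<close> bounds the former below and the latter above for every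
  approximant, and the bound \<open>\<eta>b\<close> is uniform, so the limit can be taken. The last
  conclusion makes the real bound usable as an \<open>ennreal\<close>.\<close>

lemma glue_dirichlet:
  fixes w :: "pt \<Rightarrow> real" and \<mu> :: "real \<Rightarrow> real" and \<phi> :: "nat \<Rightarrow> pt \<Rightarrow> real" and a b c \<gamma> \<kappa> lm T C \<eta>b :: real
  assumes w: "in_W12_2 Bplus w" and ap: "approx w \<mu> \<phi>" and arcb: "arc_below \<gamma> \<phi>"
    and c\<mu>: "continuous_on {-1..1} \<mu>" and m\<mu>: "set_borel_measurable lborel I1 \<mu>"
    and b: "b + 1 < 0" and T: "0 \<le> T" and lm: "lm \<ge> 0" and \<kappa>: "\<kappa> \<ge> 0" and a: "a > 0"
    and arc: "a * (c + \<kappa> * (T - b)) = \<gamma>"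
    and cdef: "c = integral {b..b+1} (\<lambda>s. (1 - \<mu> (exp s)) - lm * (s - b))"
    and \<eta>: "\<And>n. integral (rect b (b+1)) (\<lambda>p. (lp_s (\<lambda>x. 1 - \<phi> n x) p - lm)^2 + (lp_t (\<lambda>x. 1 - \<phi> n x) p)^2) \<le> \<eta>b"
    and C: "\<And>\<tau>. 0 \<le> \<tau> \<Longrightarrow> \<bar>deriv cutoff \<tau> * (2 * \<tau>)\<bar> \<le> C"
  defines "Qb \<equiv> (4 + 16 * pi^2 * C^2) * \<eta>b + 4 * pi * (1 + C^2) * (lm - \<kappa>)^2"
    and "w' \<equiv> \<lambda>x. add_part a (exp (b - T)) c \<kappa> x + mult_part a (exp (b - T)) x * w ((1 / exp (- T)) *\<^sub>R x)"
    and "\<mu>' \<equiv> \<lambda>t. add_part a (exp (b - T)) c \<kappa> (t, 0) + mult_part a (exp (b - T)) (t, 0) * \<mu> (t / exp (- T))"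
  shows "w' \<in> Wmu \<gamma> \<mu>'"
    and "dirichlet w' \<le> ennreal (a^2 * (enn2real (dirichlet w) + lm^2 * pi * b - 2 * lm * (pi * \<gamma> - pi * c + pi * lm * b)
      + 2 * (lm + \<kappa>) * sqrt (pi * Qb) + \<kappa>^2 * pi * (T - b) + Qb))"
    and "0 \<le> enn2real (dirichlet w) + lm^2 * pi * b - 2 * lm * (pi * \<gamma> - pi * c + pi * lm * b)
      + 2 * (lm + \<kappa>) * sqrt (pi * Qb) + \<kappa>^2 * pi * (T - b) + Qb"
proof -
  have s\<phi>: "smooth2 (\<phi> n)" for n using ap by (simp add: approx_def)
  define \<psi> where "\<psi> n = (\<lambda>x. 1 - \<phi> n x)" for n
  have s\<psi>: "smooth2 (\<psi> n)" for n unfolding \<psi>_def by (intro smooth2_diff smooth2_const s\<phi>)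
  define \<phi>' where "\<phi>' n = (\<lambda>x. add_part a (exp (b - T)) c \<kappa> x + mult_part a (exp (b - T)) x * \<phi> n ((1 / exp (- T)) *\<^sub>R x))" for n
  have s\<phi>': "smooth2 (\<phi>' n)" for n unfolding \<phi>'_def by (intro smooth2_add smooth2_mult smooth2_add_part smooth2_mult_part smooth2_scale s\<phi>)
  have arc1: "add_part a (exp (b - T)) c \<kappa> (cos t, sin t) \<le> 1 - \<gamma>" for t
    using add_part_unit[of "(cos t, sin t)" b T a c \<kappa>] arc b T by (simp add: sqn_def)
  note R = competitor_rescale[OF w ap m\<mu> smooth2_add_part smooth2_mult_part, of "exp (- T)" "exp (b + 1)" a "exp (b - T)", OF _ _ _ _ arc1]
  show "w' \<in> Wmu \<gamma> \<mu>'"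
    unfolding w'_def \<mu>'_def using T b mult_part_support by (intro R(1)) auto
  have lim': "(\<lambda>n. grad_sq (\<phi>' n)) \<longlonglongrightarrow> dirichlet w'"
    unfolding w'_def \<phi>'_def using T b mult_part_support by (intro R(2)) auto
  define Dn where "Dn n = enn2real (grad_sq (\<phi> n))" for n
  have Dn: "grad_sq (\<phi> n) = ennreal (Dn n)" "Dn n \<ge> 0" for n
    using nn_integral_grad_Bplus_finite[OF s\<phi>, of n] by (auto simp: Dn_def less_top)
  have Dlim: "Dn \<longlonglongrightarrow> enn2real (dirichlet w)"
    unfolding Dn_def by (rule tendsto_enn2real) (use approx_dirichlet[OF w ap] in auto)
  obtain \<delta> where \<delta>: "\<delta> \<longlonglongrightarrow> 0" "\<forall>\<^sub>F n in sequentially. pi * \<gamma> - \<delta> n \<le> integral {0..pi} (\<lambda>t. lp (\<psi> n) (0, t))"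
    using arc_deficit_tendsto[OF s\<phi> arcb] unfolding \<psi>_def by blast
  define d where "d n = integral {b..b+1} (\<lambda>s. lp (\<psi> n) (s, 0) - lm * (s - b)) - c" for n
  have dlim: "d \<longlonglongrightarrow> 0"
    unfolding d_def[abs_def] \<psi>_def by (rule flat_deviation_tendsto[OF ap c\<mu> m\<mu> b cdef])
  \<comment> \<open>\<open>Qb\<close> is the quantity \<open>Q\<close> of \<open>strip_glue\<close>
    at \<open>d = 0\<close>, with \<open>\<eta>b\<close> in place of the integral; the additional
    term tends to zero with \<open>d n\<close>.\<close>
  define Rn where "Rn n = Qb + 8 * pi * C^2 * (d n)^2" for n
  define X where "X n = Dn n + lm^2 * pi * b - 2 * lm * (pi * \<gamma> - \<delta> n - pi * c + pi * lm * b)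
      + 2 * (lm + \<kappa>) * sqrt (pi * Rn n) + \<kappa>^2 * pi * (T - b) + Rn n" for n
  have Rlim: "Rn \<longlonglongrightarrow> Qb"
  proof -
    have "Rn \<longlonglongrightarrow> Qb + 8 * pi * C^2 * 0^2" unfolding Rn_def by (intro tendsto_intros dlim)
    then show ?thesis by simp
  qed
  have Xlim: "(\<lambda>n. ennreal (a^2 * X n)) \<longlonglongrightarrow> ennreal (a^2 * (enn2real (dirichlet w) + lm^2 * pi * b - 2 * lm * (pi * \<gamma> - 0 - pi * c + pi * lm * b)
      + 2 * (lm + \<kappa>) * sqrt (pi * Qb) + \<kappa>^2 * pi * (T - b) + Qb))"
    unfolding X_def by (intro tendsto_ennrealI tendsto_intros Dlim \<delta>(1) Rlim)
  have le: "\<forall>\<^sub>F n in sequentially. (grad_sq (\<phi>' n)) \<le> ennreal (a^2 * X n) \<and> 0 \<le> X n"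
    using \<delta>(2)
  proof eventually_elim
    case (elim n)
    let ?ct = "\<lambda>s. cutoff (exp (2 * (s - b)))" and ?ct' = "\<lambda>s. deriv cutoff (exp (2 * (s - b))) * (2 * exp (2 * (s - b)))"
    have ct1: "?ct s = 1" if "s \<le> b" for s using that by (intro cutoff_1) simp
    have ct0: "?ct s = 0" if "b + 1 \<le> s" for s using that by (intro cutoff_0) simp
    have ctC: "\<bar>?ct' s\<bar> \<le> C" for s by (rule C) simp
    note G = strip_glue[where b = b and T = T and c = c, OF strip_fun_lp[OF s\<psi>[of n]] _ _ cutoff_exp_has_deriv continuous_on_deriv_cutoff_exp ct1 ct0 cutoff_bounds(1) cutoff_bounds(2) ctC lm \<kappa>]
    define \<eta>n where "\<eta>n = integral (rect b (b+1)) (\<lambda>p. (lp_s (\<psi> n) p - lm)^2 + (lp_t (\<psi> n) p)^2)"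
    define Q where "Q = (4 + 16 * pi^2 * C^2) * \<eta>n + 8 * pi * C^2 * (d n)^2 + 4 * pi * (1 + C^2) * (lm - \<kappa>)^2"
    have bb: "b + 1 \<le> 0" "b + 1 \<le> T" using b T by auto
    have QR: "Q \<le> Rn n"
    proof -
      have "(4 + 16 * pi^2 * C^2) * \<eta>n \<le> (4 + 16 * pi^2 * C^2) * \<eta>b"
        unfolding \<eta>n_def \<psi>_def by (intro mult_left_mono \<eta>) auto
      then show ?thesis by (simp add: Q_def Rn_def Qb_def)
    qed
    define E0 where "E0 = integral (rect b 0) (lp_en (\<psi> n))"
    define ET where "ET = integral (rect b T) (glue_en b c \<kappa> (\<psi> n))"
    define A where "A = integral {0..pi} (\<lambda>t. lp (\<psi> n) (0, t))"
    have g2: "- lm\<^sup>2 * pi * b + 2 * lm * (A - pi * c + pi * lm * b) - 2 * lm * sqrt (pi * Q) \<le> E0"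
      using G(2)[OF bb] unfolding Q_def d_def \<eta>n_def E0_def A_def lp_en_def .
    have g3: "ET \<le> \<kappa>^2 * pi * (T - b) + 2 * \<kappa> * sqrt (pi * Q) + Q"
      using G(3)[OF bb] unfolding Q_def d_def \<eta>n_def ET_def glue_en_def .
    have E0n: "0 \<le> E0" unfolding E0_def by (rule rect_nonneg[OF continuous_on_lp(4)[OF s\<psi>]]) (simp add: lp_en_def)
    have ETn: "0 \<le> ET" unfolding ET_def by (rule rect_nonneg[OF continuous_glue_en[OF s\<psi>]]) (simp add: glue_en_def)
    have split: "strip_en (\<psi> n) {..<b} + ennreal E0 = ennreal (Dn n)"
      using strip_en_split[OF s\<psi>, of b 0 n] b grad_one_minus[OF s\<phi>, of n] Dn(1)[of n]
      unfolding \<psi>_def E0_def by simp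
    have sb: "strip_en (\<psi> n) {..<b} = ennreal (Dn n - E0)" "E0 \<le> Dn n"
    proof -
      obtain x where x: "x \<ge> 0" "strip_en (\<psi> n) {..<b} = ennreal x"
        using split by (cases "strip_en (\<psi> n) {..<b}") auto
      then have "ennreal (x + E0) = ennreal (Dn n)" using split E0n by (metis ennreal_plus)
      then have "x + E0 = Dn n" using x E0n Dn(2)[of n] by (simp del: ennreal_plus)
      then show "strip_en (\<psi> n) {..<b} = ennreal (Dn n - E0)" "E0 \<le> Dn n" using x by auto
    qed
    have sq: "sqrt (pi * Q) \<le> sqrt (pi * Rn n)" using QR by simp
    have EX: "Dn n - E0 + ET \<le> X n"
    proof -
      have "2 * lm * (pi * \<gamma> - \<delta> n - pi * c + pi * lm * b) \<le> 2 * lm * (A - pi * c + pi * lm * b)"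
        using elim lm by (intro mult_left_mono) (auto simp: A_def)
      moreover have "2 * lm * sqrt (pi * Q) \<le> 2 * lm * sqrt (pi * Rn n)" "2 * \<kappa> * sqrt (pi * Q) \<le> 2 * \<kappa> * sqrt (pi * Rn n)"
        using sq lm \<kappa> by (intro mult_left_mono; simp)+
      moreover have "2 * (lm + \<kappa>) * sqrt (pi * Rn n) = 2 * lm * sqrt (pi * Rn n) + 2 * \<kappa> * sqrt (pi * Rn n)" by (simp add: algebra_simps)
      ultimately show ?thesis using g2 g3 QR unfolding X_def by linarith
    qed
    have "grad_sq (\<phi>' n) = strip_en (\<phi>' n) {..<0}"
      by (rule nn_integral_grad_Bplus[OF s\<phi>'])
    also have "\<dots> = ennreal (a^2) * (strip_en (\<psi> n) {..<b} + ennreal ET)"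
      unfolding \<phi>'_def ET_def \<psi>_def using b T by (intro glue_strip_en s\<phi>) simp
    also have "\<dots> = ennreal (a^2 * (Dn n - E0 + ET))"
      using sb ETn by (simp add: ennreal_plus[symmetric] ennreal_mult[symmetric] del: ennreal_plus)
    also have "\<dots> \<le> ennreal (a^2 * X n)"
      using EX by (intro ennreal_leI mult_left_mono) auto
    finally show ?case using EX sb(2) ETn by simp
  qed
  have "dirichlet w' \<le> ennreal (a^2 * (enn2real (dirichlet w) + lm^2 * pi * b - 2 * lm * (pi * \<gamma> - 0 - pi * c + pi * lm * b)
      + 2 * (lm + \<kappa>) * sqrt (pi * Qb) + \<kappa>^2 * pi * (T - b) + Qb))"
    by (rule tendsto_le[OF _ Xlim lim' eventually_mono[OF le]]) auto
  then show "dirichlet w' \<le> ennreal (a^2 * (enn2real (dirichlet w) + lm^2 * pi * b - 2 * lm * (pi * \<gamma> - pi * c + pi * lm * b)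
      + 2 * (lm + \<kappa>) * sqrt (pi * Qb) + \<kappa>^2 * pi * (T - b) + Qb))" by simp
  have "X \<longlonglongrightarrow> enn2real (dirichlet w) + lm^2 * pi * b - 2 * lm * (pi * \<gamma> - 0 - pi * c + pi * lm * b)
      + 2 * (lm + \<kappa>) * sqrt (pi * Qb) + \<kappa>^2 * pi * (T - b) + Qb"
    unfolding X_def by (intro tendsto_intros Dlim \<delta>(1) Rlim)
  from tendsto_lowerbound[OF this eventually_mono[OF le]]
  show "0 \<le> enn2real (dirichlet w) + lm^2 * pi * b - 2 * lm * (pi * \<gamma> - pi * c + pi * lm * b)
      + 2 * (lm + \<kappa>) * sqrt (pi * Qb) + \<kappa>^2 * pi * (T - b) + Qb" by simp
qed

subsection \<open>Wall energy of the glued competitor\<close>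

text \<open>Joint convexity of \<open>g\<^sup>2 / (u (2 - u))\<close>, up to the factor coming from the transition term \<open>X\<close>.\<close>

lemma wall_mix:
  fixes K u l a g X t c Y :: real
  assumes K: "0 \<le> K" "K \<le> 1" and u: "0 \<le> u" "u \<le> 2" and g0: "u = 0 \<or> u = 2 \<Longrightarrow> g = 0"
    and c: "c > 0" "c \<le> l" and a: "a > 0" and t: "0 < t" "t \<le> 1"
    and au: "a * u \<le> 2 * t / (1 + t)" and al: "a * l \<le> 2 * t / (1 + t)" and X: "X^2 \<le> (1 - K) * Y" and Y: "Y \<ge> 0"
  defines "U \<equiv> K * u + (1 - K) * l"
  shows "(X - K * g)^2 / (U * (2 - a * U)) \<le> (1 + t)^2 * (g^2 / (u * (2 - u))) + (1 + 1 / t) * (Y / c)"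
proof -
  have U0: "U \<ge> 0" unfolding U_def using K u c by (intro add_nonneg_nonneg mult_nonneg_nonneg) auto
  have "a * U = K * (a * u) + (1 - K) * (a * l)" by (simp add: U_def algebra_simps)
  also have "\<dots> \<le> K * (2 * t / (1 + t)) + (1 - K) * (2 * t / (1 + t))"
    using K au al by (intro add_mono mult_left_mono) auto
  also have "\<dots> = 2 * t / (1 + t)"
  proof -
    have "K * z + (1 - K) * z = z" for z :: real by (simp add: algebra_simps)
    then show ?thesis .
  qed
  finally have aU: "a * U \<le> 2 * t / (1 + t)" .
  have "2 - 2 * t / (1 + t) = 2 / (1 + t)" using t by (simp add: field_simps)
  then have den: "2 / (1 + t) \<le> 2 - a * U" using aU by linarith
  have p2: "0 < 2 / (1 + t)" using t by simp
  \<comment> \<open>Since \<open>U >= K * u\<close>, one factor \<open>K\<close> cancels. Smallness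
    of \<open>a\<close> keeps \<open>2 - a * U\<close> above \<open>2 / (1 + t)\<close>, whereas the
    original denominator has \<open>2 - u <= 2\<close>; this loses only the factor
    \<open>1 + t\<close>.\<close>
  have T1: "K^2 * g^2 / (U * (2 - a * U)) \<le> (1 + t) * (g^2 / (u * (2 - u)))"
  proof (cases "g = 0 \<or> K = 0")
    case True
    have "0 \<le> (1 + t) * (g^2 / (u * (2 - u)))" using u t by auto
    then show ?thesis using True by auto
  next
    case False
    then have uu: "0 < u" "u < 2" using g0 u by (auto simp: less_le)
    have KU: "K * u \<le> U" unfolding U_def using K c by simp
    have Ku: "0 < K * u" using False K uu by simp
    have "K^2 * g^2 / (U * (2 - a * U)) \<le> K^2 * g^2 / (K * u * (2 / (1 + t)))"
    proof (rule divide_left_mono)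
      show "K * u * (2 / (1 + t)) \<le> U * (2 - a * U)" using KU den Ku p2 by (intro mult_mono) auto
      have "0 < U" "0 < 2 - a * U" using KU Ku den p2 by linarith+
      then show "0 < U * (2 - a * U) * (K * u * (2 / (1 + t)))" using Ku p2 by simp
    qed simp
    also have "\<dots> = (1 + t) * (K * (g^2 / (u * 2)))"
      using False uu t by (simp add: power2_eq_square field_simps)
    also have "\<dots> \<le> (1 + t) * (1 * (g^2 / (u * (2 - u))))"
      using K uu t by (intro mult_left_mono mult_mono divide_left_mono) auto
    finally show ?thesis by simp
  qed
  \<comment> \<open>\<open>X^2\<close> carries the factor \<open>1 - K\<close> and
    \<open>U >= (1 - K) * c\<close>, so the degenerate factor cancels. This is what the squared
    cut-off and the positivity of \<open>c\<close> are for.\<close>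
  have T2: "X^2 / (U * (2 - a * U)) \<le> Y / c"
  proof (cases "K = 1")
    case True
    then have "X = 0" using X by simp
    then show ?thesis using Y c by simp
  next
    case False
    then have K1: "0 < 1 - K" using K by simp
    have "(1 - K) * c \<le> (1 - K) * l" using c K1 by (intro mult_left_mono) auto
    moreover have "0 \<le> K * u" using K u by simp
    ultimately have KU: "(1 - K) * c \<le> U" unfolding U_def by linarith
    have p: "0 < (1 - K) * c" using K1 c by simp
    have one: "1 \<le> 2 / (1 + t)" using t by simp
    then have "(1 - K) * c * 1 \<le> U * (2 - a * U)" using KU den p by (intro mult_mono) auto
    then have "X^2 / (U * (2 - a * U)) \<le> (1 - K) * Y / ((1 - K) * c)"
      using X p K1 Y by (intro frac_le) auto
    also have "\<dots> = Y / c" using K1 by simp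
    finally show ?thesis .
  qed
  have "(X - K * g)^2 \<le> (1 + 1 / t) * X^2 + (1 + t) * (K^2 * g^2)"
  proof -
    have "0 \<le> (X / t + K * g)^2 * t" using t by simp
    also have "\<dots> = X^2 / t + 2 * X * (K * g) + t * (K^2 * g^2)" using t by (simp add: power2_eq_square field_simps)
    finally show ?thesis by (simp add: power2_diff power_mult_distrib algebra_simps)
  qed
  then have "(X - K * g)^2 / (U * (2 - a * U)) \<le> ((1 + 1 / t) * X^2 + (1 + t) * (K^2 * g^2)) / (U * (2 - a * U))"
  proof (rule divide_right_mono)
    have "0 \<le> 2 - a * U" using den p2 by linarith
    then show "0 \<le> U * (2 - a * U)" using U0 by simp
  qed
  also have "\<dots> = (1 + 1 / t) * (X^2 / (U * (2 - a * U))) + (1 + t) * (K^2 * g^2 / (U * (2 - a * U)))"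
    by (simp add: add_divide_distrib)
  also have "\<dots> \<le> (1 + 1 / t) * (Y / c) + (1 + t) * ((1 + t) * (g^2 / (u * (2 - u))))"
    using T1 T2 t by (intro add_mono mult_left_mono) auto
  finally show ?thesis by (simp add: power2_eq_square mult.assoc)
qed

lemma nn_integral_inverse_square_tails:
  assumes r: "r > (0::real)"
  shows "(\<integral>\<^sup>+y. ennreal (1 / y^2) * indicator {y. r \<le> \<bar>y\<bar>} y \<partial>lborel) \<le> ennreal (2 / r)"
proof -
  have 1: "(\<integral>\<^sup>+y. ennreal (1 / y^2) * indicator {r..} y \<partial>lborel) = ennreal (0 - (- (1 / r)))"
  proof (rule nn_integral_FTC_atLeast)
    show "((\<lambda>y. - (1 / y)) has_real_derivative 1 / y^2) (at y)" if "r \<le> y" for y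
      using that r by (auto intro!: derivative_eq_intros simp: power2_eq_square)
    show "((\<lambda>y::real. - (1 / y)) \<longlongrightarrow> 0) at_top" by real_asymp
  qed auto
  have 2: "(\<integral>\<^sup>+y. ennreal (1 / y^2) * indicator {r..} (- y) \<partial>lborel) = ennreal (1 / r)"
  proof -
    have "(\<integral>\<^sup>+y. ennreal (1 / y^2) * indicator {r..} y \<partial>lborel) = ennreal \<bar>-1\<bar> * (\<integral>\<^sup>+y. ennreal (1 / (0 + -1 * y)^2) * indicator {r..} (0 + -1 * y) \<partial>lborel)"
      by (rule nn_integral_real_affine) auto
    then show ?thesis using 1 by simp
  qed
  have "(\<integral>\<^sup>+y. ennreal (1 / y^2) * indicator {y. r \<le> \<bar>y\<bar>} y \<partial>lborel)
      \<le> (\<integral>\<^sup>+y. ennreal (1 / y^2) * indicator {r..} y + ennreal (1 / y^2) * indicator {r..} (- y) \<partial>lborel)"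
    by (rule nn_integral_mono) (auto simp: indicator_def abs_if)
  also have "\<dots> = ennreal (1 / r) + ennreal (1 / r)"
    using 1 2 by (subst nn_integral_add) auto
  also have "\<dots> = ennreal (2 / r)" using r by (simp add: ennreal_plus[symmetric] del: ennreal_plus)
  finally show ?thesis .
qed

lemma wall_integrand_measurable:
  assumes "W12_1 I1 \<mu> g"
  shows "(\<lambda>x. ennreal ((g x)^2 / (1 - (\<mu> x)\<^sup>2)) * indicator I1 x) \<in> borel_measurable borel"
proof -
  have 1: "(\<lambda>y. indicat_real I1 y * g y) \<in> borel_measurable borel" "(\<lambda>y. indicat_real I1 y * \<mu> y) \<in> borel_measurable borel"
    using assms by (auto simp: W12_1_def set_borel_measurable_def)
  have "(\<lambda>y. ennreal ((indicat_real I1 y * g y)^2 / (1 - (indicat_real I1 y * \<mu> y)\<^sup>2)) * indicator I1 y) \<in> borel_measurable borel"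
    using 1 by measurable
  moreover have "(\<lambda>y. ennreal ((indicat_real I1 y * g y)^2 / (1 - (indicat_real I1 y * \<mu> y)\<^sup>2)) * indicator I1 y)
      = (\<lambda>y. ennreal ((g y)^2 / (1 - (\<mu> y)\<^sup>2)) * indicator I1 y)"
    by (auto simp: indicator_def)
  ultimately show ?thesis by simp
qed

text \<open>In the variable \<open>y = x / s\<close> with \<open>s = exp (- T)\<close> the new
  profile is \<open>1 - a * U y\<close>. Its squared derivative brings \<open>(a / s)^2\<close>, the
  denominator a factor \<open>a\<close>, and the line element \<open>s\<close>, which together give
  \<open>a / s\<close>. Whatever is new decays like \<open>1 / y^2\<close> beyond radius
  \<open>exp b\<close>, hence the factor \<open>exp (- b)\<close>.\<close>

lemma glue_wall:
  fixes \<mu> :: "real \<Rightarrow> real" and a b c \<gamma> \<kappa> t T C :: real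
  assumes W: "in_W12_1 I1 \<mu>" and c\<mu>: "continuous_on {-1..1} \<mu>" and \<mu>0: "\<mu> 0 = 1"
    and bnd: "\<forall>x\<in>{-1..1}. \<bar>\<mu> x\<bar> \<le> 1" and \<gamma>: "0 < \<gamma>" "\<gamma> < 2"
    and b: "b + 1 < 0" and T: "0 \<le> T" and a: "0 < a" and \<kappa>: "\<kappa> \<ge> 0" and c: "c > 0"
    and arc: "a * (c + \<kappa> * (T - b)) = \<gamma>" and t: "0 < t" "t \<le> 1" and small: "a * (2 + c + \<kappa>) \<le> 2 * t / (1 + t)"
    and C: "C > 0" "\<And>\<tau>. (deriv cutoff \<tau>)^2 \<le> C * (1 - cutoff \<tau>)"
  defines "\<mu>' \<equiv> \<lambda>x. add_part a (exp (b - T)) c \<kappa> (x, 0) + mult_part a (exp (b - T)) (x, 0) * \<mu> (x / exp (- T))"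
    and "M \<equiv> (2 * \<kappa>^2 + 8 * exp 4 * C * (2 + c + \<kappa>)^2) / c + \<kappa>^2 / (c * (2 - \<gamma>))"
  shows "\<mu>' \<in> Mgam \<gamma>"
    and "wall \<mu>' \<le> ennreal (a / exp (- T)) * (ennreal ((1 + t)^2) * wall \<mu> + ennreal ((1 + 1 / t) * (2 * M * exp (- b))))"
proof -
  define s where "s = exp (- T)"
  define r where "r = exp b"
  define R where "R = exp (b - T)"
  have s: "0 < s" "s \<le> 1" using T by (auto simp: s_def)
  have r: "0 < r" by (simp add: r_def)
  have R: "R = s * r" "R > 0" by (simp_all add: R_def s_def r_def flip: exp_add)
  define g where "g = wderiv1 I1 \<mu>"
  have Wg: "W12_1 I1 \<mu> g" unfolding g_def by (rule W12_1_wderiv1[OF W])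
  define p where "p x = add_part a R c \<kappa> (x, 0)" for x
  define \<theta> where "\<theta> x = mult_part a R (x, 0)" for x
  have sp: "smooth_on UNIV p" unfolding p_def[abs_def] by (rule smooth2_line[OF smooth2_add_part])
  have s\<theta>: "smooth_on UNIV \<theta>" unfolding \<theta>_def[abs_def] by (rule smooth2_line[OF smooth2_mult_part])
  have q1: "exp (b + 1) < 1" using b by simp
  have sup: "\<theta> x = 0" if "s * exp (b + 1) \<le> \<bar>x\<bar>" for x
    unfolding \<theta>_def R_def using that by (intro mult_part_support) (simp add: s_def norm_Pair)
  define g' where "g' x = deriv p x + deriv \<theta> x * \<mu> (x / s) + \<theta> x * g (x / s) / s" for x
  have \<mu>': "\<mu>' = (\<lambda>x. p x + \<theta> x * \<mu> (x / s))" by (simp add: \<mu>'_def p_def \<theta>_def R_def s_def)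
  have W': "W12_1 I1 \<mu>' g'"
    unfolding \<mu>' g'_def using sup by (intro W12_1_rescale[OF Wg sp s\<theta> s(1) q1]) auto
  define u where "u y = 1 - \<mu> y" for y
  have u02: "0 \<le> u y" "u y \<le> 2" if "\<bar>y\<bar> \<le> 1" for y using bnd that by (auto simp: u_def abs_le_iff)
  define \<tau> where "\<tau> y = y^2 / r^2" for y
  define K where "K y = cutoff (\<tau> y)" for y
  define K' where "K' y = deriv cutoff (\<tau> y)" for y
  define l where "l y = c + \<kappa> / 2 * ln (\<tau> y)" for y
  define U where "U y = K y * u y + (1 - K y) * l y" for y
  define X where "X y = 2 * y / r^2 * K' y * (u y - l y) + (1 - K y) * \<kappa> / y" for y
  have Kb: "0 \<le> K y" "K y \<le> 1" for y by (auto simp: K_def cutoff_bounds)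
  have tau: "sqn (s * y, 0) / R^2 = \<tau> y" for y
    using s r by (simp add: sqn_def \<tau>_def R(1) power_mult_distrib)
  have m': "\<mu>' (s * y) = 1 - a * U y" for y
    unfolding \<mu>' p_def \<theta>_def add_part_def mult_part_def outer_def tau U_def K_def l_def u_def
    using s by (simp add: algebra_simps)
  have dsq: "((\<lambda>x. sqn (x, 0) / R^2) has_real_derivative 2 * x / R^2) (at x)" for x
  proof -
    have "((\<lambda>x. x^2) has_real_derivative 2 * x) (at x)" by (auto intro!: derivative_eq_intros)
    then show ?thesis unfolding sqn_def by (auto dest: DERIV_cdivide)
  qed
  have dp: "deriv p x = - a * ((deriv cutoff (sqn (x, 0) / R^2) + deriv (outer c \<kappa>) (sqn (x, 0) / R^2)) * (2 * x / R^2))" for x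
  proof (rule DERIV_imp_deriv)
    have 1: "((\<lambda>x. cutoff (sqn (x, 0) / R^2)) has_real_derivative deriv cutoff (sqn (x, 0) / R^2) * (2 * x / R^2)) (at x)"
      by (rule DERIV_chain2[OF smooth_on_has_deriv[OF smooth_on_cutoff UNIV_I] dsq])
    have 2: "((\<lambda>x. outer c \<kappa> (sqn (x, 0) / R^2)) has_real_derivative deriv (outer c \<kappa>) (sqn (x, 0) / R^2) * (2 * x / R^2)) (at x)"
      by (rule DERIV_chain2[OF smooth_on_has_deriv[OF smooth_on_outer UNIV_I] dsq])
    show "(p has_real_derivative - a * ((deriv cutoff (sqn (x, 0) / R^2) + deriv (outer c \<kappa>) (sqn (x, 0) / R^2)) * (2 * x / R^2))) (at x)"
      unfolding p_def[abs_def] add_part_def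
      by (rule DERIV_cong[OF DERIV_diff[OF DERIV_const DERIV_cmult[OF DERIV_add[OF 1 2]]]]) (simp add: algebra_simps)
  qed
  have d\<theta>: "deriv \<theta> x = a * (deriv cutoff (sqn (x, 0) / R^2) * (2 * x / R^2))" for x
  proof (rule DERIV_imp_deriv)
    have 1: "((\<lambda>x. cutoff (sqn (x, 0) / R^2)) has_real_derivative deriv cutoff (sqn (x, 0) / R^2) * (2 * x / R^2)) (at x)"
      by (rule DERIV_chain2[OF smooth_on_has_deriv[OF smooth_on_cutoff UNIV_I] dsq])
    show "(\<theta> has_real_derivative a * (deriv cutoff (sqn (x, 0) / R^2) * (2 * x / R^2))) (at x)"
      unfolding \<theta>_def[abs_def] mult_part_def by (rule DERIV_cmult[OF 1])
  qed
  have gX: "g' (s * y) = - (a / s) * (X y - K y * g y)" if y: "y \<noteq> 0" for y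
  proof -
    have \<tau>0: "\<tau> y > 0" using y r by (simp add: \<tau>_def)
    have c1: "2 * (s * y) / R^2 = 2 * y / r^2 / s" using s r by (simp add: R(1) power_mult_distrib power2_eq_square)
    have o: "deriv (outer c \<kappa>) (\<tau> y) = - K' y * l y + (1 - K y) * (\<kappa> / (2 * \<tau> y))"
      unfolding outer_deriv[OF \<tau>0] K'_def l_def K_def by simp
    have c2: "2 * y / r^2 * (\<kappa> / (2 * \<tau> y)) = \<kappa> / y"
      using y r by (simp add: \<tau>_def field_simps power2_eq_square)
    have "g' (s * y) = - (a / s) * (2 * y / r^2 * (K' y * u y + deriv (outer c \<kappa>) (\<tau> y)) - K y * g y)"
    proof -
      define q where "q = 2 * y / r^2"
      define D where "D = deriv (outer c \<kappa>) (\<tau> y)"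
      have "s * y / s = y" using s by simp
      then have "g' (s * y) = - a * ((K' y + D) * (q / s)) + a * (K' y * (q / s)) * \<mu> y + a * K y * g y / s"
        unfolding g'_def dp d\<theta> c1 \<theta>_def mult_part_def tau D_def q_def K'_def K_def by simp
      also have "\<dots> = - (a / s) * (q * (K' y * u y + D) - K y * g y)"
        unfolding u_def using s by (simp add: field_simps)
      finally show ?thesis unfolding q_def D_def .
    qed
    also have "2 * y / r^2 * (K' y * u y + deriv (outer c \<kappa>) (\<tau> y)) = 2 * y / r^2 * K' y * (u y - l y) + (1 - K y) * (2 * y / r^2 * (\<kappa> / (2 * \<tau> y)))"
    proof -
      have "q * (k * v + (- k * w + j * z)) = q * k * (v - w) + j * (q * z)" for q k v w j z :: real by (simp add: algebra_simps)
      then show ?thesis unfolding o by blast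
    qed
    also have "\<dots> = X y" unfolding c2 X_def by simp
    finally show ?thesis .
  qed
  have tge: "r \<le> \<bar>y\<bar>" if "1 \<le> \<tau> y" for y
  proof -
    have "r^2 \<le> y^2" using that r by (simp add: \<tau>_def)
    then show ?thesis using r by (simp add: abs_le_square_iff[symmetric])
  qed
  have tI1: "\<bar>y\<bar> < 1" if "\<tau> y \<le> exp 2" for y
  proof -
    have e2: "exp 2 = (exp (1::real))^2" by (simp add: power2_eq_square flip: exp_add)
    have "y^2 \<le> (exp 1 * r)^2" using that r by (simp add: \<tau>_def e2 power_mult_distrib field_simps)
    then have "\<bar>y\<bar> \<le> exp 1 * r" using r by (simp add: abs_le_square_iff[symmetric])
    also have "exp 1 * r < 1" using q1 by (simp add: r_def mult.commute flip: exp_add)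
    finally show ?thesis .
  qed
  have t1: "2 * t / (1 + t) \<le> 1" using t by (simp add: field_simps)
  have au: "a * u y \<le> 2 * t / (1 + t)" if "\<bar>y\<bar> \<le> 1" for y
  proof -
    have "a * u y \<le> a * (2 + c + \<kappa>)" using u02[OF that] a c \<kappa> by (intro mult_left_mono) auto
    then show ?thesis using small by linarith
  qed
  have lmid: "c \<le> l y" "l y \<le> c + \<kappa>" if "1 \<le> \<tau> y" "\<tau> y \<le> exp 2" for y
  proof -
    have "0 \<le> ln (\<tau> y)" "ln (\<tau> y) \<le> 2" using that ln_le_cancel_iff[of "\<tau> y" "exp 2"] by auto
    then have "0 \<le> \<kappa> / 2 * ln (\<tau> y)" "\<kappa> / 2 * ln (\<tau> y) \<le> \<kappa> / 2 * 2" using \<kappa> by (intro mult_nonneg_nonneg mult_left_mono; simp)+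
    then show "c \<le> l y" "l y \<le> c + \<kappa>" by (auto simp: l_def)
  qed
  \<comment> \<open>Up to radius 1 the logarithm stays below its value on the arc, so
    \<open>arc\<close> bounds \<open>a * l y\<close> by \<gamma> and the factor
    \<open>2 - a * l y\<close> of the denominator by \<open>2 - \<gamma>\<close> from below.\<close>
  have lout: "c \<le> l y" "a * l y \<le> \<gamma>" if "exp 2 < \<tau> y" "\<bar>s * y\<bar> \<le> 1" for y
  proof -
    have \<tau>1: "1 \<le> \<tau> y" using that(1) by (smt (verit) one_le_exp_iff)
    have "0 \<le> \<kappa> / 2 * ln (\<tau> y)" using \<kappa> \<tau>1 by simp
    then show "c \<le> l y" by (simp add: l_def)
    have "(s * y)^2 \<le> 1" using that(2) by (simp add: abs_square_le_1)
    then have "\<tau> y \<le> 1 / R^2" using s r by (simp add: \<tau>_def R(1) power_mult_distrib field_simps)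
    also have "1 / R^2 = exp (2 * (T - b))" by (simp add: R_def power2_eq_square divide_inverse flip: exp_add exp_minus)
    finally have "ln (\<tau> y) \<le> 2 * (T - b)" using \<tau>1 by (metis exp_gt_zero less_le_trans ln_exp ln_le_cancel_iff zero_less_one)
    then have "l y \<le> c + \<kappa> * (T - b)" using \<kappa> mult_left_mono[of "ln (\<tau> y)" "2 * (T - b)" "\<kappa> / 2"] by (simp add: l_def algebra_simps)
    then show "a * l y \<le> \<gamma>" using a arc by (metis mult_le_cancel_left_pos)
  qed
  have al: "a * l y \<le> 2 * t / (1 + t)" if "1 \<le> \<tau> y" "\<tau> y \<le> exp 2" for y
  proof -
    have "a * l y \<le> a * (2 + c + \<kappa>)" using lmid[OF that] a by (intro mult_left_mono) auto
    then show ?thesis using small by linarith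
  qed
  have Ub: "0 \<le> U y \<and> a * U y \<le> 2" if y: "\<bar>s * y\<bar> \<le> 1" for y
  proof -
    consider "\<tau> y < 1" | "1 \<le> \<tau> y" "\<tau> y \<le> exp 2" | "exp 2 < \<tau> y" by linarith
    then show ?thesis
    proof cases
      case 1
      then have "\<bar>y\<bar> \<le> 1" using tI1[of y] by (smt (verit) one_le_exp_iff)
      moreover have "K y = 1" using 1 by (simp add: K_def cutoff_1)
      ultimately show ?thesis using u02[of y] au[of y] t1 by (simp add: U_def)
    next
      case 2
      then have y1: "\<bar>y\<bar> \<le> 1" using tI1[of y] by simp
      have "a * U y = K y * (a * u y) + (1 - K y) * (a * l y)" by (simp add: U_def algebra_simps)
      also have "\<dots> \<le> K y * 1 + (1 - K y) * 1"
        using Kb[of y] au[OF y1] al[OF 2] t1 by (intro add_mono mult_left_mono) auto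
      finally have "a * U y \<le> 2" by simp
      moreover have "0 \<le> U y" unfolding U_def using Kb[of y] u02[OF y1] lmid[OF 2] c by (intro add_nonneg_nonneg mult_nonneg_nonneg) auto
      ultimately show ?thesis by simp
    next
      case 3
      then have "K y = 0" by (simp add: K_def cutoff_0)
      then show ?thesis using lout[OF 3 y] c \<gamma> by (simp add: U_def)
    qed
  qed
  \<comment> \<open>Twice the squares of the two parts of \<open>X\<close>, up to the factor
    \<open>(1 - K y) / y^2\<close>. In the transition zone \<open>\<tau> <= exp 2\<close>, and
    \<open>(2 * y / r^2)^2 = 4 * \<tau>^2 / y^2\<close> accounts for \<open>exp 4\<close>.\<close>
  define Y0 where "Y0 = 2 * \<kappa>^2 + 8 * exp 4 * C * (2 + c + \<kappa>)^2"
  have Y0: "Y0 \<ge> 0" using C by (simp add: Y0_def)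
  have M: "M = Y0 / c + \<kappa>^2 / (c * (2 - \<gamma>))" by (simp add: M_def Y0_def)
  have M1: "Y0 / c \<le> M" "\<kappa>^2 / (c * (2 - \<gamma>)) \<le> M" "0 \<le> M" using Y0 c \<gamma> by (auto simp: M)
  \<comment> \<open>Three zones: inside only the factor \<open>a\<close> changes the profile, in the
    transition zone \<open>wall_mix\<close> applies with \<open>X\<close> as the transition term,
    and outside the profile is the pure logarithm with derivative proportional to
    \<open>\<kappa> / y\<close>.\<close>
  have pw: "(g' (s * y))^2 / (1 - (\<mu>' (s * y))\<^sup>2) \<le> a / s^2 * ((1 + t)^2 * ((g y)^2 / (1 - (\<mu> y)\<^sup>2) * indicator I1 y) + (1 + 1 / t) * M * (1 / y^2 * indicator {y. r \<le> \<bar>y\<bar>} y))"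
    if y: "y \<noteq> 0" "\<bar>s * y\<bar> \<le> 1" and g0: "y \<in> I1 \<Longrightarrow> u y = 0 \<or> u y = 2 \<Longrightarrow> g y = 0" for y
  proof -
    let ?V = "(X y - K y * g y)^2 / (U y * (2 - a * U y))"
    have uu: "u y * (2 - u y) = 1 - (\<mu> y)\<^sup>2" by (simp add: u_def power2_eq_square algebra_simps)
    have eq: "(g' (s * y))^2 / (1 - (\<mu>' (s * y))\<^sup>2) = a / s^2 * ?V"
    proof -
      have "1 - (1 - a * U y)\<^sup>2 = a * (U y * (2 - a * U y))" by (simp add: power2_eq_square algebra_simps)
      moreover have "(- (a / s) * (X y - K y * g y))^2 = a * (a / s^2 * (X y - K y * g y)^2)"
        by (simp add: power_mult_distrib power_divide power2_eq_square)
      ultimately show ?thesis unfolding gX[OF y(1)] m' using a by simp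
    qed
    have wn: "0 \<le> (1 + t)^2 * ((g y)^2 / (1 - (\<mu> y)\<^sup>2) * indicator I1 y)"
    proof (cases "y \<in> I1")
      case True
      then have "0 \<le> u y * (2 - u y)" using u02[of y] by auto
      then show ?thesis unfolding uu by simp
    qed simp
    have Mn: "0 \<le> (1 + 1 / t) * M * (1 / y^2 * indicator {y. r \<le> \<bar>y\<bar>} y)" using M1 t by simp
    have tp: "1 \<le> 1 + 1 / t" using t by simp
    have "?V \<le> (1 + t)^2 * ((g y)^2 / (1 - (\<mu> y)\<^sup>2) * indicator I1 y) + (1 + 1 / t) * M * (1 / y^2 * indicator {y. r \<le> \<bar>y\<bar>} y)"
    proof -
      consider "\<tau> y < 1" | "1 \<le> \<tau> y" "\<tau> y \<le> exp 2" | "exp 2 < \<tau> y" by linarith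
      then show ?thesis
      proof cases
        case 1
        then have y1: "\<bar>y\<bar> < 1" using tI1[of y] by (smt (verit) one_le_exp_iff)
        have yI: "y \<in> I1" using y1 by auto
        note g0' = g0[OF yI]
        have K1: "K y = 1" "K' y = 0" using 1 by (auto simp: K_def cutoff_1 K'_def cutoff_deriv_0)
        have "(0 - 1 * g y)^2 / ((1 * u y + (1 - 1) * c) * (2 - a * (1 * u y + (1 - 1) * c))) \<le> (1 + t)^2 * ((g y)^2 / (u y * (2 - u y))) + (1 + 1 / t) * (0 / c)"
        proof (rule wall_mix)
          show "a * c \<le> 2 * t / (1 + t)"
          proof -
            have "a * c \<le> a * (2 + c + \<kappa>)" using a \<kappa> by (intro mult_left_mono) auto
            then show ?thesis using small by linarith
          qed
        qed (use u02[of y] y1 g0' c a t au[of y] in auto)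
        then have "?V \<le> (1 + t)^2 * ((g y)^2 / (1 - (\<mu> y)\<^sup>2))" unfolding uu by (simp add: X_def K1 U_def)
        then show ?thesis using yI Mn by simp
      next
        case 2
        then have y1: "\<bar>y\<bar> < 1" using tI1[of y] by simp
        have yI: "y \<in> I1" using y1 by auto
        note g0' = g0[OF yI]
        have ry: "r \<le> \<bar>y\<bar>" by (rule tge[OF 2(1)])
        have XY: "(X y)^2 \<le> (1 - K y) * (Y0 / y^2)"
        proof -
          have "(X y)^2 \<le> 2 * (2 * y / r^2 * K' y * (u y - l y))^2 + 2 * ((1 - K y) * \<kappa> / y)^2"
            unfolding X_def by (rule sq_add_le)
          also have "(2 * y / r^2 * K' y * (u y - l y))^2 \<le> 4 * exp 4 / y^2 * (C * (1 - K y)) * (2 + c + \<kappa>)^2"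
          proof -
            have "(2 * y / r^2 * K' y * (u y - l y))^2 = (2 * y / r^2)^2 * (K' y)^2 * (u y - l y)^2"
              by (simp only: power_mult_distrib)
            also have "(2 * y / r^2)^2 = 4 * (\<tau> y)^2 / y^2" using y r by (simp add: \<tau>_def field_simps power2_eq_square)
            also have "4 * (\<tau> y)^2 / y^2 * (K' y)^2 * (u y - l y)^2 \<le> 4 * exp 4 / y^2 * (C * (1 - K y)) * (2 + c + \<kappa>)^2"
            proof (rule mult_mono[OF mult_mono[OF divide_right_mono]])
              have "(\<tau> y)^2 \<le> (exp 2)^2" using 2 by (intro power_mono) auto
              also have "(exp 2)^2 = exp (4::real)" by (simp add: power2_eq_square flip: exp_add)
              finally show "4 * (\<tau> y)^2 \<le> 4 * exp 4" by simp
              show "(K' y)^2 \<le> C * (1 - K y)" unfolding K'_def K_def by (rule C(2))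
              have "\<bar>u y - l y\<bar> \<le> 2 + c + \<kappa>" using u02[of y] y1 lmid[OF 2] c \<kappa> by auto
              then show "(u y - l y)^2 \<le> (2 + c + \<kappa>)^2" using c \<kappa> by (simp add: abs_le_square_iff[symmetric])
            qed (use C Kb[of y] in auto)
            finally show ?thesis .
          qed
          also have "((1 - K y) * \<kappa> / y)^2 \<le> (1 - K y) * (\<kappa>^2 / y^2)"
          proof -
            have "(1 - K y)^2 \<le> (1 - K y)" using Kb[of y] by (simp add: power2_eq_square mult_left_le_one_le)
            then have "(1 - K y)^2 * (\<kappa>^2 / y^2) \<le> (1 - K y) * (\<kappa>^2 / y^2)" by (intro mult_right_mono) auto
            then show ?thesis by (simp add: power_mult_distrib power_divide)
          qed
          finally have "(X y)^2 \<le> 2 * (4 * exp 4 / y^2 * (C * (1 - K y)) * (2 + c + \<kappa>)^2) + 2 * ((1 - K y) * (\<kappa>^2 / y^2))" by simp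
          also have "\<dots> = (1 - K y) * (Y0 / y^2)" unfolding Y0_def add_divide_distrib by (simp add: algebra_simps)
          finally show ?thesis .
        qed
        have "?V \<le> (1 + t)^2 * ((g y)^2 / (u y * (2 - u y))) + (1 + 1 / t) * (Y0 / y^2 / c)"
          unfolding U_def
        proof (rule wall_mix[OF _ _ _ _ _ _ _ _ _ _ _ _ XY])
          show "0 \<le> Y0 / y^2" using Y0 by simp
        qed (use Kb[of y] u02[of y] y1 g0' c a t au[of y] al[OF 2] lmid[OF 2] in auto)
        also have "(1 + 1 / t) * (Y0 / y^2 / c) \<le> (1 + 1 / t) * M * (1 / y^2)"
        proof -
          have "Y0 / y^2 / c = Y0 / c * (1 / y^2)" by simp
          also have "\<dots> \<le> M * (1 / y^2)" using M1 by (intro mult_right_mono) auto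
          finally have "(1 + 1 / t) * (Y0 / y^2 / c) \<le> (1 + 1 / t) * (M * (1 / y^2))" using tp by (intro mult_left_mono) auto
          then show ?thesis by (simp add: mult.assoc)
        qed
        finally show ?thesis using yI ry unfolding uu by simp
      next
        case 3
        have ry: "r \<le> \<bar>y\<bar>" using 3 by (intro tge) (smt (verit) one_le_exp_iff)
        have K1: "K y = 0" "K' y = 0" using 3 by (auto simp: K_def cutoff_0 K'_def cutoff_deriv_0)
        note lo = lout[OF 3 y(2)]
        have "?V = (\<kappa>^2 / y^2) / (l y * (2 - a * l y))" by (simp add: X_def K1 U_def power_divide)
        also have "\<dots> \<le> (\<kappa>^2 / y^2) / (c * (2 - \<gamma>))"
          using lo c \<gamma> by (intro divide_left_mono mult_mono mult_pos_pos) auto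
        also have "\<dots> = \<kappa>^2 / (c * (2 - \<gamma>)) * (1 / y^2)" by simp
        also have "\<dots> \<le> M * (1 / y^2)" using M1 by (intro mult_right_mono) auto
        also have "\<dots> \<le> (1 + 1 / t) * (M * (1 / y^2))" using mult_right_mono[OF tp, of "M * (1 / y^2)"] M1 by simp
        finally show ?thesis using wn ry by (simp add: mult.assoc)
      qed
    qed
    then show ?thesis unfolding eq using a by (intro mult_left_mono) auto
  qed
  have ab': "\<forall>x\<in>{-1..1}. \<bar>\<mu>' x\<bar> \<le> 1"
  proof
    fix x :: real assume x: "x \<in> {-1..1}"
    have "\<bar>s * (x / s)\<bar> \<le> 1" using x s by auto
    from Ub[OF this] have "0 \<le> a * U (x / s)" "a * U (x / s) \<le> 2" using a by auto
    moreover have "\<mu>' x = 1 - a * U (x / s)" using m'[of "x / s"] s by simp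
    ultimately show "\<bar>\<mu>' x\<bar> \<le> 1" by auto
  qed
  show "\<mu>' \<in> Mgam \<gamma>"
    unfolding Mgam_def mem_Collect_eq
  proof (intro conjI)
    show "in_W12_1 I1 \<mu>'" using W' by (auto simp: in_W12_1_def)
    \<comment> \<open>\<mu> is continuous only on \<open>{-1..1}\<close>. The closed sets where
      \<open>|x| <= s\<close> and where \<theta> is known to vanish cover the interval, and the
      product is continuous on each.\<close>
    have 1: "continuous_on {-s..s} (\<lambda>x. \<theta> x * \<mu> (x / s))"
      by (intro continuous_on_mult smooth_on_continuous[OF s\<theta>] continuous_on_compose2[OF c\<mu>] continuous_intros)
         (use s in \<open>auto simp: field_simps\<close>)
    have 2: "continuous_on {x. s * exp (b + 1) \<le> \<bar>x\<bar>} (\<lambda>x. \<theta> x * \<mu> (x / s))"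
      by (rule continuous_on_eq[OF continuous_on_const[of _ 0]]) (simp add: sup)
    have "closed {x::real. s * exp (b + 1) \<le> \<bar>x\<bar>}" by (intro closed_Collect_le continuous_intros)
    then have "continuous_on ({-s..s} \<union> {x. s * exp (b + 1) \<le> \<bar>x\<bar>}) (\<lambda>x. \<theta> x * \<mu> (x / s))"
      using 1 2 by (intro continuous_on_closed_Un) auto
    moreover have "{-1..1} \<subseteq> {-s..s} \<union> {x. s * exp (b + 1) \<le> \<bar>x\<bar>}"
    proof
      fix x :: real
      have "s * exp (b + 1) \<le> s" using q1 s by simp
      then show "x \<in> {-s..s} \<union> {x. s * exp (b + 1) \<le> \<bar>x\<bar>}" by (cases "\<bar>x\<bar> \<le> s") auto
    qed
    ultimately have "continuous_on {-1..1} (\<lambda>x. \<theta> x * \<mu> (x / s))" by (rule continuous_on_subset)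
    then show "continuous_on {-1..1} \<mu>'" unfolding \<mu>' by (intro continuous_on_add smooth_on_continuous[OF sp])
    have "K 0 = 1" by (simp add: K_def \<tau>_def cutoff_1)
    then have "U 0 = 0" by (simp add: U_def u_def \<mu>0)
    then show "\<mu>' 0 = 1" using m'[of 0] by simp
    have "s * exp (b + 1) \<le> 1" using s q1 by (simp add: mult_le_one)
    then have "\<theta> 1 = 0" "\<theta> (-1) = 0" by (auto intro!: sup)
    moreover have "p 1 = 1 - \<gamma>" "p (-1) = 1 - \<gamma>"
      unfolding p_def R_def using arc b T by (simp_all add: add_part_unit sqn_def)
    ultimately show "\<mu>' (-1) \<le> 1 - \<gamma>" "\<mu>' 1 \<le> 1 - \<gamma>" by (simp_all add: \<mu>')
  qed
  have cI: "continuous_on I1 \<mu>" by (rule continuous_on_subset[OF c\<mu>]) auto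
  \<comment> \<open>Where \<mu> is 1 or -1 the wall integrand is a quotient by zero and counts as 0.
    The comparison is still valid there because the weak derivative vanishes almost everywhere on a
    level set.\<close>
  have lev: "AE y in lborel. y \<in> I1 \<longrightarrow> \<mu> y = k \<longrightarrow> g y = 0" for k
    by (rule weak_deriv_zero_on_level_set[OF W12_1_integrable(2)[OF Wg]])
       (use cI W12_1_FTC[OF Wg c\<mu>] in auto)
  have AEp: "AE y in lborel. ennreal ((g' (0 + s * y))^2 / (1 - (\<mu>' (0 + s * y))\<^sup>2)) * indicator I1 (0 + s * y)
     \<le> ennreal (a / s^2) * (ennreal ((1 + t)^2) * (ennreal ((g y)^2 / (1 - (\<mu> y)\<^sup>2)) * indicator I1 y)
       + ennreal ((1 + 1 / t) * M) * (ennreal (1 / y^2) * indicator {y. r \<le> \<bar>y\<bar>} y))"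
    using lev[of 1] lev[of "-1"] AE_lborel_singleton[of "0::real"]
  proof eventually_elim
    case (elim y)
    show ?case
    proof (cases "0 + s * y \<in> I1")
      case True
      then have sy: "\<bar>s * y\<bar> \<le> 1" by auto
      have g0: "u y = 0 \<or> u y = 2 \<Longrightarrow> g y = 0" if "y \<in> I1" using elim that by (auto simp: u_def)
      let ?w = "(g y)^2 / (1 - (\<mu> y)\<^sup>2) * indicator I1 y" and ?z = "1 / y^2 * indicator {y. r \<le> \<bar>y\<bar>} y"
      have wn: "0 \<le> ?w"
      proof (cases "y \<in> I1")
        case True
        have "u y * (2 - u y) = 1 - (\<mu> y)\<^sup>2" by (simp add: u_def power2_eq_square algebra_simps)
        moreover have "0 \<le> u y * (2 - u y)" using u02[of y] True by auto
        ultimately show ?thesis by simp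
      qed simp
      have zn: "0 \<le> ?z" by simp
      have "ennreal ((g' (s * y))^2 / (1 - (\<mu>' (s * y))\<^sup>2)) \<le> ennreal (a / s^2 * ((1 + t)^2 * ?w + (1 + 1 / t) * M * ?z))"
        by (rule ennreal_leI, rule pw) (use elim sy g0 in auto)
      also have "\<dots> = ennreal (a / s^2) * (ennreal ((1 + t)^2) * ennreal ?w + ennreal ((1 + 1 / t) * M) * ennreal ?z)"
        using a t M1 wn zn by (simp only: ennreal_mult ennreal_plus mult_nonneg_nonneg add_nonneg_nonneg zero_le_power2 divide_nonneg_nonneg less_imp_le zero_le_one)
      also have "ennreal ?w = ennreal ((g y)^2 / (1 - (\<mu> y)\<^sup>2)) * indicator I1 y" by (simp add: indicator_def)
      also have "ennreal ?z = ennreal (1 / y^2) * indicator {y. r \<le> \<bar>y\<bar>} y" by (simp add: indicator_def)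
      finally show ?thesis using True by simp
    qed simp
  qed
  have "wall \<mu>' = (\<integral>\<^sup>+x\<in>I1. ennreal ((g' x)^2 / (1 - (\<mu>' x)\<^sup>2)) \<partial>lborel)" by (rule wall_eq[OF W' ab'])
  also have "\<dots> = ennreal \<bar>s\<bar> * (\<integral>\<^sup>+y. ennreal ((g' (0 + s * y))^2 / (1 - (\<mu>' (0 + s * y))\<^sup>2)) * indicator I1 (0 + s * y) \<partial>lborel)"
    by (rule nn_integral_real_affine[OF wall_integrand_measurable[OF W']]) (use s in simp)
  also have "\<dots> \<le> ennreal \<bar>s\<bar> * (\<integral>\<^sup>+y. ennreal (a / s^2) * (ennreal ((1 + t)^2) * (ennreal ((g y)^2 / (1 - (\<mu> y)\<^sup>2)) * indicator I1 y)
       + ennreal ((1 + 1 / t) * M) * (ennreal (1 / y^2) * indicator {y. r \<le> \<bar>y\<bar>} y)) \<partial>lborel)"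
    by (intro mult_left_mono nn_integral_mono_AE AEp) simp
  also have "\<dots> = ennreal \<bar>s\<bar> * (ennreal (a / s^2) * (ennreal ((1 + t)^2) * wall \<mu>
       + ennreal ((1 + 1 / t) * M) * (\<integral>\<^sup>+y. ennreal (1 / y^2) * indicator {y. r \<le> \<bar>y\<bar>} y \<partial>lborel)))"
  proof -
    note [measurable] = wall_integrand_measurable[OF Wg]
    have [measurable]: "(\<lambda>y::real. ennreal (1 / y^2) * indicator {y. r \<le> \<bar>y\<bar>} y) \<in> borel_measurable borel" by measurable
    show ?thesis unfolding wall_eq[OF Wg bnd] by (simp add: nn_integral_cmult nn_integral_add)
  qed
  also have "\<dots> \<le> ennreal \<bar>s\<bar> * (ennreal (a / s^2) * (ennreal ((1 + t)^2) * wall \<mu> + ennreal ((1 + 1 / t) * M) * ennreal (2 / r)))"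
    by (intro mult_left_mono add_left_mono nn_integral_inverse_square_tails[OF r]) auto
  also have "\<dots> = ennreal (a / exp (- T)) * (ennreal ((1 + t)^2) * wall \<mu> + ennreal ((1 + 1 / t) * (2 * M * exp (- b))))"
  proof -
    have "ennreal \<bar>s\<bar> * ennreal (a / s^2) = ennreal (a / exp (- T))"
      using s a by (simp add: ennreal_mult[symmetric] power2_eq_square s_def)
    moreover have "ennreal ((1 + 1 / t) * M) * ennreal (2 / r) = ennreal ((1 + 1 / t) * (2 * M * exp (- b)))"
      using t M1 r by (simp add: ennreal_mult[symmetric] r_def exp_minus divide_inverse mult.assoc mult.left_commute)
    ultimately show ?thesis by (simp add: mult.assoc[symmetric])
  qed
  finally show "wall \<mu>' \<le> ennreal (a / exp (- T)) * (ennreal ((1 + t)^2) * wall \<mu> + ennreal ((1 + 1 / t) * (2 * M * exp (- b))))" .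
qed

subsection \<open>Bounds for the renormalised energy\<close>

lemma W12_1_smooth:
  assumes "smooth_on UNIV p"
  shows "W12_1 I1 p (deriv p)"
proof -
  have "W12_1 I1 (\<lambda>_. 0) (\<lambda>_. 0)" by (simp add: W12_1_def set_borel_measurable_def)
  from W12_1_rescale[OF this assms smooth_on_const[of UNIV 0] zero_less_one zero_less_one]
  show ?thesis by simp
qed

text \<open>The rescaling construction applied to the zero function with
  \<open>\<Theta> = 0\<close>, so that only the smooth part \<open>P\<close> remains.\<close>

lemma smooth_competitor:
  assumes P: "smooth2 P" and arc: "\<And>t. t \<in> {0<..<pi} \<Longrightarrow> P (cos t, sin t) \<le> 1 - \<gamma>"
  shows "P \<in> Wmu \<gamma> (\<lambda>t. P (t, 0))" "dirichlet P = grad_sq P"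
proof -
  have 0: "W12_2 Bplus (\<lambda>_. 0) (\<lambda>_. 0)" by (simp add: W12_2_def set_borel_measurable_def)
  then have in0: "in_W12_2 Bplus (\<lambda>_. 0)" by (auto simp: in_W12_2_def)
  have g0: "grad2 (\<lambda>_. 0) x = 0" for x by (simp add: grad2_def pd_def zero_prod_def split: prod.splits)
  have "sqint Bplus (\<lambda>x. norm (grad2 (\<lambda>_. 0) x - wgrad Bplus (\<lambda>_. 0) x)) = 0"
  proof -
    have "sqint Bplus (\<lambda>x. norm (grad2 (\<lambda>_. 0) x - wgrad Bplus (\<lambda>_. 0) x)) = (\<integral>\<^sup>+x. 0 \<partial>(lborel :: pt measure))"
      using wgrad_AE[OF 0] by (intro nn_integral_cong_AE) (auto elim!: eventually_mono simp: g0 indicator_def)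
    then show ?thesis by simp
  qed
  then have ap: "approx (\<lambda>_. 0) (\<lambda>_. 0) (\<lambda>_ _. 0)" by (simp add: approx_def smooth2_const)
  note R = competitor_rescale[OF in0 ap _ P smooth2_const[of 0] zero_less_one order_refl zero_less_one _ arc]
  show "P \<in> Wmu \<gamma> (\<lambda>t. P (t, 0))" using R(1) by (simp add: set_borel_measurable_def)
  have "(\<lambda>n. grad_sq P) \<longlonglongrightarrow> dirichlet P"
    using R(2) by (simp add: set_borel_measurable_def)
  then show "dirichlet P = grad_sq P"
    using LIMSEQ_unique tendsto_const by blast
qed

lemma Einf_le: "\<mu> \<in> Mgam \<gamma> \<Longrightarrow> w \<in> Wmu \<gamma> \<mu> \<Longrightarrow> Einf \<gamma> \<epsilon> \<le> ennreal (\<epsilon> / 2) * wall \<mu> + ennreal (1/2) * dirichlet w"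
  unfolding Einf_def Egam_def by (rule INF_lower2[of \<mu>]) (auto intro!: add_left_mono mult_left_mono INF_lower)

text \<open>The competitor equals \<open>1 - \<gamma>\<close> on the arc and has a logarithmic profile outside the ball of radius \<open>\<delta>\<close>.\<close>

lemma barrier_energy:
  fixes \<gamma> \<delta> L :: real
  assumes \<gamma>: "0 < \<gamma>" "\<gamma> < 2" and L: "0 < L" and \<delta>: "\<delta> = exp (- L)"
  obtains \<mu> w where "\<mu> \<in> Mgam \<gamma>" "w \<in> Wmu \<gamma> \<mu>" "dirichlet w \<le> ennreal (pi * \<gamma>^2 / L)"
    "wall \<mu> \<le> ennreal (8 * pi * \<gamma> / ((2 - \<gamma>) * L * \<delta>))"
proof -
  \<comment> \<open>The profile is \<open>1 - k * ln (1 + r^4 / \<delta>^4)\<close> at radius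
    \<open>r\<close>, smooth at the origin. \<open>\<Lambda>\<close> is the logarithm at
    \<open>r = 1\<close>, so \<open>k = \<gamma> / \<Lambda>\<close> gives exactly
    \<open>1 - \<gamma>\<close> on the arc.\<close>
  define \<Lambda> where "\<Lambda> = ln (1 + 1 / \<delta>^4)"
  have d: "0 < \<delta>" by (simp add: \<delta>)
  have d4: "1 / \<delta>^4 = exp (4 * L)" by (simp add: \<delta> divide_inverse flip: exp_minus exp_of_nat_mult)
  have \<Lambda>: "\<Lambda> \<ge> 4 * L"
  proof -
    have "4 * L = ln (exp (4 * L))" by simp
    also have "\<dots> \<le> \<Lambda>" unfolding \<Lambda>_def d4 by (subst ln_le_cancel_iff) (auto intro: add_pos_pos)
    finally show ?thesis .
  qed
  then have \<Lambda>0: "\<Lambda> > 0" using L by linarith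
  define k where "k = \<gamma> / \<Lambda>"
  have k: "k > 0" using \<gamma> \<Lambda>0 by (simp add: k_def)
  define f where "f t = ln (1 + t^2)" for t :: real
  have f: "smooth_on UNIV f" unfolding f_def
    by (intro smooth_on_comp[OF _ _ smooth_on_ln]) (auto intro!: smooth_on_add smooth_on_mult add_pos_nonneg simp: power2_eq_square)
  define w where "w x = 1 - k * f (sqn x / \<delta>^2)" for x
  define \<mu> where "\<mu> t = w (t, 0)" for t
  have sw: "smooth2 w" unfolding w_def[abs_def] by (intro smooth2_diff smooth2_mult smooth2_const smooth2_radial f)
  have kf: "k * f (1 / \<delta>^2) = \<gamma>"
    using \<Lambda>0 by (simp add: k_def f_def \<Lambda>_def power_divide flip: power_mult)
  have arc: "w (cos t, sin t) \<le> 1 - \<gamma>" for t using kf by (simp add: w_def sqn_def)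
  have W: "w \<in> Wmu \<gamma> \<mu>" unfolding \<mu>_def by (rule smooth_competitor[OF sw arc])
  have s\<mu>: "smooth_on UNIV \<mu>" unfolding \<mu>_def[abs_def] by (rule smooth2_line[OF sw])
  have \<mu>e: "\<mu> t = 1 - k * ln (1 + t^4 / \<delta>^4)" for t
    by (simp add: \<mu>_def w_def f_def sqn_def power_divide flip: power_mult)
  have M: "\<mu> \<in> Mgam \<gamma>"
    unfolding Mgam_def mem_Collect_eq
  proof (intro conjI)
    show "in_W12_1 I1 \<mu>" using W12_1_smooth[OF s\<mu>] by (auto simp: in_W12_1_def)
    show "continuous_on {-1..1} \<mu>" by (rule smooth_on_continuous[OF s\<mu>])
    show "\<mu> 0 = 1" by (simp add: \<mu>e)
    have "k * ln (1 + 1 / \<delta>^4) = \<gamma>" using \<Lambda>0 by (simp add: k_def \<Lambda>_def)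
    then show "\<mu> (-1) \<le> 1 - \<gamma>" "\<mu> 1 \<le> 1 - \<gamma>" by (simp_all add: \<mu>e)
  qed
  have lpw: "lp w (s, t) = 1 - k * ln (1 + exp (4 * s) / \<delta>^4)" for s t
    by (simp add: lp_def w_def f_def sqn_polar power_divide flip: power_mult exp_of_nat_mult)
  have p4: "\<delta>^4 + exp (4 * s) > 0" "\<delta>^4 + x^4 > 0" for s x :: real
    using d by (intro add_pos_pos add_pos_nonneg; simp add: zero_le_even_power)+
  have lps: "lp_s w (s, t) = - k * (4 * exp (4 * s) / (\<delta>^4 + exp (4 * s)))" for s t
  proof (rule DERIV_unique[OF lp_deriv(1)[OF sw]])
    have "((\<lambda>s. 1 - k * ln (1 + j * exp (4 * s))) has_real_derivative - k * (4 * exp (4 * s) * j / (1 + j * exp (4 * s)))) (at s)" if "j > 0" for j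
    proof -
      have "1 + j * exp (4 * s) > 0" using that by (intro add_pos_pos) auto
      then show ?thesis by (auto intro!: derivative_eq_intros)
    qed
    from this[of "1 / \<delta>^4"]
    have "((\<lambda>s. 1 - k * ln (1 + exp (4 * s) / \<delta>^4)) has_real_derivative - k * (4 * exp (4 * s) / \<delta>^4 / (1 + exp (4 * s) / \<delta>^4))) (at s)"
      using d by simp
    moreover have "4 * exp (4 * s) / \<delta>^4 / (1 + exp (4 * s) / \<delta>^4) = 4 * exp (4 * s) / (\<delta>^4 + exp (4 * s))"
      using d p4[of s] by (simp add: field_simps)
    ultimately show "((\<lambda>s. lp w (s, t)) has_real_derivative - k * (4 * exp (4 * s) / (\<delta>^4 + exp (4 * s)))) (at s)"
      by (simp add: lpw)
  qed
  have lpt: "lp_t w (s, t) = 0" for s t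
    by (rule DERIV_unique[OF lp_deriv(2)[OF sw]]) (simp add: lpw)
  \<comment> \<open>Replacing the square of a quotient in \<open>{0..1}\<close> by the quotient
    itself leaves an integrand with primitive \<open>ln (\<delta>^4 + exp (4 * s)) / 4\<close>,
    whose integral over \<open>s < 0\<close> is \<open>\<Lambda> / 4\<close>.\<close>
  have en: "lp_en w (s, t) \<le> 16 * k^2 * (exp (4 * s) / (\<delta>^4 + exp (4 * s)))" for s t
  proof -
    let ?q = "exp (4 * s) / (\<delta>^4 + exp (4 * s))"
    have "?q \<le> 1" "0 \<le> ?q" using p4(1)[of s] d by (auto simp: divide_le_eq_1)
    then have "?q^2 \<le> ?q" unfolding power2_eq_square using mult_left_le_one_le[of ?q ?q] by blast
    then have "16 * k^2 * ?q^2 \<le> 16 * k^2 * ?q" by (intro mult_left_mono) auto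
    moreover have "lp_en w (s, t) = 16 * k^2 * ?q^2"
      unfolding lp_en_def lps lpt by (simp add: power_mult_distrib power_divide)
    ultimately show ?thesis by simp
  qed
  define h where "h s = exp (4 * s) / (\<delta>^4 + exp (4 * s))" for s
  have hm [measurable]: "h \<in> borel_measurable borel" unfolding h_def[abs_def] by measurable
  have h0: "h s \<ge> 0" for s using p4(1)[of s] by (simp add: h_def)
  have hint: "(\<integral>\<^sup>+s. ennreal (h s) * indicator {..<0} s \<partial>lborel) \<le> ennreal (\<Lambda> / 4)"
  proof -
    have "(\<integral>\<^sup>+s. ennreal (h s) * indicator {..<0} s \<partial>lborel) \<le> (\<integral>\<^sup>+s. ennreal (h s) * indicator {..0} s \<partial>lborel)"
      by (intro nn_integral_mono) (auto simp: indicator_def)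
    also have "\<dots> = ennreal \<bar>-1\<bar> * (\<integral>\<^sup>+s. ennreal (h (0 + -1 * s)) * indicator {..0} (0 + -1 * s) \<partial>lborel)"
      by (rule nn_integral_real_affine) auto
    also have "\<dots> = (\<integral>\<^sup>+s. ennreal (h (- s)) * indicator {0..} s \<partial>lborel)"
      by (auto intro!: nn_integral_cong simp: indicator_def)
    also have "\<dots> = ennreal (- ln (\<delta>^4) / 4 - (- ln (\<delta>^4 + exp (4 * (- 0))) / 4))"
    proof (rule nn_integral_FTC_atLeast)
      show "((\<lambda>s. - ln (\<delta>^4 + exp (4 * (- s))) / 4) has_real_derivative h (- s)) (at s)" for s
      proof -
        have "16 * y / (x * 16 + y * 16) = y / (x + y)" for x y :: real
        proof -
          have "x * 16 + y * 16 = 16 * (x + y)" by simp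
          then show ?thesis by (metis mult_divide_mult_cancel_left zero_neq_numeral)
        qed
        then show ?thesis using p4(1)[of "- s"] by (auto intro!: derivative_eq_intros simp: h_def)
      qed
      have "((\<lambda>s. - ln (\<delta>^4 + exp (4 * (- s))) / 4) \<longlongrightarrow> - ln (\<delta>^4 + 0) / 4) at_top"
      proof (intro tendsto_intros)
        show "((\<lambda>s::real. exp (4 * (- s))) \<longlongrightarrow> 0) at_top" by real_asymp
      qed (use d in auto)
      then show "((\<lambda>s. - ln (\<delta>^4 + exp (4 * (- s))) / 4) \<longlongrightarrow> - ln (\<delta>^4) / 4) at_top" by simp
    qed (use h0 in auto)
    also have "- ln (\<delta>^4) / 4 - (- ln (\<delta>^4 + exp (4 * (- 0))) / 4) = \<Lambda> / 4"
    proof -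
      have "1 + 1 / \<delta>^4 = (\<delta>^4 + 1) / \<delta>^4" using d by (simp add: field_simps)
      then have "\<Lambda> = ln (\<delta>^4 + 1) - ln (\<delta>^4)" unfolding \<Lambda>_def using d p4(1)[of 0] by (simp add: ln_div)
      then show ?thesis by simp
    qed
    finally show ?thesis .
  qed
  have D: "dirichlet w \<le> ennreal (pi * \<gamma>^2 / L)"
  proof -
    have "dirichlet w = strip_en w {..<0}"
      by (simp add: smooth_competitor(2)[OF sw arc] nn_integral_grad_Bplus[OF sw])
    also have "\<dots> \<le> (\<integral>\<^sup>+s. (\<integral>\<^sup>+t. ennreal (16 * k^2 * h s) * indicator {0<..<pi} t \<partial>lborel) * indicator {..<0} s \<partial>lborel)"
      unfolding strip_en_def using en unfolding h_def
      by (intro nn_integral_mono mult_right_mono ennreal_leI) auto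
    also have "\<dots> = (\<integral>\<^sup>+s. ennreal (16 * k^2 * pi) * (ennreal (h s) * indicator {..<0} s) \<partial>lborel)"
    proof (rule nn_integral_cong)
      fix s
      have "(\<integral>\<^sup>+t. ennreal (16 * k^2 * h s) * indicator {0<..<pi} t \<partial>lborel) = ennreal (16 * k^2 * h s) * ennreal pi"
        by (subst nn_integral_cmult_indicator) auto
      also have "\<dots> = ennreal (16 * k^2 * pi) * ennreal (h s)"
        using h0[of s] by (simp add: ennreal_mult[symmetric] mult_ac)
      finally show "(\<integral>\<^sup>+t. ennreal (16 * k^2 * h s) * indicator {0<..<pi} t \<partial>lborel) * indicator {..<0} s = ennreal (16 * k^2 * pi) * (ennreal (h s) * indicator {..<0} s)"
        by (simp add: mult.assoc)
    qed
    also have "\<dots> = ennreal (16 * k^2 * pi) * (\<integral>\<^sup>+s. ennreal (h s) * indicator {..<0} s \<partial>lborel)"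
      by (rule nn_integral_cmult) measurable
    also have "\<dots> \<le> ennreal (16 * k^2 * pi) * ennreal (\<Lambda> / 4)" by (intro mult_left_mono hint) simp
    also have "\<dots> = ennreal (4 * pi * \<gamma>^2 / \<Lambda>)"
      using \<Lambda>0 by (simp add: ennreal_mult[symmetric] k_def power2_eq_square)
    also have "\<dots> \<le> ennreal (4 * pi * \<gamma>^2 / (4 * L))" using \<Lambda> L \<gamma> by (intro ennreal_leI divide_left_mono) auto
    finally show ?thesis by simp
  qed
  have d\<mu>: "deriv \<mu> x = - k * (4 * x^3 / (\<delta>^4 + x^4))" for x
  proof (rule DERIV_imp_deriv)
    have 1: "1 + x^4 / \<delta>^4 > 0" using d by (intro add_pos_nonneg) (auto simp: zero_le_even_power)
    have "((\<lambda>x. 1 - k * ln (1 + j * x^4)) has_real_derivative - k * (4 * x^3 * j / (1 + j * x^4))) (at x)" if "j > 0" for j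
    proof -
      have "1 + j * x^4 > 0" using that by (intro add_pos_nonneg mult_nonneg_nonneg) (auto simp: zero_le_even_power)
      then show ?thesis by (auto intro!: derivative_eq_intros)
    qed
    from this[of "1 / \<delta>^4"]
    have "((\<lambda>x. 1 - k * ln (1 + x^4 / \<delta>^4)) has_real_derivative - k * (4 * x^3 / \<delta>^4 / (1 + x^4 / \<delta>^4))) (at x)"
      using d by simp
    moreover have "4 * x^3 / \<delta>^4 / (1 + x^4 / \<delta>^4) = 4 * x^3 / (\<delta>^4 + x^4)"
      using d p4(2)[of x] 1 by (simp add: field_simps)
    ultimately show "(\<mu> has_real_derivative - k * (4 * x^3 / (\<delta>^4 + x^4))) (at x)" by (simp only: \<mu>e[abs_def])
  qed
  have uu: "0 \<le> k * ln (1 + x^4 / \<delta>^4)" "k * ln (1 + x^4 / \<delta>^4) \<le> \<gamma>" if "\<bar>x\<bar> \<le> 1" for x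
  proof -
    have "x^4 \<le> 1" using that power_mono[of "\<bar>x\<bar>" 1 4] by (simp add: power_even_abs)
    then have l: "x^4 / \<delta>^4 \<le> 1 / \<delta>^4" "0 \<le> x^4 / \<delta>^4" using d by (auto intro!: divide_right_mono simp: zero_le_even_power)
    then show "0 \<le> k * ln (1 + x^4 / \<delta>^4)" using k by simp
    have "ln (1 + x^4 / \<delta>^4) \<le> \<Lambda>" unfolding \<Lambda>_def by (subst ln_le_cancel_iff; use l in linarith)
    then have "k * ln (1 + x^4 / \<delta>^4) \<le> k * \<Lambda>" using k by (intro mult_left_mono) auto
    then show "k * ln (1 + x^4 / \<delta>^4) \<le> \<gamma>" using \<Lambda>0 by (simp add: k_def)
  qed
  have bnd: "\<forall>x\<in>{-1..1}. \<bar>\<mu> x\<bar> \<le> 1" using uu \<gamma> unfolding \<mu>e by (smt (verit) atLeastAtMost_iff)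
  have pw: "(deriv \<mu> x)^2 / (1 - (\<mu> x)\<^sup>2) \<le> 32 * k / (2 - \<gamma>) * (1 / (\<delta>^2 + x^2))" if x: "\<bar>x\<bar> \<le> 1" "x \<noteq> 0" for x
  proof -
    define u where "u = k * ln (1 + x^4 / \<delta>^4)"
    define v where "v = x^4 / (\<delta>^4 + x^4)"
    have x4: "x^4 > 0" using x by (simp add: zero_less_power_eq)
    have v: "v > 0" using x4 p4(2)[of x] by (simp add: v_def)
    have z: "1 + x^4 / \<delta>^4 > 0" using x4 d by (intro add_pos_pos) auto
    \<comment> \<open>In the form \<open>ln (1 + z) >= z / (1 + z)\<close> this bounds
      \<open>1 - \<mu>\<close> below by \<open>k * v\<close>, a factor which then cancels against
      the squared derivative, including its zero at the origin.\<close>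
    have "ln (inverse (1 + x^4 / \<delta>^4)) \<le> inverse (1 + x^4 / \<delta>^4) - 1" using z by (intro ln_le_minus_one) simp
    moreover have "inverse (1 + x^4 / \<delta>^4) = 1 - v" using d p4(2)[of x] z by (simp add: v_def field_simps)
    moreover have "ln (inverse (1 + x^4 / \<delta>^4)) = - ln (1 + x^4 / \<delta>^4)" by (rule ln_inverse)
    ultimately have "v \<le> ln (1 + x^4 / \<delta>^4)" by linarith
    then have uv: "k * v \<le> u" unfolding u_def using k by (intro mult_left_mono) auto
    have u\<gamma>: "u \<le> \<gamma>" unfolding u_def by (rule uu[OF x(1)])
    have kv: "0 < k * v" using k v by simp
    have m: "1 - (\<mu> x)\<^sup>2 = u * (2 - u)" by (simp add: \<mu>e u_def power2_eq_square algebra_simps)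
    have le: "k * v * (2 - \<gamma>) \<le> u * (2 - u)" using uv u\<gamma> kv \<gamma> by (intro mult_mono) auto
    have "(deriv \<mu> x)^2 / (1 - (\<mu> x)\<^sup>2) \<le> (deriv \<mu> x)^2 / (k * v * (2 - \<gamma>))"
      unfolding m
    proof (rule divide_left_mono[OF le])
      have "0 < u" "u < 2" using uv kv u\<gamma> \<gamma> by linarith+
      then show "0 < u * (2 - u) * (k * v * (2 - \<gamma>))" using kv \<gamma> by simp
    qed simp
    also have "(deriv \<mu> x)^2 / (k * v * (2 - \<gamma>)) = 16 * k^2 * (x^2 * v / (\<delta>^4 + x^4)) / (k * v * (2 - \<gamma>))"
      unfolding d\<mu> v_def by (simp add: power_mult_distrib power_divide power2_eq_square power3_eq_cube power4_eq_xxxx)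
    also have "16 * k^2 * (x^2 * v / (\<delta>^4 + x^4)) / (k * v * (2 - \<gamma>)) = 16 * k / (2 - \<gamma>) * (x^2 / (\<delta>^4 + x^4))"
      using k v by (simp add: power2_eq_square mult_ac)
    \<comment> \<open>The bound by \<open>2 / (\<delta>^2 + x^2)\<close> has an arctangent as
      primitive, with total mass at most a multiple of \<open>1 / \<delta>\<close>.\<close>
    also have "\<dots> \<le> 16 * k / (2 - \<gamma>) * (2 / (\<delta>^2 + x^2))"
    proof (intro mult_left_mono)
      have "x^2 * (\<delta>^2 + x^2) \<le> 2 * (\<delta>^4 + x^4)"
        using sum_squares_bound[of "x^2" "\<delta>^2"] zero_le_even_power[of 4 x] zero_le_even_power[of 4 \<delta>]
        by (simp add: algebra_simps power4_eq_xxxx power2_eq_square)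
      moreover have "\<delta>^2 + x^2 > 0" using d by (intro add_pos_nonneg) auto
      ultimately have "x^2 \<le> 2 * (\<delta>^4 + x^4) / (\<delta>^2 + x^2)" by (simp add: pos_le_divide_eq)
      then have "x^2 / (\<delta>^4 + x^4) \<le> 2 * (\<delta>^4 + x^4) / (\<delta>^2 + x^2) / (\<delta>^4 + x^4)"
        using p4(2)[of x] by (intro divide_right_mono) auto
      also have "\<dots> = 2 / (\<delta>^2 + x^2)" using p4(2)[of x] by (metis less_irrefl nonzero_mult_div_cancel_right times_divide_eq_left times_divide_eq_right)
      finally show "x^2 / (\<delta>^4 + x^4) \<le> 2 / (\<delta>^2 + x^2)" .
    qed (use k \<gamma> in auto)
    finally show ?thesis by simp
  qed
  have Wl: "wall \<mu> \<le> ennreal (8 * pi * \<gamma> / ((2 - \<gamma>) * L * \<delta>))"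
  proof -
    have "wall \<mu> = (\<integral>\<^sup>+x\<in>I1. ennreal ((deriv \<mu> x)^2 / (1 - (\<mu> x)\<^sup>2)) \<partial>lborel)"
      by (rule wall_eq[OF W12_1_smooth[OF s\<mu>] bnd])
    also have "\<dots> \<le> (\<integral>\<^sup>+x. ennreal (32 * k / (2 - \<gamma>)) * (ennreal (1 / (\<delta>^2 + x^2)) * indicator {-1..1} x) \<partial>lborel)"
    proof (rule nn_integral_mono_AE)
      show "AE x in lborel. ennreal ((deriv \<mu> x)^2 / (1 - (\<mu> x)\<^sup>2)) * indicator I1 x \<le> ennreal (32 * k / (2 - \<gamma>)) * (ennreal (1 / (\<delta>^2 + x^2)) * indicator {-1..1} x)"
        using AE_lborel_singleton[of "0::real"]
      proof eventually_elim
        case (elim x)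
        show ?case
        proof (cases "x \<in> I1")
          case True
          then have "ennreal ((deriv \<mu> x)^2 / (1 - (\<mu> x)\<^sup>2)) \<le> ennreal (32 * k / (2 - \<gamma>) * (1 / (\<delta>^2 + x^2)))"
            using elim by (intro ennreal_leI pw) auto
          then show ?thesis using True k \<gamma> by (simp add: ennreal_mult[symmetric])
        qed simp
      qed
    qed
    also have "\<dots> = ennreal (32 * k / (2 - \<gamma>)) * (\<integral>\<^sup>+x. ennreal (1 / (\<delta>^2 + x^2)) * indicator {-1..1} x \<partial>lborel)"
      by (rule nn_integral_cmult) measurable
    also have "(\<integral>\<^sup>+x. ennreal (1 / (\<delta>^2 + x^2)) * indicator {-1..1} x \<partial>lborel) = ennreal (arctan (1 / \<delta>) / \<delta> - arctan (-1 / \<delta>) / \<delta>)"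
    proof (rule nn_integral_FTC_Icc[where F = "\<lambda>x. arctan (x / \<delta>) / \<delta>"])
      show "((\<lambda>x. arctan (x / \<delta>) / \<delta>) has_real_derivative 1 / (\<delta>^2 + x^2)) (at x)" for x
      proof -
        have "1 / (\<delta> * (1 + (x / \<delta>)^2)) / \<delta> = 1 / (\<delta>^2 + x^2)"
        proof -
          have "\<delta> * (1 + (x / \<delta>)^2) * \<delta> = \<delta>^2 + x^2" using d by (simp add: field_simps power2_eq_square)
          then show ?thesis by (simp only: divide_divide_eq_left)
        qed
        moreover have "((\<lambda>x. x / \<delta>) has_real_derivative 1 / \<delta>) (at x)" by (auto intro: DERIV_cdivide)
        from DERIV_cdivide[OF DERIV_chain2[OF DERIV_arctan this], of \<delta>]
        have "((\<lambda>x. arctan (x / \<delta>) / \<delta>) has_real_derivative 1 / (\<delta> * (1 + (x / \<delta>)^2)) / \<delta>) (at x)"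
          by (rule DERIV_cong) (simp add: divide_inverse mult.commute)
        ultimately show ?thesis by simp
      qed
    qed (auto simp: add_nonneg_nonneg)
    also have "\<dots> \<le> ennreal (pi / \<delta>)"
    proof (rule ennreal_leI)
      have "arctan (1 / \<delta>) - arctan (-1 / \<delta>) \<le> pi" using arctan_bounded[of "1 / \<delta>"] arctan_bounded[of "-1 / \<delta>"] by linarith
      then show "arctan (1 / \<delta>) / \<delta> - arctan (-1 / \<delta>) / \<delta> \<le> pi / \<delta>"
        using d by (simp only: diff_divide_distrib[symmetric]) (simp add: divide_right_mono)
    qed
    finally have "wall \<mu> \<le> ennreal (32 * k / (2 - \<gamma>)) * ennreal (pi / \<delta>)" by (simp add: mult_left_mono)
    also have "\<dots> = ennreal (32 * pi * \<gamma> / ((2 - \<gamma>) * \<Lambda> * \<delta>))"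
      using \<Lambda>0 \<gamma> d by (subst ennreal_mult[symmetric]) (auto simp: k_def mult_ac)
    also have "\<dots> \<le> ennreal (32 * pi * \<gamma> / ((2 - \<gamma>) * (4 * L) * \<delta>))"
      using \<Lambda> L \<gamma> d \<Lambda>0 by (intro ennreal_leI divide_left_mono mult_right_mono mult_left_mono mult_pos_pos) auto
    also have "32 * pi * \<gamma> / ((2 - \<gamma>) * (4 * L) * \<delta>) = 8 * pi * \<gamma> / ((2 - \<gamma>) * L * \<delta>)"
    proof -
      have "32 * pi * \<gamma> / (4 * Z) = 8 * pi * \<gamma> / Z" for Z by simp
      moreover have "(2 - \<gamma>) * (4 * L) * \<delta> = 4 * ((2 - \<gamma>) * L * \<delta>)" by (simp only: mult_ac)
      ultimately show ?thesis by (simp only:)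
    qed
    finally show ?thesis .
  qed
  from that[OF M W D Wl] show ?thesis .
qed

section \<open>Lower bounds for the Dirichlet energy of admissible pairs\<close>

lemma dirichlet_real_tendsto:
  assumes "in_W12_2 Bplus w" "approx w \<mu> \<phi>"
  shows "(\<lambda>n. enn2real (grad_sq (\<phi> n))) \<longlonglongrightarrow> enn2real (dirichlet w)"
  by (rule tendsto_enn2real) (use approx_dirichlet[OF assms] in auto)

lemma strip_le_dirichlet:
  assumes "smooth2 \<phi>" "a \<le> 0"
  shows "integral (rect a 0) (lp_en (\<lambda>x. 1 - \<phi> x)) \<le> enn2real (grad_sq \<phi>)"
proof -
  have s: "smooth2 (\<lambda>x. 1 - \<phi> x)" by (intro smooth2_diff smooth2_const assms)
  have "ennreal (integral (rect a 0) (lp_en (\<lambda>x. 1 - \<phi> x))) \<le> grad_sq \<phi>"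
    using strip_en_split[OF s assms(2)] grad_one_minus[OF assms(1)] by simp
  from enn2real_mono[OF this nn_integral_grad_Bplus_finite[OF assms(1), unfolded infinity_ennreal_def]]
  show ?thesis
    by (subst (asm) enn2real_ennreal) (auto intro!: rect_nonneg continuous_on_lp s simp: lp_en_def)
qed

lemma wall_finite_bounded: "wall \<mu> < \<infinity> \<Longrightarrow> \<forall>x\<in>{-1..1}. \<bar>\<mu> x\<bar> \<le> 1"
  by (auto simp: wall_def split: if_splits)

abbreviation excess :: "real \<Rightarrow> (pt \<Rightarrow> real) \<Rightarrow> pt \<Rightarrow> real" where
  "excess lm \<phi> \<equiv> \<lambda>p. (lp_s (\<lambda>x. 1 - \<phi> x) p - lm)^2 + (lp_t (\<lambda>x. 1 - \<phi> x) p)^2"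

lemma continuous_excess: "smooth2 \<phi> \<Longrightarrow> continuous_on UNIV (excess lm \<phi>)"
  by (intro continuous_intros continuous_on_lp smooth2_diff smooth2_const)

text \<open>The limit form of \<open>strip_excess\<close>. Here the two energies meet: the average
  of \<open>1 - \<mu>\<close> over the flat boundary near \<open>exp a\<close>, which lowers the
  flux, is controlled by the wall energy through \<open>wall_growth\<close>.\<close>

lemma dirichlet_excess:
  fixes \<gamma> lm a e :: real
  assumes M: "\<mu> \<in> Mgam \<gamma>" and w: "in_W12_2 Bplus w" and ap: "approx w \<mu> \<phi>" and arcb: "arc_below \<gamma> \<phi>"
    and fin: "wall \<mu> < \<infinity>" and a: "a + 1 < 0" and lm: "lm \<ge> 0" and e: "e > 0"
  shows "\<forall>\<^sub>F n in sequentially. integral (rect (a+1) 0) (excess lm (\<phi> n))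
    \<le> enn2real (dirichlet w) - 2 * lm * (pi * \<gamma> - pi * (2 * exp (a + 1) * enn2real (wall \<mu>))) + lm^2 * pi * (- a + pi^2) + e"
proof -
  define W where "W = enn2real (wall \<mu>)"
  have c\<mu>: "continuous_on {-1..1} \<mu>" and \<mu>0: "\<mu> 0 = 1" using M by (auto simp: Mgam_def)
  obtain g where Wg: "W12_1 I1 \<mu> g" using M by (auto simp: Mgam_def in_W12_1_def)
  have m\<mu>: "set_borel_measurable lborel I1 \<mu>" using Wg by (simp add: W12_1_def)
  have s\<phi>: "smooth2 (\<phi> n)" for n using ap by (simp add: approx_def)
  \<comment> \<open>The term \<open>0 * (s - a)\<close> brings the average into the form of
    \<open>flat_deviation_tendsto\<close> with slope 0.\<close>
  define m where "m = integral {a..a+1} (\<lambda>s. (1 - \<mu> (exp s)) - 0 * (s - a))"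
  have m: "m \<le> 2 * exp (a + 1) * W"
  proof -
    have sub: "exp ` {a..a+1} \<subseteq> {-1..1}"
    proof
      fix x assume "x \<in> exp ` {a..a+1}"
      then obtain s where "x = exp s" "s \<le> a + 1" by auto
      then show "x \<in> {-1..1}" using a exp_gt_zero[of s] by (simp del: exp_gt_zero)
    qed
    have "m \<le> integral {a..a+1} (\<lambda>s. 2 * exp (a + 1) * W)"
      unfolding m_def
    proof (rule integral_le)
      show "(\<lambda>s. (1 - \<mu> (exp s)) - 0 * (s - a)) integrable_on {a..a+1}"
        by (intro integrable_continuous_real continuous_intros continuous_on_compose2[OF c\<mu> _ sub])
      fix s assume s: "s \<in> {a..a+1}"
      have "1 - \<mu> (exp s) \<le> 2 * exp s * W" unfolding W_def
        using s a by (intro wall_growth[OF Wg c\<mu> \<mu>0 wall_finite_bounded[OF fin] fin]) auto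
      also have "\<dots> \<le> 2 * exp (a + 1) * W" using s by (intro mult_right_mono mult_left_mono) (auto simp: W_def)
      finally show "(1 - \<mu> (exp s)) - 0 * (s - a) \<le> 2 * exp (a + 1) * W" by simp
    qed auto
    then show ?thesis by simp
  qed
  define mn where "mn n = integral {a..a+1} (\<lambda>s. lp (\<lambda>x. 1 - \<phi> n x) (s, 0))" for n
  have mn: "mn \<longlonglongrightarrow> m"
    using flat_deviation_tendsto[OF ap c\<mu> m\<mu> a m_def] unfolding mn_def by (simp add: LIM_zero_iff)
  define Dn where "Dn n = enn2real (grad_sq (\<phi> n))" for n
  have Dlim: "Dn \<longlonglongrightarrow> enn2real (dirichlet w)" unfolding Dn_def by (rule dirichlet_real_tendsto[OF w ap])
  obtain \<delta> where \<delta>: "\<delta> \<longlonglongrightarrow> 0" "\<forall>\<^sub>F n in sequentially. pi * \<gamma> - \<delta> n \<le> integral {0..pi} (\<lambda>t. lp (\<lambda>x. 1 - \<phi> n x) (0, t))"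
    using arc_deficit_tendsto[OF s\<phi> arcb] by blast
  define X where "X n = Dn n - 2 * lm * (pi * \<gamma> - \<delta> n - pi * mn n) + lm^2 * pi * (- a + pi^2)" for n
  have Xlim: "X \<longlonglongrightarrow> enn2real (dirichlet w) - 2 * lm * (pi * \<gamma> - 0 - pi * m) + lm^2 * pi * (- a + pi^2)"
    unfolding X_def by (intro tendsto_intros Dlim \<delta>(1) mn)
  have "2 * lm * (pi * m) \<le> 2 * lm * (pi * (2 * exp (a + 1) * W))" using m lm by (intro mult_left_mono) auto
  then have "enn2real (dirichlet w) - 2 * lm * (pi * \<gamma> - 0 - pi * m) + lm^2 * pi * (- a + pi^2)
      < enn2real (dirichlet w) - 2 * lm * (pi * \<gamma> - pi * (2 * exp (a + 1) * W)) + lm^2 * pi * (- a + pi^2) + e"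
    using e unfolding right_diff_distrib by linarith
  from order_tendstoD(2)[OF Xlim this] \<delta>(2)
  show ?thesis unfolding W_def[symmetric]
  proof eventually_elim
    case (elim n)
    have s\<psi>: "smooth2 (\<lambda>x. 1 - \<phi> n x)" by (intro smooth2_diff smooth2_const s\<phi>)
    have E: "integral (rect (a+1) 0) (excess lm (\<phi> n)) + 2 * lm * (integral {0..pi} (\<lambda>t. lp (\<lambda>x. 1 - \<phi> n x) (0, t)) - pi * mn n) - lm\<^sup>2 * pi * (- a + pi^2)
        \<le> integral (rect a 0) (lp_en (\<lambda>x. 1 - \<phi> n x))"
      using strip_excess[OF strip_fun_lp[OF s\<psi>], of a lm] a unfolding mn_def lp_en_def[abs_def] by simp
    have "integral (rect a 0) (lp_en (\<lambda>x. 1 - \<phi> n x)) \<le> Dn n"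
      unfolding Dn_def using a by (intro strip_le_dirichlet s\<phi>) simp
    moreover have "2 * lm * (pi * \<gamma> - \<delta> n - pi * mn n) \<le> 2 * lm * (integral {0..pi} (\<lambda>t. lp (\<lambda>x. 1 - \<phi> n x) (0, t)) - pi * mn n)"
      using elim lm by (intro mult_left_mono) auto
    ultimately show ?case using E elim(1) unfolding X_def by linarith
  qed
qed

text \<open>With \<open>L = ln (1 / \<delta>)\<close> and \<open>l = ln (1 / \<epsilon>)\<close>, the hypothesis \<open>\<epsilon> * l = exp (- L)\<close> says \<open>\<delta> = \<epsilon> l\<close>.\<close>

lemma renormalised_excess:
  fixes \<gamma> \<epsilon> L l e :: real and \<mu> :: "real \<Rightarrow> real" and w :: "pt \<Rightarrow> real"
  assumes \<gamma>: "0 < \<gamma>" and M: "\<mu> \<in> Mgam \<gamma>" and w: "in_W12_2 Bplus w" and ap: "approx w \<mu> \<phi>" and arcb: "arc_below \<gamma> \<phi>"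
    and fin: "wall \<mu> < \<infinity>" and L: "L > 0" and \<epsilon>: "\<epsilon> > 0" "\<epsilon> * l = exp (- L)" "l \<le> 2 * L" and e: "e > 0"
  defines "q \<equiv> 1 + 16 * pi * \<gamma>"
    and "Wh \<equiv> L\<^sup>2 * (\<epsilon> / 2 * enn2real (wall \<mu>))"
    and "H \<equiv> L\<^sup>2 * (\<epsilon> / 2 * enn2real (wall \<mu>) + enn2real (dirichlet w) / 2) - pi * \<gamma>^2 / 2 * L"
  shows "\<forall>\<^sub>F n in sequentially. L^2 * integral (rect (- L - q + 1) 0) (excess (\<gamma> / L) (\<phi> n)) \<le> 2 * H - Wh + \<gamma>^2 * pi * (q + pi^2) + e"
proof -
  have q: "q \<ge> 1" using \<gamma> by (simp add: q_def)
  let ?W = "enn2real (wall \<mu>)" and ?D = "enn2real (dirichlet w)"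
  have eq: "L^2 * (?D - 2 * (\<gamma> / L) * (pi * \<gamma> - pi * (2 * exp (- L - q + 1) * ?W)) + (\<gamma> / L)^2 * pi * (- (- L - q) + pi^2) + e / L^2)
     = L^2 * ?D - 2 * L * \<gamma> * (pi * \<gamma> - pi * (2 * exp (- L - q + 1) * ?W)) + \<gamma>^2 * pi * (L + q + pi^2) + e"
    using L by (simp add: field_simps power2_eq_square)
  \<comment> \<open>This is what \<open>q\<close> is chosen for. Starting the strip \<open>q\<close>
    units below \<open>- L\<close> makes the flat boundary term at most \<open>Wh\<close>, whereas
    expressing the Dirichlet term through \<open>H\<close> leaves \<open>- 2 * Wh\<close>. The
    surviving \<open>- Wh\<close> later bounds the wall energy itself.\<close>
  have "16 * pi * \<gamma> * exp (1 - q) \<le> 1"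
  proof -
    have "16 * pi * \<gamma> \<le> exp (16 * pi * \<gamma>)" using exp_ge_add_one_self[of "16 * pi * \<gamma>"] by linarith
    then have "16 * pi * \<gamma> * exp (- (16 * pi * \<gamma>)) \<le> exp (16 * pi * \<gamma>) * exp (- (16 * pi * \<gamma>))" by (intro mult_right_mono) auto
    then show ?thesis by (simp add: q_def flip: exp_add)
  qed
  moreover have p: "0 \<le> L * exp (- L) * ?W" using L by simp
  ultimately have "(16 * pi * \<gamma> * exp (1 - q)) * (L * exp (- L) * ?W) \<le> 1 * (L * exp (- L) * ?W)" by (rule mult_right_mono)
  moreover have "exp (- L - q + 1) = exp (1 - q) * exp (- L)" by (simp flip: exp_add)
  ultimately have "2 * L * \<gamma> * (pi * (2 * exp (- L - q + 1) * ?W)) \<le> L * exp (- L) * ?W / 4" by (simp add: mult_ac)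
  also have "\<dots> \<le> Wh"
  proof -
    have "L * \<epsilon> * ?W * l \<le> L * \<epsilon> * ?W * (2 * L)" using L \<epsilon> by (intro mult_left_mono) auto
    moreover have "L * exp (- L) * ?W = L * \<epsilon> * ?W * l" unfolding \<epsilon>(2)[symmetric] by (simp only: mult_ac)
    moreover have "Wh = L * \<epsilon> * ?W * (2 * L) / 4" by (simp add: Wh_def power2_eq_square)
    ultimately show ?thesis by linarith
  qed
  finally have W: "2 * L * \<gamma> * (pi * (2 * exp (- L - q + 1) * ?W)) \<le> Wh" .
  have lm: "\<gamma> / L \<ge> 0" and ee: "e / L^2 > 0" and a: "(- L - q) + 1 < 0" using \<gamma> L e q by auto
  show ?thesis using dirichlet_excess[OF M w ap arcb fin a lm ee]
  proof eventually_elim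
    case (elim n)
    have "L^2 * integral (rect (- L - q + 1) 0) (excess (\<gamma> / L) (\<phi> n)) \<le> L^2 * ?D - 2 * L * \<gamma> * (pi * \<gamma> - pi * (2 * exp (- L - q + 1) * ?W)) + \<gamma>^2 * pi * (L + q + pi^2) + e"
      unfolding eq[symmetric] using elim by (intro mult_left_mono) auto
    also have "\<dots> = L^2 * ?D - \<gamma>\<^sup>2 * pi * L + 2 * L * \<gamma> * (pi * (2 * exp (- L - q + 1) * ?W)) + \<gamma>^2 * pi * (q + pi^2) + e"
      by (simp add: algebra_simps power2_eq_square)
    also have "\<dots> \<le> L^2 * ?D - \<gamma>\<^sup>2 * pi * L + Wh + \<gamma>^2 * pi * (q + pi^2) + e" using W by linarith
    also have "\<dots> = 2 * H - Wh + \<gamma>^2 * pi * (q + pi^2) + e" by (simp add: H_def Wh_def algebra_simps)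
    finally show ?case .
  qed
qed

section \<open>Nearly optimal pairs and the choice of an annulus\<close>

lemma near_optimal:
  assumes E: "Einf \<gamma> \<epsilon> < ennreal E" and \<epsilon>: "\<epsilon> > 0"
  obtains \<mu> w where "\<mu> \<in> Mgam \<gamma>" "w \<in> Wmu \<gamma> \<mu>" "wall \<mu> < \<infinity>" "\<epsilon> / 2 * enn2real (wall \<mu>) + enn2real (dirichlet w) / 2 < E"
proof -
  obtain \<mu> where \<mu>: "\<mu> \<in> Mgam \<gamma>" "Egam \<gamma> \<epsilon> \<mu> < ennreal E" using E by (auto simp: Einf_def INF_less_iff)
  let ?I = "INF w\<in>Wmu \<gamma> \<mu>. dirichlet w"
  have lt: "ennreal (\<epsilon> / 2) * wall \<mu> + ennreal (1/2) * ?I < ennreal E" using \<mu>(2) by (simp add: Egam_def)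
  then have "ennreal (\<epsilon> / 2) * wall \<mu> < top" "ennreal (1/2) * ?I < top"
    by (auto simp: less_top[symmetric] intro: le_less_trans dest: order.strict_trans[OF _ ennreal_less_top])
  then have wf: "wall \<mu> < \<infinity>" and If: "?I < top" using \<epsilon> unfolding ennreal_mult_less_top by auto
  then obtain W i where W: "wall \<mu> = ennreal W" "W \<ge> 0" and i: "?I = ennreal i" "i \<ge> 0"
    by (cases "wall \<mu>"; cases ?I) auto
  have "ennreal (\<epsilon> / 2 * W + 1 / 2 * i) < ennreal E"
  proof -
    have "ennreal (\<epsilon> / 2 * W) = ennreal (\<epsilon> / 2) * ennreal W" "ennreal (1 / 2 * i) = ennreal (1 / 2) * ennreal i"
      using W i \<epsilon> by (intro ennreal_mult; simp)+
    moreover have "ennreal (\<epsilon> / 2 * W + 1 / 2 * i) = ennreal (\<epsilon> / 2 * W) + ennreal (1 / 2 * i)"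
      using W i \<epsilon> by (intro ennreal_plus) auto
    ultimately show ?thesis using lt unfolding W(1) i(1) by (simp only:)
  qed
  then have "\<epsilon> / 2 * W + i / 2 < E" using W i \<epsilon> ennreal_less_iff[of "\<epsilon> / 2 * W + 1 / 2 * i" E] by (simp del: ennreal_plus)
  then have "?I < ennreal (2 * (E - \<epsilon> / 2 * W))" unfolding i(1) using i(2) by (simp add: ennreal_less_iff)
  then obtain w where w: "w \<in> Wmu \<gamma> \<mu>" "dirichlet w < ennreal (2 * (E - \<epsilon> / 2 * W))" by (auto simp: INF_less_iff)
  obtain D where D: "dirichlet w = ennreal D" "D \<ge> 0" using w(2) by (cases "dirichlet w") auto
  have "D < 2 * (E - \<epsilon> / 2 * W)" using w(2) D by (simp add: ennreal_less_iff)
  then have "\<epsilon> / 2 * enn2real (wall \<mu>) + enn2real (dirichlet w) / 2 < E" using W D by simp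
  from that[OF \<mu>(1) w(1) wf this] show ?thesis .
qed

lemma rect_annuli_sum:
  assumes f: "continuous_on UNIV (f :: pt \<Rightarrow> real)"
  shows "(\<Sum>k = 1..N. integral (rect (- real k - 1) (- real k)) f) = integral (rect (- real N - 1) (- 1)) f"
proof (induction N)
  case 0
  show ?case using rect_fubini(1)[OF f, of "-1" "-1"] by simp
next
  case (Suc N)
  have "integral (rect (- real (Suc N) - 1) (- 1)) f = integral (rect (- real (Suc N) - 1) (- real (Suc N))) f + integral (rect (- real (Suc N)) (- 1)) f"
    by (rule rect_split[OF f]) auto
  moreover have "integral (rect (- real (Suc N)) (- 1)) f = integral (rect (- real N - 1) (- 1)) f"
    by (rule arg_cong[where f = "\<lambda>x. integral (rect x (- 1)) f"]) simp
  moreover have "(\<Sum>k = 1..Suc N. g k) = (\<Sum>k = 1..N. g k) + g (Suc N)" for g :: "nat \<Rightarrow> real" by simp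
  ultimately show ?case using Suc.IH by (simp only:)
qed

text \<open>Two pigeonhole arguments: for each large \<open>n\<close> one of the \<open>N\<close>
  annuli has at most the average excess, and since there are finitely many, one annulus serves
  infinitely many \<open>n\<close>. The subsequence makes its position independent of
  \<open>n\<close>.\<close>

lemma good_annulus:
  assumes s: "\<And>n. smooth2 (\<phi> n)" and N: "N \<ge> 1" "a \<le> - real N - 1"
    and ev: "\<forall>\<^sub>F n in sequentially. integral (rect a 0) (excess lm (\<phi> n)) \<le> X"
  obtains r b where "strict_mono (r :: nat \<Rightarrow> nat)" "- real N - 1 \<le> b" "b + 1 < 0"
    "\<And>n. integral (rect b (b + 1)) (excess lm (\<phi> (r n))) \<le> X / real N" "\<And>n. integral (rect b 0) (excess lm (\<phi> (r n))) \<le> X"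
proof -
  define P where "P k n \<longleftrightarrow> integral (rect (- real k - 1) (- real k)) (excess lm (\<phi> n)) \<le> X / real N \<and> integral (rect (- real k - 1) 0) (excess lm (\<phi> n)) \<le> X" for k n
  have "\<forall>\<^sub>F n in sequentially. \<exists>k\<in>{1..N}. P k n"
    using ev
  proof eventually_elim
    case (elim n)
    let ?f = "excess lm (\<phi> n)"
    have c: "continuous_on UNIV ?f" by (rule continuous_excess[OF s])
    have sub: "integral (rect x y) ?f \<le> X" if "a \<le> x" "x \<le> y" "y \<le> 0" for x y
    proof -
      have "integral (rect a 0) ?f = integral (rect a x) ?f + (integral (rect x y) ?f + integral (rect y 0) ?f)"
        using that by (subst rect_split[OF c, of a x]; (subst rect_split[OF c, of x y])?) auto
      moreover have "0 \<le> integral (rect a x) ?f" "0 \<le> integral (rect y 0) ?f" by (rule rect_nonneg[OF c]; simp)+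
      ultimately show ?thesis using elim by linarith
    qed
    have "\<exists>k\<in>{1..N}. integral (rect (- real k - 1) (- real k)) ?f \<le> X / real N"
    proof (rule ccontr)
      assume "\<not> ?thesis"
      then have "\<forall>k\<in>{1..N}. X / real N < integral (rect (- real k - 1) (- real k)) ?f" by force
      then have "(\<Sum>k = 1..N. X / real N) < (\<Sum>k = 1..N. integral (rect (- real k - 1) (- real k)) ?f)"
        using N by (intro sum_strict_mono) auto
      then have "X < integral (rect (- real N - 1) (- 1)) ?f" using N rect_annuli_sum[OF c] by simp
      then show False using sub[of "- real N - 1" "-1"] N by simp
    qed
    then obtain k where "k \<in> {1..N}" "integral (rect (- real k - 1) (- real k)) ?f \<le> X / real N" by blast
    moreover from this have "integral (rect (- real k - 1) 0) ?f \<le> X" using N by (intro sub) auto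
    ultimately show ?case unfolding P_def by blast
  qed
  then have "\<exists>\<^sub>F n in sequentially. \<exists>k\<in>{1..N}. P k n" by (intro eventually_frequently) auto
  then obtain k where k: "k \<in> {1..N}" "\<exists>\<^sub>F n in sequentially. P k n" by (auto dest: frequently_bex_finite[rotated])
  then have "infinite {n. P k n}" by (simp add: frequently_cofinite flip: cofinite_eq_sequentially)
  then obtain r where r: "strict_mono (r :: nat \<Rightarrow> nat)" "\<And>n. r n \<in> {n. P k n}" using infinite_enumerate by blast
  show ?thesis
    by (rule that[of r "- real k - 1"]) (use k(1) r in \<open>auto simp: P_def\<close>)
qed

text \<open>Provides the lower bound for the average \<open>c\<close>, by which the wall estimate of
  the glued profile divides. The flux from the annulus to the arc differs from that of the logarithm
  of slope \<open>lm\<close> only by the square root of the excess.\<close>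

lemma flat_average_lower:
  fixes b c \<gamma> lm C \<eta> I :: real
  assumes ap: "approx w \<mu> \<phi>" and arcb: "arc_below \<gamma> \<phi>"
    and c\<mu>: "continuous_on {-1..1} \<mu>" and m\<mu>: "set_borel_measurable lborel I1 \<mu>"
    and b: "b + 1 < 0" and lm: "lm \<ge> 0"
    and cdef: "c = integral {b..b+1} (\<lambda>s. (1 - \<mu> (exp s)) - lm * (s - b))"
    and \<eta>: "\<And>n. integral (rect b (b+1)) (excess lm (\<phi> n)) \<le> \<eta>"
    and I: "\<And>n. integral (rect b 0) (excess lm (\<phi> n)) \<le> I"
    and C: "\<And>\<tau>. 0 \<le> \<tau> \<Longrightarrow> \<bar>deriv cutoff \<tau> * (2 * \<tau>)\<bar> \<le> C"
  shows "pi * \<gamma> - pi * c + pi * lm * b \<le> sqrt (pi * (- b) * I) + sqrt (pi * ((4 + 16 * pi^2 * C^2) * \<eta>))"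
proof -
  have s\<phi>: "smooth2 (\<phi> n)" for n using ap by (simp add: approx_def)
  obtain \<delta> where \<delta>: "\<delta> \<longlonglongrightarrow> 0" "\<forall>\<^sub>F n in sequentially. pi * \<gamma> - \<delta> n \<le> integral {0..pi} (\<lambda>t. lp (\<lambda>x. 1 - \<phi> n x) (0, t))"
    using arc_deficit_tendsto[OF s\<phi> arcb] by blast
  define d where "d n = integral {b..b+1} (\<lambda>s. lp (\<lambda>x. 1 - \<phi> n x) (s, 0) - lm * (s - b)) - c" for n
  have dlim: "d \<longlonglongrightarrow> 0" unfolding d_def by (rule flat_deviation_tendsto[OF ap c\<mu> m\<mu> b cdef])
  define R where "R n = \<delta> n + sqrt (pi * (- b) * I) + sqrt (pi * ((4 + 16 * pi^2 * C^2) * \<eta> + 8 * pi * C^2 * (d n)^2))" for n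
  have "R \<longlonglongrightarrow> 0 + sqrt (pi * (- b) * I) + sqrt (pi * ((4 + 16 * pi^2 * C^2) * \<eta> + 8 * pi * C^2 * 0^2))"
    unfolding R_def by (intro tendsto_intros \<delta>(1) dlim)
  moreover have "\<forall>\<^sub>F n in sequentially. pi * \<gamma> - pi * c + pi * lm * b \<le> R n"
    using \<delta>(2)
  proof eventually_elim
    case (elim n)
    have s\<psi>: "smooth2 (\<lambda>x. 1 - \<phi> n x)" by (intro smooth2_diff smooth2_const s\<phi>)
    let ?ct = "\<lambda>s. cutoff (exp (2 * (s - b)))" and ?ct' = "\<lambda>s. deriv cutoff (exp (2 * (s - b))) * (2 * exp (2 * (s - b)))"
    have ct1: "?ct s = 1" if "s \<le> b" for s using that by (intro cutoff_1) simp
    have ct0: "?ct s = 0" if "b + 1 \<le> s" for s using that by (intro cutoff_0) simp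
    have ctC: "\<bar>?ct' s\<bar> \<le> C" for s by (rule C) simp
    have b0: "b + 1 \<le> 0" using b by simp
    \<comment> \<open>With \<open>\<kappa> = lm\<close> the term in \<open>(lm - \<kappa>)^2\<close>
      drops out of \<open>Q\<close>. The fourth conclusion does not involve \<open>T\<close>, so
      \<open>T = 0\<close> may be taken.\<close>
    note G = strip_glue(4)[where b = b and T = 0 and c = c, OF strip_fun_lp[OF s\<psi>] b0 b0 cutoff_exp_has_deriv continuous_on_deriv_cutoff_exp ct1 ct0 cutoff_bounds(1) cutoff_bounds(2) ctC lm lm]
    let ?Q = "(4 + 16 * pi^2 * C^2) * integral (rect b (b+1)) (excess lm (\<phi> n)) + 8 * pi * C^2 * (d n)^2"
    have "integral {0..pi} (\<lambda>t. lp (\<lambda>x. 1 - \<phi> n x) (0, t)) - pi * c + pi * lm * b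
      \<le> sqrt (pi * (- b) * integral (rect b 0) (excess lm (\<phi> n))) + sqrt (pi * ?Q)"
      using G unfolding d_def by simp
    moreover have "sqrt (pi * (- b) * integral (rect b 0) (excess lm (\<phi> n))) \<le> sqrt (pi * (- b) * I)"
      unfolding real_sqrt_le_iff using b by (intro mult_left_mono[OF I] mult_nonneg_nonneg) auto
    moreover have "sqrt (pi * ?Q) \<le> sqrt (pi * ((4 + 16 * pi^2 * C^2) * \<eta> + 8 * pi * C^2 * (d n)^2))"
      unfolding real_sqrt_le_iff using \<eta> by (intro mult_left_mono add_right_mono) auto
    ultimately show ?case using elim unfolding R_def by linarith
  qed
  ultimately show ?thesis using tendsto_lowerbound[of R _ sequentially "pi * \<gamma> - pi * c + pi * lm * b"] by simp
qed

text \<open>The limit is the limes superior, the infimum of the eventual upper bounds. Each value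
  plus its error is such a bound, so values far along the filter cannot lie much below the
  infimum.\<close>

lemma tendsto_if_almost_decreasing:
  fixes G err :: "'a \<Rightarrow> real"
  assumes F: "F \<noteq> bot" and lower: "\<forall>\<^sub>F x in F. - B \<le> G x" and upper: "\<forall>\<^sub>F x in F. G x \<le> B"
    and err: "(err \<longlongrightarrow> 0) F" and dec: "\<forall>\<^sub>F x in F. \<forall>\<^sub>F y in F. G y \<le> G x + err x"
  shows "\<exists>e. (G \<longlongrightarrow> e) F"
proof -
  define S where "S = {x. \<forall>\<^sub>F y in F. G y \<le> x}"
  have BS: "B \<in> S" using upper by (simp add: S_def)
  have bdd: "bdd_below S"
  proof (rule bdd_belowI)
    fix x assume "x \<in> S"
    then have "\<forall>\<^sub>F y in F. - B \<le> x" using lower unfolding S_def by (auto elim: eventually_elim2)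
    then show "- B \<le> x" using F by (simp add: eventually_const_iff)
  qed
  have "(G \<longlongrightarrow> Inf S) F"
  proof (rule order_tendstoI)
    fix h assume h: "h < Inf S"
    have "\<forall>\<^sub>F x in F. err x < Inf S - h" using order_tendstoD(2)[OF err, of "Inf S - h"] h by simp
    then show "\<forall>\<^sub>F x in F. h < G x" using dec
    proof eventually_elim
      case (elim x)
      then have "G x + err x \<in> S" by (simp add: S_def)
      then have "Inf S \<le> G x + err x" by (rule cInf_lower[OF _ bdd])
      then show ?case using elim by linarith
    qed
  next
    fix h assume "Inf S < h"
    then obtain x where "x \<in> S" "x < h" using cInf_lessD[of S h] BS by auto
    then show "\<forall>\<^sub>F x in F. G x < h" unfolding S_def by (auto elim: eventually_mono)
  qed
  then show ?thesis ..
qed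

subsection \<open>Comparison of the minimal energies at two scales\<close>

text \<open>The scale \<open>L\<close>, the pair and the annulus are fixed while \<open>L'\<close>
  grows, so all dependence on \<open>L'\<close> cancels, tends to zero into \<open>e\<close>, or is
  bounded independently of \<open>L'\<close>. Quantifying over \<epsilon> and \<open>l\<close> under
  the limit lets the result be composed with the dependence of \<open>L'\<close> on
  \<epsilon>.\<close>

lemma glued_energy:
  fixes \<mu> :: "real \<Rightarrow> real" and w :: "pt \<Rightarrow> real" and \<gamma> L b c t C \<eta> e lm K M' :: real
  assumes \<gamma>: "0 < \<gamma>" "\<gamma> < 2" and M: "\<mu> \<in> Mgam \<gamma>" and fin: "wall \<mu> < \<infinity>" and w: "in_W12_2 Bplus w"
    and ap: "approx w \<mu> \<phi>" and arcb: "arc_below \<gamma> \<phi>" and b: "b + 1 < 0" and L: "0 < L" and lmL: "lm * L = \<gamma>"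
    and cdef: "c = integral {b..b+1} (\<lambda>s. (1 - \<mu> (exp s)) - lm * (s - b))" and c: "c > 0"
    and \<eta>: "\<And>n. integral (rect b (b+1)) (excess lm (\<phi> n)) \<le> \<eta>"
    and C: "C > 0" "\<And>\<tau>. (deriv cutoff \<tau>)^2 \<le> C * (1 - cutoff \<tau>)" "\<And>\<tau>. 0 \<le> \<tau> \<Longrightarrow> \<bar>deriv cutoff \<tau> * (2 * \<tau>)\<bar> \<le> C"
    and t: "0 < t" "t \<le> 1" and e: "e > 0"
  defines "K \<equiv> 4 + 16 * pi^2 * C^2"
    and "M' \<equiv> (2 * (lm + 1)^2 + 8 * exp 4 * C * (2 + c + (lm + 1))^2) / c + (lm + 1)^2 / (c * (2 - \<gamma>))"
  shows "\<forall>\<^sub>F L' in at_top. \<forall>\<epsilon> l. 0 < \<epsilon> \<longrightarrow> L' \<le> l \<longrightarrow> \<epsilon> * l = exp (- L') \<longrightarrow>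
    L'\<^sup>2 * enn2real (Einf \<gamma> \<epsilon>) - pi * \<gamma>^2 / 2 * L' \<le> L^2 * (enn2real (dirichlet w) / 2) - pi * \<gamma>^2 / 2 * L
      + L^2 / 2 * (4 * lm * sqrt (pi * (K * \<eta>)) + K * \<eta>)
      + L / 2 * exp (- L) * ((1 + t)^2 * enn2real (wall \<mu>) + (1 + 1 / t) * (2 * M' * exp (- b))) + e"
proof -
  define W where "W = enn2real (wall \<mu>)"
  define D where "D = enn2real (dirichlet w)"
  have W: "wall \<mu> = ennreal W" "W \<ge> 0" using fin by (auto simp: W_def less_top)
  have lm: "lm > 0" using lmL L \<gamma> by (metis zero_less_mult_pos2)
  have c\<mu>: "continuous_on {-1..1} \<mu>" and \<mu>0: "\<mu> 0 = 1" and in1: "in_W12_1 I1 \<mu>" using M by (auto simp: Mgam_def)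
  have m\<mu>: "set_borel_measurable lborel I1 \<mu>" using in1 by (auto simp: in_W12_1_def W12_1_def)
  note bnd = wall_finite_bounded[OF fin]
  \<comment> \<open>With \<open>a = L / L'\<close> and \<open>lm * L = \<gamma>\<close>, the value
    \<gamma> on the arc requires \<open>\<kappa> * (L' - L - b) = lm * L' - c\<close>. The
    right-hand side is \<open>lm * (L' - L - b) + B\<close>, so \<kappa> tends to
    \<open>lm\<close>.\<close>
  define B where "B = lm * (L + b) - c"
  define \<kappa> where "\<kappa> L' = lm + B / (L' - L - b)" for L'
  define Qb where "Qb L' = K * \<eta> + 4 * pi * (1 + C^2) * (lm - \<kappa> L')^2" for L'
  define F where "F L' = L^2 / 2 * (2 * (lm + \<kappa> L') * sqrt (pi * Qb L') + Qb L') + pi * L^2 / 2 * (B^2 / (L' - L - b))" for L'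
  have q0: "((\<lambda>L'. x / (L' - L - b)) \<longlongrightarrow> 0) at_top" for x :: real
    by (rule real_tendsto_divide_at_top[OF tendsto_const]) real_asymp
  have \<kappa>lim: "(\<kappa> \<longlongrightarrow> lm) at_top"
    unfolding \<kappa>_def using tendsto_add[OF tendsto_const q0, of lm B] by simp
  have Qlim: "(Qb \<longlongrightarrow> K * \<eta>) at_top"
  proof -
    have "(Qb \<longlongrightarrow> K * \<eta> + 4 * pi * (1 + C^2) * (lm - lm)^2) at_top" unfolding Qb_def by (intro tendsto_intros \<kappa>lim)
    then show ?thesis by simp
  qed
  have Flim: "(F \<longlongrightarrow> L\<^sup>2 / 2 * (4 * lm * sqrt (pi * (K * \<eta>)) + K * \<eta>)) at_top"
  proof -
    have "(F \<longlongrightarrow> L\<^sup>2 / 2 * (2 * (lm + lm) * sqrt (pi * (K * \<eta>)) + K * \<eta>) + pi * L^2 / 2 * 0) at_top"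
      unfolding F_def by (intro tendsto_intros \<kappa>lim Qlim q0)
    then show ?thesis by simp
  qed
  have ev1: "\<forall>\<^sub>F L' in at_top. F L' < L^2 / 2 * (4 * lm * sqrt (pi * (K * \<eta>)) + K * \<eta>) + e"
    by (rule order_tendstoD(2)[OF Flim]) (use e in simp)
  have ev2: "\<forall>\<^sub>F L' in at_top. 0 < \<kappa> L'" "\<forall>\<^sub>F L' in at_top. \<kappa> L' < lm + 1"
    using order_tendstoD[OF \<kappa>lim] lm by simp_all
  have ev3: "\<forall>\<^sub>F L' in at_top. L / L' * (2 + c + (lm + 1)) < 2 * t / (1 + t)"
  proof (rule order_tendstoD(2))
    show "((\<lambda>L'. L / L' * (2 + c + (lm + 1))) \<longlongrightarrow> 0 * (2 + c + (lm + 1))) at_top"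
      by (intro tendsto_intros real_tendsto_divide_at_top[OF tendsto_const] filterlim_ident)
  qed (use t in simp)
  show ?thesis
    using ev1 ev2 ev3 eventually_gt_at_top[of L]
  proof eventually_elim
    case (elim L')
    show ?case
    proof (intro allI impI)
      fix \<epsilon> l :: real assume \<epsilon>: "0 < \<epsilon>" "L' \<le> l" "\<epsilon> * l = exp (- L')"
      define T where "T = L' - L"
      define a where "a = L / L'"
      define k where "k = \<kappa> L'"
      define S where "S = L' - L - b"
      have L': "L' > 0" using elim L by linarith
      have T0: "0 \<le> T" using elim by (simp add: T_def)
      have S: "S > 0" "T - b = S" using elim b by (auto simp: S_def T_def)
      have a: "a > 0" using L L' by (simp add: a_def)
      have k: "k \<ge> 0" "k \<le> lm + 1" using elim by (auto simp: k_def)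
      have kS: "k = lm + B / S" by (simp add: k_def \<kappa>_def S_def)
      have kS1: "k * S = lm * L' - c" using S unfolding kS by (simp add: B_def S_def field_simps)
      have arc: "a * (c + k * (T - b)) = \<gamma>" using L' lmL unfolding S(2) kS1 by (simp add: a_def mult.commute)
      have small: "a * (2 + c + k) \<le> 2 * t / (1 + t)"
      proof -
        have "a * (2 + c + k) \<le> a * (2 + c + (lm + 1))" using k a by (intro mult_left_mono) auto
        then show ?thesis using elim by (simp add: a_def)
      qed
      define w' where "w' = (\<lambda>x. add_part a (exp (b - T)) c k x + mult_part a (exp (b - T)) x * w ((1 / exp (- T)) *\<^sub>R x))"
      define \<mu>' where "\<mu>' = (\<lambda>t. add_part a (exp (b - T)) c k (t, 0) + mult_part a (exp (b - T)) (t, 0) * \<mu> (t / exp (- T)))"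
      define Y where "Y = D + lm^2 * pi * b - 2 * lm * (pi * \<gamma> - pi * c + pi * lm * b) + 2 * (lm + k) * sqrt (pi * Qb L') + k^2 * pi * (T - b) + Qb L'"
      note G1 = glue_dirichlet[OF w ap arcb c\<mu> m\<mu> b T0 less_imp_le[OF lm] k(1) a arc cdef \<eta> C(3)]
      note G2 = glue_wall[OF in1 c\<mu> \<mu>0 bnd \<gamma> b T0 a k(1) c arc t small C(1,2)]
      have w': "w' \<in> Wmu \<gamma> \<mu>'" unfolding w'_def \<mu>'_def by (rule G1(1))
      have dw': "dirichlet w' \<le> ennreal (a^2 * Y)" and Y0: "0 \<le> Y"
        using G1(2,3) unfolding w'_def Y_def D_def Qb_def K_def k_def by (simp_all only:)
      define Mk where "Mk = (2 * k^2 + 8 * exp 4 * C * (2 + c + k)^2) / c + k^2 / (c * (2 - \<gamma>))"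
      define Z where "Z = (1 + t)^2 * W + (1 + 1 / t) * (2 * Mk * exp (- b))"
      have \<mu>': "\<mu>' \<in> Mgam \<gamma>" unfolding \<mu>'_def by (rule G2(1))
      have Mk0: "0 \<le> Mk" using c \<gamma> C by (simp add: Mk_def)
      have ww: "wall \<mu>' \<le> ennreal (a / exp (- T) * Z)"
      proof -
        have "wall \<mu>' \<le> ennreal (a / exp (- T)) * (ennreal ((1 + t)^2) * wall \<mu> + ennreal ((1 + 1 / t) * (2 * Mk * exp (- b))))"
          using G2(2) unfolding \<mu>'_def Mk_def .
        also have "ennreal ((1 + t)^2) * wall \<mu> + ennreal ((1 + 1 / t) * (2 * Mk * exp (- b))) = ennreal Z"
          unfolding W(1) Z_def using W(2) t Mk0 by (simp add: ennreal_mult ennreal_plus)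
        also have "ennreal (a / exp (- T)) * ennreal Z = ennreal (a / exp (- T) * Z)"
          using a W t Mk0 by (subst ennreal_mult) (auto simp: Z_def)
        finally show ?thesis .
      qed
      have Z0: "0 \<le> Z" using W t Mk0 by (simp add: Z_def)
      have "Einf \<gamma> \<epsilon> \<le> ennreal (\<epsilon> / 2) * wall \<mu>' + ennreal (1 / 2) * dirichlet w'" by (rule Einf_le[OF \<mu>' w'])
      also have "\<dots> \<le> ennreal (\<epsilon> / 2) * ennreal (a / exp (- T) * Z) + ennreal (1 / 2) * ennreal (a^2 * Y)"
        by (intro add_mono mult_left_mono ww dw') auto
      also have "\<dots> = ennreal (\<epsilon> / 2 * (a / exp (- T) * Z) + 1 / 2 * (a^2 * Y))"
      proof -
        have "ennreal (\<epsilon> / 2 * (a / exp (- T) * Z)) = ennreal (\<epsilon> / 2) * ennreal (a / exp (- T) * Z)" "ennreal (1 / 2 * (a^2 * Y)) = ennreal (1 / 2) * ennreal (a^2 * Y)"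
          using \<epsilon> a Z0 Y0 by (intro ennreal_mult; simp)+
        moreover have "ennreal (\<epsilon> / 2 * (a / exp (- T) * Z) + 1 / 2 * (a^2 * Y)) = ennreal (\<epsilon> / 2 * (a / exp (- T) * Z)) + ennreal (1 / 2 * (a^2 * Y))"
          using \<epsilon> a Z0 Y0 by (intro ennreal_plus) auto
        ultimately show ?thesis by (simp only:)
      qed
      finally have "enn2real (Einf \<gamma> \<epsilon>) \<le> \<epsilon> / 2 * (a / exp (- T) * Z) + 1 / 2 * (a^2 * Y)"
        using \<epsilon> a Z0 Y0 by (intro enn2real_leI) auto
      then have "L'^2 * enn2real (Einf \<gamma> \<epsilon>) \<le> L'^2 * (\<epsilon> / 2 * (a / exp (- T) * Z) + 1 / 2 * (a^2 * Y))"
        by (rule mult_left_mono) simp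
      also have "\<dots> = L'^2 * (\<epsilon> / 2 * (a / exp (- T) * Z)) + L^2 / 2 * Y"
        using L' by (simp add: a_def power_divide distrib_left)
      finally have E: "L'^2 * enn2real (Einf \<gamma> \<epsilon>) \<le> L'^2 * (\<epsilon> / 2 * (a / exp (- T) * Z)) + L^2 / 2 * Y" .
      \<comment> \<open>By the choice of scales, \<open>\<epsilon> * L' * exp L' <= 1\<close>. This
        cancels the growth \<open>exp T\<close> of the wall energy under shrinking and leaves the
        factor \<open>L / 2 * exp (- L)\<close>, which belongs to the old scale.\<close>
      have wallpart: "L'^2 * (\<epsilon> / 2 * (a / exp (- T) * Z)) \<le> L / 2 * exp (- L) * ((1 + t)^2 * W + (1 + 1 / t) * (2 * M' * exp (- b)))"
      proof -
        have "\<epsilon> * L' \<le> exp (- L')" using \<epsilon> mult_left_mono[of L' l \<epsilon>] by simp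
        then have "\<epsilon> * L' * exp L' \<le> exp (- L') * exp L'" by (intro mult_right_mono) auto
        then have 1: "\<epsilon> * L' * exp L' \<le> 1" by (simp flip: exp_add)
        have "a / exp (- T) = L / L' * (exp L' * exp (- L))" by (simp add: a_def T_def divide_inverse flip: exp_add exp_minus)
        then have "L'^2 * (\<epsilon> / 2 * (a / exp (- T) * Z)) = \<epsilon> * L' * exp L' * (L / 2 * exp (- L) * Z)"
          using L' by (simp add: power2_eq_square)
        also have "\<dots> \<le> 1 * (L / 2 * exp (- L) * Z)" using 1 L Z0 by (intro mult_right_mono) auto
        also have "\<dots> \<le> L / 2 * exp (- L) * ((1 + t)^2 * W + (1 + 1 / t) * (2 * M' * exp (- b)))"
        proof -
          have kk: "k^2 \<le> (lm + 1)^2" "(2 + c + k)^2 \<le> (2 + c + (lm + 1))^2" using k c by (intro power_mono; simp)+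
          have "Mk \<le> M'" unfolding Mk_def M'_def
            by (intro add_mono divide_right_mono mult_left_mono kk) (use c \<gamma> C in auto)
          then have "(1 + 1 / t) * (2 * Mk * exp (- b)) \<le> (1 + 1 / t) * (2 * M' * exp (- b))"
            using t by (intro mult_left_mono mult_right_mono) auto
          then show ?thesis unfolding Z_def mult_1 using L by (intro mult_left_mono) auto
        qed
        finally show ?thesis .
      qed
      \<comment> \<open>An identity rather than an estimate: all terms linear in \<open>L'\<close>
        and the mixed terms with \<open>B\<close> cancel, and only the gluing errors and
        \<open>B^2 / S\<close>, collected in \<open>F\<close>, remain.\<close>
      have "L^2 / 2 * Y - pi * \<gamma>^2 / 2 * L' = L^2 * (D / 2) - pi * \<gamma>^2 / 2 * L + F L'"
      proof -
        define z where "z = B^2 / S"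
        have "k^2 * S = lm^2 * S + 2 * lm * B + z" using S unfolding kS z_def by (simp add: power2_eq_square field_simps)
        moreover have "k^2 * pi * (T - b) = pi * (k^2 * S)" unfolding S(2) by (simp only: mult_ac)
        ultimately have k2: "k^2 * pi * (T - b) = pi * (lm^2 * (L' - L - b) + 2 * lm * (lm * (L + b) - c) + z)"
          by (simp only: S_def B_def)
        have "L^2 / 2 * (D + lm^2 * p * b - 2 * lm * (p * (lm * L) - p * c + p * lm * b) + x
            + p * (lm^2 * (L' - L - b) + 2 * lm * (lm * (L + b) - c) + z) + Q) - p * (lm * L)^2 / 2 * L'
          = L^2 * (D / 2) - p * (lm * L)^2 / 2 * L + (L^2 / 2 * (x + Q) + p * L^2 / 2 * z)" for p x Q
          by (simp add: power2_eq_square field_simps)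
        then show ?thesis
          unfolding Y_def F_def k2 k_def[symmetric] S_def[symmetric] z_def[symmetric] lmL[symmetric] by blast
      qed
      then show "L'^2 * enn2real (Einf \<gamma> \<epsilon>) - pi * \<gamma>^2 / 2 * L' \<le> L^2 * (enn2real (dirichlet w) / 2) - pi * \<gamma>^2 / 2 * L
        + L^2 / 2 * (4 * lm * sqrt (pi * (K * \<eta>)) + K * \<eta>)
        + L / 2 * exp (- L) * ((1 + t)^2 * enn2real (wall \<mu>) + (1 + 1 / t) * (2 * M' * exp (- b))) + e"
        using E wallpart elim(1) unfolding D_def[symmetric] W_def[symmetric] by linarith
    qed
  qed
qed

text \<open>The parameters left free by \<open>glued_energy\<close> become functions of
  \<open>L\<close>: the accuracy of the almost minimiser, the parameter \<open>t\<close> and the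
  position of the annulus. The bound \<open>B\<close> on \<open>G\<close> makes \<open>C3\<close>
  independent of \<epsilon>, so the final error depends only on \<open>L\<close> and
  \<open>l\<close>.\<close>

lemma almost_decreasing:
  fixes \<gamma> \<epsilon> L l C B K C1 C3 q Mb G :: real
  assumes \<gamma>: "0 < \<gamma>" "\<gamma> < 2"
    and C: "C > 0" "\<And>\<tau>. (deriv cutoff \<tau>)^2 \<le> C * (1 - cutoff \<tau>)" "\<And>\<tau>. 0 \<le> \<tau> \<Longrightarrow> \<bar>deriv cutoff \<tau> * (2 * \<tau>)\<bar> \<le> C"
    and L: "L \<ge> 8" and \<epsilon>: "\<epsilon> > 0" "\<epsilon> * l = exp (- L)" "L \<le> l" "l \<le> 2 * L"
    and fin: "Einf \<gamma> \<epsilon> < \<infinity>"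
  defines "G \<equiv> L\<^sup>2 * enn2real (Einf \<gamma> \<epsilon>) - pi * \<gamma>^2 / 2 * L"
    and "q \<equiv> 1 + 16 * pi * \<gamma>"
    and "K \<equiv> 4 + 16 * pi^2 * C^2"
    and "Mb \<equiv> (2 * (\<gamma> + 1)^2 + 8 * exp 4 * C * (2 + 2 + (\<gamma> + 1))^2) / (\<gamma> / 4) + (\<gamma> + 1)^2 / (\<gamma> / 4 * (2 - \<gamma>))"
  defines "C1 \<equiv> \<gamma>\<^sup>2 * pi * (q + pi^2)"
  defines "C3 \<equiv> 2 * B + C1 + 3"
  assumes B: "G \<le> B" and small: "sqrt (pi * (L / 2) * (C3 / L^2)) + sqrt (pi * (K * (8 * C3 / L^3))) \<le> pi * \<gamma> / 4"
  shows "- (C1 + 3) / 2 \<le> G"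
    and "\<forall>\<^sub>F L' in at_top. \<forall>\<epsilon>' l'. 0 < \<epsilon>' \<longrightarrow> L' \<le> l' \<longrightarrow> \<epsilon>' * l' = exp (- L') \<longrightarrow>
      L'\<^sup>2 * enn2real (Einf \<gamma> \<epsilon>') - pi * \<gamma>^2 / 2 * L' \<le> G
        + (2 * \<gamma> * L * sqrt (pi * (K * (8 * C3 / L^3))) + K * (4 * C3 / L) + C3 * ((1 + 1 / L)^2 * (l / L) - 1)
           + L * (1 + L) * exp (- (L / 2)) * Mb + 2 / L)"
proof -
  have L0: "L > 0" using L by simp
  \<comment> \<open>The tolerance \<open>1 / L^3\<close> becomes \<open>1 / L\<close> after
    multiplication by \<open>L^2\<close>.\<close>
  have "Einf \<gamma> \<epsilon> < ennreal (enn2real (Einf \<gamma> \<epsilon>) + 1 / L^3)"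
    using fin L0 by (cases "Einf \<gamma> \<epsilon>") (auto simp: ennreal_less_iff)
  from near_optimal[OF this \<epsilon>(1)] obtain \<mu> w where \<mu>: "\<mu> \<in> Mgam \<gamma>" "w \<in> Wmu \<gamma> \<mu>" "wall \<mu> < \<infinity>"
    and en: "\<epsilon> / 2 * enn2real (wall \<mu>) + enn2real (dirichlet w) / 2 < enn2real (Einf \<gamma> \<epsilon>) + 1 / L^3" by metis
  note w = WmuD(1)[OF \<mu>(2)]
  obtain \<phi>0 where \<phi>0: "approx w \<mu> \<phi>0" "arc_below \<gamma> \<phi>0" using WmuD(2)[OF \<mu>(2)] by blast
  define W where "W = enn2real (wall \<mu>)"
  define Wh where "Wh = L^2 * (\<epsilon> / 2 * W)"
  define H where "H = L^2 * (\<epsilon> / 2 * W + enn2real (dirichlet w) / 2) - pi * \<gamma>^2 / 2 * L"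
  have HG: "H \<le> G + 1 / L"
  proof -
    have "L^2 * (\<epsilon> / 2 * W + enn2real (dirichlet w) / 2) \<le> L^2 * (enn2real (Einf \<gamma> \<epsilon>) + 1 / L^3)"
      using en unfolding W_def by (intro mult_left_mono) auto
    also have "\<dots> = L^2 * enn2real (Einf \<gamma> \<epsilon>) + 1 / L" using L0 by (simp add: distrib_left power2_eq_square power3_eq_cube)
    finally show ?thesis by (simp add: H_def G_def)
  qed
  have L1: "1 / L \<le> 1" using L by simp
  have Wh0: "Wh \<ge> 0" using \<epsilon> by (simp add: Wh_def W_def)
  define lm where "lm = \<gamma> / L"
  have lm: "lm \<ge> 0" "lm * L = \<gamma>" "lm \<le> \<gamma>" using \<gamma> L by (auto simp: lm_def field_simps)
  have ex: "\<forall>\<^sub>F n in sequentially. L^2 * integral (rect (- L - q + 1) 0) (excess lm (\<phi>0 n)) \<le> 2 * H - Wh + C1 + 1"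
    unfolding q_def H_def Wh_def W_def C1_def lm_def
    by (rule renormalised_excess[OF \<gamma>(1) \<mu>(1) w \<phi>0 \<mu>(3) L0 \<epsilon>(1,2,4)]) simp
  have s\<phi>0: "smooth2 (\<phi>0 n)" for n using \<phi>0 by (simp add: approx_def)
  have "\<exists>n. L^2 * integral (rect (- L - q + 1) 0) (excess lm (\<phi>0 n)) \<le> 2 * H - Wh + C1 + 1"
    using eventually_happens[OF ex] by simp
  then obtain n where n: "L^2 * integral (rect (- L - q + 1) 0) (excess lm (\<phi>0 n)) \<le> 2 * H - Wh + C1 + 1" ..
  have "0 \<le> integral (rect (- L - q + 1) 0) (excess lm (\<phi>0 n))" by (rule rect_nonneg[OF continuous_excess[OF s\<phi>0]]) simp
  \<comment> \<open>Nonnegativity of the excess gives two bounds at once: the lower bound for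
    \<open>G\<close> and, through the term \<open>- Wh\<close>, an upper bound for the renormalised
    wall energy.\<close>
  then have nn: "0 \<le> 2 * H - Wh + C1 + 1" using n by (meson order_trans mult_nonneg_nonneg zero_le_power2)
  have "H \<le> G + 1" using HG L1 by linarith
  then have "0 \<le> 2 * G + C1 + 3" using nn Wh0 by linarith
  then show "- (C1 + 3) / 2 \<le> G" by simp
  have C3: "2 * H - Wh + C1 + 1 \<le> C3" "Wh \<le> C3" "0 \<le> C3" using HG L1 B Wh0 nn by (auto simp: C3_def)
  have ev: "\<forall>\<^sub>F n in sequentially. integral (rect (- L - q + 1) 0) (excess lm (\<phi>0 n)) \<le> C3 / L^2"
    using ex
  proof eventually_elim
    case (elim n)
    then have "L^2 * integral (rect (- L - q + 1) 0) (excess lm (\<phi>0 n)) \<le> C3" using C3 by linarith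
    then show ?case using L0 by (simp add: pos_le_divide_eq mult.commute)
  qed
  \<comment> \<open>\<open>N >= L / 8\<close> gives the excess \<open>8 * C3 / L^3\<close> on the
    chosen annulus, and \<open>N + 1 <= L / 2\<close> keeps its inner radius large enough; both use
    \<open>L >= 8\<close>.\<close>
  define N where "N = nat \<lfloor>L / 4\<rfloor>"
  have N: "N \<ge> 1" "real N \<le> L / 4" "L / 8 \<le> real N"
  proof -
    have f: "2 \<le> \<lfloor>L / 4\<rfloor>" using L by (simp add: le_floor_iff)
    then show "N \<ge> 1" unfolding N_def by linarith
    have "real N = of_int \<lfloor>L / 4\<rfloor>" using f by (simp add: N_def)
    then show "real N \<le> L / 4" "L / 8 \<le> real N" using L by linarith+
  qed
  have q1: "q \<ge> 1" using \<gamma> by (simp add: q_def)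
  have aN: "- L - q + 1 \<le> - real N - 1" using N q1 L by linarith
  obtain r b where rb: "strict_mono (r :: nat \<Rightarrow> nat)" "- real N - 1 \<le> b" "b + 1 < 0"
    and \<eta>0: "\<And>n. integral (rect b (b + 1)) (excess lm (\<phi>0 (r n))) \<le> C3 / L^2 / real N"
    and I: "\<And>n. integral (rect b 0) (excess lm (\<phi>0 (r n))) \<le> C3 / L^2"
    by (rule good_annulus[OF s\<phi>0 N(1) aN ev]) (rule that)
  define \<phi> where "\<phi> = \<phi>0 \<circ> r"
  have ap: "approx w \<mu> \<phi>" and arcb: "arc_below \<gamma> \<phi>" unfolding \<phi>_def by (rule approx_subseq[OF \<phi>0 rb(1)])+
  define \<eta> where "\<eta> = 8 * C3 / L^3"
  have \<eta>: "integral (rect b (b + 1)) (excess lm (\<phi> n)) \<le> \<eta>" for n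
  proof -
    have "C3 / L^2 / real N \<le> C3 / L^2 / (L / 8)" using N C3 L0 by (intro divide_left_mono) auto
    also have "\<dots> = \<eta>" by (simp add: \<eta>_def power2_eq_square power3_eq_cube)
    finally show ?thesis using \<eta>0[of n] by (simp add: \<phi>_def)
  qed
  have I: "integral (rect b 0) (excess lm (\<phi> n)) \<le> C3 / L^2" for n using I[of n] by (simp add: \<phi>_def)
  have bL: "- b \<le> L / 2" "b < 0" using rb N L by auto
  have c\<mu>: "continuous_on {-1..1} \<mu>" and m\<mu>: "set_borel_measurable lborel I1 \<mu>" using \<mu>(1) by (auto simp: Mgam_def in_W12_1_def W12_1_def)
  define c where "c = integral {b..b+1} (\<lambda>s. (1 - \<mu> (exp s)) - lm * (s - b))"
  \<comment> \<open>Of the total drop \<gamma>, the logarithm of slope \<open>\<gamma> / L\<close>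
    uses at most \<open>\<gamma> / 2\<close> outside the annulus because
    \<open>- b <= L / 2\<close>, and the errors at most \<open>\<gamma> / 4\<close> by
    \<open>small\<close>; the rest is left for \<open>c\<close>.\<close>
  have cl: "\<gamma> / 4 \<le> c"
  proof -
    have "pi * \<gamma> - pi * c + pi * lm * b \<le> sqrt (pi * (- b) * (C3 / L^2)) + sqrt (pi * (K * \<eta>))"
      unfolding K_def by (rule flat_average_lower[OF ap arcb c\<mu> m\<mu> rb(3) lm(1) c_def \<eta> I C(3)])
    also have "sqrt (pi * (- b) * (C3 / L^2)) \<le> sqrt (pi * (L / 2) * (C3 / L^2))"
      unfolding real_sqrt_le_iff using bL C3 by (intro mult_right_mono mult_left_mono) auto
    finally have "pi * \<gamma> - pi * c + pi * lm * b \<le> pi * \<gamma> / 4" using small unfolding \<eta>_def by linarith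
    moreover have "pi * (\<gamma> / 2) \<ge> pi * (lm * (- b))"
    proof (rule mult_left_mono)
      have "lm * (- b) \<le> lm * (L / 2)" using bL lm by (intro mult_left_mono) auto
      then show "lm * (- b) \<le> \<gamma> / 2" using lm(2) by simp
    qed simp
    moreover have "pi * (lm * (- b)) = - (pi * lm * b)" "pi * (\<gamma> / 2) = pi * \<gamma> / 2" "pi * (\<gamma> / 4) = pi * \<gamma> / 4" by simp_all
    ultimately have "pi * (\<gamma> / 4) \<le> pi * c" by linarith
    then show ?thesis by (simp only: mult_le_cancel_left_pos[OF pi_gt_zero])
  qed
  have bnd: "\<forall>x\<in>{-1..1}. \<bar>\<mu> x\<bar> \<le> 1" by (rule wall_finite_bounded[OF \<mu>(3)])
  have cu: "c \<le> 2"
  proof -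
    have ei: "exp s \<in> {-1..1}" if "s \<in> {b..b+1}" for s
    proof -
      have "exp s \<le> 1" using that rb(3) by simp
      moreover have "0 < exp s" by simp
      ultimately show ?thesis by (auto simp del: exp_le_one_iff exp_gt_zero)
    qed
    have "c \<le> integral {b..b+1} (\<lambda>s. 2)"
      unfolding c_def
    proof (rule integral_le)
      show "(\<lambda>s. (1 - \<mu> (exp s)) - lm * (s - b)) integrable_on {b..b+1}"
        by (intro integrable_continuous_real continuous_intros continuous_on_compose2[OF c\<mu>]) (use ei in auto)
      fix s assume s: "s \<in> {b..b+1}"
      have "\<bar>\<mu> (exp s)\<bar> \<le> 1" using bnd ei[OF s] by blast
      moreover have "0 \<le> lm * (s - b)" using s lm by simp
      ultimately show "(1 - \<mu> (exp s)) - lm * (s - b) \<le> 2" by linarith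
    qed auto
    then show ?thesis by simp
  qed
  have c0: "c > 0" using cl \<gamma> by linarith
  \<comment> \<open>The parameter of \<open>glue_wall\<close> is taken as \<open>1 / L\<close>: the
    factor \<open>(1 + 1 / L)^2\<close> tends to 1, while the large factor \<open>1 + L\<close> in
    front of the transition cost is beaten by \<open>exp (- (L / 2))\<close>.\<close>
  have t: "0 < 1 / L" "1 / L \<le> 1" using L by auto
  define M' where "M' = (2 * (lm + 1)^2 + 8 * exp 4 * C * (2 + c + (lm + 1))^2) / c + (lm + 1)^2 / (c * (2 - \<gamma>))"
  have M': "M' \<le> Mb"
  proof -
    have kk: "(lm + 1)^2 \<le> (\<gamma> + 1)^2" "(2 + c + (lm + 1))^2 \<le> (2 + 2 + (\<gamma> + 1))^2" using lm c0 cu \<gamma> by (intro power_mono; simp)+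
    show ?thesis unfolding M'_def Mb_def
      by (intro add_mono frac_le mult_left_mono mult_right_mono kk) (use cl \<gamma> C in auto)
  qed
  have final: "L^2 * (enn2real (dirichlet w) / 2) - pi * \<gamma>^2 / 2 * L + L^2 / 2 * (4 * lm * sqrt (pi * (K * \<eta>)) + K * \<eta>)
      + L / 2 * exp (- L) * ((1 + 1 / L)^2 * W + (1 + 1 / (1 / L)) * (2 * M' * exp (- b))) + 1 / L
      \<le> G + (2 * \<gamma> * L * sqrt (pi * (K * (8 * C3 / L^3))) + K * (4 * C3 / L) + C3 * ((1 + 1 / L)^2 * (l / L) - 1)
           + L * (1 + L) * exp (- (L / 2)) * Mb + 2 / L)"
  proof -
    have 1: "L^2 / 2 * (4 * lm * sqrt (pi * (K * \<eta>)) + K * \<eta>) = 2 * \<gamma> * L * sqrt (pi * (K * (8 * C3 / L^3))) + K * (4 * C3 / L)"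
    proof -
      have "L^2 / 2 * (K * \<eta>) = K * (4 * C3 / L)" using L0 by (simp add: \<eta>_def power2_eq_square power3_eq_cube)
      moreover have "L^2 / 2 * (4 * lm * z) = 2 * \<gamma> * L * z" for z using L0 by (simp add: lm_def power2_eq_square)
      ultimately show ?thesis unfolding distrib_left by (simp only: \<eta>_def)
    qed
    \<comment> \<open>At the old scale \<open>L / 2 * exp (- L) * W = Wh * (l / L)\<close>. The wall
      energy is thus preserved up to factors tending to 1, and their effect is at most
      \<open>C3\<close> times the deviation because \<open>Wh <= C3\<close>.\<close>
    have 2: "L / 2 * exp (- L) * ((1 + 1 / L)^2 * W) \<le> Wh + C3 * ((1 + 1 / L)^2 * (l / L) - 1)"
    proof -
      have "L / 2 * exp (- L) * W = Wh * (l / L)" unfolding \<epsilon>(2)[symmetric] Wh_def using L0 by (simp add: power2_eq_square)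
      moreover have "L / 2 * exp (- L) * ((1 + 1 / L)^2 * W) = (L / 2 * exp (- L) * W) * (1 + 1 / L)^2" by (simp only: mult_ac)
      ultimately have "L / 2 * exp (- L) * ((1 + 1 / L)^2 * W) = Wh * ((1 + 1 / L)^2 * (l / L))" by (simp only: mult_ac)
      also have "\<dots> = Wh + Wh * ((1 + 1 / L)^2 * (l / L) - 1)" by (simp add: algebra_simps)
      also have "Wh * ((1 + 1 / L)^2 * (l / L) - 1) \<le> C3 * ((1 + 1 / L)^2 * (l / L) - 1)"
      proof (rule mult_right_mono[OF C3(2)])
        have "1 \<le> l / L" "1 \<le> (1 + 1 / L)^2" using \<epsilon> L0 by (auto intro: one_le_power)
        then have "1 * 1 \<le> (1 + 1 / L)^2 * (l / L)" by (intro mult_mono) auto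
        then show "0 \<le> (1 + 1 / L)^2 * (l / L) - 1" by simp
      qed
      finally show ?thesis by simp
    qed
    have 3: "L / 2 * exp (- L) * ((1 + 1 / (1 / L)) * (2 * M' * exp (- b))) \<le> L * (1 + L) * exp (- (L / 2)) * Mb"
    proof -
      have M0: "0 \<le> Mb" using \<gamma> C by (simp add: Mb_def)
      have "exp (- b) \<le> exp (L / 2)" using bL by simp
      then have "M' * exp (- b) \<le> Mb * exp (L / 2)" using M' M0 by (intro mult_mono) auto
      then have "L * (1 + L) * exp (- L) * (M' * exp (- b)) \<le> L * (1 + L) * exp (- L) * (Mb * exp (L / 2))"
        using L0 by (intro mult_left_mono) auto
      also have "\<dots> = L * (1 + L) * (exp (- L) * exp (L / 2)) * Mb" by (simp only: mult_ac)
      also have "exp (- L) * exp (L / 2) = exp (- (L / 2))" by (simp flip: exp_add)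
      finally show ?thesis by (simp add: mult_ac)
    qed
    have "L^2 * (enn2real (dirichlet w) / 2) - pi * \<gamma>^2 / 2 * L + Wh = H" by (simp add: H_def Wh_def distrib_left)
    moreover have "2 / L = 1 / L + 1 / L" by simp
    ultimately show ?thesis using HG 1 2 3 unfolding distrib_left[of "L / 2 * exp (- L)"] by linarith
  qed
  have e: "0 < 1 / L" using L0 by simp
  from glued_energy[OF \<gamma> \<mu>(1,3) w ap arcb rb(3) L0 lm(2) c_def c0 \<eta> C t e]
  show "\<forall>\<^sub>F L' in at_top. \<forall>\<epsilon>' l'. 0 < \<epsilon>' \<longrightarrow> L' \<le> l' \<longrightarrow> \<epsilon>' * l' = exp (- L') \<longrightarrow>
      L'\<^sup>2 * enn2real (Einf \<gamma> \<epsilon>') - pi * \<gamma>^2 / 2 * L' \<le> G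
        + (2 * \<gamma> * L * sqrt (pi * (K * (8 * C3 / L^3))) + K * (4 * C3 / L) + C3 * ((1 + 1 / L)^2 * (l / L) - 1)
           + L * (1 + L) * exp (- (L / 2)) * Mb + 2 / L)"
    unfolding K_def[symmetric] M'_def[symmetric] W_def[symmetric]
    by (rule eventually_mono) (assumption | intro allI impI, rule order_trans[OF _ final], blast)+
qed

text \<open>The barrier at scale \<open>exp (- L)\<close>: its Dirichlet bound is exactly the
  subtracted logarithmic term, and its wall bound stays finite after renormalisation because
  \<open>\<epsilon> / exp (- L) = 1 / l\<close> and \<open>L <= l\<close>.\<close>

lemma energy_upper:
  fixes \<gamma> \<epsilon> L l :: real
  assumes \<gamma>: "0 < \<gamma>" "\<gamma> < 2" and L: "0 < L" and \<epsilon>: "0 < \<epsilon>" "\<epsilon> * l = exp (- L)" "L \<le> l"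
  shows "Einf \<gamma> \<epsilon> < \<infinity>"
    and "L^2 * enn2real (Einf \<gamma> \<epsilon>) - pi * \<gamma>^2 / 2 * L \<le> 4 * pi * \<gamma> / (2 - \<gamma>)"
proof -
  obtain \<mu> w where b: "\<mu> \<in> Mgam \<gamma>" "w \<in> Wmu \<gamma> \<mu>" "dirichlet w \<le> ennreal (pi * \<gamma>^2 / L)"
    "wall \<mu> \<le> ennreal (8 * pi * \<gamma> / ((2 - \<gamma>) * L * exp (- L)))" by (rule barrier_energy[OF \<gamma> L refl])
  define x where "x = \<epsilon> / 2 * (8 * pi * \<gamma> / ((2 - \<gamma>) * L * exp (- L)))"
  define y where "y = 1 / 2 * (pi * \<gamma>^2 / L)"
  have l: "l > 0" using \<epsilon> L by linarith
  have xy: "0 \<le> x" "0 \<le> y" using \<gamma> L \<epsilon> by (auto simp: x_def y_def)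
  have "Einf \<gamma> \<epsilon> \<le> ennreal (\<epsilon> / 2) * wall \<mu> + ennreal (1 / 2) * dirichlet w" by (rule Einf_le[OF b(1,2)])
  also have "\<dots> \<le> ennreal (\<epsilon> / 2) * ennreal (8 * pi * \<gamma> / ((2 - \<gamma>) * L * exp (- L))) + ennreal (1 / 2) * ennreal (pi * \<gamma>^2 / L)"
    by (intro add_mono mult_left_mono b) auto
  also have "\<dots> = ennreal (x + y)"
  proof -
    have "ennreal x = ennreal (\<epsilon> / 2) * ennreal (8 * pi * \<gamma> / ((2 - \<gamma>) * L * exp (- L)))"
      unfolding x_def using \<gamma> L \<epsilon> by (intro ennreal_mult) auto
    moreover have "ennreal y = ennreal (1 / 2) * ennreal (pi * \<gamma>^2 / L)"
      unfolding y_def using \<gamma> L by (intro ennreal_mult) auto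
    ultimately show ?thesis using xy by (simp only: ennreal_plus)
  qed
  finally have E: "Einf \<gamma> \<epsilon> \<le> ennreal (x + y)" .
  then show "Einf \<gamma> \<epsilon> < \<infinity>" by (rule le_less_trans) simp
  have "enn2real (Einf \<gamma> \<epsilon>) \<le> x + y" using E xy by (intro enn2real_leI) auto
  then have "L^2 * enn2real (Einf \<gamma> \<epsilon>) \<le> L^2 * (x + y)" by (rule mult_left_mono) simp
  also have "\<dots> = 4 * pi * \<gamma> / (2 - \<gamma>) * (L / l) + pi * \<gamma>^2 / 2 * L"
  proof -
    have "L^2 * y = pi * \<gamma>^2 / 2 * L" using L by (simp add: y_def power2_eq_square)
    moreover have "L^2 * x = 4 * pi * \<gamma> / (2 - \<gamma>) * (L / l)"
      unfolding x_def \<epsilon>(2)[symmetric] using L l \<epsilon>(1) by (simp add: power2_eq_square mult_ac)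
    ultimately show ?thesis by (simp add: distrib_left)
  qed
  finally have "L^2 * enn2real (Einf \<gamma> \<epsilon>) - pi * \<gamma>^2 / 2 * L \<le> 4 * pi * \<gamma> / (2 - \<gamma>) * (L / l)" by simp
  also have "\<dots> \<le> 4 * pi * \<gamma> / (2 - \<gamma>) * 1" using \<gamma> \<epsilon> l by (intro mult_left_mono) auto
  finally show "L^2 * enn2real (Einf \<gamma> \<epsilon>) - pi * \<gamma>^2 / 2 * L \<le> 4 * pi * \<gamma> / (2 - \<gamma>)" by simp
qed

theorem theorem4p12:
  fixes \<gamma> :: real
  assumes "0 < \<gamma>" and "\<gamma> < 2"
  shows "\<exists>e::real.
    ((\<lambda>\<epsilon>::real. let \<delta> = \<epsilon> * ln (1 / \<epsilon>) in
        ereal ((ln (1 / \<delta>))\<^sup>2) * enn2ereal (Einf \<gamma> \<epsilon>) - ereal (pi * \<gamma>\<^sup>2 / 2 * ln (1 / \<delta>)))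
      \<longlongrightarrow> ereal e) (at_right 0)"
proof -
  note \<gamma> = assms
  obtain C where C: "C > 0" "\<And>\<tau>. (deriv cutoff \<tau>)^2 \<le> C * (1 - cutoff \<tau>)" "\<And>\<tau>. 0 \<le> \<tau> \<Longrightarrow> \<bar>deriv cutoff \<tau> * (2 * \<tau>)\<bar> \<le> C"
    by (rule cutoff_deriv_bounds) (rule that)
  define l where "l \<epsilon> = ln (1 / \<epsilon>)" for \<epsilon> :: real
  define L where "L \<epsilon> = ln (1 / (\<epsilon> * ln (1 / \<epsilon>)))" for \<epsilon> :: real
  define G where "G \<epsilon> = (L \<epsilon>)^2 * enn2real (Einf \<gamma> \<epsilon>) - pi * \<gamma>^2 / 2 * L \<epsilon>" for \<epsilon>
  define B where "B = 4 * pi * \<gamma> / (2 - \<gamma>)"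
  define q where "q = 1 + 16 * pi * \<gamma>"
  define K where "K = 4 + 16 * pi^2 * C^2"
  define Mb where "Mb = (2 * (\<gamma> + 1)^2 + 8 * exp 4 * C * (2 + 2 + (\<gamma> + 1))^2) / (\<gamma> / 4) + (\<gamma> + 1)^2 / (\<gamma> / 4 * (2 - \<gamma>))"
  define C1 where "C1 = \<gamma>^2 * pi * (q + pi^2)"
  define C3 where "C3 = 2 * B + C1 + 3"
  have Ltop: "filterlim L at_top (at_right 0)" unfolding L_def by real_asymp
  have ltop: "filterlim l at_top (at_right 0)" unfolding l_def by real_asymp
  have ratio: "((\<lambda>\<epsilon>. l \<epsilon> / L \<epsilon>) \<longlongrightarrow> 1) (at_right 0)" unfolding l_def L_def by real_asymp
  \<comment> \<open>The relations between \<epsilon>, \<open>L\<close> and \<open>l\<close> on which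
    the energy lemmas rely. They hold near 0: \<open>L <= l\<close> because eventually
    \<open>l >= 1\<close>, and \<open>l <= 2 * L\<close> because the ratio tends to 1.\<close>
  define good where "good \<epsilon> \<longleftrightarrow> 0 < \<epsilon> \<and> 8 \<le> L \<epsilon> \<and> \<epsilon> * l \<epsilon> = exp (- L \<epsilon>) \<and> L \<epsilon> \<le> l \<epsilon> \<and> l \<epsilon> \<le> 2 * L \<epsilon>" for \<epsilon>
  have ev_good: "eventually good (at_right 0)"
  proof -
    have "\<forall>\<^sub>F \<epsilon> in at_right 0. 8 \<le> L \<epsilon>" "\<forall>\<^sub>F \<epsilon> in at_right 0. 1 \<le> l \<epsilon>"
      using Ltop ltop by (auto simp: filterlim_at_top)
    moreover have "\<forall>\<^sub>F \<epsilon> in at_right 0. l \<epsilon> / L \<epsilon> < 2" by (rule order_tendstoD(2)[OF ratio]) simp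
    moreover have "\<forall>\<^sub>F \<epsilon> in at_right 0. 0 < (\<epsilon>::real)" by (rule eventually_at_right_less)
    ultimately show ?thesis
    proof eventually_elim
      case (elim \<epsilon>)
      have p: "0 < \<epsilon> * l \<epsilon>" using elim by simp
      have l\<epsilon>: "ln (1 / \<epsilon>) = l \<epsilon>" by (simp only: l_def)
      have Le: "L \<epsilon> = - ln (\<epsilon> * l \<epsilon>)" unfolding L_def l\<epsilon> by (simp only: divide_inverse mult_1 ln_inverse)
      have "ln (\<epsilon> * l \<epsilon>) \<ge> ln \<epsilon>" using elim by (subst ln_le_cancel_iff) auto
      moreover have "l \<epsilon> = - ln \<epsilon>" using elim by (simp add: l_def ln_div)
      ultimately show ?case unfolding good_def using elim p Le by (simp add: divide_less_eq)
    qed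
  qed
  have up: "Einf \<gamma> \<epsilon> < \<infinity>" "G \<epsilon> \<le> B" if "good \<epsilon>" for \<epsilon>
    using that energy_upper[OF \<gamma>, of "L \<epsilon>" \<epsilon> "l \<epsilon>"] by (auto simp: good_def G_def B_def)
  have lim0: "((\<lambda>x. k * (1 / x)) \<longlongrightarrow> 0) at_top" for k :: real
    by (intro tendsto_mult_right_zero) real_asymp
  have sq0: "((\<lambda>x. sqrt (k * (1 / x))) \<longlongrightarrow> 0) at_top" for k :: real
    using tendsto_real_sqrt[OF lim0[of k]] by simp
  have small: "\<forall>\<^sub>F x in at_top. sqrt (pi * (x / 2) * (C3 / x^2)) + sqrt (pi * (K * (8 * C3 / x^3))) \<le> pi * \<gamma> / 4"
  proof -
    have a: "((\<lambda>x. sqrt (pi * C3 / 2 * (1 / x)) + sqrt (pi * K * 8 * C3 * (1 / x^3))) \<longlongrightarrow> 0 + 0) at_top"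
    proof (intro tendsto_add sq0)
      have "((\<lambda>x. pi * K * 8 * C3 * (1 / x^3)) \<longlongrightarrow> 0) at_top" by (intro tendsto_mult_right_zero) real_asymp
      from tendsto_real_sqrt[OF this] show "((\<lambda>x. sqrt (pi * K * 8 * C3 * (1 / x^3))) \<longlongrightarrow> 0) at_top" by simp
    qed
    have "\<forall>\<^sub>F x in at_top. sqrt (pi * C3 / 2 * (1 / x)) + sqrt (pi * K * 8 * C3 * (1 / x^3)) < pi * \<gamma> / 4"
      by (rule order_tendstoD(2)[OF a]) (use \<gamma> in simp)
    then show ?thesis using eventually_gt_at_top[of 0]
    proof eventually_elim
      case (elim x)
      have "pi * (x / 2) * (C3 / x^2) = pi * C3 / 2 * (1 / x)" using elim by (simp add: power2_eq_square)
      moreover have "pi * (K * (8 * C3 / x^3)) = pi * K * 8 * C3 * (1 / x^3)" by simp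
      ultimately show ?case using elim by (simp only:)
    qed
  qed
  \<comment> \<open>The part of the error that depends on \<open>L\<close> alone, so that its limit
    at infinity can be composed with \<open>Ltop\<close>. The term in \<open>l / L\<close> is
    treated separately through \<open>ratio\<close>.\<close>
  define e1 where "e1 x = 2 * \<gamma> * x * sqrt (pi * (K * (8 * C3 / x^3))) + K * (4 * C3 / x) + x * (1 + x) * exp (- (x / 2)) * Mb + 2 / x" for x :: real
  define err where "err \<epsilon> = 2 * \<gamma> * L \<epsilon> * sqrt (pi * (K * (8 * C3 / L \<epsilon> ^ 3))) + K * (4 * C3 / L \<epsilon>)
    + C3 * ((1 + 1 / L \<epsilon>)^2 * (l \<epsilon> / L \<epsilon>) - 1) + L \<epsilon> * (1 + L \<epsilon>) * exp (- (L \<epsilon> / 2)) * Mb + 2 / L \<epsilon>" for \<epsilon>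
  have e1: "(e1 \<longlongrightarrow> 0) at_top"
  proof -
    have "((\<lambda>x. 2 * \<gamma> * sqrt (pi * K * 8 * C3 * (1 / x)) + K * 4 * C3 * (1 / x) + (x * (1 + x) * exp (- (x / 2))) * Mb + 2 * (1 / x)) \<longlongrightarrow> 0 + 0 + 0 + 0) at_top"
    proof (intro tendsto_add lim0 tendsto_mult_right_zero[OF sq0] tendsto_mult_left_zero)
      show "((\<lambda>x::real. x * (1 + x) * exp (- (x / 2))) \<longlongrightarrow> 0) at_top" by real_asymp
    qed
    moreover have "\<forall>\<^sub>F x in at_top. 2 * \<gamma> * sqrt (pi * K * 8 * C3 * (1 / x)) + K * 4 * C3 * (1 / x) + (x * (1 + x) * exp (- (x / 2))) * Mb + 2 * (1 / x) = e1 x"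
      using eventually_gt_at_top[of 0]
    proof eventually_elim
      case (elim x)
      have "x * sqrt z = sqrt (x^2 * z)" for z using elim by (simp add: real_sqrt_mult)
      moreover have "x^2 * (pi * (K * (8 * C3 / x^3))) = pi * K * 8 * C3 * (1 / x)"
        using elim by (simp add: power2_eq_square power3_eq_cube)
      ultimately have "sqrt (pi * K * 8 * C3 * (1 / x)) = x * sqrt (pi * (K * (8 * C3 / x^3)))" by simp
      then show ?case unfolding e1_def by simp
    qed
    ultimately show ?thesis by (simp add: tendsto_cong)
  qed
  have err: "(err \<longlongrightarrow> 0) (at_right 0)"
  proof -
    have "((\<lambda>\<epsilon>. e1 (L \<epsilon>) + C3 * ((1 + 1 * (1 / L \<epsilon>))^2 * (l \<epsilon> / L \<epsilon>) - 1)) \<longlongrightarrow> 0 + C3 * ((1 + 0)^2 * 1 - 1)) (at_right 0)"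
      by (intro tendsto_intros filterlim_compose[OF e1 Ltop] filterlim_compose[OF lim0 Ltop] ratio)
    then show ?thesis unfolding err_def[abs_def] e1_def by (simp add: add_ac)
  qed
  have ev_small: "\<forall>\<^sub>F \<epsilon> in at_right 0. sqrt (pi * (L \<epsilon> / 2) * (C3 / (L \<epsilon>)^2)) + sqrt (pi * (K * (8 * C3 / L \<epsilon> ^ 3))) \<le> pi * \<gamma> / 4"
    by (rule eventually_compose_filterlim[OF small Ltop])
  have step: "- (C1 + 3) / 2 \<le> G \<epsilon>" "\<forall>\<^sub>F \<epsilon>' in at_right 0. G \<epsilon>' \<le> G \<epsilon> + err \<epsilon>"
    if g: "good \<epsilon>" and sm: "sqrt (pi * (L \<epsilon> / 2) * (C3 / (L \<epsilon>)^2)) + sqrt (pi * (K * (8 * C3 / L \<epsilon> ^ 3))) \<le> pi * \<gamma> / 4" for \<epsilon>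
  proof -
    have h: "8 \<le> L \<epsilon>" "0 < \<epsilon>" "\<epsilon> * l \<epsilon> = exp (- L \<epsilon>)" "L \<epsilon> \<le> l \<epsilon>" "l \<epsilon> \<le> 2 * L \<epsilon>" using g by (auto simp: good_def)
    note A = almost_decreasing[OF \<gamma> C h up(1)[OF g], of B, folded G_def q_def K_def Mb_def, folded C1_def, folded C3_def, OF _ up(2)[OF g] sm]
    show "- (C1 + 3) / 2 \<le> G \<epsilon>" by (rule A(1))
    show "\<forall>\<^sub>F \<epsilon>' in at_right 0. G \<epsilon>' \<le> G \<epsilon> + err \<epsilon>"
      by (rule eventually_mono[OF eventually_conj[OF eventually_compose_filterlim[OF A(2) Ltop] ev_good]])
         (assumption | auto simp: good_def G_def err_def)+
  qed
  define B' where "B' = max B ((C1 + 3) / 2)"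
  have "\<exists>e. (G \<longlongrightarrow> e) (at_right 0)"
  proof (rule tendsto_if_almost_decreasing[OF _ _ _ err])
    show "\<forall>\<^sub>F \<epsilon> in at_right 0. - B' \<le> G \<epsilon>"
      using ev_good ev_small
    proof eventually_elim
      case (elim \<epsilon>)
      have "(C1 + 3) / 2 \<le> B'" unfolding B'_def by (rule max.cobounded2)
      then show "- B' \<le> G \<epsilon>" using step(1)[OF elim] unfolding minus_divide_left[symmetric] by linarith
    qed
    show "\<forall>\<^sub>F \<epsilon> in at_right 0. G \<epsilon> \<le> B'"
      using ev_good by eventually_elim (use up(2) in \<open>force simp: B'_def\<close>)
    show "\<forall>\<^sub>F \<epsilon> in at_right 0. \<forall>\<^sub>F \<epsilon>' in at_right 0. G \<epsilon>' \<le> G \<epsilon> + err \<epsilon>"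
      using ev_good ev_small by eventually_elim (rule step(2))
  qed simp
  then obtain e where e: "(G \<longlongrightarrow> e) (at_right 0)" ..
  have "\<forall>\<^sub>F \<epsilon> in at_right 0. ereal (G \<epsilon>) = (let \<delta> = \<epsilon> * ln (1 / \<epsilon>) in
        ereal ((ln (1 / \<delta>))^2) * enn2ereal (Einf \<gamma> \<epsilon>) - ereal (pi * \<gamma>^2 / 2 * ln (1 / \<delta>)))"
    using ev_good
  proof eventually_elim
    case (elim \<epsilon>)
    \<comment> \<open>Finiteness of the infimum, known from the barrier, turns the extended real
      expression of the theorem into the real number \<open>G \<epsilon>\<close>.\<close>
    obtain x where x: "Einf \<gamma> \<epsilon> = ennreal x" "0 \<le> x" using up(1)[OF elim] by (cases "Einf \<gamma> \<epsilon>") auto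
    then have "enn2ereal (Einf \<gamma> \<epsilon>) = ereal x" "enn2real (Einf \<gamma> \<epsilon>) = x" by (auto simp: enn2ereal_ennreal)
    then show ?case by (simp add: Let_def G_def L_def)
  qed
  moreover have "((\<lambda>\<epsilon>. ereal (G \<epsilon>)) \<longlongrightarrow> ereal e) (at_right 0)" using e by simp
  ultimately show ?thesis by (intro exI[of _ e]) (rule Lim_transform_eventually)
qed

end
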